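(* Let $V$ be a simple vertex operator algebra and $G$ a finite nilpotent group acting faithfully as automorphisms of $V$ (i.e. $G\le \mathrm{Aut}(V)$). Assume that for every $g\in G$ there is, up to isomorphism, a unique simple $g$-twisted $V$-module $M(g)$. Let $V^*=\bigoplus_{g\in G}M(g)$ and let $D_\alpha(G)$ be the twisted quantum double determined by the family $(M(g))_{g\in G}$. Then, with respect to the commuting actions of $D_\alpha(G)$ and $V^G$ on $V^*$, there is a decomposition into a direct sum $$V^*=\bigoplus_{\chi}M_\chi\otimes V_\chi,$$ where $\chi$ ranges over the simple characters of $D_\alpha(G)$, $M_\chi$ is a $D_\alpha(G)$-module which affords $\chi$, and $V_\chi$ is a simple $V^G$-module. Moreover $M_\chi\mapsto V_\chi$ is a bijection from the set of isomorphism classes of simple $D_\alpha(G)$-modules to the set of isomorphism classes of simple $V^G$-modules which are contained in $V^*$.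
   Context: All spaces are over $\mathbb C$. A vertex operator algebra (VOA) $(V,Y,\mathbf 1,\omega)$ is understood in the standard sense: $V=\bigoplus_{n\in\mathbb Z}V_n$, $\dim V_n<\infty$, $V_n=0$ for $n$ sufficiently small, $Y(v,z)=\sum_{n\in\mathbb Z}v_nz^{-n-1}$, Jacobi identity, vacuum $\mathbf 1$, Virasoro vector $\omega$ with $Y(\omega,z)=\sum_n L(n)z^{-n-2}$, $V_n$ the $n$-eigenspace of $L(0)$, rank in $\mathbb Q$. $\mathrm{Aut}(V)$ is the group of linear automorphisms $g$ of $V$ with $gY(v,z)g^{-1}=Y(gv,z)$, $g\mathbf 1=\mathbf 1$, $g\omega=\omega$. $V^G$ is the sub-VOA of $G$-fixed vectors. Twisted modules. Let $g\in \mathrm{Aut}(V)$ have finite order $N$ and let $V^j=\{v\in V: gv=e^{2\pi i j/N}v\}$. A weak $g$-twisted $V$-module is a $\mathbb C$-graded space $M=\bigoplus_{n\in\mathbb C}M_n$ such that for each $\lambda\in\mathbb C$, $M_{n+\lambda}=0$ for $n\in\frac1N\mathbb Z$ sufficiently small, with a linear map $v\mapsto Y_g(v,z)=\sum_{n\in\frac1N\mathbb Z}v_nz^{-n-1}$, $v_n\in\mathrm{End}(M)$, such that: $Y_g(v,z)=\sum_{n\in j/N+\mathbb Z}v_nz^{-n-1}$ for $v\in V^j$; $u_nw=0$ for $n$ sufficiently large; $Y_g(\mathbf 1,z)=1$; for $u\in V^k$, $$z_0^{-1}\delta\!\left(\tfrac{z_1-z_2}{z_0}\right)Y_g(u,z_1)Y_g(v,z_2)-z_0^{-1}\delta\!\left(\tfrac{z_2-z_1}{-z_0}\right)Y_g(v,z_2)Y_g(u,z_1)=z_2^{-1}\left(\tfrac{z_1-z_0}{z_2}\right)^{-k/N}\delta\!\left(\tfrac{z_1-z_0}{z_2}\right)Y_g(Y(u,z_0)v,z_2);$$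 the Virasoro relations hold for the components $L(n)$ of $\omega$, $L(0)w=nw$ for $w\in M_n$, and $\frac{d}{dz}Y_g(v,z)=Y_g(L(-1)v,z)$. It is a $g$-twisted $V$-module if moreover every $M_n$ is finite-dimensional; for $g=1$ these are the (weak) $V$-modules. Each $g$-twisted $V$-module ($g\in G$) is a $V^G$-module by restriction, so $V^*$ is a $V^G$-module. The twisted quantum double. By uniqueness of the $M(g)=(M(g),Y_g)$, for all $g,h\in G$ there is a linear isomorphism $\phi_g(h):M(g)\to M(hgh^{-1})$ with $\phi_g(h)Y_g(v,z)\phi_g(h)^{-1}=Y_{hgh^{-1}}(hv,z)$ for all $v\in V$; it is unique up to a nonzero scalar. Fix a choice of these. Then there are $\alpha_g(h,k)\in\mathbb C^\times$ with $\phi_g(hk)=\alpha_g(h,k)^{-1}\phi_{kgk^{-1}}(h)\phi_g(k)$, and they satisfy $\alpha_g(hk,l)\alpha_{lgl^{-1}}(h,k)=\alpha_g(h,kl)\alpha_g(k,l)$. Let $\mathbb C[G]^*$ have basis $e(g)$, $g\in G$, with $e(g)e(h)=\delta_{g,h}e(g)$. $D_\alpha(G)$ is the associative algebra with underlying space $\mathbb C[G]\otimes\mathbb C[G]^*$ and multiplication $$(a\otimes e(x))\cdot(b\otimes e(y))=\alpha_y(a,b)\,ab\otimes e(b^{-1}xb)e(y)\qquad(a,b,x,y\in G).$$ It acts on $V^*$ by $(a\otimes e(x))\cdot m=\delta_{x,g}\phi_x(a)m$ for $m\in M(g)$, and this action commutes with the vertex operators of $V^G$. *)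

theory Defs
  imports
    Complex_Main
    "HOL-Library.Function_Algebras"
    "HOL-Library.Groups_Big_Fun"
    "HOL-Algebra.Multiplicative_Group"
    "HOL-Algebra.Generated_Groups"
    "HOL-Algebra.Bij"
begin

section \<open>Complex vector spaces\<close>

text \<open>
  All spaces below are subspaces (``carriers'') of types of the following class.
  Maps between them are HOL functions whose values off the carrier are irrelevant.
\<close>

class complex_vector = ab_group_add +
  fixes scaleC :: "complex \<Rightarrow> 'a \<Rightarrow> 'a"  (infixr \<open>*\<^sub>C\<close> 75)
  assumes scaleC_add_right: "c *\<^sub>C (x + y) = c *\<^sub>C x + c *\<^sub>C y"
    and scaleC_add_left: "(c + d) *\<^sub>C x = c *\<^sub>C x + d *\<^sub>C x"
    and scaleC_scaleC: "c *\<^sub>C d *\<^sub>C x = (c * d) *\<^sub>C x"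
    and scaleC_one: "1 *\<^sub>C x = x"

global_interpretation cvec: vector_space "scaleC :: complex \<Rightarrow> 'a \<Rightarrow> 'a::complex_vector"
  by unfold_locales (simp_all add: scaleC_add_right scaleC_add_left scaleC_scaleC scaleC_one)

instantiation complex :: complex_vector
begin
definition "c *\<^sub>C (z::complex) = c * z"
instance by standard (simp_all add: scaleC_complex_def algebra_simps)
end

instantiation "fun" :: (type, complex_vector) complex_vector
begin
definition "c *\<^sub>C (f :: 'a \<Rightarrow> 'b) = (\<lambda>x. c *\<^sub>C f x)"
instance
  by standard (simp_all add: scaleC_fun_def plus_fun_def scaleC_add_right scaleC_add_left
      scaleC_scaleC scaleC_one)
end

definition linear_map :: "'a::complex_vector set \<Rightarrow> 'b::complex_vector set \<Rightarrow> ('a \<Rightarrow> 'b) \<Rightarrow> bool" where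
  "linear_map S T f \<longleftrightarrow>
     (\<forall>x\<in>S. f x \<in> T) \<and>
     (\<forall>x\<in>S. \<forall>y\<in>S. f (x + y) = f x + f y) \<and>
     (\<forall>c. \<forall>x\<in>S. f (c *\<^sub>C x) = c *\<^sub>C f x)"

definition fin_dim :: "'a::complex_vector set \<Rightarrow> bool" where
  "fin_dim S \<longleftrightarrow> (\<exists>B. finite B \<and> S = cvec.span B)"

definition is_basis :: "'a::complex_vector set \<Rightarrow> 'a set \<Rightarrow> bool" where
  "is_basis B S \<longleftrightarrow> cvec.independent B \<and> cvec.span B = S"

definition trace_on :: "'a::complex_vector set \<Rightarrow> ('a \<Rightarrow> 'a) \<Rightarrow> complex" where
  "trace_on S f = (let B = (SOME B. is_basis B S) in \<Sum>b\<in>B. cvec.representation B (f b) b)"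

definition direct_sum :: "'i set \<Rightarrow> ('i \<Rightarrow> 'a::complex_vector set) \<Rightarrow> 'a set \<Rightarrow> bool" where
  "direct_sum I T S \<longleftrightarrow>
     (\<forall>i\<in>I. cvec.subspace (T i)) \<and>
     cvec.span (\<Union>i\<in>I. T i) = S \<and>
     (\<forall>J f. finite J \<and> J \<subseteq> I \<and> (\<forall>i\<in>J. f i \<in> T i) \<and> (\<Sum>i\<in>J. f i) = 0 \<longrightarrow> (\<forall>i\<in>J. f i = 0))"

text \<open>\<open>T\<close> together with \<open>\<tau> : A \<times> B \<rightarrow> T\<close>, \<open>(a, b) \<mapsto> a \<otimes> b\<close>, is a tensor product of \<open>A\<close> and \<open>B\<close>:
  \<open>\<tau>\<close> is bilinear and carries pairs of bases to a basis, which over a field is the universal property.\<close>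

definition is_tensor_product ::
    "('a::complex_vector \<Rightarrow> 'b::complex_vector \<Rightarrow> 't::complex_vector) \<Rightarrow> 'a set \<Rightarrow> 'b set \<Rightarrow> 't set \<Rightarrow> bool" where
  "is_tensor_product \<tau> A B T \<longleftrightarrow>
     (\<forall>a\<in>A. linear_map B T (\<tau> a)) \<and>
     (\<forall>b\<in>B. linear_map A T (\<lambda>a. \<tau> a b)) \<and>
     (\<forall>X Y. is_basis X A \<and> is_basis Y B \<longrightarrow>
        inj_on (\<lambda>(x, y). \<tau> x y) (X \<times> Y) \<and> is_basis ((\<lambda>(x, y). \<tau> x y) ` (X \<times> Y)) T)"

section \<open>Nilpotent groups\<close>

primrec lower_central :: "('g, 'x) monoid_scheme \<Rightarrow> nat \<Rightarrow> 'g set" where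
  "lower_central G 0 = carrier G"
| "lower_central G (Suc n) =
     generate G {x \<otimes>\<^bsub>G\<^esub> y \<otimes>\<^bsub>G\<^esub> inv\<^bsub>G\<^esub> x \<otimes>\<^bsub>G\<^esub> inv\<^bsub>G\<^esub> y | x y. x \<in> lower_central G n \<and> y \<in> carrier G}"

definition nilpotent_group :: "('g, 'x) monoid_scheme \<Rightarrow> bool" where
  "nilpotent_group G \<longleftrightarrow> group G \<and> (\<exists>n. lower_central G n = {\<one>\<^bsub>G\<^esub>})"

section \<open>Vertex operator algebras\<close>

text \<open>
  \<open>vY V u n v\<close> is \<open>u\<^sub>n v\<close>, where \<open>Y(u,z) = \<Sum>n. u\<^sub>n z^(-n-1)\<close>; \<open>L(n)\<close> is the mode \<open>n + 1\<close> of the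
  Virasoro vector.
\<close>

record 'v voa =
  vcarrier :: "'v set"
  vY :: "'v \<Rightarrow> int \<Rightarrow> 'v \<Rightarrow> 'v"
  vvac :: 'v
  vomega :: 'v
  vrank :: rat

definition voa_L :: "'v voa \<Rightarrow> int \<Rightarrow> 'v \<Rightarrow> 'v" where
  "voa_L V n = vY V (vomega V) (n + 1)"

definition voa_weight_space :: "'v::complex_vector voa \<Rightarrow> int \<Rightarrow> 'v set" where
  "voa_weight_space V n = {v \<in> vcarrier V. voa_L V 0 v = of_int n *\<^sub>C v}"

text \<open>
  The Jacobi identity is given by its coefficients of
  \<open>z\<^sub>0^(-l-1) z\<^sub>1^(-m-1) z\<^sub>2^(-n-1)\<close>; the truncation condition makes all sums finite.
\<close>

definition voa_jacobi :: "'v::complex_vector voa \<Rightarrow> bool" where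
  "voa_jacobi V \<longleftrightarrow>
     (\<forall>u\<in>vcarrier V. \<forall>v\<in>vcarrier V. \<forall>w\<in>vcarrier V. \<forall>l m n.
        Sum_any (\<lambda>i::nat. ((-1) ^ i * (of_int l gchoose i)) *\<^sub>C
            (vY V u (m + l - int i) (vY V v (n + int i) w)
             - ((-1) powi l) *\<^sub>C vY V v (n + l - int i) (vY V u (m + int i) w)))
        = Sum_any (\<lambda>i::nat. (of_int m gchoose i) *\<^sub>C
            vY V (vY V u (l + int i) v) (m + n - int i) w))"

definition is_voa :: "'v::complex_vector voa \<Rightarrow> bool" where
  "is_voa V \<longleftrightarrow>
     cvec.subspace (vcarrier V) \<and>
     (\<forall>u\<in>vcarrier V. \<forall>n. linear_map (vcarrier V) (vcarrier V) (vY V u n)) \<and>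
     (\<forall>v\<in>vcarrier V. \<forall>n. linear_map (vcarrier V) (vcarrier V) (\<lambda>u. vY V u n v)) \<and>
     (\<forall>u\<in>vcarrier V. \<forall>v\<in>vcarrier V. \<exists>n0. \<forall>n\<ge>n0. vY V u n v = 0) \<and>
     vvac V \<in> vcarrier V \<and>
     (\<forall>v\<in>vcarrier V. \<forall>n. vY V (vvac V) n v = (if n = -1 then v else 0)) \<and>
     (\<forall>v\<in>vcarrier V. vY V v (-1) (vvac V) = v \<and> (\<forall>n\<ge>0. vY V v n (vvac V) = 0)) \<and>
     voa_jacobi V \<and>
     vomega V \<in> vcarrier V \<and>
     (\<forall>m n. \<forall>v\<in>vcarrier V.
        voa_L V m (voa_L V n v) - voa_L V n (voa_L V m v)
        = of_int (m - n) *\<^sub>C voa_L V (m + n) v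
          + (if m + n = 0 then of_int (m ^ 3 - m) / 12 * of_rat (vrank V) else 0) *\<^sub>C v) \<and>
     (\<forall>u\<in>vcarrier V. \<forall>v\<in>vcarrier V. \<forall>n.
        vY V (voa_L V (-1) u) n v = - of_int n *\<^sub>C vY V u (n - 1) v) \<and>
     direct_sum UNIV (voa_weight_space V) (vcarrier V) \<and>
     (\<forall>n. fin_dim (voa_weight_space V n)) \<and>
     (\<exists>n0. \<forall>n<n0. voa_weight_space V n = {0})"

definition simple_voa :: "'v::complex_vector voa \<Rightarrow> bool" where
  "simple_voa V \<longleftrightarrow> is_voa V \<and> vcarrier V \<noteq> {0} \<and>
     (\<forall>I. cvec.subspace I \<and> I \<subseteq> vcarrier V \<and> (\<forall>u\<in>vcarrier V. \<forall>n. \<forall>x\<in>I. vY V u n x \<in> I)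
        \<longrightarrow> I = {0} \<or> I = vcarrier V)"

definition voa_Aut :: "'v::complex_vector voa \<Rightarrow> ('v \<Rightarrow> 'v) monoid" where
  "voa_Aut V = BijGroup (vcarrier V)
     \<lparr>carrier := {g \<in> Bij (vcarrier V).
        linear_map (vcarrier V) (vcarrier V) g \<and>
        (\<forall>u\<in>vcarrier V. \<forall>n. \<forall>v\<in>vcarrier V. g (vY V u n v) = vY V (g u) n (g v)) \<and>
        g (vvac V) = vvac V \<and> g (vomega V) = vomega V}\<rparr>"

definition fixed_voa :: "'v voa \<Rightarrow> ('g, 'x) monoid_scheme \<Rightarrow> ('g \<Rightarrow> 'v \<Rightarrow> 'v) \<Rightarrow> 'v voa" where
  "fixed_voa V G \<rho> = V\<lparr>vcarrier := {v \<in> vcarrier V. \<forall>g\<in>carrier G. \<rho> g v = v}\<rparr>"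

section \<open>Twisted modules\<close>

text \<open>\<open>mY M v n\<close> is the mode \<open>v\<^sub>n\<close>, where \<open>n\<close> ranges over rational numbers.\<close>

record ('v, 'm) vmodule =
  mcarrier :: "'m set"
  mY :: "'v \<Rightarrow> rat \<Rightarrow> 'm \<Rightarrow> 'm"

definition aut_eigenspace :: "'v::complex_vector voa \<Rightarrow> ('v \<Rightarrow> 'v) \<Rightarrow> int \<Rightarrow> 'v set" where
  "aut_eigenspace V g j =
     {v \<in> vcarrier V. g v = exp (2 * of_real pi * \<i> * of_int j / of_nat (group.ord (voa_Aut V) g)) *\<^sub>C v}"

definition mod_L :: "'v voa \<Rightarrow> ('v, 'm) vmodule \<Rightarrow> int \<Rightarrow> 'm \<Rightarrow> 'm" where
  "mod_L V M n = mY M (vomega V) (of_int n + 1)"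

text \<open>
  The grading of a module is not recorded: in a direct sum of spaces \<open>M\<^sub>c\<close> on which \<open>L(0)\<close> acts
  as \<open>c\<close>, each \<open>M\<^sub>c\<close> is the full \<open>c\<close>-eigenspace.
\<close>

definition mod_weight_space :: "'v voa \<Rightarrow> ('v, 'm::complex_vector) vmodule \<Rightarrow> complex \<Rightarrow> 'm set" where
  "mod_weight_space V M c = {w \<in> mcarrier M. mod_L V M 0 w = c *\<^sub>C w}"

text \<open>
  Coefficient of \<open>z\<^sub>0^(-l-1) z\<^sub>1^(-m-1) z\<^sub>2^(-n-1)\<close> of the twisted Jacobi identity. For \<open>u \<in> V\<^sup>k\<close> both
  sides only involve \<open>m \<in> k/N + \<int>\<close>, and the binomial coefficient on the right comes from
  expanding \<open>(z\<^sub>1 - z\<^sub>0)^s\<close>, \<open>s \<in> -k/N + \<int>\<close>, with \<open>(-1)^i (i-m-1 gchoose i) = (m gchoose i)\<close>.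
\<close>

definition twisted_jacobi ::
    "'v::complex_vector voa \<Rightarrow> ('v \<Rightarrow> 'v) \<Rightarrow> ('v, 'm::complex_vector) vmodule \<Rightarrow> bool" where
  "twisted_jacobi V g M \<longleftrightarrow>
     (let N = group.ord (voa_Aut V) g in
      \<forall>k. \<forall>u\<in>aut_eigenspace V g k. \<forall>v\<in>vcarrier V. \<forall>w\<in>mcarrier M.
      \<forall>l::int. \<forall>m n :: rat. m - of_int k / of_nat N \<in> \<int> \<and> of_nat N * n \<in> \<int> \<longrightarrow>
        Sum_any (\<lambda>i::nat. ((-1) ^ i * (of_int l gchoose i)) *\<^sub>C
            (mY M u (m + of_int l - of_nat i) (mY M v (n + of_nat i) w)
             - ((-1) powi l) *\<^sub>C mY M v (n + of_int l - of_nat i) (mY M u (m + of_nat i) w)))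
        = Sum_any (\<lambda>i::nat. (of_rat m gchoose i) *\<^sub>C
            mY M (vY V u (l + int i) v) (m + n - of_nat i) w))"

definition weak_twisted_module ::
    "'v::complex_vector voa \<Rightarrow> ('v \<Rightarrow> 'v) \<Rightarrow> ('v, 'm::complex_vector) vmodule \<Rightarrow> bool" where
  "weak_twisted_module V g M \<longleftrightarrow>
     g \<in> carrier (voa_Aut V) \<and>
     (let N = group.ord (voa_Aut V) g in
     N > 0 \<and>
     cvec.subspace (mcarrier M) \<and>
     direct_sum UNIV (mod_weight_space V M) (mcarrier M) \<and>
     (\<forall>c. \<exists>b. \<forall>n::rat. of_nat N * n \<in> \<int> \<and> n < b \<longrightarrow> mod_weight_space V M (of_rat n + c) = {0}) \<and>
     (\<forall>v\<in>vcarrier V. \<forall>n. linear_map (mcarrier M) (mcarrier M) (mY M v n)) \<and>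
     (\<forall>w\<in>mcarrier M. \<forall>n. linear_map (vcarrier V) (mcarrier M) (\<lambda>v. mY M v n w)) \<and>
     (\<forall>j. \<forall>v\<in>aut_eigenspace V g j. \<forall>n. n - of_int j / of_nat N \<notin> \<int> \<longrightarrow>
        (\<forall>w\<in>mcarrier M. mY M v n w = 0)) \<and>
     (\<forall>v\<in>vcarrier V. \<forall>w\<in>mcarrier M. \<exists>n0. \<forall>n\<ge>n0. mY M v n w = 0) \<and>
     (\<forall>w\<in>mcarrier M. \<forall>n. mY M (vvac V) n w = (if n = -1 then w else 0)) \<and>
     twisted_jacobi V g M \<and>
     (\<forall>m n. \<forall>w\<in>mcarrier M.
        mod_L V M m (mod_L V M n w) - mod_L V M n (mod_L V M m w)
        = of_int (m - n) *\<^sub>C mod_L V M (m + n) w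
          + (if m + n = 0 then of_int (m ^ 3 - m) / 12 * of_rat (vrank V) else 0) *\<^sub>C w) \<and>
     (\<forall>v\<in>vcarrier V. \<forall>w\<in>mcarrier M. \<forall>n.
        mY M (voa_L V (-1) v) n w = - of_rat n *\<^sub>C mY M v (n - 1) w))"

definition twisted_module ::
    "'v::complex_vector voa \<Rightarrow> ('v \<Rightarrow> 'v) \<Rightarrow> ('v, 'm::complex_vector) vmodule \<Rightarrow> bool" where
  "twisted_module V g M \<longleftrightarrow> weak_twisted_module V g M \<and> (\<forall>c. fin_dim (mod_weight_space V M c))"

definition vsubmodule :: "'v voa \<Rightarrow> ('v, 'm::complex_vector) vmodule \<Rightarrow> 'm set \<Rightarrow> bool" where
  "vsubmodule V M W \<longleftrightarrow> cvec.subspace W \<and> W \<subseteq> mcarrier M \<and>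
     (\<forall>v\<in>vcarrier V. \<forall>n. \<forall>w\<in>W. mY M v n w \<in> W)"

definition simple_twisted_module ::
    "'v::complex_vector voa \<Rightarrow> ('v \<Rightarrow> 'v) \<Rightarrow> ('v, 'm::complex_vector) vmodule \<Rightarrow> bool" where
  "simple_twisted_module V g M \<longleftrightarrow> twisted_module V g M \<and> mcarrier M \<noteq> {0} \<and>
     (\<forall>W. vsubmodule V M W \<longrightarrow> W = {0} \<or> W = mcarrier M)"

definition simple_voa_module :: "'v::complex_vector voa \<Rightarrow> ('v, 'm::complex_vector) vmodule \<Rightarrow> bool" where
  "simple_voa_module V M \<longleftrightarrow> simple_twisted_module V \<one>\<^bsub>voa_Aut V\<^esub> M"

definition vmodule_iso ::
    "'v voa \<Rightarrow> ('v, 'm::complex_vector) vmodule \<Rightarrow> ('v, 'n::complex_vector) vmodule \<Rightarrow> bool" where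
  "vmodule_iso V M N \<longleftrightarrow>
     (\<exists>f. bij_betw f (mcarrier M) (mcarrier N) \<and> linear_map (mcarrier M) (mcarrier N) f \<and>
        (\<forall>v\<in>vcarrier V. \<forall>n. \<forall>w\<in>mcarrier M. f (mY M v n w) = mY N v n (f w)))"

text \<open>
  A simple \<open>g\<close>-twisted module has weights in a single coset \<open>c + \<int>/N\<close> and finite-dimensional weight
  spaces, so it has countable dimension and is isomorphic to one carried by a subspace of
  \<open>nat \<Rightarrow> complex\<close>. Quantifying over the latter is quantifying over all of them.
\<close>

definition unique_simple_twisted_module ::
    "'v::complex_vector voa \<Rightarrow> ('v \<Rightarrow> 'v) \<Rightarrow> ('v, 'm::complex_vector) vmodule \<Rightarrow> bool" where
  "unique_simple_twisted_module V g M \<longleftrightarrow> simple_twisted_module V g M \<and>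
     (\<forall>N :: ('v, nat \<Rightarrow> complex) vmodule. simple_twisted_module V g N \<longrightarrow> vmodule_iso V N M)"

text \<open>The direct sum of the \<open>M g\<close>; it is a module for the fixed-point VOA by restriction.\<close>

definition Vstar ::
    "('g, 'x) monoid_scheme \<Rightarrow> ('g \<Rightarrow> ('v, 'm::complex_vector) vmodule) \<Rightarrow> ('v, 'g \<Rightarrow> 'm) vmodule" where
  "Vstar G M =
     \<lparr>mcarrier = {f. (\<forall>g\<in>carrier G. f g \<in> mcarrier (M g)) \<and> (\<forall>g. g \<notin> carrier G \<longrightarrow> f g = 0)},
      mY = (\<lambda>v n f g. if g \<in> carrier G then mY (M g) v n (f g) else 0)\<rparr>"

text \<open>The simple modules for \<open>V\<close> contained in the module \<open>M\<close>.\<close>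

definition simple_vsubmodules ::
    "'v::complex_vector voa \<Rightarrow> ('v, 'm::complex_vector) vmodule \<Rightarrow> ('v, 'm) vmodule set" where
  "simple_vsubmodules V M =
     {M\<lparr>mcarrier := W\<rparr> | W. vsubmodule V M W \<and> simple_voa_module V (M\<lparr>mcarrier := W\<rparr>)}"

definition vmodule_iso_rel ::
    "'v::complex_vector voa \<Rightarrow> ('v, 'm::complex_vector) vmodule set \<Rightarrow> (('v, 'm) vmodule \<times> ('v, 'm) vmodule) set" where
  "vmodule_iso_rel V S = {(M, N). M \<in> S \<and> N \<in> S \<and> vmodule_iso V M N}"

section \<open>Algebras, modules and characters\<close>

record 'a calgebra =
  acarrier :: "'a set"
  amult :: "'a \<Rightarrow> 'a \<Rightarrow> 'a"
  aunit :: 'a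

record ('a, 'u) amodule =
  ucarrier :: "'u set"
  uact :: "'a \<Rightarrow> 'u \<Rightarrow> 'u"

definition alg_module :: "'a::complex_vector calgebra \<Rightarrow> ('a, 'u::complex_vector) amodule \<Rightarrow> bool" where
  "alg_module A U \<longleftrightarrow>
     cvec.subspace (ucarrier U) \<and>
     (\<forall>a\<in>acarrier A. linear_map (ucarrier U) (ucarrier U) (uact U a)) \<and>
     (\<forall>u\<in>ucarrier U. linear_map (acarrier A) (ucarrier U) (\<lambda>a. uact U a u)) \<and>
     (\<forall>a\<in>acarrier A. \<forall>b\<in>acarrier A. \<forall>u\<in>ucarrier U. uact U (amult A a b) u = uact U a (uact U b u)) \<and>
     (\<forall>u\<in>ucarrier U. uact U (aunit A) u = u)"

definition simple_alg_module :: "'a::complex_vector calgebra \<Rightarrow> ('a, 'u::complex_vector) amodule \<Rightarrow> bool" where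
  "simple_alg_module A U \<longleftrightarrow> alg_module A U \<and> ucarrier U \<noteq> {0} \<and>
     (\<forall>W. cvec.subspace W \<and> W \<subseteq> ucarrier U \<and> (\<forall>a\<in>acarrier A. \<forall>w\<in>W. uact U a w \<in> W)
        \<longrightarrow> W = {0} \<or> W = ucarrier U)"

definition alg_module_iso ::
    "'a calgebra \<Rightarrow> ('a, 'u::complex_vector) amodule \<Rightarrow> ('a, 'w::complex_vector) amodule \<Rightarrow> bool" where
  "alg_module_iso A U W \<longleftrightarrow>
     (\<exists>f. bij_betw f (ucarrier U) (ucarrier W) \<and> linear_map (ucarrier U) (ucarrier W) f \<and>
        (\<forall>a\<in>acarrier A. \<forall>u\<in>ucarrier U. f (uact U a u) = uact W a (f u)))"

definition alg_character :: "'a calgebra \<Rightarrow> ('a, 'u::complex_vector) amodule \<Rightarrow> 'a \<Rightarrow> complex" where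
  "alg_character A U = (\<lambda>a\<in>acarrier A. trace_on (ucarrier U) (uact U a))"

text \<open>
  A simple module for a finite-dimensional algebra is finite-dimensional, hence isomorphic to one
  carried by a subspace of \<open>nat \<Rightarrow> complex\<close>.
\<close>

definition simple_alg_modules :: "'a::complex_vector calgebra \<Rightarrow> ('a, nat \<Rightarrow> complex) amodule set" where
  "simple_alg_modules A = {U. simple_alg_module A U}"

definition alg_module_iso_rel ::
    "'a::complex_vector calgebra \<Rightarrow> ('a, 'u::complex_vector) amodule set \<Rightarrow> (('a, 'u) amodule \<times> ('a, 'u) amodule) set" where
  "alg_module_iso_rel A S = {(U, W). U \<in> S \<and> W \<in> S \<and> alg_module_iso A U W}"

definition simple_characters :: "'a::complex_vector calgebra \<Rightarrow> ('a \<Rightarrow> complex) set" where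
  "simple_characters A = alg_character A ` simple_alg_modules A"

section \<open>The twisted quantum double\<close>

text \<open>A choice of linear isomorphisms \<open>\<phi> g h : M g \<rightarrow> M (h g h\<inverse>)\<close>, each unique up to a nonzero scalar.\<close>

definition intertwiners ::
    "('g, 'x) monoid_scheme \<Rightarrow> 'v voa \<Rightarrow> ('g \<Rightarrow> 'v \<Rightarrow> 'v) \<Rightarrow> ('g \<Rightarrow> ('v, 'm::complex_vector) vmodule) \<Rightarrow>
      ('g \<Rightarrow> 'g \<Rightarrow> 'm \<Rightarrow> 'm) \<Rightarrow> bool" where
  "intertwiners G V \<rho> M \<phi> \<longleftrightarrow>
     (\<forall>g\<in>carrier G. \<forall>h\<in>carrier G.
        let g' = h \<otimes>\<^bsub>G\<^esub> g \<otimes>\<^bsub>G\<^esub> inv\<^bsub>G\<^esub> h in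
        bij_betw (\<phi> g h) (mcarrier (M g)) (mcarrier (M g')) \<and>
        linear_map (mcarrier (M g)) (mcarrier (M g')) (\<phi> g h) \<and>
        (\<forall>v\<in>vcarrier V. \<forall>n. \<forall>w\<in>mcarrier (M g).
           \<phi> g h (mY (M g) v n w) = mY (M g') (\<rho> h v) n (\<phi> g h w)))"

text \<open>\<open>\<alpha>\<^sub>g(h,k)\<close>; the defining equation determines it because \<open>M g \<noteq> 0\<close>.\<close>

definition double_cocycle ::
    "('g, 'x) monoid_scheme \<Rightarrow> ('g \<Rightarrow> ('v, 'm::complex_vector) vmodule) \<Rightarrow> ('g \<Rightarrow> 'g \<Rightarrow> 'm \<Rightarrow> 'm) \<Rightarrow>
      'g \<Rightarrow> 'g \<Rightarrow> 'g \<Rightarrow> complex" where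
  "double_cocycle G M \<phi> g h k =
     (THE c. c \<noteq> 0 \<and> (\<forall>w\<in>mcarrier (M g).
        \<phi> g (h \<otimes>\<^bsub>G\<^esub> k) w = inverse c *\<^sub>C \<phi> (k \<otimes>\<^bsub>G\<^esub> g \<otimes>\<^bsub>G\<^esub> inv\<^bsub>G\<^esub> k) h (\<phi> g k w)))"

text \<open>
  Elements are the functions \<open>d\<close> supported on \<open>G \<times> G\<close>, where \<open>d (a, x)\<close> is the coefficient of
  \<open>a \<otimes> e(x)\<close>. As \<open>\<phi> g \<one>\<close> need not be the identity, the unit is the sum of all
  \<open>\<alpha>\<^sub>x(\<one>,\<one>)\<inverse> \<one> \<otimes> e(x)\<close>.
\<close>

definition double_basis :: "'g \<Rightarrow> 'g \<Rightarrow> 'g \<times> 'g \<Rightarrow> complex" where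
  "double_basis a x = (\<lambda>p. if p = (a, x) then 1 else 0)"

definition twisted_double ::
    "('g, 'x) monoid_scheme \<Rightarrow> ('g \<Rightarrow> 'g \<Rightarrow> 'g \<Rightarrow> complex) \<Rightarrow> ('g \<times> 'g \<Rightarrow> complex) calgebra" where
  "twisted_double G \<alpha> =
     \<lparr>acarrier = {d. \<forall>p. p \<notin> carrier G \<times> carrier G \<longrightarrow> d p = 0},
      amult = (\<lambda>d d'. \<Sum>(a, x)\<in>carrier G \<times> carrier G. \<Sum>(b, y)\<in>carrier G \<times> carrier G.
        (d (a, x) * d' (b, y)) *\<^sub>C
          (if inv\<^bsub>G\<^esub> b \<otimes>\<^bsub>G\<^esub> x \<otimes>\<^bsub>G\<^esub> b = y then \<alpha> y a b *\<^sub>C double_basis (a \<otimes>\<^bsub>G\<^esub> b) y else 0)),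
      aunit = (\<Sum>x\<in>carrier G. inverse (\<alpha> x \<one>\<^bsub>G\<^esub> \<one>\<^bsub>G\<^esub>) *\<^sub>C double_basis \<one>\<^bsub>G\<^esub> x)\<rparr>"

text \<open>\<open>a \<otimes> e(x)\<close> maps \<open>f \<in> V*\<close> to the vector \<open>\<phi> x a (f x)\<close> of the summand \<open>M (a x a\<inverse>)\<close>.\<close>

definition double_action ::
    "('g, 'x) monoid_scheme \<Rightarrow> ('g \<Rightarrow> 'g \<Rightarrow> 'm::complex_vector \<Rightarrow> 'm) \<Rightarrow>
      ('g \<times> 'g \<Rightarrow> complex) \<Rightarrow> ('g \<Rightarrow> 'm) \<Rightarrow> 'g \<Rightarrow> 'm" where
  "double_action G \<phi> d f =
     (\<Sum>(a, x)\<in>carrier G \<times> carrier G.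
        d (a, x) *\<^sub>C (\<lambda>y. if y = a \<otimes>\<^bsub>G\<^esub> x \<otimes>\<^bsub>G\<^esub> inv\<^bsub>G\<^esub> a then \<phi> x a (f x) else 0))"

end

theory Submission
  imports
    Defs
    "HOL-Computational_Algebra.Fundamental_Theorem_Algebra"
    "HOL-Computational_Algebra.Formal_Power_Series"
begin

text \<open>
  On finitely many vectors of \<open>V\<^sup>*\<close> a product of two modes of \<open>V\<close> equals one linear combination of modes,
  with coefficients independent of the twist. So the span of the modes acts densely on the pairwise
  non-isomorphic simple modules \<open>M(g)\<close> (Jacobson), and averaging over \<open>G\<close> shows that the modes of \<open>V\<^sup>G\<close>
  realize every \<open>D\<close>-linear map on a finite-dimensional \<open>D\<close>-submodule of \<open>V\<^sup>*\<close>. The twisted double \<open>D\<close>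
  is semisimple, and it acts faithfully on \<open>V\<^sup>*\<close>, since matrix coefficients of the faithful action of \<open>G\<close>
  on \<open>V\<close> split any linear relation between the intertwiners \<open>\<phi>\<close>. Hence every simple \<open>D\<close>-module occurs
  in \<open>V\<^sup>*\<close>, and by the density statement its multiplicity space is a simple \<open>V\<^sup>G\<close>-module that determines it.
\<close>

section \<open>Linear algebra\<close>

text \<open>The obstacle is that a mode of \<open>V\<close> acts on the various \<open>M g\<close>
  with indices in different cosets of \<int>, and the twisted Jacobi identity has binomials
  depending on the coset, so its coefficients differ from twist to twist. What is uniform is the
  expansion at z1 = z2 of (z1 - z2)^K Y(u, z1) Y(v, z2) w: in a fixed total degree it has finitely
  many terms, and the exponent -p-1 of z1 enters only through (-p-1 choose a), a polynomial in p.
  Simplicity of \<open>V\<close> acts through annihilators: the vectors of \<open>V\<close> that are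
  zero on a nonzero twisted module form a subspace stable under all modes and without the vacuum.
  Hence a module determines its twist, so the \<open>M g\<close> are non-isomorphic, and relations
  between intertwiners may be multiplied by matrix coefficients. The modules are
  infinite-dimensional, so Schur's lemma takes its eigenvalue from a weight space. A homomorphism
  out of a simple module of the double is recorded by its value at one fixed vector; multiplicity
  spaces are thereby subspaces of the sum of the \<open>M g\<close>, with the restricted action of
  \<open>VG\<close>.\<close>

lemma linear_map_mem: "linear_map S T f \<Longrightarrow> x \<in> S \<Longrightarrow> f x \<in> T"
  by (simp add: linear_map_def)

lemma linear_map_add: "linear_map S T f \<Longrightarrow> x \<in> S \<Longrightarrow> y \<in> S \<Longrightarrow> f (x + y) = f x + f y"
  by (simp add: linear_map_def)

lemma linear_map_scale: "linear_map S T f \<Longrightarrow> x \<in> S \<Longrightarrow> f (c *\<^sub>C x) = c *\<^sub>C f x"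
  by (simp add: linear_map_def)

lemma linear_map_zero:
  assumes "linear_map S T f" "cvec.subspace S"
  shows "f 0 = 0"
proof -
  have "f (0 *\<^sub>C 0) = 0 *\<^sub>C f 0"
    using assms by (intro linear_map_scale cvec.subspace_0)
  then show ?thesis by simp
qed

lemma linear_map_diff:
  assumes "linear_map S T f" "cvec.subspace S" "x \<in> S" "y \<in> S"
  shows "f (x - y) = f x - f y"
proof -
  have "f (x - y) + f y = f (x - y + y)"
    using assms by (intro linear_map_add[symmetric] cvec.subspace_diff)
  then show ?thesis by (simp add: eq_diff_eq)
qed

lemma linear_map_sum:
  assumes "linear_map S T f" "cvec.subspace S" "\<And>i. i \<in> I \<Longrightarrow> x i \<in> S"
  shows "f (\<Sum>i\<in>I. x i) = (\<Sum>i\<in>I. f (x i))"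
  using assms(3)
proof (induction I rule: infinite_finite_induct)
  case (insert i I)
  have "f (x i + (\<Sum>i\<in>I. x i)) = f (x i) + f (\<Sum>i\<in>I. x i)"
    using insert.prems by (intro linear_map_add[OF assms(1)] cvec.subspace_sum[OF assms(2)]) auto
  then show ?case using insert by simp
qed (use linear_map_zero[OF assms(1,2)] in auto)

lemma linear_map_lincomb:
  assumes "linear_map S T f" "cvec.subspace S" "\<And>i. i \<in> I \<Longrightarrow> x i \<in> S"
  shows "f (\<Sum>i\<in>I. c i *\<^sub>C x i) = (\<Sum>i\<in>I. c i *\<^sub>C f (x i))"
proof -
  have "f (\<Sum>i\<in>I. c i *\<^sub>C x i) = (\<Sum>i\<in>I. f (c i *\<^sub>C x i))"
    using assms by (intro linear_map_sum cvec.subspace_scale)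
  also have "\<dots> = (\<Sum>i\<in>I. c i *\<^sub>C f (x i))"
    using assms by (intro sum.cong refl linear_map_scale)
  finally show ?thesis .
qed

lemma linear_map_comp:
  "linear_map S T f \<Longrightarrow> linear_map T U h \<Longrightarrow> linear_map S U (\<lambda>x. h (f x))"
  by (simp add: linear_map_def)

lemma linear_map_subspace_image:
  assumes "linear_map S T f" "cvec.subspace S"
  shows "cvec.subspace (f ` S)"
proof (rule cvec.subspaceI)
  show "0 \<in> f ` S"
    using linear_map_zero[OF assms] cvec.subspace_0[OF assms(2)] by force
  fix x y assume "x \<in> f ` S" "y \<in> f ` S"
  then obtain a b where "a \<in> S" "b \<in> S" "x = f a" "y = f b" by auto
  then show "x + y \<in> f ` S"
    using linear_map_add[OF assms(1)] cvec.subspace_add[OF assms(2)] by (metis imageI)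
next
  fix c x assume "x \<in> f ` S"
  then show "c *\<^sub>C x \<in> f ` S"
    using linear_map_scale[OF assms(1)] cvec.subspace_scale[OF assms(2)] by (metis imageE imageI)
qed

lemma linear_map_subspace_kernel:
  assumes "linear_map S T f" "cvec.subspace S"
  shows "cvec.subspace {x \<in> S. f x = 0}"
  using assms linear_map_zero[OF assms] linear_map_add[OF assms(1)] linear_map_scale[OF assms(1)]
  by (auto intro!: cvec.subspaceI
      simp: cvec.subspace_0 cvec.subspace_add cvec.subspace_scale)

lemma linear_map_inj:
  assumes "linear_map S T f" "cvec.subspace S" "\<And>x. x \<in> S \<Longrightarrow> f x = 0 \<Longrightarrow> x = 0"
  shows "inj_on f S"
proof (rule inj_onI)
  fix x y assume xy: "x \<in> S" "y \<in> S" "f x = f y"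
  then have "f (x - y) = 0" using linear_map_diff[OF assms(1,2)] by simp
  then show "x = y"
    using assms(3)[of "x - y"] xy cvec.subspace_diff[OF assms(2)] by simp
qed

lemma linear_map_inverse:
  assumes "linear_map S T f" "cvec.subspace S" "bij_betw f S T"
  shows "linear_map T S (the_inv_into S f)"
proof -
  have inj: "inj_on f S" and im: "f ` S = T"
    using assms(3) by (auto simp: bij_betw_def)
  have "the_inv_into S f (f x) = x" if "x \<in> S" for x
    using that inj by (simp add: the_inv_into_f_f)
  then show ?thesis
    unfolding linear_map_def im[symmetric]
    using linear_map_add[OF assms(1), symmetric] linear_map_scale[OF assms(1), symmetric]
      cvec.subspace_add[OF assms(2)] cvec.subspace_scale[OF assms(2)]
    by auto
qed

lemma ex_linear_functional:
  fixes x :: "'a :: complex_vector"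
  assumes "x \<noteq> 0"
  obtains f :: "'a \<Rightarrow> complex" where "linear_map UNIV UNIV f" "f x = 1"
proof -
  let ?B = "cvec.extend_basis {x}"
  have i1: "cvec.independent {x}" using assms by simp
  have B: "cvec.independent ?B" "cvec.span ?B = UNIV" "x \<in> ?B"
    using cvec.independent_extend_basis[OF i1] cvec.span_extend_basis[OF i1]
      cvec.extend_basis_superset[OF i1] by auto
  have "linear_map UNIV UNIV (\<lambda>y. cvec.representation ?B y x)"
    using B by (auto simp: linear_map_def scaleC_complex_def cvec.representation_add
        cvec.representation_scale)
  moreover have "cvec.representation ?B x x = 1"
    using B by (simp add: cvec.representation_basis)
  ultimately show ?thesis using that by blast
qed

lemma ex_linear_projection:
  assumes "cvec.subspace (W :: 'a :: complex_vector set)"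
  obtains p where "linear_map UNIV W p" "\<And>x. x \<in> W \<Longrightarrow> p x = x"
proof -
  obtain B where B: "B \<subseteq> W" "cvec.independent B" "W \<subseteq> cvec.span B"
    using cvec.maximal_independent_subset[of W] by auto
  define C where "C = cvec.extend_basis B"
  have C: "cvec.independent C" "cvec.span C = UNIV" "B \<subseteq> C"
    using cvec.independent_extend_basis[OF B(2)] cvec.span_extend_basis[OF B(2)]
      cvec.extend_basis_superset[OF B(2)] by (auto simp: C_def)
  define p where "p x = (\<Sum>b | b \<in> B \<and> cvec.representation C x b \<noteq> 0. cvec.representation C x b *\<^sub>C b)" for x
  \<comment> \<open>The range of the sum depends on x; over a common finite set \<open>F\<close> the
    sums for x, y and x + y can be compared term by term.\<close>
  have p: "p x = (\<Sum>b\<in>F. cvec.representation C x b *\<^sub>C b)"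
    if "finite F" "F \<subseteq> B" "\<And>b. b \<in> B \<Longrightarrow> cvec.representation C x b \<noteq> 0 \<Longrightarrow> b \<in> F" for F x
    unfolding p_def using that by (intro sum.mono_neutral_left) auto
  have fin: "finite {b \<in> B. cvec.representation C x b \<noteq> 0}" for x
    by (rule finite_subset[OF _ cvec.finite_representation[of C x]]) auto
  show ?thesis
  proof
    show "linear_map UNIV W p"
      unfolding linear_map_def
    proof (intro conjI ballI allI)
      fix x
      show "p x \<in> W"
        unfolding p_def using B(1) assms by (intro cvec.subspace_sum cvec.subspace_scale) auto
      fix y
      let ?F = "{b \<in> B. cvec.representation C x b \<noteq> 0} \<union> {b \<in> B. cvec.representation C y b \<noteq> 0}"
      have r: "cvec.representation C (x + y) b = cvec.representation C x b + cvec.representation C y b" for b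
        using C by (simp add: cvec.representation_add)
      have "p (x + y) = (\<Sum>b\<in>?F. cvec.representation C (x + y) b *\<^sub>C b)"
        using fin by (intro p) (auto simp: r)
      moreover have "p x = (\<Sum>b\<in>?F. cvec.representation C x b *\<^sub>C b)"
        "p y = (\<Sum>b\<in>?F. cvec.representation C y b *\<^sub>C b)"
        using fin by (auto intro!: p)
      ultimately show "p (x + y) = p x + p y"
        by (simp add: r scaleC_add_left sum.distrib)
    next
      fix c x
      let ?F = "{b \<in> B. cvec.representation C x b \<noteq> 0}"
      have r: "cvec.representation C (c *\<^sub>C x) b = c * cvec.representation C x b" for b
        using C by (simp add: cvec.representation_scale)
      have "p (c *\<^sub>C x) = (\<Sum>b\<in>?F. cvec.representation C (c *\<^sub>C x) b *\<^sub>C b)"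
        using fin by (intro p) (auto simp: r)
      then show "p (c *\<^sub>C x) = c *\<^sub>C p x"
        unfolding p_def by (simp add: r cvec.scale_sum_right scaleC_scaleC)
    qed
  next
    fix x assume "x \<in> W"
    then have "x \<in> cvec.span B" using B by auto
    then have "cvec.representation C x = cvec.representation B x"
      using C by (intro cvec.representation_extend) auto
    moreover have "(\<Sum>b | cvec.representation B x b \<noteq> 0. cvec.representation B x b *\<^sub>C b) = x"
      using B(2) \<open>x \<in> cvec.span B\<close> by (rule cvec.sum_nonzero_representation_eq)
    moreover have "{b \<in> B. cvec.representation B x b \<noteq> 0} = {b. cvec.representation B x b \<noteq> 0}"
      using cvec.representation_ne_zero by blast
    ultimately show "p x = x" by (simp add: p_def)
  qed
qed

section \<open>Finite-dimensional subspaces and eigenvectors\<close>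

lemma fin_dim_basis:
  assumes "fin_dim S"
  obtains B where "finite B" "is_basis B S" "B \<subseteq> S"
proof -
  obtain F where F: "finite F" "S = cvec.span F" using assms by (auto simp: fin_dim_def)
  obtain B where B: "B \<subseteq> F" "cvec.independent B" "F \<subseteq> cvec.span B"
    using cvec.maximal_independent_subset[of F] by auto
  have "cvec.span B = S"
    using B F cvec.span_mono[of B F] cvec.span_mono[of F "cvec.span B"]
    unfolding cvec.span_span by blast
  then show ?thesis
    using that[of B] B(1,2) finite_subset[OF B(1) F(1)] cvec.span_superset[of B]
    by (simp add: is_basis_def)
qed

lemma fin_dim_subspace: "fin_dim S \<Longrightarrow> cvec.subspace S"
  by (auto simp: fin_dim_def)

lemma fin_dim_subset:
  assumes "fin_dim S" "W \<subseteq> S" "cvec.subspace W"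
  shows "fin_dim W"
proof -
  obtain F where F: "finite F" "S = cvec.span F" using assms by (auto simp: fin_dim_def)
  obtain B where B: "B \<subseteq> W" "cvec.independent B" "W \<subseteq> cvec.span B"
    using cvec.maximal_independent_subset[of W] by auto
  have "finite B"
    using cvec.independent_span_bound[OF F(1) B(2)] B(1) F(2) assms(2) by auto
  moreover have "cvec.span B = W"
    using B assms(3) cvec.span_minimal[of B W] by auto
  ultimately show ?thesis by (auto simp: fin_dim_def)
qed

lemma is_basis_finite:
  assumes "fin_dim S" "is_basis B S"
  shows "finite B"
proof -
  obtain F where "finite F" "S = cvec.span F" using assms by (auto simp: fin_dim_def)
  then show ?thesis
    using cvec.independent_span_bound[of F B] assms(2) cvec.span_superset[of B]
    by (auto simp: is_basis_def)
qed

lemma is_basis_subset: "is_basis B S \<Longrightarrow> B \<subseteq> S"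
  using cvec.span_superset[of B] by (auto simp: is_basis_def)

lemma is_basis_sum_representation:
  assumes "is_basis B S" "finite B" "x \<in> S"
  shows "(\<Sum>b\<in>B. cvec.representation B x b *\<^sub>C b) = x"
  using assms by (intro cvec.sum_representation_eq) (auto simp: is_basis_def)

lemma independent_sum_eq_zero:
  assumes "cvec.independent B" "finite B" "(\<Sum>b\<in>B. c b *\<^sub>C b) = 0" "b \<in> B"
  shows "c b = 0"
  using cvec.independentD[OF assms(1,2) subset_refl assms(3,4)] .

lemma image_fin_dim:
  assumes "linear_map S T f" "fin_dim S"
  shows "fin_dim (f ` S)"
proof -
  obtain B where B: "finite B" "is_basis B S" "B \<subseteq> S" using fin_dim_basis[OF assms(2)] .
  have S: "cvec.subspace S" using assms(2) by (rule fin_dim_subspace)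
  have "f ` S = cvec.span (f ` B)"
  proof
    show "f ` S \<subseteq> cvec.span (f ` B)"
    proof
      fix y assume "y \<in> f ` S"
      then obtain x where x: "x \<in> S" "y = f x" by auto
      have "y = f (\<Sum>b\<in>B. cvec.representation B x b *\<^sub>C b)"
        using is_basis_sum_representation[OF B(2,1) x(1)] x by simp
      also have "\<dots> = (\<Sum>b\<in>B. cvec.representation B x b *\<^sub>C f b)"
        using B by (intro linear_map_lincomb[OF assms(1) S]) auto
      also have "\<dots> \<in> cvec.span (f ` B)"
        by (intro cvec.span_sum cvec.span_scale cvec.span_base) auto
      finally show "y \<in> cvec.span (f ` B)" .
    qed
    show "cvec.span (f ` B) \<subseteq> f ` S"
      using B linear_map_subspace_image[OF assms(1) S] by (intro cvec.span_minimal) auto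
  qed
  then show ?thesis using B by (auto simp: fin_dim_def)
qed

text \<open>The annihilating polynomial of a vector splits, and a linear factor of one of minimal degree
  yields the eigenvector.\<close>

lemma ex_eigenvector:
  fixes S :: "'a :: complex_vector set"
  assumes "fin_dim S" "S \<noteq> {0}" "linear_map S S f"
  obtains c x where "x \<in> S" "x \<noteq> 0" "f x = c *\<^sub>C x"
proof -
  have S: "cvec.subspace S" using assms(1) by (rule fin_dim_subspace)
  obtain w where w: "w \<in> S" "w \<noteq> 0" using assms(2) cvec.subspace_0[OF S] by auto
  have mem: "(f ^^ i) w \<in> S" for i
    by (induction i) (auto simp: w linear_map_mem[OF assms(3)])
  \<comment> \<open>This is p(f) w cut off after n terms; \<open>ann\<close> demands n beyond the
    degree, so that nothing is cut.\<close>
  define E where "E n p = (\<Sum>i<n. coeff p i *\<^sub>C (f ^^ i) w)" for n and p :: "complex poly"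
  have E_mem: "E n p \<in> S" for n p
    unfolding E_def by (intro cvec.subspace_sum[OF S] cvec.subspace_scale[OF S] mem)
  define ann where "ann p \<longleftrightarrow> p \<noteq> 0 \<and> (\<exists>n>degree p. E n p = 0)" for p :: "complex poly"
  obtain F where F: "finite F" "S = cvec.span F" using assms(1) by (auto simp: fin_dim_def)
  have "\<exists>p. ann p"
  \<comment> \<open>If two of the powers agree, the set \<open>?A\<close> below may be too small to
    be dependent by dimension; but then x^i - x^j already annihilates \<open>w\<close>.\<close>
  proof (cases "inj_on (\<lambda>i. (f ^^ i) w) {..card F}")
    case False
    then obtain i j where ij: "i \<le> card F" "j \<le> card F" "i \<noteq> j" "(f ^^ i) w = (f ^^ j) w"
      by (auto simp: inj_on_def)
    define p where "p = monom (1 :: complex) i - monom 1 j"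
    have c: "coeff p k = (if k = i then 1 else if k = j then -1 else 0)" for k
      using ij by (auto simp: p_def)
    have "E (Suc (card F)) p = (\<Sum>k\<in>{i, j}. coeff p k *\<^sub>C (f ^^ k) w)"
      unfolding E_def using ij by (intro sum.mono_neutral_right) (auto simp: c)
    also have "\<dots> = 0" using ij by (simp add: c)
    finally have "E (Suc (card F)) p = 0" .
    moreover have "degree p \<le> card F"
      using ij by (intro degree_le) (auto simp: c)
    moreover have "p \<noteq> 0" using c[of i] by auto
    ultimately show ?thesis unfolding ann_def by (meson le_imp_less_Suc)
  next
    case True
    let ?A = "(\<lambda>i. (f ^^ i) w) ` {..card F}"
    have "cvec.dependent ?A"
    proof (rule ccontr)
      assume "\<not> cvec.dependent ?A"
      then have "card ?A \<le> card F"
        using cvec.independent_span_bound[OF F(1), of ?A] mem F(2) by auto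
      then show False using card_image[OF True] by simp
    qed
    then obtain u where u: "\<exists>v\<in>?A. u v \<noteq> 0" "(\<Sum>v\<in>?A. u v *\<^sub>C v) = 0"
      using cvec.dependent_finite[of ?A] by auto
    define p where "p = (\<Sum>i\<le>card F. monom (u ((f ^^ i) w)) i)"
    have c: "coeff p k = (if k \<le> card F then u ((f ^^ k) w) else 0)" for k
      unfolding p_def by (simp add: coeff_sum)
    have "E (Suc (card F)) p = (\<Sum>i\<le>card F. u ((f ^^ i) w) *\<^sub>C (f ^^ i) w)"
      unfolding E_def by (intro sum.cong) (auto simp: c)
    also have "\<dots> = 0" using u(2) by (simp add: sum.reindex[OF True])
    finally have "E (Suc (card F)) p = 0" .
    moreover have "degree p \<le> card F" by (intro degree_le) (auto simp: c)
    moreover have "p \<noteq> 0" using u(1) c by (auto simp: poly_eq_iff)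
    ultimately show ?thesis unfolding ann_def by (meson le_imp_less_Suc)
  qed
  then obtain p where p: "ann p" "\<And>q. ann q \<Longrightarrow> degree p \<le> degree q"
    using arg_min_natI[of ann _ degree] arg_min_nat_le[of ann _ degree] by metis
  obtain n where n: "n > degree p" "E n p = 0" "p \<noteq> 0" using p(1) by (auto simp: ann_def)
  have "degree p \<noteq> 0"
  proof
    assume "degree p = 0"
    then obtain a where a: "p = [:a:]" by (metis degree_eq_zeroE)
    have "E n p = (\<Sum>i\<in>{0}. coeff p i *\<^sub>C (f ^^ i) w)"
      unfolding E_def using n(1) by (intro sum.mono_neutral_right) (auto simp: a coeff_pCons split: nat.splits)
    then show False using n w by (simp add: a)
  qed
  then obtain c where "poly p c = 0"
    using fundamental_theorem_of_algebra[of p] by (auto simp: constant_degree)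
  then obtain q where q: "p = [:-c, 1:] * q" by (auto simp: poly_eq_0_iff_dvd)
  with n have "q \<noteq> 0" by auto
  then have deg: "degree p = Suc (degree q)" unfolding q by (subst degree_mult_eq) auto
  obtain m where m: "n = Suc m" using n(1) by (cases n) auto
  have "E n q \<noteq> 0"
    using p(2)[of q] deg n(1) \<open>q \<noteq> 0\<close> unfolding ann_def
    by (metis Suc_lessD Suc_n_not_le_n)
  moreover have "f (E n q) = c *\<^sub>C E n q"
  proof -
    \<comment> \<open>Applying \<open>f\<close> would push the term of index m out of the range of
      \<open>E n\<close>; it is zero because q has smaller degree than p.\<close>
    have qm: "coeff q m = 0" using n(1) deg m by (intro coeff_eq_0) auto
    have "f (E n q) = (\<Sum>i<n. coeff q i *\<^sub>C f ((f ^^ i) w))"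
      unfolding E_def by (intro linear_map_lincomb[OF assms(3) S] mem)
    also have "\<dots> = (\<Sum>i<m. coeff q i *\<^sub>C (f ^^ Suc i) w)"
      by (simp add: m qm)
    also have "\<dots> = (\<Sum>i<n. coeff (pCons 0 q) i *\<^sub>C (f ^^ i) w)"
      unfolding m by (subst sum.lessThan_Suc_shift) simp
    finally have "f (E n q) = (\<Sum>i<n. coeff (pCons 0 q) i *\<^sub>C (f ^^ i) w)" .
    moreover have "p = pCons 0 q - smult c q" unfolding q by simp
    then have "E n p = (\<Sum>i<n. coeff (pCons 0 q) i *\<^sub>C (f ^^ i) w) - c *\<^sub>C E n q"
      unfolding E_def
      by (simp add: cvec.scale_left_diff_distrib sum_subtractf cvec.scale_sum_right scaleC_scaleC)
    ultimately show ?thesis using n(2) by simp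
  qed
  ultimately show ?thesis using that E_mem by blast
qed

text \<open>\<open>trace_on\<close> takes its basis by choice, so independence of the basis has to
  be shown. Expanding \<open>f b\<close> through \<open>C\<close> and \<open>f c\<close> through
  \<open>B\<close> leads to the same double sum, as in trace(PQ) = trace(QP).\<close>

lemma sum_representation_trace_eq:
  assumes B: "is_basis B S" "finite B" and C: "is_basis C S" "finite C"
    and f: "linear_map S S f" and S: "cvec.subspace S"
  shows "(\<Sum>b\<in>B. cvec.representation B (f b) b) = (\<Sum>c\<in>C. cvec.representation C (f c) c)"
proof -
  let ?rB = "cvec.representation B" and ?rC = "cvec.representation C"
  have BS: "B \<subseteq> S" "C \<subseteq> S" using B C by (auto dest: is_basis_subset)
  have iB: "cvec.independent B" "cvec.span B = S" and iC: "cvec.independent C" "cvec.span C = S"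
    using B C by (auto simp: is_basis_def)
  have rB: "?rB (\<Sum>i\<in>I. a i *\<^sub>C x i) y = (\<Sum>i\<in>I. a i * ?rB (x i) y)"
    if "\<And>i. i \<in> I \<Longrightarrow> x i \<in> S" for I :: "'a set" and a x y
    using that iB S
    by (subst cvec.representation_sum)
       (auto simp: cvec.representation_scale cvec.subspace_scale intro!: sum.cong)
  have rC: "?rC (\<Sum>i\<in>I. a i *\<^sub>C x i) y = (\<Sum>i\<in>I. a i * ?rC (x i) y)"
    if "\<And>i. i \<in> I \<Longrightarrow> x i \<in> S" for I :: "'a set" and a x y
    using that iC S
    by (subst cvec.representation_sum)
       (auto simp: cvec.representation_scale cvec.subspace_scale intro!: sum.cong)
  have fS: "f x \<in> S" if "x \<in> S" for x using linear_map_mem[OF f that] .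
  have 1: "?rB (f b) b = (\<Sum>c\<in>C. ?rC b c * ?rB (f c) b)" if "b \<in> B" for b
  proof -
    have "f b = f (\<Sum>c\<in>C. ?rC b c *\<^sub>C c)"
      using is_basis_sum_representation[OF C] that BS by auto
    also have "\<dots> = (\<Sum>c\<in>C. ?rC b c *\<^sub>C f c)"
      using BS by (intro linear_map_lincomb[OF f S]) auto
    finally show ?thesis using BS fS by (simp add: rB subset_iff)
  qed
  have 2: "?rC (f c) c = (\<Sum>b\<in>B. ?rB (f c) b * ?rC b c)" if "c \<in> C" for c
  proof -
    have "f c = (\<Sum>b\<in>B. ?rB (f c) b *\<^sub>C b)"
      using is_basis_sum_representation[OF B] that BS fS by auto
    then have "?rC (f c) c = ?rC (\<Sum>b\<in>B. ?rB (f c) b *\<^sub>C b) c" by simp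
    then show ?thesis using BS by (simp add: rC subset_iff)
  qed
  have "(\<Sum>b\<in>B. ?rB (f b) b) = (\<Sum>b\<in>B. \<Sum>c\<in>C. ?rC b c * ?rB (f c) b)"
    by (simp add: 1)
  also have "\<dots> = (\<Sum>c\<in>C. \<Sum>b\<in>B. ?rB (f c) b * ?rC b c)"
    by (subst sum.swap) (simp add: mult.commute)
  finally show ?thesis by (simp add: 2)
qed

lemma trace_on_basis:
  assumes "is_basis B S" "finite B" "linear_map S S f"
  shows "trace_on S f = (\<Sum>b\<in>B. cvec.representation B (f b) b)"
proof -
  have S: "cvec.subspace S" "fin_dim S"
    using assms by (auto simp: is_basis_def fin_dim_def)
  have "is_basis (SOME B. is_basis B S) S" using assms(1) by (rule someI)
  then show ?thesis
    unfolding trace_on_def Let_def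
    using is_basis_finite[OF S(2)] assms S by (intro sum_representation_trace_eq[where S = S]) auto
qed

lemma is_basis_image:
  assumes "is_basis B S" "linear_map S T f" "bij_betw f S T"
  shows "is_basis (f ` B) T"
proof -
  have B: "B \<subseteq> S" "cvec.independent B" "cvec.span B = S" "cvec.subspace S"
    using assms is_basis_subset[OF assms(1)] by (auto simp: is_basis_def)
  have inj: "inj_on f S" and im: "f ` S = T" using assms by (auto simp: bij_betw_def)
  have ST: "cvec.subspace T"
    using linear_map_subspace_image[OF assms(2) B(4)] im by simp
  have "cvec.independent (f ` B)"
    unfolding cvec.independent_explicit_module
  proof (intro allI impI)
    fix t u v assume t: "finite t" "t \<subseteq> f ` B" "(\<Sum>v\<in>t. u v *\<^sub>C v) = 0" "v \<in> t"
    obtain s where s: "s \<subseteq> B" "t = f ` s" using t(2) by (auto simp: subset_image_iff)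
    have injs: "inj_on f s" using inj s B by (meson inj_on_subset subset_trans)
    then have fs: "finite s" using t(1) s finite_image_iff by auto
    have sS: "s \<subseteq> S" using s B by auto
    have "f (\<Sum>b\<in>s. u (f b) *\<^sub>C b) = (\<Sum>b\<in>s. u (f b) *\<^sub>C f b)"
      using sS by (intro linear_map_lincomb[OF assms(2) B(4)]) auto
    also have "\<dots> = 0" using t(3) s injs by (simp add: sum.reindex)
    also have "\<dots> = f 0" using linear_map_zero[OF assms(2) B(4)] by simp
    finally have "(\<Sum>b\<in>s. u (f b) *\<^sub>C b) = 0"
      by (rule inj_onD[OF inj])
         (use sS B(4) in \<open>auto simp: cvec.subspace_0 intro!: cvec.subspace_sum cvec.subspace_scale\<close>)
    then show "u v = 0"
      using cvec.independentD[OF B(2) fs s(1), of "\<lambda>b. u (f b)"] t(4) s by auto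
  qed
  moreover have "cvec.span (f ` B) = T"
  proof
    show "cvec.span (f ` B) \<subseteq> T" using B im ST by (intro cvec.span_minimal) auto
    show "T \<subseteq> cvec.span (f ` B)"
    proof
      fix y assume "y \<in> T"
      then obtain x where x: "x \<in> S" "y = f x" using im by auto
      then obtain t r where t: "finite t" "t \<subseteq> B" "x = (\<Sum>a\<in>t. r a *\<^sub>C a)"
        using B(3) by (auto simp: cvec.span_explicit)
      have "f x = (\<Sum>a\<in>t. r a *\<^sub>C f a)"
        unfolding t(3) using t(2) B by (intro linear_map_lincomb[OF assms(2) B(4)]) auto
      also have "\<dots> \<in> cvec.span (f ` B)"
        using t by (intro cvec.span_sum cvec.span_scale cvec.span_base) auto
      finally show "y \<in> cvec.span (f ` B)" using x by simp
    qed
  qed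
  ultimately show ?thesis by (simp add: is_basis_def)
qed

text \<open>\<open>f\<close> carries a basis to a basis in which \<open>b\<close> has the matrix of
  \<open>a\<close>. This makes the character an invariant of the isomorphism class.\<close>

lemma trace_on_iso:
  assumes "fin_dim S" "linear_map S T f" "bij_betw f S T" "linear_map S S a" "linear_map T T b"
    "\<And>x. x \<in> S \<Longrightarrow> f (a x) = b (f x)"
  shows "trace_on S a = trace_on T b"
proof -
  obtain B where B: "finite B" "is_basis B S" "B \<subseteq> S" using fin_dim_basis[OF assms(1)] .
  have S: "cvec.subspace S" using assms(1) by (rule fin_dim_subspace)
  have inj: "inj_on f S" using assms(3) by (auto simp: bij_betw_def)
  have injB: "inj_on f B" using inj B(3) by (rule inj_on_subset)
  have fB: "is_basis (f ` B) T" using is_basis_image[OF B(2) assms(2,3)] .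
  have rep: "cvec.representation (f ` B) (f x) (f b) = cvec.representation B x b" if "x \<in> S" "b \<in> B" for x b
  proof -
    have "f x = f (\<Sum>b\<in>B. cvec.representation B x b *\<^sub>C b)"
      using is_basis_sum_representation[OF B(2,1) that(1)] by simp
    also have "\<dots> = (\<Sum>b\<in>B. cvec.representation B x b *\<^sub>C f b)"
      using B by (intro linear_map_lincomb[OF assms(2) S]) auto
    finally have fx: "f x = \<dots>" .
    have i: "cvec.independent (f ` B)" "cvec.span (f ` B) = T" using fB by (auto simp: is_basis_def)
    have fbm: "f b' \<in> cvec.span (f ` B)" if "b' \<in> B" for b'
      using that by (intro cvec.span_base) auto
    have "cvec.representation (f ` B) (f x) (f b)
        = (\<Sum>b'\<in>B. cvec.representation B x b' * cvec.representation (f ` B) (f b') (f b))"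
      unfolding fx using i(1) fbm
      by (subst cvec.representation_sum)
         (auto simp: cvec.representation_scale intro!: cvec.span_scale)
    also have "\<dots> = (\<Sum>b'\<in>B. if b' = b then cvec.representation B x b' else 0)"
      using i(1) injB that(2)
      by (intro sum.cong refl) (auto simp: cvec.representation_basis inj_on_def)
    finally show ?thesis using that B(1) by simp
  qed
  have "trace_on T b = (\<Sum>c\<in>f ` B. cvec.representation (f ` B) (b c) c)"
    using fB B(1) assms(5) by (intro trace_on_basis) auto
  also have "\<dots> = (\<Sum>c\<in>B. cvec.representation (f ` B) (f (a c)) (f c))"
    using B(3) assms(6) by (subst sum.reindex[OF injB]) (auto intro!: sum.cong)
  also have "\<dots> = (\<Sum>c\<in>B. cvec.representation B (a c) c)"
    using B(3) linear_map_mem[OF assms(4)] by (intro sum.cong refl rep) auto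
  also have "\<dots> = trace_on S a"
    using B assms(4) by (intro trace_on_basis[symmetric]) auto
  finally show ?thesis ..
qed

lemma trace_on_zero_map:
  assumes "fin_dim S" "\<And>x. x \<in> S \<Longrightarrow> f x = 0"
  shows "trace_on S f = 0"
proof -
  obtain B where B: "finite B" "is_basis B S" "B \<subseteq> S" using fin_dim_basis[OF assms(1)] .
  have "linear_map S S f"
    using assms fin_dim_subspace[OF assms(1)]
    by (auto simp: linear_map_def cvec.subspace_0 cvec.subspace_add cvec.subspace_scale)
  then have "trace_on S f = (\<Sum>b\<in>B. cvec.representation B (f b) b)"
    using B by (intro trace_on_basis)
  also have "\<dots> = 0" using B assms by (intro sum.neutral) (auto simp: cvec.representation_zero)
  finally show ?thesis .
qed

text \<open>The value is the dimension, a positive integer. With \<open>trace_on_zero_map\<close> it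
  lets characters distinguish modules on which one element acts as 1 and as 0.\<close>

lemma trace_on_id_map:
  assumes "fin_dim S" "S \<noteq> {0}" "\<And>x. x \<in> S \<Longrightarrow> f x = x"
  shows "trace_on S f \<noteq> 0"
proof -
  obtain B where B: "finite B" "is_basis B S" "B \<subseteq> S" using fin_dim_basis[OF assms(1)] .
  have "linear_map S S f"
    using assms fin_dim_subspace[OF assms(1)]
    by (auto simp: linear_map_def cvec.subspace_add cvec.subspace_scale)
  then have "trace_on S f = (\<Sum>b\<in>B. cvec.representation B (f b) b)"
    using B by (intro trace_on_basis)
  also have "\<dots> = (\<Sum>b\<in>B. 1)"
    using B assms(3) by (intro sum.cong refl) (auto simp: is_basis_def cvec.representation_basis subset_iff)
  also have "\<dots> = of_nat (card B)" by simp
  also have "\<dots> \<noteq> 0"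
    using B assms(2) by (auto simp: is_basis_def)
  finally show ?thesis .
qed

section \<open>The density theorem\<close>

text \<open>\<open>Op\<close> is only a set of operators and \<open>R\<close> an invariant subspace
  of the product of copies of the \<open>S k\<close>, one for each slot in \<open>J\<close>; no
  algebra generated by \<open>Op\<close> is formed. One statement thus serves both for orbits of a
  tuple and for solution spaces of linear relations. Induction on \<open>J\<close>: \<open>R\<close>
  surjects onto the remaining slots and meets slot \<open>j0\<close> either fully, which suffices,
  or trivially. In the second case \<open>R\<close> is the graph of a homomorphism, Schur's lemma
  makes it a combination of scalars, and the vector of slot \<open>j0\<close> would depend linearly
  on the others.\<close>

lemma jacobson_density:
  fixes S :: "'k \<Rightarrow> 'm::complex_vector set" and act :: "'k \<Rightarrow> 'o \<Rightarrow> 'm \<Rightarrow> 'm"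
    and R :: "('k \<times> 'm \<Rightarrow> 'm) set"
  assumes subspace: "\<And>k. k \<in> K \<Longrightarrow> cvec.subspace (S k)"
    and linear: "\<And>k a. k \<in> K \<Longrightarrow> a \<in> Op \<Longrightarrow> linear_map (S k) (S k) (act k a)"
    and simple: "\<And>k W. k \<in> K \<Longrightarrow> cvec.subspace W \<Longrightarrow> W \<subseteq> S k \<Longrightarrow>
        (\<forall>a\<in>Op. \<forall>w\<in>W. act k a w \<in> W) \<Longrightarrow> W = {0} \<or> W = S k"
    and schur: "\<And>k l f. k \<in> K \<Longrightarrow> l \<in> K \<Longrightarrow> linear_map (S k) (S l) f \<Longrightarrow>
        (\<forall>a\<in>Op. \<forall>w\<in>S k. f (act k a w) = act l a (f w)) \<Longrightarrow>
        \<exists>c. \<forall>w\<in>S k. f w = (if k = l then c *\<^sub>C w else 0)"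
    and "finite J" "\<And>k b. (k, b) \<in> J \<Longrightarrow> k \<in> K \<and> b \<in> S k"
    and "\<And>k. k \<in> K \<Longrightarrow> cvec.independent {b. (k, b) \<in> J}"
    and "cvec.subspace R"
    and "\<And>r j. r \<in> R \<Longrightarrow> j \<in> J \<Longrightarrow> r j \<in> S (fst j)" "\<And>r j. r \<in> R \<Longrightarrow> j \<notin> J \<Longrightarrow> r j = 0"
    and "\<And>r a. r \<in> R \<Longrightarrow> a \<in> Op \<Longrightarrow> (\<lambda>j. if j \<in> J then act (fst j) a (r j) else 0) \<in> R"
    and "(\<lambda>j. if j \<in> J then snd j else 0) \<in> R"
    and "\<And>j. j \<in> J \<Longrightarrow> t j \<in> S (fst j)" "\<And>j. j \<notin> J \<Longrightarrow> t j = 0"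
  shows "t \<in> R"
  using assms(5-)
proof (induction J arbitrary: R t rule: finite_induct)
  case empty
  have "t = 0" using empty.prems(9) by (auto simp: fun_eq_iff)
  then show ?case by (metis cvec.subspace_0[OF empty.prems(3)])
next
  case (insert j0 J)
  define k0 where "k0 = fst j0"
  let ?J = "insert j0 J"
  have j0: "j0 = (k0, snd j0)" by (simp add: k0_def)
  have "fst j \<in> K \<and> snd j \<in> S (fst j)" if "j \<in> ?J" for j
    using insert.prems(1)[of "fst j" "snd j"] that by simp
  then have K: "k0 \<in> K" "snd j0 \<in> S k0" "\<And>j. j \<in> ?J \<Longrightarrow> fst j \<in> K" "\<And>j. j \<in> ?J \<Longrightarrow> snd j \<in> S (fst j)"
    by (auto simp: k0_def)
  have act0: "act k a 0 = 0" if "k \<in> K" "a \<in> Op" for k a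
    using linear_map_zero[OF linear subspace] that by blast
  note R = insert.prems(3)
  note Radd = cvec.subspace_add[OF R] and Rscale = cvec.subspace_scale[OF R]
    and Rdiff = cvec.subspace_diff[OF R]
  define res where "res t = (\<lambda>j. if j \<in> J then t j else 0)" for t :: "'k \<times> 'm \<Rightarrow> 'm"
  define single where "single j x = (\<lambda>i. if i = j then x else 0)" for j :: "'k \<times> 'm" and x :: 'm
  define A where "A a t = (\<lambda>j. if j \<in> J then act (fst j) a (t j) else 0)" for a t
  define A' where "A' a t = (\<lambda>j. if j \<in> ?J then act (fst j) a (t j) else 0)" for a t
  have res_add: "res (r + r') = res r + res r'" and res_scale: "res (c *\<^sub>C r) = c *\<^sub>C res r" for r r' c
    by (auto simp: res_def fun_eq_iff scaleC_fun_def)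
  have res_A: "res (A' a r) = A a (res r)" for a r
    by (auto simp: res_def A_def A'_def fun_eq_iff)
  have A'R: "A' a r \<in> R" if "r \<in> R" "a \<in> Op" for a r
    unfolding A'_def using insert.prems(6)[OF that] .
  have res_surj: "t \<in> res ` R" if t: "\<And>j. j \<in> J \<Longrightarrow> t j \<in> S (fst j)" "\<And>j. j \<notin> J \<Longrightarrow> t j = 0" for t
  proof (rule insert.IH)
    show "k \<in> K \<and> b \<in> S k" if "(k, b) \<in> J" for k b using insert.prems(1) that by auto
    show "cvec.independent {b. (k, b) \<in> J}" if "k \<in> K" for k
      using insert.prems(2)[OF that] by (rule cvec.independent_mono) auto
    show "cvec.subspace (res ` R)"
    proof (rule cvec.subspaceI)
      show "0 \<in> res ` R"
        using cvec.subspace_0[OF R] by (intro image_eqI[of _ _ 0]) (auto simp: res_def fun_eq_iff)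
    qed (use Radd Rscale in \<open>auto simp flip: res_add res_scale\<close>)
    show "r j \<in> S (fst j)" if "r \<in> res ` R" "j \<in> J" for r j
    proof -
      from that obtain r' where "r' \<in> R" "r = res r'" by blast
      then show ?thesis using that(2) insert.prems(4)[of r' j] by (simp add: res_def)
    qed
    show "r j = 0" if "r \<in> res ` R" "j \<notin> J" for r j
      using that by (auto simp: res_def)
    show "(\<lambda>j. if j \<in> J then act (fst j) a (r j) else 0) \<in> res ` R"
      if "r \<in> res ` R" "a \<in> Op" for r a
      using that A'R by (auto simp: A_def[symmetric] res_A[symmetric])
    have "(\<lambda>j. if j \<in> J then snd j else 0) = res (\<lambda>j. if j \<in> ?J then snd j else 0)"
      by (auto simp: res_def)
    then show "(\<lambda>j. if j \<in> J then snd j else 0) \<in> res ` R"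
      using insert.prems(7) by blast
  qed (use t in auto)
  \<comment> \<open>The part of \<open>R\<close> supported in slot \<open>j0\<close>, an invariant
    subspace of the simple \<open>S k0\<close>.\<close>
  define R0 where "R0 = {x \<in> S k0. single j0 x \<in> R}"
  have single_add: "single j (x + y) = single j x + single j y"
    and single_scale: "single j (c *\<^sub>C x) = c *\<^sub>C single j x" for j x y c
    by (auto simp: single_def fun_eq_iff scaleC_fun_def)
  have "R0 = {0} \<or> R0 = S k0"
  proof (rule simple[OF K(1)])
    have "single j0 0 = 0" by (auto simp: single_def)
    then show "cvec.subspace R0"
      unfolding R0_def using subspace[OF K(1)] cvec.subspace_0[OF R] Radd Rscale
      by (intro cvec.subspaceI)
         (auto simp: cvec.subspace_0 cvec.subspace_add cvec.subspace_scale single_add single_scale)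
    show "\<forall>a\<in>Op. \<forall>w\<in>R0. act k0 a w \<in> R0"
    proof (intro ballI)
      fix a w assume a: "a \<in> Op" "w \<in> R0"
      have "single j0 (act k0 a w) = A' a (single j0 w)"
        using act0[OF K(3) a(1)] by (intro ext) (simp add: single_def A'_def k0_def)
      then show "act k0 a w \<in> R0"
        using a A'R linear_map_mem[OF linear[OF K(1)]] by (auto simp: R0_def)
    qed
  qed (auto simp: R0_def)
  then consider "R0 = S k0" | "R0 = {0}" by blast
  then show ?case
  proof cases
    case 1
    have "res t \<in> res ` R"
      using insert.prems(8) by (intro res_surj) (auto simp: res_def)
    then obtain r where r: "r \<in> R" "res t = res r" by blast
    have "t j0 - r j0 \<in> S k0"
      using insert.prems(8)[of j0] insert.prems(4)[OF r(1), of j0] subspace[OF K(1)]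
      by (auto simp: k0_def intro: cvec.subspace_diff)
    then have "single j0 (t j0 - r j0) \<in> R" using 1 by (auto simp: R0_def)
    moreover have "t = r + single j0 (t j0 - r j0)"
    proof
      fix j
      show "t j = (r + single j0 (t j0 - r j0)) j"
        using fun_cong[OF r(2), of j] insert.prems(9)[of j] insert.prems(5)[OF r(1), of j]
        by (auto simp: res_def single_def split: if_splits)
    qed
    ultimately show ?thesis using Radd r(1) by metis
  next
    case 2
    \<comment> \<open>Now an element of \<open>R\<close> is determined by its other slots, so its
      entry at \<open>j0\<close> is a well-defined function \<open>F\<close> of them.\<close>
    have uniq: "r j0 = r' j0" if "r \<in> R" "r' \<in> R" "res r = res r'" for r r'
    proof -
      have "r - r' = single j0 (r j0 - r' j0)"
      proof
        fix j
        show "(r - r') j = single j0 (r j0 - r' j0) j"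
          using fun_cong[OF that(3), of j] insert.prems(5)[OF that(1), of j] insert.prems(5)[OF that(2), of j]
          by (auto simp: res_def single_def split: if_splits)
      qed
      then have "single j0 (r j0 - r' j0) \<in> R" using Rdiff that by metis
      moreover have "r j0 - r' j0 \<in> S k0"
        using insert.prems(4)[OF that(1), of j0] insert.prems(4)[OF that(2), of j0] subspace[OF K(1)]
        by (auto simp: k0_def intro: cvec.subspace_diff)
      ultimately have "r j0 - r' j0 \<in> R0" by (auto simp: R0_def)
      then show ?thesis using 2 by auto
    qed
    define F where "F t = (SOME r. r \<in> R \<and> res r = t) j0" for t
    have F: "F (res r) = r j0" if "r \<in> R" for r
    proof -
      have "\<exists>r'. r' \<in> R \<and> res r' = res r" using that by blast
      from someI_ex[OF this] show ?thesis unfolding F_def using that uniq by blast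
    qed
    have F_add: "F (t + t') = F t + F t'" if "t \<in> res ` R" "t' \<in> res ` R" for t t'
      using that F Radd by (auto simp flip: res_add)
    have F_scale: "F (c *\<^sub>C t) = c *\<^sub>C F t" if t: "t \<in> res ` R" for t c
    proof -
      obtain r where r: "r \<in> R" "t = res r" using t by blast
      have "F (c *\<^sub>C t) = (c *\<^sub>C r) j0" unfolding r(2) res_scale[symmetric] by (rule F[OF Rscale[OF r(1)]])
      then show ?thesis using F[OF r(1)] r(2) by (simp add: scaleC_fun_def)
    qed
    have F_A: "F (A a t) = act k0 a (F t)" if t: "t \<in> res ` R" "a \<in> Op" for t a
    proof -
      obtain r where r: "r \<in> R" "t = res r" using t by blast
      have "F (A a t) = A' a r j0" using F[OF A'R[OF r(1) t(2)]] r(2) res_A by simp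
      also have "\<dots> = act k0 a (F t)" using F[OF r(1)] r(2) by (simp add: A'_def k0_def)
      finally show ?thesis .
    qed
    have single_res: "single j x \<in> res ` R" if "j \<in> J" "x \<in> S (fst j)" for j x
      using that subspace[OF K(3)] by (intro res_surj) (auto simp: single_def cvec.subspace_0)
    \<comment> \<open>Restricted to one slot, \<open>F\<close> commutes with \<open>Op\<close>: it
      is a scalar if that slot has type \<open>k0\<close>, and zero otherwise.\<close>
    have "\<exists>c. \<forall>w\<in>S (fst j). F (single j w) = (if fst j = k0 then c *\<^sub>C w else 0)" if j: "j \<in> J" for j
    proof (rule schur)
      show "fst j \<in> K" "k0 \<in> K" using j K by auto
      show "linear_map (S (fst j)) (S k0) (\<lambda>w. F (single j w))"
        unfolding linear_map_def
      proof (intro conjI ballI allI)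
        fix x assume x: "x \<in> S (fst j)"
        then obtain r where "r \<in> R" "single j x = res r" using single_res j by blast
        then show "F (single j x) \<in> S k0"
          using F insert.prems(4)[of r j0] by (auto simp: k0_def)
        fix y assume y: "y \<in> S (fst j)"
        show "F (single j (x + y)) = F (single j x) + F (single j y)"
          unfolding single_add using j x y by (intro F_add single_res)
      next
        fix c x assume x: "x \<in> S (fst j)"
        show "F (single j (c *\<^sub>C x)) = c *\<^sub>C F (single j x)"
          unfolding single_scale using j x by (intro F_scale single_res)
      qed
      show "\<forall>a\<in>Op. \<forall>w\<in>S (fst j). F (single j (act (fst j) a w)) = act k0 a (F (single j w))"
      proof (intro ballI)
        fix a w assume aw: "a \<in> Op" "w \<in> S (fst j)"
        have "single j (act (fst j) a w) = A a (single j w)"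
          using j act0[OF K(3) aw(1)] by (intro ext) (simp add: single_def A_def)
        then show "F (single j (act (fst j) a w)) = act k0 a (F (single j w))"
          using F_A[OF single_res[OF j aw(2)] aw(1)] by simp
      qed
    qed
    then obtain c where c: "F (single j w) = (if fst j = k0 then c j *\<^sub>C w else 0)"
      if "j \<in> J" "w \<in> S (fst j)" for j w
      by metis
    have FJ: "F (\<Sum>j\<in>I. single j (snd j)) = (\<Sum>j\<in>I. F (single j (snd j))) \<and>
        (\<Sum>j\<in>I. single j (snd j)) \<in> res ` R" if "I \<subseteq> J" for I
      using finite_subset[OF that insert.hyps(1)] that
    proof (induction I rule: finite_induct)
      case empty
      have "res 0 = 0" by (auto simp: res_def)
      then have "0 \<in> res ` R" using cvec.subspace_0[OF R] by (metis imageI)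
      moreover have "F 0 = 0" using F[OF cvec.subspace_0[OF R]] \<open>res 0 = 0\<close> by simp
      ultimately show ?case unfolding sum.empty by blast
    next
      case (insert i I)
      have i: "single i (snd i) \<in> res ` R" using insert.prems K(4) by (intro single_res) auto
      have IH: "F (\<Sum>j\<in>I. single j (snd j)) = (\<Sum>j\<in>I. F (single j (snd j)))"
        "(\<Sum>j\<in>I. single j (snd j)) \<in> res ` R"
        using insert by blast+
      have "single i (snd i) + (\<Sum>j\<in>I. single j (snd j)) \<in> res ` R"
      proof -
        from i obtain r where r: "r \<in> R" "single i (snd i) = res r" by blast
        from IH(2) obtain r' where r': "r' \<in> R" "(\<Sum>j\<in>I. single j (snd j)) = res r'" by blast
        show ?thesis
          unfolding r(2) r'(2) res_add[symmetric] using Radd[OF r(1) r'(1)] by (rule imageI)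
      qed
      then show ?case
        unfolding sum.insert[OF insert.hyps] F_add[OF i IH(2)] IH(1) by blast
    qed
    have base: "(\<lambda>j. if j \<in> J then snd j else 0) = (\<Sum>j\<in>J. single j (snd j))"
    proof
      fix i
      have "(\<Sum>j\<in>J. single j (snd j)) i = (\<Sum>j\<in>J. single j (snd j) i)"
        using insert.hyps(1) by (induction J rule: finite_induct) auto
      also have "\<dots> = (\<Sum>j\<in>J. if i = j then snd j else 0)" by (simp add: single_def)
      finally show "(if i \<in> J then snd i else 0) = (\<Sum>j\<in>J. single j (snd j)) i"
        using insert.hyps(1) by simp
    qed
    \<comment> \<open>Evaluating \<open>F\<close> at the tuple of the given vectors writes
      \<open>snd j0\<close> through vectors of the same type, against independence.\<close>
    have "snd j0 = F (\<lambda>j. if j \<in> J then snd j else 0)"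
      using F[OF insert.prems(7)] by (simp add: res_def cong: if_cong)
    also have "\<dots> = (\<Sum>j\<in>J. F (single j (snd j)))" using FJ[of J] base by simp
    also have "\<dots> = (\<Sum>j\<in>J. if fst j = k0 then c j *\<^sub>C snd j else 0)"
      using c K(4) by (intro sum.cong) auto
    also have "\<dots> \<in> cvec.span {b. (k0, b) \<in> J}"
    proof (intro cvec.span_sum)
      fix j assume j: "j \<in> J"
      have "snd j \<in> {b. (k0, b) \<in> J}" if "fst j = k0" using j that by force
      then show "(if fst j = k0 then c j *\<^sub>C snd j else 0) \<in> cvec.span {b. (k0, b) \<in> J}"
        by (simp add: cvec.span_scale cvec.span_base cvec.span_zero)
    qed
    finally have "snd j0 \<in> cvec.span {b. (k0, b) \<in> J}" .
    moreover have "{b. (k0, b) \<in> ?J} = insert (snd j0) {b. (k0, b) \<in> J}"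
      using j0 by auto
    moreover have "snd j0 \<notin> {b. (k0, b) \<in> J}" using insert.hyps(2) j0 by auto
    ultimately show ?thesis
      using insert.prems(2)[OF K(1)]
        cvec.independent_insert[of "snd j0" "{b. (k0, b) \<in> J}"] by presburger
  qed
qed

section \<open>Twisted modules\<close>

lemma is_voaD:
  assumes "is_voa V"
  shows "cvec.subspace (vcarrier V)"
    "\<And>u n. u \<in> vcarrier V \<Longrightarrow> linear_map (vcarrier V) (vcarrier V) (vY V u n)"
    "\<And>v n. v \<in> vcarrier V \<Longrightarrow> linear_map (vcarrier V) (vcarrier V) (\<lambda>u. vY V u n v)"
    "\<And>u v. u \<in> vcarrier V \<Longrightarrow> v \<in> vcarrier V \<Longrightarrow> \<exists>n0. \<forall>n\<ge>n0. vY V u n v = 0"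
    "vvac V \<in> vcarrier V" "vomega V \<in> vcarrier V"
  using assms by (simp_all add: is_voa_def)

lemma voa_AutD:
  assumes "g \<in> carrier (voa_Aut V)"
  shows "bij_betw g (vcarrier V) (vcarrier V)" "linear_map (vcarrier V) (vcarrier V) g"
    "\<And>u n v. u \<in> vcarrier V \<Longrightarrow> v \<in> vcarrier V \<Longrightarrow> g (vY V u n v) = vY V (g u) n (g v)"
    "g (vvac V) = vvac V" "g (vomega V) = vomega V"
  using assms unfolding voa_Aut_def Bij_def by auto

text \<open>Stated from closure properties alone so that it also serves for the fixed-point algebra,
  where the trivial twist must be shown to have order 1.\<close>

lemma voa_Aut_group:
  assumes sub: "cvec.subspace (vcarrier V)"
    and closed: "\<And>u n v. u \<in> vcarrier V \<Longrightarrow> v \<in> vcarrier V \<Longrightarrow> vY V u n v \<in> vcarrier V"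
    and vac: "vvac V \<in> vcarrier V" "vomega V \<in> vcarrier V"
  shows "group (voa_Aut V)"
proof -
  let ?S = "vcarrier V"
  define A where "A = carrier (voa_Aut V)"
  have eq: "voa_Aut V = BijGroup ?S \<lparr>carrier := A\<rparr>"
    by (simp add: voa_Aut_def A_def)
  have A: "g \<in> A \<longleftrightarrow> g \<in> Bij ?S \<and> linear_map ?S ?S g \<and>
        (\<forall>u\<in>?S. \<forall>n. \<forall>v\<in>?S. g (vY V u n v) = vY V (g u) n (g v)) \<and>
        g (vvac V) = vvac V \<and> g (vomega V) = vomega V" for g
    by (auto simp: A_def voa_Aut_def)
  have "subgroup A (BijGroup ?S)"
  proof (rule group.subgroupI[OF group_BijGroup])
    show "A \<subseteq> carrier (BijGroup ?S)" by (auto simp: BijGroup_def A)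
    have "(\<lambda>x\<in>?S. x) \<in> A"
      unfolding A using closed vac sub cvec.subspace_add[OF sub] cvec.subspace_scale[OF sub]
      by (auto simp: id_Bij linear_map_def)
    then show "A \<noteq> {}" by auto
    fix a assume a: "a \<in> A"
    then have aB: "a \<in> Bij ?S" and lin: "linear_map ?S ?S a"
      and Y: "\<And>u n v. u \<in> ?S \<Longrightarrow> v \<in> ?S \<Longrightarrow> a (vY V u n v) = vY V (a u) n (a v)"
      by (auto simp: A)
    have bij: "bij_betw a ?S ?S" using aB by (simp add: Bij_def)
    let ?i = "\<lambda>x\<in>?S. inv_into ?S a x"
    have im: "?i (a x) = x" if "x \<in> ?S" for x
      using that bij by (simp add: bij_betwE bij_betw_imp_inj_on)
    have ex: "\<exists>y\<in>?S. x = a y" if "x \<in> ?S" for x using that bij by (auto simp: bij_betw_def)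
    have "?i \<in> A"
      unfolding A
    proof (intro conjI ballI allI)
      show "?i \<in> Bij ?S" using aB by (rule restrict_inv_into_Bij)
      show "linear_map ?S ?S ?i"
        unfolding linear_map_def
      proof (intro conjI ballI allI)
        fix x assume "x \<in> ?S"
        then obtain x' where x: "x' \<in> ?S" "x = a x'" using ex by blast
        then show "?i x \<in> ?S" using im by simp
        show "?i (c *\<^sub>C x) = c *\<^sub>C ?i x" for c
          using x im cvec.subspace_scale[OF sub] linear_map_scale[OF lin, symmetric] by metis
        fix y assume "y \<in> ?S"
        then obtain y' where y: "y' \<in> ?S" "y = a y'" using ex by blast
        show "?i (x + y) = ?i x + ?i y"
          using x y im cvec.subspace_add[OF sub] linear_map_add[OF lin, symmetric] by metis
      qed
      fix u n v assume "u \<in> ?S" "v \<in> ?S"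
      then obtain u' v' where "u' \<in> ?S" "v' \<in> ?S" "u = a u'" "v = a v'" using ex by blast
      then show "?i (vY V u n v) = vY V (?i u) n (?i v)" using im Y closed by metis
    next
      show "?i (vvac V) = vvac V" "?i (vomega V) = vomega V"
        using im a vac by (metis A)+
    qed
    then show "inv\<^bsub>BijGroup ?S\<^esub> a \<in> A" using inv_BijGroup[OF aB] by simp
    fix b assume b: "b \<in> A"
    then have bB: "b \<in> Bij ?S" and linb: "linear_map ?S ?S b"
      and Yb: "\<And>u n v. u \<in> ?S \<Longrightarrow> v \<in> ?S \<Longrightarrow> b (vY V u n v) = vY V (b u) n (b v)"
      by (auto simp: A)
    have "compose ?S a b \<in> A"
      unfolding A
    proof (intro conjI ballI allI)
      show "compose ?S a b \<in> Bij ?S" using aB bB by (rule compose_Bij)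
      have "linear_map ?S ?S (\<lambda>x. a (b x))" using linb lin by (rule linear_map_comp)
      then show "linear_map ?S ?S (compose ?S a b)"
        using cvec.subspace_add[OF sub] cvec.subspace_scale[OF sub]
        by (auto simp: linear_map_def compose_def)
    qed (use closed vac Y Yb a b linear_map_mem[OF linb] in \<open>auto simp: compose_def A\<close>)
    then show "a \<otimes>\<^bsub>BijGroup ?S\<^esub> b \<in> A" using aB bB by (simp add: BijGroup_def)
  qed
  then show ?thesis
    unfolding eq by (rule subgroup.subgroup_is_group[OF _ group_BijGroup])
qed

lemma is_voa_Aut_group: "is_voa V \<Longrightarrow> group (voa_Aut V)"
  by (rule voa_Aut_group) (auto dest: is_voaD intro: linear_map_mem[OF is_voaD(2)])

lemma voa_Aut_mult:
  assumes "a \<in> carrier (voa_Aut V)" "b \<in> carrier (voa_Aut V)" "v \<in> vcarrier V"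
  shows "(a \<otimes>\<^bsub>voa_Aut V\<^esub> b) v = a (b v)"
  using assms by (auto simp: voa_Aut_def BijGroup_def compose_def)

lemma voa_Aut_one: "v \<in> vcarrier V \<Longrightarrow> \<one>\<^bsub>voa_Aut V\<^esub> v = v"
  by (auto simp: voa_Aut_def BijGroup_def)

lemma voa_Aut_pow:
  assumes "group (voa_Aut V)" "a \<in> carrier (voa_Aut V)" "v \<in> vcarrier V"
  shows "(a [^]\<^bsub>voa_Aut V\<^esub> (n::nat)) v = (a ^^ n) v"
  using assms(3)
proof (induction n arbitrary: v)
  case 0
  then show ?case by (simp add: voa_Aut_one)
next
  case (Suc n)
  interpret group "voa_Aut V" by fact
  have "a v \<in> vcarrier V" using Suc.prems voa_AutD(2)[OF assms(2)] linear_map_mem by blast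
  then show ?case
    using Suc assms(2) by (simp add: voa_Aut_mult funpow_Suc_right del: funpow.simps)
qed

text \<open>The base is an N-th root of unity other than 1, so the geometric sum vanishes. This is
  the orthogonality behind \<open>sum_eigenpart\<close>.\<close>

lemma sum_powers_root_unity:
  assumes "0 < i" "i < N"
  shows "(\<Sum>k<N. exp (2 * of_real pi * \<i> * of_nat i / of_nat N) ^ k) = 0"
proof -
  let ?z = "exp (2 * of_real pi * \<i> * of_nat i / of_nat N)"
  have c: "?z = cis (2 * pi * real i / real N)"
    by (simp add: cis_conv_exp mult_ac)
  have inj: "inj_on (\<lambda>k. cis (2 * pi * real k / real N)) {..<N}"
    using bij_betw_roots_unity[of N] assms by (auto simp: bij_betw_def)
  have "?z \<noteq> 1"
  proof
    assume "?z = 1"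
    then have "cis (2 * pi * real i / real N) = cis (2 * pi * real 0 / real N)" using c by simp
    from inj_onD[OF inj this] show False using assms by auto
  qed
  moreover have "?z ^ N = 1"
    using bij_betwE[OF bij_betw_roots_unity[of N]] assms unfolding c by auto
  ultimately show ?thesis by (simp add: geometric_sum)
qed

locale twisted_mod =
  fixes V :: "'v::complex_vector voa" and g :: "'v \<Rightarrow> 'v" and M :: "('v, 'm::complex_vector) vmodule"
  assumes voa: "is_voa V" and module: "weak_twisted_module V g M"
begin

definition N :: nat where "N = group.ord (voa_Aut V) g"

lemma
  shows g_Aut: "g \<in> carrier (voa_Aut V)"
    and N_pos: "N > 0"
    and M_subspace: "cvec.subspace (mcarrier M)"
    and M_weights: "direct_sum UNIV (mod_weight_space V M) (mcarrier M)"
    and M_lower: "\<exists>b. \<forall>n::rat. of_nat N * n \<in> \<int> \<and> n < b \<longrightarrow> mod_weight_space V M (of_rat n + c) = {0}"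
    and Y_linear: "v \<in> vcarrier V \<Longrightarrow> linear_map (mcarrier M) (mcarrier M) (mY M v n)"
    and Y_linear_left: "w \<in> mcarrier M \<Longrightarrow> linear_map (vcarrier V) (mcarrier M) (\<lambda>v. mY M v n w)"
    and Y_eigen: "v \<in> aut_eigenspace V g j \<Longrightarrow> n - of_int j / of_nat N \<notin> \<int> \<Longrightarrow> w \<in> mcarrier M \<Longrightarrow> mY M v n w = 0"
    and Y_trunc: "v \<in> vcarrier V \<Longrightarrow> w \<in> mcarrier M \<Longrightarrow> \<exists>n0. \<forall>n\<ge>n0. mY M v n w = 0"
    and Y_vac: "w \<in> mcarrier M \<Longrightarrow> mY M (vvac V) n w = (if n = -1 then w else 0)"
    and M_jacobi: "twisted_jacobi V g M"
  using module by (simp_all add: weak_twisted_module_def Let_def N_def)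

lemma V_subspace: "cvec.subspace (vcarrier V)" using is_voaD[OF voa] by blast
lemma g_linear: "linear_map (vcarrier V) (vcarrier V) g" using voa_AutD[OF g_Aut] by blast
lemma vY_mem: "u \<in> vcarrier V \<Longrightarrow> v \<in> vcarrier V \<Longrightarrow> vY V u n v \<in> vcarrier V"
  using linear_map_mem[OF is_voaD(2)[OF voa]] .
lemma Y_mem: "v \<in> vcarrier V \<Longrightarrow> w \<in> mcarrier M \<Longrightarrow> mY M v n w \<in> mcarrier M"
  using linear_map_mem[OF Y_linear] .
lemma Y_zero: "v \<in> vcarrier V \<Longrightarrow> mY M v n 0 = 0"
  using linear_map_zero[OF Y_linear M_subspace] .
lemma Y_zero_left: "w \<in> mcarrier M \<Longrightarrow> mY M 0 n w = 0"
  using linear_map_zero[OF Y_linear_left V_subspace] .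

lemma eigenspace_subset: "v \<in> aut_eigenspace V g k \<Longrightarrow> v \<in> vcarrier V"
  by (simp add: aut_eigenspace_def)

lemma funpow_mem: "v \<in> vcarrier V \<Longrightarrow> (g ^^ i) v \<in> vcarrier V"
  by (induction i) (auto intro: linear_map_mem[OF g_linear])

lemma funpow_N: "v \<in> vcarrier V \<Longrightarrow> (g ^^ N) v = v"
proof -
  assume v: "v \<in> vcarrier V"
  interpret A: group "voa_Aut V" using voa by (rule is_voa_Aut_group)
  have "g [^]\<^bsub>voa_Aut V\<^esub> N = \<one>\<^bsub>voa_Aut V\<^esub>"
    unfolding N_def using g_Aut by (rule A.pow_ord_eq_1)
  then show ?thesis using voa_Aut_pow[OF A.is_group g_Aut v, of N] voa_Aut_one[OF v] by simp
qed

definition zeta :: "int \<Rightarrow> complex" where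
  "zeta k = exp (2 * of_real pi * \<i> * of_int k / of_nat N)"

lemma zeta_add: "zeta (j + k) = zeta j * zeta k"
  by (simp add: zeta_def exp_add[symmetric] add_divide_distrib algebra_simps)

lemma zeta_0 [simp]: "zeta 0 = 1" by (simp add: zeta_def)

lemma zeta_mult_nat: "zeta (k * int i) = zeta k ^ i"
  by (induction i) (auto simp: algebra_simps zeta_add)

lemma zeta_N: "zeta (k * int N) = 1"
proof -
  have "zeta (k * int N) = exp (2 * of_int k * of_real pi * \<i>)"
    using N_pos by (simp add: zeta_def mult_ac)
  also have "\<dots> = cis (2 * pi * of_int k)" by (simp add: cis_conv_exp mult_ac)
  also have "\<dots> = 1" by (rule cis_multiple_2pi) auto
  finally show ?thesis .
qed

text \<open>Projection to the k-th eigenspace by a discrete Fourier transform over the powers of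
  \<open>g\<close>. The twisted Jacobi identity is available only for eigenvectors in the first
  argument, so general vectors are split this way.\<close>

definition eigenpart :: "nat \<Rightarrow> 'v \<Rightarrow> 'v" where
  "eigenpart k v = (1 / of_nat N) *\<^sub>C (\<Sum>i<N. zeta (- int k * int i) *\<^sub>C (g ^^ i) v)"

lemma eigenpart_mem:
  assumes "v \<in> vcarrier V"
  shows "eigenpart k v \<in> aut_eigenspace V g (int k)"
proof -
  have c: "eigenpart k v \<in> vcarrier V"
    unfolding eigenpart_def using assms
    by (intro cvec.subspace_scale[OF V_subspace] cvec.subspace_sum[OF V_subspace] funpow_mem)
  let ?F = "\<lambda>i. zeta (- int k * int i) *\<^sub>C (g ^^ i) v"
  have "zeta k * zeta (- int k * int (Suc i)) = zeta (- int k * int i)" for i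
    by (simp add: zeta_add[symmetric] algebra_simps)
  then have step: "zeta (- int k * int i) *\<^sub>C g ((g ^^ i) v) = zeta k *\<^sub>C ?F (Suc i)" for i
    by (simp only: scaleC_scaleC funpow.simps comp_apply)
  have "g (\<Sum>i<N. ?F i) = (\<Sum>i<N. zeta (- int k * int i) *\<^sub>C g ((g ^^ i) v))"
    using assms by (intro linear_map_lincomb[OF g_linear V_subspace] funpow_mem)
  also have "\<dots> = zeta k *\<^sub>C (\<Sum>i<N. ?F (Suc i))"
    unfolding cvec.scale_sum_right step ..
  \<comment> \<open>A cyclic shift of the summation: the terms 0 and \<open>N\<close> agree because
    \<open>g\<close> has order \<open>N\<close>.\<close>
  also have "(\<Sum>i<N. ?F (Suc i)) = (\<Sum>i<N. ?F i)"
  proof -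
    have "?F N = ?F 0" using zeta_N[of "- int k"] funpow_N[OF assms] by simp
    moreover have "(\<Sum>i<Suc N. ?F i) = ?F 0 + (\<Sum>i<N. ?F (Suc i))"
      by (rule sum.lessThan_Suc_shift)
    ultimately show ?thesis by simp
  qed
  finally have "g (\<Sum>i<N. ?F i) = zeta k *\<^sub>C (\<Sum>i<N. ?F i)" .
  moreover have "g (eigenpart k v) = (1 / of_nat N) *\<^sub>C g (\<Sum>i<N. ?F i)"
    unfolding eigenpart_def using assms
    by (intro linear_map_scale[OF g_linear] cvec.subspace_sum[OF V_subspace]
        cvec.subspace_scale[OF V_subspace] funpow_mem)
  ultimately have "g (eigenpart k v) = zeta k *\<^sub>C eigenpart k v"
    by (simp add: eigenpart_def scaleC_scaleC mult.commute)
  then show ?thesis using c by (simp add: aut_eigenspace_def zeta_def N_def)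
qed

lemma sum_eigenpart:
  assumes "v \<in> vcarrier V"
  shows "(\<Sum>k<N. eigenpart k v) = v"
proof -
  have z: "(\<Sum>k<N. zeta (- int k * int i)) = (if i = 0 then of_nat N else 0)" if "i < N" for i
  proof (cases "i = 0")
    case False
    have "zeta (- int k * int i) = exp (2 * of_real pi * \<i> * of_nat (N - i) / of_nat N) ^ k" for k
    proof -
      have "zeta (- int k * int i) = zeta (- int i) ^ k"
        using zeta_mult_nat[of "- int i" k] by (simp add: mult.commute)
      also have "zeta (- int i) = zeta (int (N - i))"
        using zeta_add[of "- int i" "int N"] zeta_N[of 1] that by (simp add: of_nat_diff)
      finally show ?thesis by (simp add: zeta_def)
    qed
    then show ?thesis using sum_powers_root_unity[of "N - i" N] False that by simp
  qed auto
  have "(\<Sum>k<N. eigenpart k v)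
      = (1 / of_nat N) *\<^sub>C (\<Sum>i<N. (\<Sum>k<N. zeta (- int k * int i)) *\<^sub>C (g ^^ i) v)"
    unfolding eigenpart_def cvec.scale_sum_right[symmetric] cvec.scale_sum_left
    by (subst sum.swap) simp
  also have "(\<Sum>i<N. (\<Sum>k<N. zeta (- int k * int i)) *\<^sub>C (g ^^ i) v)
      = (\<Sum>i<N. if i = 0 then of_nat N *\<^sub>C v else 0)"
    using z by (intro sum.cong) auto
  finally show ?thesis using N_pos by (simp add: scaleC_scaleC)
qed

lemma coset_unique:
  assumes "n - of_nat j / of_nat N \<in> (\<int> :: rat set)" "n - of_nat k / of_nat N \<in> \<int>" "j < N" "k < N"
  shows "j = k"
proof -
  have "(n - of_nat j / of_nat N) - (n - of_nat k / of_nat N) \<in> (\<int> :: rat set)"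
    using assms(1,2) by (rule Ints_diff)
  then obtain z where "(n - of_nat j / of_nat N) - (n - of_nat k / of_nat N) = (of_int z :: rat)"
    by (auto elim: Ints_cases)
  then have "(of_nat k - of_nat j) / of_nat N = (of_int z :: rat)"
    by (simp add: diff_divide_distrib)
  then have "(of_nat k - of_nat j :: rat) = of_int z * of_nat N"
    using N_pos by (metis divide_eq_eq less_not_refl of_nat_eq_0_iff)
  then have "(of_int (int k - int j) :: rat) = of_int (z * int N)" by simp
  then have "int k - int j = z * int N" unfolding of_int_eq_iff .
  then have "int N dvd int k - int j" by simp
  then have "int N dvd \<bar>int k - int j\<bar>" by simp
  then have "int N \<le> \<bar>int k - int j\<bar>" if "j \<noteq> k"
    using that by (intro zdvd_imp_le) auto
  then show ?thesis using assms(3,4) by fastforce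
qed

lemma coset_N: "n - of_int j / of_nat N \<in> (\<int> :: rat set) \<Longrightarrow> of_nat N * n \<in> \<int>"
proof -
  assume "n - of_int j / of_nat N \<in> \<int>"
  then obtain z where "n - of_int j / of_nat N = (of_int z :: rat)" by (auto elim: Ints_cases)
  then have "of_nat N * n = of_int (z * int N + j)" using N_pos by (simp add: field_simps)
  then show ?thesis by (metis Ints_of_int)
qed

lemma Y_sum_eigenpart:
  assumes "v \<in> vcarrier V" "w \<in> mcarrier M"
  shows "mY M v n w = (\<Sum>k<N. mY M (eigenpart k v) n w)"
proof -
  have "mY M (\<Sum>k<N. eigenpart k v) n w = (\<Sum>k<N. mY M (eigenpart k v) n w)"
    using assms eigenpart_mem eigenspace_subset
    by (intro linear_map_sum[OF Y_linear_left V_subspace]) auto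
  then show ?thesis using sum_eigenpart[OF assms(1)] by simp
qed

text \<open>The modes of the j-th eigencomponent live in j/N + \<int>, and these cosets are disjoint
  for different j below \<open>N\<close>.\<close>

lemma Y_coset:
  assumes "v \<in> vcarrier V" "w \<in> mcarrier M" "k < N" "n - of_nat k / of_nat N \<in> \<int>"
  shows "mY M (eigenpart k v) n w = mY M v n w"
proof -
  have "mY M (eigenpart j v) n w = 0" if "j < N" "j \<noteq> k" for j
    using coset_unique[OF _ assms(4) that(1) assms(3)] that(2) assms
    by (intro Y_eigen[OF eigenpart_mem]) auto
  then have "(\<Sum>j<N. mY M (eigenpart j v) n w) = (\<Sum>j\<in>{k}. mY M (eigenpart j v) n w)"
    using assms(3) by (intro sum.mono_neutral_right) auto
  then show ?thesis using Y_sum_eigenpart[OF assms(1,2)] by simp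
qed

lemma Y_off:
  assumes "v \<in> vcarrier V" "w \<in> mcarrier M" "of_nat N * n \<notin> \<int>"
  shows "mY M v n w = 0"
  unfolding Y_sum_eigenpart[OF assms(1,2)]
proof (intro sum.neutral ballI)
  fix k
  show "mY M (eigenpart k v) n w = 0"
    using coset_N[of n "int k"] assms(3) by (intro Y_eigen[OF eigenpart_mem[OF assms(1)] _ assms(2)]) auto
qed

text \<open>A mode of an eigencomponent is either the same mode of \<open>v\<close> or zero, so
  truncation bounds for \<open>v\<close> are inherited by its components.\<close>

lemma eigenpart_Y_zero:
  assumes "v \<in> vcarrier V" "w \<in> mcarrier M" "k < N" "mY M v n w = 0"
  shows "mY M (eigenpart k v) n w = 0"
  using assms Y_coset[OF assms(1-3), of n] Y_eigen[OF eigenpart_mem, of v n k w]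
  by (cases "n - of_nat k / of_nat N \<in> \<int>") auto

text \<open>An eigencomponent mixes all powers of \<open>g\<close>; this is why the locality bounds
  below are required for every \<open>(g ^^ i) u\<close>.\<close>

lemma eigenpart_vY_zero:
  assumes "u \<in> vcarrier V" "v \<in> vcarrier V" "\<And>i. vY V ((g ^^ i) u) l v = 0"
  shows "vY V (eigenpart k u) l v = 0"
proof -
  note lin = is_voaD(3)[OF voa assms(2)]
  have "vY V (\<Sum>i<N. zeta (- int k * int i) *\<^sub>C (g ^^ i) u) l v
      = (\<Sum>i<N. zeta (- int k * int i) *\<^sub>C vY V ((g ^^ i) u) l v)"
    using assms by (intro linear_map_lincomb[OF lin V_subspace] funpow_mem)
  then show ?thesis
    unfolding eigenpart_def using assms
    by (subst linear_map_scale[OF lin])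
       (auto intro!: cvec.subspace_sum[OF V_subspace] cvec.subspace_scale[OF V_subspace] funpow_mem)
qed

text \<open>The formally infinite sums become sums up to a common truncation bound \<open>I\<close>.
  The index \<open>n\<close> may be any rational number: if \<open>of_nat N * n\<close> is not an
  integer, both sides vanish term by term.\<close>

lemma jacobi:
  assumes u: "u \<in> aut_eigenspace V g k" and v: "v \<in> vcarrier V" and w: "w \<in> mcarrier M"
    and m: "m - of_int k / of_nat N \<in> \<int>"
    and I: "\<And>i. i \<ge> I \<Longrightarrow> mY M v (n + of_nat i) w = 0"
      "\<And>i. i \<ge> I \<Longrightarrow> mY M u (m + of_nat i) w = 0"
      "\<And>i. i \<ge> I \<Longrightarrow> vY V u (l + int i) v = 0"
  shows "(\<Sum>i<I. ((-1) ^ i * (of_int l gchoose i)) *\<^sub>C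
            (mY M u (m + of_int l - of_nat i) (mY M v (n + of_nat i) w)
             - ((-1) powi l) *\<^sub>C mY M v (n + of_int l - of_nat i) (mY M u (m + of_nat i) w)))
        = (\<Sum>i<I. (of_rat m gchoose i) *\<^sub>C mY M (vY V u (l + int i) v) (m + n - of_nat i) w)"
    (is "(\<Sum>i<I. ?L i) = (\<Sum>i<I. ?R i)")
proof (cases "of_nat N * n \<in> \<int>")
  case True
  have uV: "u \<in> vcarrier V" using u by (rule eigenspace_subset)
  have "Sum_any ?L = Sum_any ?R"
    using M_jacobi u v w m True unfolding twisted_jacobi_def Let_def N_def[symmetric] by blast
  moreover have "Sum_any ?L = (\<Sum>i<I. ?L i)"
  proof (rule Sum_any.expand_superset)
    show "{i. ?L i \<noteq> 0} \<subseteq> {..<I}"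
    proof
      fix i assume i: "i \<in> {i. ?L i \<noteq> 0}"
      have "?L i = 0" if "i \<ge> I"
        using I(1,2)[OF that] Y_zero[OF uV] Y_zero[OF v] by simp
      then show "i \<in> {..<I}" using i unfolding mem_Collect_eq lessThan_iff not_less[symmetric] by blast
    qed
  qed auto
  moreover have "Sum_any ?R = (\<Sum>i<I. ?R i)"
  proof (rule Sum_any.expand_superset)
    show "{i. ?R i \<noteq> 0} \<subseteq> {..<I}"
    proof
      fix i assume i: "i \<in> {i. ?R i \<noteq> 0}"
      have "?R i = 0" if "i \<ge> I"
        using I(3)[OF that] Y_zero_left[OF w] by simp
      then show "i \<in> {..<I}" using i unfolding mem_Collect_eq lessThan_iff not_less[symmetric] by blast
    qed
  qed auto
  ultimately show ?thesis by simp
next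
  case False
  have uV: "u \<in> vcarrier V" using u by (rule eigenspace_subset)
  have sh: "of_nat N * (n + of_int j) \<notin> \<int>" for j
  proof
    assume "of_nat N * (n + of_int j) \<in> \<int>"
    then have "of_nat N * (n + of_int j) - of_int (int N * j) \<in> \<int>" by (intro Ints_diff Ints_of_int)
    then show False using False by (simp add: algebra_simps)
  qed
  have 1: "mY M v (n + of_int j) x = 0" if "x \<in> mcarrier M" for j x
    using Y_off[OF v that sh] .
  have mN: "of_nat N * m \<in> \<int>" using m by (rule coset_N)
  have "of_nat N * (m + n - of_nat i) \<notin> \<int>" for i
  proof
    assume "of_nat N * (m + n - of_nat i) \<in> \<int>"
    then have "of_nat N * (m + n - of_nat i) - of_nat N * m \<in> \<int>" using mN by (rule Ints_diff)
    then show False using sh[of "- int i"] by (simp add: algebra_simps)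
  qed
  then have "?R i = 0" for i
    using Y_off[OF vY_mem[OF uV v] w] by simp
  moreover have "?L i = 0" for i
  proof -
    have "mY M v (n + of_nat i) w = 0" using 1[OF w, of "int i"] by simp
    moreover have "mY M v (n + of_int l - of_nat i) (mY M u (m + of_nat i) w) = 0"
      using 1[OF Y_mem[OF uV w], of "l - int i" "m + of_nat i"] by (simp add: algebra_simps)
    ultimately show ?thesis using Y_zero[OF uV] by simp
  qed
  ultimately have "(\<Sum>i<I. ?L i) = 0" "(\<Sum>i<I. ?R i) = 0"
    by (blast intro: sum.neutral)+
  then show ?thesis by (rule trans[OF _ sym])
qed

end

section \<open>Iterates of twisted vertex operators as combinations of products\<close>

lemma sum_gbinomial_mult: "(\<Sum>i\<le>n. (a gchoose i) * (b gchoose (n - i))) = (a + b :: complex) gchoose n"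
  using gbinomial_Vandermonde[of a b n] by (simp add: atMost_atLeast0)

text \<open>With S the shift of sequences this is (1 + S)^x (1 + S)^y = (1 + S)^(x + y), truncated
  at total degree a. For y = -x it inverts the binomial sum on the right of the Jacobi
  identity.\<close>

lemma sum_gbinomial_vandermonde:
  fixes f :: "nat \<Rightarrow> 'a::complex_vector"
  shows "(\<Sum>i\<le>a. \<Sum>j\<le>a - i. ((x gchoose i) * (y gchoose j)) *\<^sub>C f (i + j))
      = (\<Sum>t\<le>a. ((x + y) gchoose t) *\<^sub>C f t)"
proof -
  have "(\<Sum>i\<le>a. \<Sum>j\<le>a - i. ((x gchoose i) * (y gchoose j)) *\<^sub>C f (i + j))
      = (\<Sum>(i, j)\<in>Sigma {..a} (\<lambda>i. {..a - i}). ((x gchoose i) * (y gchoose j)) *\<^sub>C f (i + j))"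
    by (rule sum.Sigma) auto
  also have "Sigma {..a} (\<lambda>i. {..a - i}) = {(i, j). i + j \<le> a}" by auto
  also have "(\<Sum>(i, j)\<in>{(i, j). i + j \<le> a}. ((x gchoose i) * (y gchoose j)) *\<^sub>C f (i + j))
      = (\<Sum>t\<le>a. \<Sum>i\<le>t. ((x gchoose i) * (y gchoose (t - i))) *\<^sub>C f (i + (t - i)))"
    by (rule sum.triangle_reindex_eq)
  also have "\<dots> = (\<Sum>t\<le>a. (\<Sum>i\<le>t. (x gchoose i) * (y gchoose (t - i))) *\<^sub>C f t)"
    unfolding cvec.scale_sum_left by (intro sum.cong) auto
  finally show ?thesis by (simp add: sum_gbinomial_mult)
qed

lemma gbinomial_of_nat_eq_0: "K < i \<Longrightarrow> (of_nat K :: complex) gchoose i = 0"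
  by (simp add: binomial_gbinomial[symmetric] binomial_eq_0)

text \<open>For the shift S this is (1 - S)^(-b-1) (1 - S)^K = (1 - S)^(K-1-b); the numbers (b+j
  choose j) are the coefficients of the first factor. It trades a varying power of z1 - z2 in front
  of a product of vertex operators for the fixed power K.\<close>

lemma sum_gbinomial_inverse_power:
  fixes f :: "nat \<Rightarrow> 'a::complex_vector"
  assumes "\<And>t. t \<ge> J \<Longrightarrow> f t = 0"
  shows "(\<Sum>j<J. (of_nat (b + j) gchoose j) *\<^sub>C (\<Sum>i\<le>K. ((-1) ^ i * (of_nat K gchoose i)) *\<^sub>C f (i + j)))
      = (\<Sum>t<J. ((-1) ^ t * (of_int (int K - 1 - int b) gchoose t)) *\<^sub>C f t)"
proof -
  define h where "h i j = ((of_nat (b + j) gchoose j) * ((-1) ^ i * (of_nat K gchoose i))) *\<^sub>C f (i + j)"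
    for i j :: nat
  have "(of_nat (b + j) gchoose j) *\<^sub>C (\<Sum>i\<le>K. ((-1) ^ i * (of_nat K gchoose i)) *\<^sub>C f (i + j))
      = (\<Sum>i<J - j. h i j)" if "j < J" for j
  proof -
    have "(\<Sum>i\<le>K. h i j) = (\<Sum>i\<le>K + J. h i j)"
      by (rule sum.mono_neutral_left) (auto simp: h_def gbinomial_of_nat_eq_0)
    also have "\<dots> = (\<Sum>i<J - j. h i j)"
      by (rule sum.mono_neutral_right) (auto simp: h_def assms)
    finally show ?thesis by (simp add: h_def cvec.scale_sum_right scaleC_scaleC)
  qed
  then have "(\<Sum>j<J. (of_nat (b + j) gchoose j) *\<^sub>C (\<Sum>i\<le>K. ((-1) ^ i * (of_nat K gchoose i)) *\<^sub>C f (i + j)))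
      = (\<Sum>j<J. \<Sum>i<J - j. h i j)" by (intro sum.cong) auto
  also have "\<dots> = (\<Sum>(j, i)\<in>Sigma {..<J} (\<lambda>j. {..<J - j}). h i j)"
    by (rule sum.Sigma) auto
  also have "Sigma {..<J} (\<lambda>j. {..<J - j}) = {(j, i). j + i < J}" by auto
  also have "(\<Sum>(j, i)\<in>{(j, i). j + i < J}. h i j) = (\<Sum>t<J. \<Sum>j\<le>t. h (t - j) j)"
    by (rule sum.triangle_reindex)
  also have "\<dots> = (\<Sum>t<J. ((-1) ^ t * (of_int (int K - 1 - int b) gchoose t)) *\<^sub>C f t)"
  proof (intro sum.cong refl)
    fix t
    \<comment> \<open>Negating the upper index turns the coefficients of the first factor into
      ordinary binomials, to which Vandermonde applies.\<close>
    have m: "(of_nat (b + j) :: complex) gchoose j = (-1) ^ j * ((- of_nat (Suc b)) gchoose j)" for j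
      by (subst gbinomial_minus) (simp add: mult.assoc[symmetric] power_mult_distrib[symmetric])
    have "(\<Sum>j\<le>t. h (t - j) j)
        = (\<Sum>j\<le>t. (-1) ^ t * (((- of_nat (Suc b)) gchoose j) * (of_nat K gchoose (t - j)))) *\<^sub>C f t"
      unfolding cvec.scale_sum_left
    proof (intro sum.cong refl)
      fix j assume j: "j \<in> {..t}"
      have "(-1 :: complex) ^ t = (-1) ^ j * (-1) ^ (t - j)" using j by (simp flip: power_add)
      then show "h (t - j) j = ((-1) ^ t * (((- of_nat (Suc b)) gchoose j) * (of_nat K gchoose (t - j)))) *\<^sub>C f t"
        using j unfolding h_def m by (simp add: mult_ac)
    qed
    also have "(\<Sum>j\<le>t. (-1 :: complex) ^ t * (((- of_nat (Suc b)) gchoose j) * (of_nat K gchoose (t - j))))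
        = (-1) ^ t * ((- of_nat (Suc b) + of_nat K) gchoose t)"
      by (simp add: sum_distrib_left[symmetric] sum_gbinomial_mult)
    also have "(- of_nat (Suc b) + of_nat K :: complex) = of_int (int K - 1 - int b)" by simp
    finally show "(\<Sum>j\<le>t. h (t - j) j) = ((-1) ^ t * (of_int (int K - 1 - int b) gchoose t)) *\<^sub>C f t" .
  qed
  finally show ?thesis .
qed

text \<open>With t = j - i and the symmetry of binomials, (a-i+j choose j) becomes (a+t choose a-i),
  and Vandermonde over i leaves (x+a+t choose a). The vanishing assumptions on \<open>F\<close>
  allow the ranges of t for the various i to be replaced by \<open>{..<J}\<close>.\<close>

lemma sum_gbinomial_shift:
  fixes F :: "int \<Rightarrow> 'a::complex_vector"
  assumes "\<And>t. t \<le> 0 \<Longrightarrow> F t = 0" "\<And>t. t + int a \<ge> int J \<Longrightarrow> F t = 0"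
  shows "(\<Sum>i\<le>a. (x gchoose i) *\<^sub>C (\<Sum>j<J. (of_nat (a - i + j) gchoose j) *\<^sub>C F (int j - int i)))
      = (\<Sum>t<J. ((x + of_nat (a + t)) gchoose a) *\<^sub>C F (int t))"
proof -
  have "(\<Sum>j<J. (of_nat (a - i + j) gchoose j) *\<^sub>C F (int j - int i))
      = (\<Sum>t<J. (of_nat (a + t) gchoose (a - i)) *\<^sub>C F (int t))" if "i \<le> a" for i
  proof -
    have "(\<Sum>j<J. (of_nat (a - i + j) gchoose j) *\<^sub>C F (int j - int i))
        = (\<Sum>j\<in>{i..<i + J}. (of_nat (a - i + j) gchoose j) *\<^sub>C F (int j - int i))"
      using that by (intro sum.mono_neutral_cong) (auto simp: assms)
    also have "\<dots> = (\<Sum>t\<in>{0..<J}. (of_nat (a - i + (t + i)) gchoose (t + i)) *\<^sub>C F (int (t + i) - int i))"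
      using sum.shift_bounds_nat_ivl[of "\<lambda>j. (of_nat (a - i + j) gchoose j) *\<^sub>C F (int j - int i)" 0 i J]
      by (simp add: add.commute)
    also have "\<dots> = (\<Sum>t<J. (of_nat (a + t) gchoose (a - i)) *\<^sub>C F (int t))"
    proof (intro sum.cong)
      fix t
      have "(of_nat (a + t) :: complex) gchoose (t + i) = of_nat (a + t) gchoose (a + t - (t + i))"
        using that by (intro gbinomial_of_nat_symmetric) auto
      then show "(of_nat (a - i + (t + i)) gchoose (t + i)) *\<^sub>C F (int (t + i) - int i)
          = (of_nat (a + t) gchoose (a - i)) *\<^sub>C F (int t)"
        using that by (simp add: add.commute)
    qed auto
    finally show ?thesis .
  qed
  then have "(\<Sum>i\<le>a. (x gchoose i) *\<^sub>C (\<Sum>j<J. (of_nat (a - i + j) gchoose j) *\<^sub>C F (int j - int i)))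
      = (\<Sum>i\<le>a. \<Sum>t<J. ((x gchoose i) * (of_nat (a + t) gchoose (a - i))) *\<^sub>C F (int t))"
    by (simp add: cvec.scale_sum_right scaleC_scaleC)
  also have "\<dots> = (\<Sum>t<J. (\<Sum>i\<le>a. (x gchoose i) * (of_nat (a + t) gchoose (a - i))) *\<^sub>C F (int t))"
    by (subst sum.swap) (simp add: cvec.scale_sum_left)
  finally show ?thesis by (simp add: sum_gbinomial_mult)
qed

lemma Ints_add_iff: "z \<in> \<int> \<Longrightarrow> x + z \<in> (\<int> :: 'a::ring_1 set) \<longleftrightarrow> x \<in> \<int>"
  by (metis Ints_add Ints_diff add_diff_cancel_right')

text \<open>Candidates for mode indices. \<open>T\<close> will be a common multiple of the orders of
  several twists, so that one finite window serves them all.\<close>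

definition fraction_window :: "nat \<Rightarrow> rat \<Rightarrow> rat \<Rightarrow> rat set" where
  "fraction_window T lo hi = {m. of_nat T * m \<in> \<int> \<and> lo \<le> m \<and> m < hi}"

lemma finite_fraction_window:
  assumes "T > 0"
  shows "finite (fraction_window T lo hi)"
proof (rule finite_subset)
  show "fraction_window T lo hi \<subseteq>
      (\<lambda>z. of_int z / of_nat T) ` {\<lfloor>of_nat T * lo\<rfloor>..\<lceil>of_nat T * hi\<rceil>}"
  proof
    fix m assume m: "m \<in> fraction_window T lo hi"
    then obtain z where z: "of_nat T * m = of_int z"
      by (auto simp: fraction_window_def elim: Ints_cases)
    have "of_nat T * lo \<le> of_nat T * m" "of_nat T * m \<le> of_nat T * hi"
      using m assms by (auto simp: fraction_window_def)
    then have "z \<in> {\<lfloor>of_nat T * lo\<rfloor>..\<lceil>of_nat T * hi\<rceil>}"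
      unfolding z by (auto simp: floor_le_iff le_ceiling_iff)
    moreover have "m = of_int z / of_nat T" using z assms by (simp add: field_simps)
    ultimately show "m \<in> (\<lambda>z. of_int z / of_nat T) ` {\<lfloor>of_nat T * lo\<rfloor>..\<lceil>of_nat T * hi\<rceil>}" by blast
  qed
qed auto

section \<open>Weak commutativity and Taylor expansion at z1 = z2\<close>

context twisted_mod
begin

lemma Y_trunc_nat:
  assumes "v \<in> vcarrier V" "w \<in> mcarrier M"
  shows "\<exists>I. \<forall>i\<ge>I. mY M v (n + of_nat i) w = 0"
proof -
  obtain n0 where n0: "\<And>n. n \<ge> n0 \<Longrightarrow> mY M v n w = 0" using Y_trunc[OF assms] by blast
  show ?thesis
  proof (intro exI allI impI)
    fix i assume "i \<ge> nat \<lceil>n0 - n\<rceil>"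
    then have "n0 - n \<le> of_nat i"
      using real_nat_ceiling_ge by (metis ceiling_le_iff nat_le_iff of_int_of_nat_eq)
    then show "mY M v (n + of_nat i) w = 0" by (intro n0) simp
  qed
qed

text \<open>The coefficient of z1^(-m-1) z2^(-n-1) in (z1 - z2)^K Y(u, z1) Y(v, z2) w.\<close>

definition cross :: "nat \<Rightarrow> 'v \<Rightarrow> 'v \<Rightarrow> 'm \<Rightarrow> rat \<Rightarrow> rat \<Rightarrow> 'm" where
  "cross K u v w m n = (\<Sum>j\<le>K. ((-1) ^ j * (of_nat K gchoose j)) *\<^sub>C
     mY M u (m + of_nat K - of_nat j) (mY M v (n + of_nat j) w))"

lemma coset_shift:
  "m + of_int z - of_int k / of_nat N \<in> (\<int> :: rat set) \<longleftrightarrow> m - of_int k / of_nat N \<in> \<int>"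
  using Ints_add_iff[of "of_int z" "m - of_int k / of_nat N"] by (simp add: algebra_simps)

text \<open>Weak commutativity: for l = K the right side of the Jacobi identity contains only
  \<open>vY V u l v\<close> with l \<ge> K, hence vanishes, and the two orders of the product agree
  once multiplied by (z1 - z2)^K.\<close>

lemma cross_commute_eigen:
  assumes u: "u \<in> aut_eigenspace V g k" and v: "v \<in> vcarrier V" and w: "w \<in> mcarrier M"
    and K: "\<And>l. l \<ge> int K \<Longrightarrow> vY V u l v = 0"
  shows "cross K u v w m n = (\<Sum>j\<le>K. ((-1) ^ j * (of_nat K gchoose j) * (-1) ^ K) *\<^sub>C
     mY M v (n + of_nat K - of_nat j) (mY M u (m + of_nat j) w))"
proof (cases "m - of_int k / of_nat N \<in> \<int>")
  case True
  have uV: "u \<in> vcarrier V" using u by (rule eigenspace_subset)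
  obtain I1 where I1: "\<And>i. i \<ge> I1 \<Longrightarrow> mY M v (n + of_nat i) w = 0" using Y_trunc_nat[OF v w] by blast
  obtain I2 where I2: "\<And>i. i \<ge> I2 \<Longrightarrow> mY M u (m + of_nat i) w = 0" using Y_trunc_nat[OF uV w] by blast
  define I where "I = I1 + I2 + Suc K"
  let ?a = "\<lambda>i. (-1) ^ i * (of_nat K gchoose i) :: complex"
  let ?X = "\<lambda>i. mY M u (m + of_nat K - of_nat i) (mY M v (n + of_nat i) w)"
  let ?Y = "\<lambda>i. mY M v (n + of_nat K - of_nat i) (mY M u (m + of_nat i) w)"
  have "(\<Sum>i<I. ?a i *\<^sub>C (?X i - (-1) ^ K *\<^sub>C ?Y i)) = 0"
  proof -
    have "(\<Sum>i<I. (of_rat m gchoose i) *\<^sub>C mY M (vY V u (int K + int i) v) (m + n - of_nat i) w) = 0"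
      using K Y_zero_left[OF w] by (intro sum.neutral) auto
    then show ?thesis
      using jacobi[OF u v w True, of I n "int K"] I1 I2 K by (simp add: I_def)
  qed
  moreover have "(\<Sum>i\<le>K. ?a i *\<^sub>C (?X i - (-1) ^ K *\<^sub>C ?Y i)) = (\<Sum>i<I. ?a i *\<^sub>C (?X i - (-1) ^ K *\<^sub>C ?Y i))"
    by (rule sum.mono_neutral_left) (auto simp: I_def gbinomial_of_nat_eq_0)
  ultimately have "(\<Sum>i\<le>K. ?a i *\<^sub>C (?X i - (-1) ^ K *\<^sub>C ?Y i)) = 0" by simp
  then show ?thesis
    unfolding cross_def
    by (simp add: cvec.scale_right_diff_distrib sum_subtractf scaleC_scaleC)
next
  case False
  have uV: "u \<in> vcarrier V" using u by (rule eigenspace_subset)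
  have 0: "mY M u (m + of_int z) x = 0" if "x \<in> mcarrier M" for z x
    using coset_shift[of m z k] False by (intro Y_eigen[OF u _ that]) simp
  have "mY M u (m + of_nat K - of_nat j) (mY M v (n + of_nat j) w) = 0" for j
    using 0[OF Y_mem[OF v w], of "int K - int j"] by (simp add: algebra_simps)
  moreover have "mY M u (m + of_nat j) w = 0" for j
    using 0[OF w, of "int j"] by simp
  ultimately show ?thesis using Y_zero[OF v] by (simp add: cross_def)
qed

lemma cross_eigenpart:
  assumes u: "u \<in> vcarrier V" and v: "v \<in> vcarrier V" and w: "w \<in> mcarrier M"
  shows "cross K u v w m n = (\<Sum>k<N. cross K (eigenpart k u) v w m n)"
proof -
  have "cross K u v w m n = (\<Sum>j\<le>K. \<Sum>k<N. ((-1) ^ j * (of_nat K gchoose j)) *\<^sub>C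
     mY M (eigenpart k u) (m + of_nat K - of_nat j) (mY M v (n + of_nat j) w))"
    unfolding cross_def cvec.scale_sum_right[symmetric]
    using Y_sum_eigenpart[OF u Y_mem[OF v w]] by simp
  also have "\<dots> = (\<Sum>k<N. cross K (eigenpart k u) v w m n)"
    unfolding cross_def by (rule sum.swap)
  finally show ?thesis .
qed

lemma cross_commute:
  assumes u: "u \<in> vcarrier V" and v: "v \<in> vcarrier V" and w: "w \<in> mcarrier M"
    and K: "\<And>i l. l \<ge> int K \<Longrightarrow> vY V ((g ^^ i) u) l v = 0"
  shows "cross K u v w m n = (\<Sum>j\<le>K. ((-1) ^ j * (of_nat K gchoose j) * (-1) ^ K) *\<^sub>C
     mY M v (n + of_nat K - of_nat j) (mY M u (m + of_nat j) w))"
proof -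
  have e: "eigenpart k u \<in> vcarrier V" for k using eigenpart_mem[OF u] eigenspace_subset by blast
  have "cross K (eigenpart k u) v w m n = (\<Sum>j\<le>K. ((-1) ^ j * (of_nat K gchoose j) * (-1) ^ K) *\<^sub>C
     mY M v (n + of_nat K - of_nat j) (mY M (eigenpart k u) (m + of_nat j) w))" for k
    using eigenpart_vY_zero[OF u v] K by (intro cross_commute_eigen[OF eigenpart_mem[OF u] v w]) auto
  then have "cross K u v w m n = (\<Sum>k<N. \<Sum>j\<le>K. ((-1) ^ j * (of_nat K gchoose j) * (-1) ^ K) *\<^sub>C
     mY M v (n + of_nat K - of_nat j) (mY M (eigenpart k u) (m + of_nat j) w))"
    unfolding cross_eigenpart[OF u v w] by simp
  also have "\<dots> = (\<Sum>j\<le>K. ((-1) ^ j * (of_nat K gchoose j) * (-1) ^ K) *\<^sub>C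
     (\<Sum>k<N. mY M v (n + of_nat K - of_nat j) (mY M (eigenpart k u) (m + of_nat j) w)))"
    unfolding cvec.scale_sum_right by (rule sum.swap)
  finally have *: "cross K u v w m n = \<dots>" .
  have "(\<Sum>k<N. mY M v p (mY M (eigenpart k u) q w)) = mY M v p (mY M u q w)" for p q
    unfolding Y_sum_eigenpart[OF u w, of q]
    by (intro linear_map_sum[OF Y_linear[OF v] M_subspace, symmetric] Y_mem[OF e w])
  then show ?thesis using * by simp
qed

text \<open>For such m only the products with \<open>u\<close> on the left survive in the Jacobi
  identity, and they equal sums of iterates with weights (m choose t). The weights (-m choose i)
  undo these. Iterates whose inner index is at least K vanish, so only a + 1 of them are involved
  and the inversion is finite.\<close>

lemma iterate_via_products_eigen:
  assumes u: "u \<in> aut_eigenspace V g k" and v: "v \<in> vcarrier V" and w: "w \<in> mcarrier M"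
    and K: "\<And>l. l \<ge> int K \<Longrightarrow> vY V u l v = 0"
    and m: "m - of_int k / of_nat N \<in> \<int>" "\<And>i. mY M u (m + of_nat i) w = 0"
    and J: "\<And>j. j \<ge> J \<Longrightarrow> mY M v (s - m - of_nat a + of_nat j) w = 0"
  shows "mY M (vY V u (int K - 1 - int a) v) s w =
     (\<Sum>i\<le>a. (of_rat (- m) gchoose i) *\<^sub>C
        (\<Sum>j<J. ((-1) ^ j * (of_int (int K - 1 - int (a - i)) gchoose j)) *\<^sub>C
           mY M u (m + of_int (int K - 1 - int (a - i)) - of_nat j) (mY M v (s - m - of_nat i + of_nat j) w)))"
proof -
  have uV: "u \<in> vcarrier V" using u by (rule eigenspace_subset)
  \<comment> \<open>The inner index of \<open>X t\<close> is t above the wanted one, so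
    \<open>X t\<close> vanishes for t > a and \<open>X 0\<close> is the goal.\<close>
  define X where "X t = mY M (vY V u (int K - 1 - int a + int t) v) (s - of_nat t) w" for t
  have "(\<Sum>j<J. ((-1) ^ j * (of_int (int K - 1 - int (a - i)) gchoose j)) *\<^sub>C
           mY M u (m + of_int (int K - 1 - int (a - i)) - of_nat j) (mY M v (s - m - of_nat i + of_nat j) w))
      = (\<Sum>t\<le>a - i. (of_rat m gchoose t) *\<^sub>C X (i + t))" (is "?l = ?r") if i: "i \<le> a" for i
  proof -
    let ?l' = "int K - 1 - int (a - i)" and ?n = "s - m - of_nat i"
    have v0: "mY M v (?n + of_nat j) w = 0" if "j \<ge> J" for j
    proof -
      have *: "?n + of_nat j = s - m - of_nat a + of_nat (a - i + j)"
        using i by (simp add: of_nat_diff)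
      show ?thesis unfolding * using that by (intro J) simp
    qed
    let ?I = "J + Suc a"
    have "(\<Sum>j<?I. ((-1) ^ j * (of_int ?l' gchoose j)) *\<^sub>C
            (mY M u (m + of_int ?l' - of_nat j) (mY M v (?n + of_nat j) w)
             - ((-1) powi ?l') *\<^sub>C mY M v (?n + of_int ?l' - of_nat j) (mY M u (m + of_nat j) w)))
        = (\<Sum>t<?I. (of_rat m gchoose t) *\<^sub>C mY M (vY V u (?l' + int t) v) (m + ?n - of_nat t) w)"
      using v0 m i K by (intro jacobi[OF u v w m(1)]) auto
    also have "\<dots> = (\<Sum>t\<le>a - i. (of_rat m gchoose t) *\<^sub>C mY M (vY V u (?l' + int t) v) (m + ?n - of_nat t) w)"
      using K Y_zero_left[OF w] by (intro sum.mono_neutral_right) auto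
    also have "\<dots> = ?r"
    proof (intro sum.cong refl)
      fix t
      have "?l' + int t = int K - 1 - int a + int (i + t)" using i by simp
      moreover have "m + ?n - of_nat t = s - of_nat (i + t)" by simp
      ultimately show "(of_rat m gchoose t) *\<^sub>C mY M (vY V u (?l' + int t) v) (m + ?n - of_nat t) w
          = (of_rat m gchoose t) *\<^sub>C X (i + t)" unfolding X_def by metis
    qed
    also have "(\<Sum>j<?I. ((-1) ^ j * (of_int ?l' gchoose j)) *\<^sub>C
            (mY M u (m + of_int ?l' - of_nat j) (mY M v (?n + of_nat j) w)
             - ((-1) powi ?l') *\<^sub>C mY M v (?n + of_int ?l' - of_nat j) (mY M u (m + of_nat j) w)))
        = ?l"
      using v0 m(2) Y_zero[OF v] Y_zero[OF uV] by (intro sum.mono_neutral_cong_right) auto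
    finally show ?thesis .
  qed
  then have "(\<Sum>i\<le>a. (of_rat (- m) gchoose i) *\<^sub>C
        (\<Sum>j<J. ((-1) ^ j * (of_int (int K - 1 - int (a - i)) gchoose j)) *\<^sub>C
           mY M u (m + of_int (int K - 1 - int (a - i)) - of_nat j) (mY M v (s - m - of_nat i + of_nat j) w)))
     = (\<Sum>i\<le>a. (of_rat (- m) gchoose i) *\<^sub>C (\<Sum>t\<le>a - i. (of_rat m gchoose t) *\<^sub>C X (i + t)))"
    by (intro sum.cong refl) auto
  also have "\<dots> = (\<Sum>t\<le>a. ((of_rat (- m) + of_rat m) gchoose t) *\<^sub>C X t)"
    unfolding sum_gbinomial_vandermonde[symmetric] cvec.scale_sum_right scaleC_scaleC ..
  also have "\<dots> = (\<Sum>t\<in>{0}. X t)"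
    by (intro sum.mono_neutral_cong_right) (auto simp: of_rat_minus gbinomial_0_left)
  finally show ?thesis by (simp add: X_def)
qed

text \<open>Taylor expansion of (z1 - z2)^K Y(u, z1) Y(v, z2) w at z1 = z2 + z0: the factor z0^K
  moves \<open>vY V u (int K - 1 - int a) v\<close> to z0^a, and z1^(-m-1) contributes (-m-1 choose
  a). These coefficients mention neither the eigenvalue of \<open>u\<close> nor \<open>N\<close>. A
  finite window suffices because weak commutativity bounds the first index by \<open>hi\<close> and
  truncation of \<open>v\<close> bounds the second by \<open>n0\<close>.\<close>

lemma iterate_via_cross_eigen:
  assumes u: "u \<in> aut_eigenspace V g k" and v: "v \<in> vcarrier V" and w: "w \<in> mcarrier M"
    and K: "\<And>l. l \<ge> int K \<Longrightarrow> vY V u l v = 0"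
    and hi: "\<And>m. m \<ge> hi \<Longrightarrow> mY M u m w = 0" and n0: "\<And>n. n \<ge> n0 \<Longrightarrow> mY M v n w = 0"
    and T: "N dvd T" "T > 0" and lo: "lo \<le> s - 1 - of_nat a - n0"
  shows "mY M (vY V u (int K - 1 - int a) v) s w =
     (\<Sum>m\<in>fraction_window T lo hi. (of_rat (- m - 1) gchoose a) *\<^sub>C cross K u v w m (s - 1 - of_nat a - m))"
proof -
  have uV: "u \<in> vcarrier V" using u by (rule eigenspace_subset)
  \<comment> \<open>An auxiliary representative of the coset of \<open>u\<close>, so large that
    every \<open>u\<close>-mode from it on kills \<open>w\<close>; the margin a + 1 beyond
    \<open>hi\<close> makes \<open>F\<close> below vanish at t \<le> 0. The absolute value takes
    care of a negative k/N.\<close>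
  define m where "m = of_int \<lceil>hi + 1 + of_nat a + \<bar>of_int k / of_nat N\<bar>\<rceil> + of_int k / (of_nat N :: rat)"
  have m_coset: "m - of_int k / of_nat N \<in> \<int>" by (simp add: m_def)
  have "hi + 1 + of_nat a + \<bar>of_int k / of_nat N\<bar> \<le> (of_int \<lceil>hi + 1 + of_nat a + \<bar>of_int k / of_nat N\<bar>\<rceil> :: rat)"
    by (rule le_of_int_ceiling)
  moreover have "- \<bar>x\<bar> \<le> x" for x :: rat by simp
  then have "- \<bar>of_int k / of_nat N\<bar> \<le> (of_int k / of_nat N :: rat)" .
  ultimately have m_hi: "m \<ge> hi + 1 + of_nat a" unfolding m_def by linarith
  obtain J0 where J0: "\<And>j. j \<ge> J0 \<Longrightarrow> mY M v (s - m - of_nat a + of_nat j) w = 0"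
    using Y_trunc_nat[OF v w, of "s - m - of_nat a"] by blast
  define J where "J = J0 + nat \<lceil>n0 - (s - m - of_nat a)\<rceil>"
  have J: "mY M v (s - m - of_nat a + of_nat j) w = 0" if "j \<ge> J" for j
    using J0 that by (simp add: J_def)
  \<comment> \<open>In the commuted form \<open>u\<close> acts on \<open>w\<close> first, with an
    index of at least \<open>hi\<close>.\<close>
  have cross0: "cross K u v w p q = 0" if "p \<ge> hi" for p q
  proof -
    have "cross K u v w p q = (\<Sum>j\<le>K. ((-1) ^ j * (of_nat K gchoose j) * (-1) ^ K) *\<^sub>C
       mY M v (q + of_nat K - of_nat j) (mY M u (p + of_nat j) w))"
      by (rule cross_commute_eigen[OF u v w]) (rule K)
    also have "\<dots> = 0"
    proof (intro sum.neutral ballI)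
      fix j
      have "mY M u (p + of_nat j) w = 0" using that by (intro hi) (simp add: add_increasing2)
      then show "((-1) ^ j * (of_nat K gchoose j) * (-1) ^ K) *\<^sub>C
         mY M v (q + of_nat K - of_nat j) (mY M u (p + of_nat j) w) = 0"
        using Y_zero[OF v] by simp
    qed
    finally show ?thesis .
  qed
  have cross0': "cross K u v w p q = 0" if "\<And>j. mY M v (q + of_nat j) w = 0" for p q
    unfolding cross_def using that Y_zero[OF uV] by (intro sum.neutral) auto
  \<comment> \<open>The cross coefficients whose two indices add up to s - 1 - a, numbered relative
    to the auxiliary representative.\<close>
  define F where "F t = cross K u v w (m - 1 - of_nat a - of_int t) (s - m + of_int t)" for t
  have F_neg: "F t = 0" if "t \<le> 0" for t
  proof -
    have "(of_int t :: rat) \<le> 0" using that by simp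
    then show ?thesis unfolding F_def using m_hi by (intro cross0) linarith
  qed
  have F_big: "F t = 0" if "t + int a \<ge> int J" for t
    unfolding F_def
  proof (rule cross0')
    fix j
    have "(of_nat (nat (t + int a)) :: rat) = of_int (t + int a)"
      using that by (subst of_nat_nat) auto
    then have *: "s - m + of_int t + of_nat j = s - m - of_nat a + of_nat (nat (t + int a) + j)"
      by simp
    show "mY M v (s - m + of_int t + of_nat j) w = 0"
      unfolding * using that by (intro J) simp
  qed
  have "mY M (vY V u (int K - 1 - int a) v) s w =
     (\<Sum>i\<le>a. (of_rat (- m) gchoose i) *\<^sub>C
        (\<Sum>j<J. ((-1) ^ j * (of_int (int K - 1 - int (a - i)) gchoose j)) *\<^sub>C
           mY M u (m + of_int (int K - 1 - int (a - i)) - of_nat j) (mY M v (s - m - of_nat i + of_nat j) w)))"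
    using m_hi by (intro iterate_via_products_eigen[OF u v w K m_coset _ J] hi) auto
  also have "\<dots> = (\<Sum>i\<le>a. (of_rat (- m) gchoose i) *\<^sub>C
      (\<Sum>j<J. (of_nat (a - i + j) gchoose j) *\<^sub>C F (int j - int i)))"
  proof (rule sum.cong[OF refl])
    fix i assume "i \<in> {..a}"
    then have i: "i \<le> a" by simp
    define y where "y t = mY M u (m + of_int (int K - 1 - int (a - i)) - of_nat t)
        (mY M v (s - m - of_nat i + of_nat t) w)" for t
    have y0: "y t = 0" if "t \<ge> J" for t
    proof -
      have *: "s - m - of_nat i + of_nat t = s - m - of_nat a + of_nat (a - i + t)"
        using i by (simp add: of_nat_diff)
      have "mY M v (s - m - of_nat i + of_nat t) w = 0"
        unfolding * using that by (intro J) simp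
      then show ?thesis unfolding y_def using Y_zero[OF uV] by simp
    qed
    \<comment> \<open>A cross coefficient is a K-th difference of the products \<open>y\<close>, so
      \<open>sum_gbinomial_inverse_power\<close> can convert their weights of order K - 1 - (a - i)
      into combinations of \<open>F\<close>.\<close>
    have "F (int j - int i) = (\<Sum>i'\<le>K. ((-1) ^ i' * (of_nat K gchoose i')) *\<^sub>C y (i' + j))" for j
      unfolding F_def cross_def y_def
    proof (intro sum.cong refl)
      fix i'
      have "m - 1 - of_nat a - of_int (int j - int i) + of_nat K - of_nat i'
          = m + of_int (int K - 1 - int (a - i)) - of_nat (i' + j)"
        using i by (simp add: of_nat_diff)
      moreover have "s - m + of_int (int j - int i) + of_nat i' = s - m - of_nat i + of_nat (i' + j)"
        by simp
      ultimately show "((-1) ^ i' * (of_nat K gchoose i')) *\<^sub>C mY M u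
          (m - 1 - of_nat a - of_int (int j - int i) + of_nat K - of_nat i')
          (mY M v (s - m + of_int (int j - int i) + of_nat i') w)
        = ((-1) ^ i' * (of_nat K gchoose i')) *\<^sub>C mY M u
          (m + of_int (int K - 1 - int (a - i)) - of_nat (i' + j))
          (mY M v (s - m - of_nat i + of_nat (i' + j)) w)" by metis
    qed
    then have "(\<Sum>j<J. ((-1) ^ j * (of_int (int K - 1 - int (a - i)) gchoose j)) *\<^sub>C y j)
        = (\<Sum>j<J. (of_nat (a - i + j) gchoose j) *\<^sub>C F (int j - int i))"
      using sum_gbinomial_inverse_power[of J y "a - i" K] y0 by simp
    then show "(of_rat (- m) gchoose i) *\<^sub>C
        (\<Sum>j<J. ((-1) ^ j * (of_int (int K - 1 - int (a - i)) gchoose j)) *\<^sub>C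
           mY M u (m + of_int (int K - 1 - int (a - i)) - of_nat j) (mY M v (s - m - of_nat i + of_nat j) w))
      = (of_rat (- m) gchoose i) *\<^sub>C
        (\<Sum>j<J. (of_nat (a - i + j) gchoose j) *\<^sub>C F (int j - int i))"
      unfolding y_def by simp
  qed
  also have "\<dots> = (\<Sum>t<J. ((of_rat (- m) + of_nat (a + t)) gchoose a) *\<^sub>C F (int t))"
    using F_neg F_big by (rule sum_gbinomial_shift)
  also have "\<dots> = (\<Sum>p\<in>fraction_window T lo hi. (of_rat (- p - 1) gchoose a) *\<^sub>C cross K u v w p (s - 1 - of_nat a - p))"
  proof -
    define H where "H p = (of_rat (- p - 1) gchoose a) *\<^sub>C cross K u v w p (s - 1 - of_nat a - p)" for p
    define A where "A = (\<lambda>t. m - 1 - of_nat a - of_nat t) ` {..<J}"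
    have "(\<Sum>t<J. ((of_rat (- m) + of_nat (a + t)) gchoose a) *\<^sub>C F (int t)) = (\<Sum>p\<in>A. H p)"
    proof -
      have "inj_on (\<lambda>t. m - 1 - of_nat a - of_nat t) {..<J}" by (auto simp: inj_on_def)
      moreover have "((of_rat (- m) + of_nat (a + t)) gchoose a) *\<^sub>C F (int t) = H (m - 1 - of_nat a - of_nat t)" for t
      proof -
        have 1: "of_rat (- (m - 1 - of_nat a - of_nat t) - 1) = (of_rat (- m) + of_nat (a + t) :: complex)"
          by (simp add: of_rat_diff of_rat_minus of_rat_add)
        have 2: "s - 1 - of_nat a - (m - 1 - of_nat a - of_nat t) = s - m + of_nat t" by simp
        show ?thesis unfolding H_def F_def 1 2 of_int_of_nat_eq ..
      qed
      ultimately show ?thesis unfolding A_def by (simp add: sum.reindex)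
    qed
    \<comment> \<open>Both index sets are compared inside their union. A nonzero term lies in the
      coset of \<open>u\<close> and in the range where \<open>F\<close> may be nonzero, hence in
      \<open>A\<close>; it also respects \<open>hi\<close> and \<open>lo\<close>, hence lies in the
      window. The result no longer depends on the auxiliary m.\<close>
    also have "\<dots> = (\<Sum>p\<in>A \<union> fraction_window T lo hi. H p)"
    proof (rule sum.mono_neutral_left)
      show "finite (A \<union> fraction_window T lo hi)"
        using T(2) by (auto simp: A_def finite_fraction_window)
      show "\<forall>p\<in>A \<union> fraction_window T lo hi - A. H p = 0"
      proof
        fix p assume p: "p \<in> A \<union> fraction_window T lo hi - A"
        show "H p = 0"
        proof (rule ccontr)
          assume "H p \<noteq> 0"
          then have c: "cross K u v w p (s - 1 - of_nat a - p) \<noteq> 0" by (auto simp: H_def)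
          have "p - of_int k / of_nat N \<in> \<int>"
          proof (rule ccontr)
            assume nc: "p - of_int k / of_nat N \<notin> \<int>"
            have "mY M u (p + of_nat K - of_nat j) x = 0" if "x \<in> mcarrier M" for j x
              using coset_shift[of p "int K - int j" k] nc
              by (intro Y_eigen[OF u _ that]) (simp add: algebra_simps)
            then show False using c Y_mem[OF v w] by (simp add: cross_def)
          qed
          with m_coset have "(m - of_int k / of_nat N) - (p - of_int k / of_nat N) \<in> \<int>" by (rule Ints_diff)
          then obtain z where "m - p = of_int z" by (auto elim: Ints_cases)
          then have pz: "p = m - 1 - of_nat a - of_int (z - 1 - int a)" by simp
          have n: "s - 1 - of_nat a - p = s - m + of_int (z - 1 - int a)" unfolding pz by simp
          have "F (z - 1 - int a) \<noteq> 0" using c unfolding F_def n pz[symmetric] by simp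
          then have "z - 1 - int a > 0" "z - 1 - int a < int J"
            using F_neg F_big by (force simp: not_le[symmetric])+
          then have "p = m - 1 - of_nat a - of_nat (nat (z - 1 - int a))" "nat (z - 1 - int a) < J"
            using pz by auto
          then have "p \<in> A" by (auto simp: A_def)
          then show False using p by simp
        qed
      qed
    qed auto
    also have "\<dots> = (\<Sum>p\<in>fraction_window T lo hi. H p)"
    proof (rule sum.mono_neutral_right)
      show "finite (A \<union> fraction_window T lo hi)"
        using T(2) by (auto simp: A_def finite_fraction_window)
      show "\<forall>p\<in>A \<union> fraction_window T lo hi - fraction_window T lo hi. H p = 0"
      proof
        fix p assume p: "p \<in> A \<union> fraction_window T lo hi - fraction_window T lo hi"
        show "H p = 0"
        proof (rule ccontr)
          assume "H p \<noteq> 0"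
          then have c: "cross K u v w p (s - 1 - of_nat a - p) \<noteq> 0" by (auto simp: H_def)
          have "p < hi" using c cross0 not_le by blast
          moreover have "lo \<le> p"
          proof (rule ccontr)
            assume "\<not> lo \<le> p"
            then have "s - 1 - of_nat a - p + of_nat j \<ge> n0" for j
              using lo of_nat_0_le_iff[of j, where 'a = rat] by linarith
            then show False using c cross0' n0 by blast
          qed
          moreover have "of_nat T * p \<in> \<int>"
          proof -
            obtain t where t: "p = m - 1 - of_nat a - of_nat t" using p by (auto simp: A_def)
            have "p - of_int k / of_nat N \<in> \<int>"
              using m_coset coset_shift[of m "- 1 - int a - int t" k] unfolding t
              by (simp add: algebra_simps)
            then have "of_nat N * p \<in> \<int>" by (rule coset_N)
            moreover obtain d where "T = N * d" using T(1) by (elim dvdE)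
            then have "of_nat T * p = of_nat d * (of_nat N * p)" by simp
            ultimately show ?thesis by (simp only: Ints_mult Ints_of_nat)
          qed
          ultimately show False using p by (simp add: fraction_window_def)
        qed
      qed
    qed auto
    finally show ?thesis by (simp add: H_def)
  qed
  finally show ?thesis .
qed

text \<open>The coefficients of \<open>iterate_via_cross_eigen\<close> do not depend on the
  eigenvalue, so that formula may be summed over the eigencomponents of \<open>u\<close>.\<close>

lemma iterate_via_cross:
  assumes u: "u \<in> vcarrier V" and v: "v \<in> vcarrier V" and w: "w \<in> mcarrier M"
    and K: "\<And>i l. l \<ge> int K \<Longrightarrow> vY V ((g ^^ i) u) l v = 0"
    and hi: "\<And>m. m \<ge> hi \<Longrightarrow> mY M u m w = 0" and n0: "\<And>n. n \<ge> n0 \<Longrightarrow> mY M v n w = 0"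
    and T: "N dvd T" "T > 0" and lo: "lo \<le> s - 1 - of_nat a - n0"
  shows "mY M (vY V u (int K - 1 - int a) v) s w =
     (\<Sum>m\<in>fraction_window T lo hi. (of_rat (- m - 1) gchoose a) *\<^sub>C cross K u v w m (s - 1 - of_nat a - m))"
proof -
  let ?l = "int K - 1 - int a"
  have e: "eigenpart k u \<in> vcarrier V" for k using eigenpart_mem[OF u] eigenspace_subset by blast
  have "vY V u ?l v = (\<Sum>k<N. vY V (eigenpart k u) ?l v)"
    using linear_map_sum[OF is_voaD(3)[OF voa v] V_subspace, of "{..<N}" "\<lambda>k. eigenpart k u"] e
    by (simp add: sum_eigenpart[OF u])
  then have "mY M (vY V u ?l v) s w = (\<Sum>k<N. mY M (vY V (eigenpart k u) ?l v) s w)"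
    using linear_map_sum[OF Y_linear_left[OF w] V_subspace, of "{..<N}" "\<lambda>k. vY V (eigenpart k u) ?l v"]
      vY_mem[OF e v] by simp
  also have "\<dots> = (\<Sum>k<N. \<Sum>m\<in>fraction_window T lo hi. (of_rat (- m - 1) gchoose a) *\<^sub>C
      cross K (eigenpart k u) v w m (s - 1 - of_nat a - m))"
    using eigenpart_vY_zero[OF u v] K hi eigenpart_Y_zero[OF u w]
    by (intro sum.cong refl iterate_via_cross_eigen[OF eigenpart_mem[OF u] v w _ _ n0 T lo]) auto
  also have "\<dots> = (\<Sum>m\<in>fraction_window T lo hi. (of_rat (- m - 1) gchoose a) *\<^sub>C
      cross K u v w m (s - 1 - of_nat a - m))"
    by (subst sum.swap) (simp add: cross_eigenpart[OF u v w] cvec.scale_sum_right)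
  finally show ?thesis .
qed

text \<open>The vectors \<open>(g ^^ i) u\<close> repeat with period \<open>N\<close>, so finitely
  many truncation bounds have a maximum.\<close>

lemma ex_locality_bound:
  assumes "u \<in> vcarrier V" "v \<in> vcarrier V"
  shows "\<exists>K. \<forall>i l. l \<ge> int K \<longrightarrow> vY V ((g ^^ i) u) l v = 0"
proof -
  have "\<exists>n0. \<forall>n\<ge>n0. vY V ((g ^^ i) u) n v = 0" for i
    using is_voaD(4)[OF voa funpow_mem[OF assms(1)] assms(2)] .
  then obtain b where b: "\<And>i n. n \<ge> b i \<Longrightarrow> vY V ((g ^^ i) u) n v = 0" by metis
  define K where "K = nat (Max (b ` {..<N}))"
  have "vY V ((g ^^ i) u) n v = 0" if "n \<ge> int K" for i n
  proof -
    have "(g ^^ i) u = (g ^^ (i mod N)) u"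
    proof -
      have "(g ^^ (N * q)) u = u" for q
        by (induction q) (auto simp: funpow_add funpow_N[OF assms(1)])
      then show ?thesis
        using funpow_add[of "i mod N" "N * (i div N)" g] by (metis comp_apply mod_mult_div_eq)
    qed
    moreover have "b (i mod N) \<le> Max (b ` {..<N})" using N_pos by (intro Max_ge) auto
    then have "b (i mod N) \<le> n" using that by (auto simp: K_def split: if_splits)
    ultimately show ?thesis using b by simp
  qed
  then show ?thesis by blast
qed

text \<open>Every cross coefficient applies a mode of \<open>v\<close> to \<open>w\<close> first, so
  it vanishes, and with it every mode of the iterate.\<close>

lemma annihilator_ideal:
  assumes u: "u \<in> vcarrier V" and v: "v \<in> vcarrier V" and w: "w \<in> mcarrier M"
    and 0: "\<And>n. mY M v n w = 0"
  shows "mY M (vY V u l v) s w = 0"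
proof -
  obtain K0 where K0: "\<And>i n. n \<ge> int K0 \<Longrightarrow> vY V ((g ^^ i) u) n v = 0"
    using ex_locality_bound[OF u v] by blast
  \<comment> \<open>Enlarged beyond \<open>l\<close>, so that \<open>l\<close> has the form K - 1 -
    a with a natural number a.\<close>
  define K where "K = K0 + nat (l + 1)"
  have K: "vY V ((g ^^ i) u) n v = 0" if "n \<ge> int K" for i n
    using that unfolding K_def by (intro K0) (simp split: if_splits)
  obtain hi where hi: "\<And>m. m \<ge> hi \<Longrightarrow> mY M u m w = 0" using Y_trunc[OF u w] by blast
  define a where "a = nat (int K - 1 - l)"
  have l: "l = int K - 1 - int a" unfolding a_def K_def by simp
  have c: "cross K u v w m n = 0" for m n
    unfolding cross_def using 0 Y_zero[OF u] by (intro sum.neutral) auto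
  have "mY M (vY V u (int K - 1 - int a) v) s w =
     (\<Sum>m\<in>fraction_window N (s - 1 - of_nat a - 0) hi. (of_rat (- m - 1) gchoose a) *\<^sub>C
        cross K u v w m (s - 1 - of_nat a - m))"
    by (rule iterate_via_cross[OF u v w _ _ _ dvd_refl N_pos order_refl]) (use K hi 0 in auto)
  then show ?thesis unfolding l using c by simp
qed

end

section \<open>The twisted quantum double and its simple modules\<close>

text \<open>Irreducibility under a bare set of operators, the common core of simple twisted modules,
  simple modules of the double and simple modules of the fixed-point algebra.\<close>

definition simple_action :: "'o set \<Rightarrow> ('o \<Rightarrow> 'm::complex_vector \<Rightarrow> 'm) \<Rightarrow> 'm set \<Rightarrow> bool" where
  "simple_action Op act S \<longleftrightarrow> cvec.subspace S \<and> S \<noteq> {0} \<and> (\<forall>a\<in>Op. linear_map S S (act a)) \<and>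
     (\<forall>W. cvec.subspace W \<and> W \<subseteq> S \<and> (\<forall>a\<in>Op. \<forall>w\<in>W. act a w \<in> W) \<longrightarrow> W = {0} \<or> W = S)"

text \<open>Schur's lemma, first half: kernel and image are invariant.\<close>

lemma simple_action_hom_bij:
  assumes S: "simple_action Op act S" and T: "simple_action Op act' T"
    and f: "linear_map S T f" and comm: "\<And>a w. a \<in> Op \<Longrightarrow> w \<in> S \<Longrightarrow> f (act a w) = act' a (f w)"
    and x: "x \<in> S" "f x \<noteq> 0"
  shows "bij_betw f S T"
proof -
  have sub: "cvec.subspace S" and lin: "\<And>a. a \<in> Op \<Longrightarrow> linear_map S S (act a)"
    and simp: "\<And>W. cvec.subspace W \<Longrightarrow> W \<subseteq> S \<Longrightarrow> (\<And>a w. a \<in> Op \<Longrightarrow> w \<in> W \<Longrightarrow> act a w \<in> W) \<Longrightarrow> W = {0} \<or> W = S"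
    using S unfolding simple_action_def by blast+
  have linT: "\<And>a. a \<in> Op \<Longrightarrow> linear_map T T (act' a)" and subT: "cvec.subspace T"
    and simpT: "\<And>W. cvec.subspace W \<Longrightarrow> W \<subseteq> T \<Longrightarrow> (\<And>a w. a \<in> Op \<Longrightarrow> w \<in> W \<Longrightarrow> act' a w \<in> W) \<Longrightarrow> W = {0} \<or> W = T"
    using T unfolding simple_action_def by blast+
  have "{x \<in> S. f x = 0} = {0} \<or> {x \<in> S. f x = 0} = S"
  proof (rule simp)
    show "cvec.subspace {x \<in> S. f x = 0}" using f sub by (rule linear_map_subspace_kernel)
    show "act a w \<in> {x \<in> S. f x = 0}" if "a \<in> Op" "w \<in> {x \<in> S. f x = 0}" for a w
      using that comm linear_map_mem[OF lin] linear_map_zero[OF linT subT] by auto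
  qed auto
  then have "inj_on f S"
    using x by (intro linear_map_inj[OF f sub]) blast
  moreover have "f ` S = {0} \<or> f ` S = T"
  proof (rule simpT)
    show "cvec.subspace (f ` S)" using f sub by (rule linear_map_subspace_image)
    show "act' a w \<in> f ` S" if "a \<in> Op" "w \<in> f ` S" for a w
      using that comm linear_map_mem[OF lin] by (auto simp flip: comm)
  qed (auto intro: linear_map_mem[OF f])
  then have "f ` S = T" using x by blast
  ultimately show ?thesis by (simp add: bij_betw_def)
qed

text \<open>Schur's lemma over the complex numbers for a possibly infinite-dimensional
  \<open>S\<close>. The finite-dimensional \<open>S0\<close>, a weight space in the case of twisted
  modules, supplies an eigenvector; the eigenspace in \<open>S\<close> is then invariant and
  nonzero.\<close>

lemma simple_action_hom_scalar:
  assumes S: "simple_action Op act S" and f: "linear_map S S f"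
    and comm: "\<And>a w. a \<in> Op \<Longrightarrow> w \<in> S \<Longrightarrow> f (act a w) = act a (f w)"
    and S0: "fin_dim S0" "S0 \<noteq> {0}" "S0 \<subseteq> S" "\<And>x. x \<in> S0 \<Longrightarrow> f x \<in> S0"
  shows "\<exists>c. \<forall>x\<in>S. f x = c *\<^sub>C x"
proof -
  have sub: "cvec.subspace S" and lin: "\<And>a. a \<in> Op \<Longrightarrow> linear_map S S (act a)"
    and simp: "\<And>W. cvec.subspace W \<Longrightarrow> W \<subseteq> S \<Longrightarrow> (\<And>a w. a \<in> Op \<Longrightarrow> w \<in> W \<Longrightarrow> act a w \<in> W) \<Longrightarrow> W = {0} \<or> W = S"
    using S unfolding simple_action_def by blast+
  have "linear_map S0 S0 f"
    using S0(3,4) linear_map_add[OF f] linear_map_scale[OF f] unfolding linear_map_def by blast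
  then obtain c x where x: "x \<in> S0" "x \<noteq> 0" "f x = c *\<^sub>C x"
    using ex_eigenvector[OF S0(1,2)] by blast
  have fc: "linear_map S S (\<lambda>x. f x - c *\<^sub>C x)"
    using f cvec.subspace_diff[OF sub] cvec.subspace_scale[OF sub]
    by (auto simp: linear_map_def cvec.scale_right_diff_distrib scaleC_add_right scaleC_scaleC mult.commute)
  let ?W = "{x \<in> S. f x - c *\<^sub>C x = 0}"
  have "?W = {0} \<or> ?W = S"
  proof (rule simp)
    show "cvec.subspace ?W" using fc sub by (rule linear_map_subspace_kernel)
    show "act a w \<in> ?W" if "a \<in> Op" "w \<in> ?W" for a w
      using that comm linear_map_mem[OF lin] linear_map_scale[OF lin] by auto
  qed auto
  moreover have "x \<in> ?W" using x S0(3) by auto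
  ultimately have "?W = S" using x(2) by blast
  then show ?thesis by (intro exI[of _ c]) auto
qed

lemma alg_moduleD:
  assumes "alg_module A U"
  shows "cvec.subspace (ucarrier U)"
    "\<And>a. a \<in> acarrier A \<Longrightarrow> linear_map (ucarrier U) (ucarrier U) (uact U a)"
    "\<And>u. u \<in> ucarrier U \<Longrightarrow> linear_map (acarrier A) (ucarrier U) (\<lambda>a. uact U a u)"
    "\<And>a b u. a \<in> acarrier A \<Longrightarrow> b \<in> acarrier A \<Longrightarrow> u \<in> ucarrier U \<Longrightarrow>
        uact U (amult A a b) u = uact U a (uact U b u)"
    "\<And>u. u \<in> ucarrier U \<Longrightarrow> uact U (aunit A) u = u"
  using assms by (simp_all add: alg_module_def)

lemma simple_alg_module_action:
  "simple_alg_module A U \<Longrightarrow> simple_action (acarrier A) (uact U) (ucarrier U)"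
  by (simp add: simple_alg_module_def alg_module_def simple_action_def)

lemma alg_module_iso_refl: "alg_module_iso A U U"
  unfolding alg_module_iso_def by (intro exI[of _ "\<lambda>x. x"]) (auto simp: linear_map_def bij_betw_def)

lemma alg_module_iso_sym:
  assumes "alg_module A U" "alg_module A W" "alg_module_iso A U W"
  shows "alg_module_iso A W U"
proof -
  obtain f where f: "bij_betw f (ucarrier U) (ucarrier W)" "linear_map (ucarrier U) (ucarrier W) f"
    "\<And>a u. a \<in> acarrier A \<Longrightarrow> u \<in> ucarrier U \<Longrightarrow> f (uact U a u) = uact W a (f u)"
    using assms(3) unfolding alg_module_iso_def by blast
  let ?h = "the_inv_into (ucarrier U) f"
  have inj: "inj_on f (ucarrier U)" and im: "f ` ucarrier U = ucarrier W"
    using f(1) by (auto simp: bij_betw_def)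
  have "bij_betw ?h (ucarrier W) (ucarrier U)" using f(1) by (rule bij_betw_the_inv_into)
  moreover have "linear_map (ucarrier W) (ucarrier U) ?h"
    using linear_map_inverse[OF f(2) alg_moduleD(1)[OF assms(1)] f(1)] .
  moreover have "?h (uact W a w) = uact U a (?h w)" if "a \<in> acarrier A" and w: "w \<in> ucarrier W" for a w
  proof -
    obtain u where u: "u \<in> ucarrier U" "w = f u" using w im by blast
    have "?h (f (uact U a u)) = uact U a u"
      using inj u linear_map_mem[OF alg_moduleD(2)[OF assms(1) that(1)]] by (intro the_inv_into_f_f) auto
    then show ?thesis using f(3)[OF that(1) u(1)] the_inv_into_f_f[OF inj u(1)] u(2) by simp
  qed
  ultimately show ?thesis unfolding alg_module_iso_def by blast
qed

lemma alg_module_iso_trans: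
  assumes "alg_module_iso A U W" "alg_module_iso A W Z"
  shows "alg_module_iso A U Z"
proof -
  obtain f where f: "bij_betw f (ucarrier U) (ucarrier W)" "linear_map (ucarrier U) (ucarrier W) f"
    "\<forall>a\<in>acarrier A. \<forall>u\<in>ucarrier U. f (uact U a u) = uact W a (f u)"
    using assms(1) unfolding alg_module_iso_def by blast
  obtain h where h: "bij_betw h (ucarrier W) (ucarrier Z)" "linear_map (ucarrier W) (ucarrier Z) h"
    "\<forall>a\<in>acarrier A. \<forall>u\<in>ucarrier W. h (uact W a u) = uact Z a (h u)"
    using assms(2) unfolding alg_module_iso_def by blast
  show ?thesis
    unfolding alg_module_iso_def
  proof (intro exI conjI ballI)
    show "bij_betw (\<lambda>x. h (f x)) (ucarrier U) (ucarrier Z)"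
      using bij_betw_trans[OF f(1) h(1)] by (simp add: comp_def)
    show "linear_map (ucarrier U) (ucarrier Z) (\<lambda>x. h (f x))" using linear_map_comp[OF f(2) h(2)] .
    show "h (f (uact U a u)) = uact Z a (h (f u))" if "a \<in> acarrier A" "u \<in> ucarrier U" for a u
      using that f(3) h(3) linear_map_mem[OF f(2)] by simp
  qed
qed

lemma simple_alg_module_iso:
  assumes "simple_alg_module A U" "simple_alg_module A W"
    "linear_map (ucarrier U) (ucarrier W) f"
    "\<And>a u. a \<in> acarrier A \<Longrightarrow> u \<in> ucarrier U \<Longrightarrow> f (uact U a u) = uact W a (f u)"
    "x \<in> ucarrier U" "f x \<noteq> 0"
  shows "alg_module_iso A U W"
  using simple_action_hom_bij[OF simple_alg_module_action[OF assms(1)]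
      simple_alg_module_action[OF assms(2)] assms(3-6)] assms(3,4)
  unfolding alg_module_iso_def by blast

section \<open>The double as twisted algebra of the conjugation groupoid\<close>

locale double = group G for G (structure) +
  fixes \<alpha> :: "'a \<Rightarrow> 'a \<Rightarrow> 'a \<Rightarrow> complex"
  assumes finite_G: "finite (carrier G)"
    and \<alpha>_nonzero: "x \<in> carrier G \<Longrightarrow> a \<in> carrier G \<Longrightarrow> b \<in> carrier G \<Longrightarrow> \<alpha> x a b \<noteq> 0"
    and cocycle: "g \<in> carrier G \<Longrightarrow> h \<in> carrier G \<Longrightarrow> k \<in> carrier G \<Longrightarrow> l \<in> carrier G \<Longrightarrow>
        \<alpha> g (h \<otimes> k) l * \<alpha> (l \<otimes> g \<otimes> inv l) h k = \<alpha> g h (k \<otimes> l) * \<alpha> g k l"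
begin

abbreviation D where "D \<equiv> twisted_double G \<alpha>"
abbreviation conj :: "'a \<Rightarrow> 'a \<Rightarrow> 'a" where "conj a x \<equiv> a \<otimes> x \<otimes> inv a"
abbreviation \<xi> :: "'a \<Rightarrow> 'a \<Rightarrow> 'a \<times> 'a \<Rightarrow> complex" where "\<xi> \<equiv> double_basis"

lemma conj_mult: "a \<in> carrier G \<Longrightarrow> b \<in> carrier G \<Longrightarrow> x \<in> carrier G \<Longrightarrow> conj (a \<otimes> b) x = conj a (conj b x)"
  by (simp add: m_assoc inv_mult_group)

lemma conj_inv: "a \<in> carrier G \<Longrightarrow> x \<in> carrier G \<Longrightarrow> conj (inv a) (conj a x) = x"
  using conj_mult[of "inv a" a x] by simp

lemma conj_eq_iff:
  "b \<in> carrier G \<Longrightarrow> x \<in> carrier G \<Longrightarrow> y \<in> carrier G \<Longrightarrow> inv b \<otimes> x \<otimes> b = y \<longleftrightarrow> x = conj b y"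
  using conj_inv[of "inv b" x] conj_inv[of b y] by auto

lemma D_subspace: "cvec.subspace (acarrier D)"
  by (rule cvec.subspaceI) (auto simp: twisted_double_def scaleC_fun_def)

lemma \<xi>_mem: "a \<in> carrier G \<Longrightarrow> x \<in> carrier G \<Longrightarrow> \<xi> a x \<in> acarrier D"
  by (auto simp: twisted_double_def double_basis_def)

lemma sum_\<xi>_apply:
  "finite I \<Longrightarrow> (\<Sum>i\<in>I. c i *\<^sub>C \<xi> (f i) (h i)) p = (\<Sum>i\<in>I. if p = (f i, h i) then c i else 0)"
  by (induction I rule: finite_induct)
     (auto simp: double_basis_def scaleC_fun_def scaleC_complex_def)

lemma D_expand:
  assumes "d \<in> acarrier D"
  shows "d = (\<Sum>p\<in>carrier G \<times> carrier G. d p *\<^sub>C \<xi> (fst p) (snd p))"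
proof
  fix q
  have fin: "finite (carrier G \<times> carrier G)" using finite_G by simp
  show "d q = (\<Sum>p\<in>carrier G \<times> carrier G. d p *\<^sub>C \<xi> (fst p) (snd p)) q"
    unfolding sum_\<xi>_apply[OF fin] using assms fin by (cases q) (auto simp: twisted_double_def)
qed

definition bmult :: "'a \<Rightarrow> 'a \<Rightarrow> 'a \<Rightarrow> 'a \<Rightarrow> 'a \<times> 'a \<Rightarrow> complex" where
  "bmult a x b y = (if x = conj b y then \<alpha> y a b *\<^sub>C \<xi> (a \<otimes> b) y else 0)"

lemma amult_expand:
  "amult D d d' = (\<Sum>p\<in>carrier G \<times> carrier G. \<Sum>q\<in>carrier G \<times> carrier G.
     (d p * d' q) *\<^sub>C bmult (fst p) (snd p) (fst q) (snd q))"
  unfolding twisted_double_def by (auto intro!: sum.cong simp: bmult_def conj_eq_iff split: prod.splits)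

lemma bmult_mem: "a \<in> carrier G \<Longrightarrow> b \<in> carrier G \<Longrightarrow> y \<in> carrier G \<Longrightarrow> bmult a x b y \<in> acarrier D"
  by (simp add: bmult_def cvec.subspace_0[OF D_subspace] cvec.subspace_scale[OF D_subspace] \<xi>_mem)

lemma amult_mem: "amult D d d' \<in> acarrier D"
  unfolding amult_expand
  by (intro cvec.subspace_sum[OF D_subspace] cvec.subspace_scale[OF D_subspace] bmult_mem) auto

lemma aunit_eq: "aunit D = (\<Sum>x\<in>carrier G. inverse (\<alpha> x \<one> \<one>) *\<^sub>C \<xi> \<one> x)"
  by (simp add: twisted_double_def)

lemma aunit_mem: "aunit D \<in> acarrier D"
  unfolding aunit_eq by (intro cvec.subspace_sum[OF D_subspace] cvec.subspace_scale[OF D_subspace] \<xi>_mem) auto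

lemma amult_\<xi>:
  assumes "a \<in> carrier G" "x \<in> carrier G" "b \<in> carrier G" "y \<in> carrier G"
  shows "amult D (\<xi> a x) (\<xi> b y) = bmult a x b y"
proof -
  have fin: "finite (carrier G \<times> carrier G)" using finite_G by simp
  have "amult D (\<xi> a x) (\<xi> b y) = (\<Sum>p\<in>carrier G \<times> carrier G. if p = (a, x) then
      (\<Sum>q\<in>carrier G \<times> carrier G. if q = (b, y) then bmult a x b y else 0) else 0)"
    unfolding amult_expand
    by (intro sum.cong refl) (auto simp: double_basis_def scaleC_one intro!: sum.neutral sum.cong)
  then show ?thesis using assms fin by simp
qed

lemma act_expand:
  assumes "alg_module D U" "d \<in> acarrier D" "u \<in> ucarrier U"
  shows "uact U d u = (\<Sum>p\<in>carrier G \<times> carrier G. d p *\<^sub>C uact U (\<xi> (fst p) (snd p)) u)"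
proof -
  have "uact U (\<Sum>p\<in>carrier G \<times> carrier G. d p *\<^sub>C \<xi> (fst p) (snd p)) u
      = (\<Sum>p\<in>carrier G \<times> carrier G. d p *\<^sub>C uact U (\<xi> (fst p) (snd p)) u)"
    by (intro linear_map_lincomb[OF alg_moduleD(3)[OF assms(1,3)] D_subspace] \<xi>_mem) auto
  then show ?thesis using D_expand[OF assms(2)] by simp
qed

lemma act_\<xi>_mult:
  assumes "alg_module D U" "u \<in> ucarrier U" "a \<in> carrier G" "x \<in> carrier G" "b \<in> carrier G" "y \<in> carrier G"
  shows "uact U (\<xi> a x) (uact U (\<xi> b y) u) =
     (if x = conj b y then \<alpha> y a b *\<^sub>C uact U (\<xi> (a \<otimes> b) y) u else 0)"
proof -
  have "uact U (\<xi> a x) (uact U (\<xi> b y) u) = uact U (bmult a x b y) u"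
    using alg_moduleD(4)[OF assms(1) \<xi>_mem \<xi>_mem] assms by (simp add: amult_\<xi>)
  also have "\<dots> = (if x = conj b y then \<alpha> y a b *\<^sub>C uact U (\<xi> (a \<otimes> b) y) u else 0)"
    unfolding bmult_def
    using linear_map_scale[OF alg_moduleD(3)[OF assms(1,2)]]
      linear_map_zero[OF alg_moduleD(3)[OF assms(1,2)] D_subspace] assms \<xi>_mem by simp
  finally show ?thesis .
qed

lemma act_unit:
  assumes "alg_module D U" "u \<in> ucarrier U"
  shows "(\<Sum>x\<in>carrier G. inverse (\<alpha> x \<one> \<one>) *\<^sub>C uact U (\<xi> \<one> x) u) = u"
proof -
  have "uact U (aunit D) u = (\<Sum>x\<in>carrier G. inverse (\<alpha> x \<one> \<one>) *\<^sub>C uact U (\<xi> \<one> x) u)"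
    unfolding aunit_eq
    by (intro linear_map_lincomb[OF alg_moduleD(3)[OF assms] D_subspace] \<xi>_mem) auto
  then show ?thesis using alg_moduleD(5)[OF assms] by simp
qed

lemma act_\<xi>_linear:
  "alg_module D U \<Longrightarrow> a \<in> carrier G \<Longrightarrow> x \<in> carrier G \<Longrightarrow> linear_map (ucarrier U) (ucarrier U) (uact U (\<xi> a x))"
  using alg_moduleD(2) \<xi>_mem by blast

lemma act_mem: "alg_module D U \<Longrightarrow> d \<in> acarrier D \<Longrightarrow> u \<in> ucarrier U \<Longrightarrow> uact U d u \<in> ucarrier U"
  using linear_map_mem[OF alg_moduleD(2)] .

lemma submodule_alg_module:
  assumes "alg_module D U" "cvec.subspace W" "W \<subseteq> ucarrier U" "\<forall>d\<in>acarrier D. \<forall>w\<in>W. uact U d w \<in> W"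
  shows "alg_module D (U\<lparr>ucarrier := W\<rparr>)"
  using assms unfolding alg_module_def linear_map_def by (simp add: subset_iff)

lemma homI:
  assumes U: "alg_module D U" and W: "alg_module D W" and f: "linear_map (ucarrier U) (ucarrier W) f"
    and c: "\<And>a x u. a \<in> carrier G \<Longrightarrow> x \<in> carrier G \<Longrightarrow> u \<in> ucarrier U \<Longrightarrow>
        f (uact U (\<xi> a x) u) = uact W (\<xi> a x) (f u)"
    and d: "d \<in> acarrier D" and u: "u \<in> ucarrier U"
  shows "f (uact U d u) = uact W d (f u)"
proof -
  have "f (uact U d u) = (\<Sum>p\<in>carrier G \<times> carrier G. d p *\<^sub>C f (uact U (\<xi> (fst p) (snd p)) u))"
    unfolding act_expand[OF U d u] using u U
    by (intro linear_map_lincomb[OF f alg_moduleD(1)[OF U]] act_mem \<xi>_mem) auto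
  also have "\<dots> = (\<Sum>p\<in>carrier G \<times> carrier G. d p *\<^sub>C uact W (\<xi> (fst p) (snd p)) (f u))"
    using c u by (intro sum.cong) auto
  also have "\<dots> = uact W d (f u)"
    using act_expand[OF W d linear_map_mem[OF f u]] by simp
  finally show ?thesis .
qed

text \<open>In this form an action of the double has to be checked only on the basis a \<otimes>
  e(x), where the product is a single term.\<close>

lemma alg_moduleI:
  fixes U :: "'u::complex_vector set"
  assumes U: "cvec.subspace U"
    and lin: "\<And>a x. a \<in> carrier G \<Longrightarrow> x \<in> carrier G \<Longrightarrow> linear_map U U (X a x)"
    and mult: "\<And>a x b y u. a \<in> carrier G \<Longrightarrow> x \<in> carrier G \<Longrightarrow> b \<in> carrier G \<Longrightarrow> y \<in> carrier G \<Longrightarrow> u \<in> U \<Longrightarrow>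
       X a x (X b y u) = (if x = conj b y then \<alpha> y a b *\<^sub>C X (a \<otimes> b) y u else 0)"
    and unit: "\<And>u. u \<in> U \<Longrightarrow> (\<Sum>x\<in>carrier G. inverse (\<alpha> x \<one> \<one>) *\<^sub>C X \<one> x u) = u"
    and act: "\<And>d u. act d u = (\<Sum>p\<in>carrier G \<times> carrier G. d p *\<^sub>C X (fst p) (snd p) u)"
  shows "alg_module D \<lparr>ucarrier = U, uact = act\<rparr>"
proof -
  let ?GG = "carrier G \<times> carrier G"
  have fin: "finite ?GG" using finite_G by simp
  have Xm: "X (fst p) (snd p) u \<in> U" if "p \<in> ?GG" "u \<in> U" for p u
    using that linear_map_mem[OF lin] by auto
  have act_add: "act (d + d') u = act d u + act d' u" for d d' u
    unfolding act by (simp add: scaleC_add_left sum.distrib)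
  have act_scale: "act (c *\<^sub>C d) u = c *\<^sub>C act d u" for c d u
    unfolding act by (simp add: cvec.scale_sum_right scaleC_scaleC scaleC_fun_def scaleC_complex_def)
  have act_0: "act 0 u = 0" for u unfolding act by simp
  have act_sum: "act (\<Sum>i\<in>I. f i) u = (\<Sum>i\<in>I. act (f i) u)" for I :: "'i set" and f u
    by (induction I rule: infinite_finite_induct) (auto simp: act_add act_0 simp del: plus_fun_apply zero_fun_apply)
  have act_\<xi>: "act (\<xi> a x) u = X a x u" if "a \<in> carrier G" "x \<in> carrier G" for a x u
  proof -
    have "act (\<xi> a x) u = (\<Sum>p\<in>?GG. if p = (a, x) then X a x u else 0)"
      unfolding act by (intro sum.cong) (auto simp: double_basis_def scaleC_one)
    then show ?thesis using that fin by simp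
  qed
  have act_bmult: "act (bmult a x b y) u = X a x (X b y u)"
    if "a \<in> carrier G" "x \<in> carrier G" "b \<in> carrier G" "y \<in> carrier G" "u \<in> U" for a x b y u
    using that by (simp add: bmult_def act_scale act_\<xi> mult act_0)
  have act_lin: "linear_map U U (act d)" for d
    unfolding linear_map_def
  proof (intro conjI ballI allI)
    fix u assume u: "u \<in> U"
    then show "act d u \<in> U"
      unfolding act using Xm by (intro cvec.subspace_sum[OF U] cvec.subspace_scale[OF U]) auto
    show "act d (c *\<^sub>C u) = c *\<^sub>C act d u" for c
      unfolding act cvec.scale_sum_right using u
      by (intro sum.cong) (auto simp: linear_map_scale[OF lin] scaleC_scaleC mult.commute)
    fix v assume v: "v \<in> U"
    show "act d (u + v) = act d u + act d v"
      unfolding act sum.distrib[symmetric] using u v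
      by (intro sum.cong) (auto simp: linear_map_add[OF lin] scaleC_add_right)
  qed
  have "act (amult D d d') u = act d (act d' u)" if u: "u \<in> U" for d d' u
  proof -
    have "act (amult D d d') u
        = (\<Sum>p\<in>?GG. \<Sum>q\<in>?GG. (d p * d' q) *\<^sub>C X (fst p) (snd p) (X (fst q) (snd q) u))"
      unfolding amult_expand act_sum act_scale using u act_bmult by (intro sum.cong) auto
    also have "\<dots> = (\<Sum>p\<in>?GG. d p *\<^sub>C X (fst p) (snd p) (\<Sum>q\<in>?GG. d' q *\<^sub>C X (fst q) (snd q) u))"
    proof (intro sum.cong refl)
      fix p assume p: "p \<in> ?GG"
      have "X (fst p) (snd p) (\<Sum>q\<in>?GG. d' q *\<^sub>C X (fst q) (snd q) u)
          = (\<Sum>q\<in>?GG. d' q *\<^sub>C X (fst p) (snd p) (X (fst q) (snd q) u))"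
        using p u Xm by (intro linear_map_lincomb[OF lin U]) auto
      then show "(\<Sum>q\<in>?GG. (d p * d' q) *\<^sub>C X (fst p) (snd p) (X (fst q) (snd q) u))
          = d p *\<^sub>C X (fst p) (snd p) (\<Sum>q\<in>?GG. d' q *\<^sub>C X (fst q) (snd q) u)"
        by (simp add: cvec.scale_sum_right scaleC_scaleC)
    qed
    finally show ?thesis unfolding act .
  qed
  moreover have "act (aunit D) u = u" if "u \<in> U" for u
    unfolding aunit_eq act_sum act_scale using unit[OF that] act_\<xi> by simp
  moreover have "linear_map (acarrier D) U (\<lambda>d. act d u)" if "u \<in> U" for u
    unfolding linear_map_def using linear_map_mem[OF act_lin that] act_add act_scale by blast
  ultimately show ?thesis
    unfolding alg_module_def using U act_lin by simp
qed

text \<open>The product of \<open>\<xi> (inv a) (conj a x)\<close> and \<open>\<xi> a x\<close> is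
  \<open>\<alpha> x (inv a) a\<close> times \<open>\<xi> \<one> x\<close>, and
  \<open>\<xi> \<one> x\<close> is \<open>\<alpha> x \<one> \<one>\<close> times the x-part of the
  unit. Both scalars are divided out.\<close>

definition inv_coeff :: "'a \<Rightarrow> 'a \<Rightarrow> complex" where
  "inv_coeff a x = inverse (\<alpha> x (inv a) a * \<alpha> x \<one> \<one>)"

text \<open>The cocycle identity for \<open>inv (b \<otimes> a)\<close>, \<open>b\<close>,
  \<open>a\<close>. It matches the scalars when the arrows in \<open>average\<close> are reindexed
  by left translation with \<open>b\<close>.\<close>

lemma inv_coeff_transform:
  assumes "a \<in> carrier G" "b \<in> carrier G" "x \<in> carrier G"
  shows "inv_coeff (b \<otimes> a) x * \<alpha> (conj a x) (inv (b \<otimes> a)) b = \<alpha> x b a * inv_coeff a x"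
proof -
  have "inv (b \<otimes> a) \<otimes> b = inv a" using assms by (simp add: inv_mult_group m_assoc)
  then have "\<alpha> x (inv a) a * \<alpha> (conj a x) (inv (b \<otimes> a)) b = \<alpha> x (inv (b \<otimes> a)) (b \<otimes> a) * \<alpha> x b a"
    using cocycle[of x "inv (b \<otimes> a)" b a] assms by simp
  moreover have "\<alpha> x (inv a) a \<noteq> 0" "\<alpha> x (inv (b \<otimes> a)) (b \<otimes> a) \<noteq> 0" "\<alpha> x \<one> \<one> \<noteq> 0"
    using assms by (simp_all add: \<alpha>_nonzero)
  ultimately show ?thesis by (simp add: inv_coeff_def field_simps)
qed

text \<open>The scalar is built for a left inverse; the cocycle identity for \<open>a\<close>,
  \<open>inv a\<close>, \<open>a\<close> makes it one for a right inverse. Cocycle values with one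
  entry \<one> reduce to values with both entries \<one>, possibly at the conjugate base
  point.\<close>

lemma inv_coeff_inverse:
  assumes a: "a \<in> carrier G" and x: "x \<in> carrier G"
  shows "inv_coeff a x * \<alpha> (conj a x) a (inv a) = inverse (\<alpha> (conj a x) \<one> \<one>)"
proof -
  have y: "conj a x \<in> carrier G" using assms by simp
  have 1: "\<alpha> x \<one> a = \<alpha> (conj a x) \<one> \<one>"
    using cocycle[of x \<one> \<one> a] \<alpha>_nonzero[of x \<one> a] a x by simp
  have 2: "\<alpha> x a \<one> = \<alpha> x \<one> \<one>"
    using cocycle[of x a \<one> \<one>] \<alpha>_nonzero[of x a \<one>] a x by simp
  have "\<alpha> x \<one> a * \<alpha> (conj a x) a (inv a) = \<alpha> x a \<one> * \<alpha> x (inv a) a"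
    using cocycle[of x a "inv a" a] a x by simp
  then have "\<alpha> (conj a x) \<one> \<one> * \<alpha> (conj a x) a (inv a) = \<alpha> x \<one> \<one> * \<alpha> x (inv a) a"
    unfolding 1 2 .
  moreover have "\<alpha> x (inv a) a \<noteq> 0" "\<alpha> x \<one> \<one> \<noteq> 0" "\<alpha> (conj a x) \<one> \<one> \<noteq> 0"
    using a x y by (simp_all add: \<alpha>_nonzero)
  ultimately show ?thesis by (simp add: inv_coeff_def field_simps)
qed

text \<open>Averaging over the arrows of the action groupoid: \<open>\<xi> a x\<close> maps the \<open>x\<close>-component to the
  \<open>conj a x\<close>-component, and \<open>inv_coeff a x *\<^sub>C \<xi> (inv a) (conj a x)\<close> is its inverse there.\<close>

definition average ::
    "('a \<times> 'a \<Rightarrow> complex, 'u::complex_vector) amodule \<Rightarrow> ('a \<times> 'a \<Rightarrow> complex, 'w::complex_vector) amodule \<Rightarrow>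
      ('u \<Rightarrow> 'w) \<Rightarrow> 'u \<Rightarrow> 'w" where
  "average U W \<theta> u = (\<Sum>x\<in>carrier G. \<Sum>a\<in>carrier G.
     uact W (\<xi> a x) (\<theta> (inv_coeff a x *\<^sub>C uact U (\<xi> (inv a) (conj a x)) u)))"

lemma average_linear:
  assumes U: "alg_module D U" and W: "alg_module D W" and \<theta>: "linear_map (ucarrier U) (ucarrier W) \<theta>"
  shows "linear_map (ucarrier U) (ucarrier W) (average U W \<theta>)"
proof -
  have 1: "linear_map (ucarrier U) (ucarrier W)
      (\<lambda>u. uact W (\<xi> a x) (\<theta> (inv_coeff a x *\<^sub>C uact U (\<xi> (inv a) (conj a x)) u)))"
    if "a \<in> carrier G" "x \<in> carrier G" for a x
  proof -
    have "linear_map (ucarrier U) (ucarrier U) (\<lambda>u. inv_coeff a x *\<^sub>C uact U (\<xi> (inv a) (conj a x)) u)"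
      using act_\<xi>_linear[OF U, of "inv a" "conj a x"] that cvec.subspace_scale[OF alg_moduleD(1)[OF U]]
      by (auto simp: linear_map_def scaleC_add_right scaleC_scaleC mult.commute)
    from linear_map_comp[OF linear_map_comp[OF this \<theta>] act_\<xi>_linear[OF W that]] show ?thesis .
  qed
  show ?thesis
    unfolding linear_map_def average_def
  proof (intro conjI ballI allI)
    fix u assume u: "u \<in> ucarrier U"
    show "(\<Sum>x\<in>carrier G. \<Sum>a\<in>carrier G.
      uact W (\<xi> a x) (\<theta> (inv_coeff a x *\<^sub>C uact U (\<xi> (inv a) (conj a x)) u))) \<in> ucarrier W"
      using linear_map_mem[OF 1 u] by (intro cvec.subspace_sum[OF alg_moduleD(1)[OF W]]) auto
    show "(\<Sum>x\<in>carrier G. \<Sum>a\<in>carrier G.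
      uact W (\<xi> a x) (\<theta> (inv_coeff a x *\<^sub>C uact U (\<xi> (inv a) (conj a x)) (c *\<^sub>C u)))) =
      c *\<^sub>C (\<Sum>x\<in>carrier G. \<Sum>a\<in>carrier G.
      uact W (\<xi> a x) (\<theta> (inv_coeff a x *\<^sub>C uact U (\<xi> (inv a) (conj a x)) u)))" for c
      unfolding cvec.scale_sum_right by (intro sum.cong refl linear_map_scale[OF 1 u]) auto
    fix v assume v: "v \<in> ucarrier U"
    show "(\<Sum>x\<in>carrier G. \<Sum>a\<in>carrier G.
      uact W (\<xi> a x) (\<theta> (inv_coeff a x *\<^sub>C uact U (\<xi> (inv a) (conj a x)) (u + v)))) =
      (\<Sum>x\<in>carrier G. \<Sum>a\<in>carrier G.
      uact W (\<xi> a x) (\<theta> (inv_coeff a x *\<^sub>C uact U (\<xi> (inv a) (conj a x)) u))) +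
      (\<Sum>x\<in>carrier G. \<Sum>a\<in>carrier G.
      uact W (\<xi> a x) (\<theta> (inv_coeff a x *\<^sub>C uact U (\<xi> (inv a) (conj a x)) v)))"
      unfolding sum.distrib[symmetric] by (intro sum.cong refl linear_map_add[OF 1 u v]) auto
  qed
qed

text \<open>On the left the arrows are reindexed from a to b \<otimes> a; each summand then matches
  the one on the right in which \<open>\<xi> b y\<close> is composed with the arrow a.\<close>

lemma average_hom:
  assumes U: "alg_module D U" and W: "alg_module D W" and \<theta>: "linear_map (ucarrier U) (ucarrier W) \<theta>"
    and b: "b \<in> carrier G" and y: "y \<in> carrier G" and u: "u \<in> ucarrier U"
  shows "average U W \<theta> (uact U (\<xi> b y) u) = uact W (\<xi> b y) (average U W \<theta> u)"
proof -
  note subW = alg_moduleD(1)[OF W] and subU = alg_moduleD(1)[OF U]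
  have um: "inv_coeff a x *\<^sub>C uact U (\<xi> (inv a) (conj a x)) u \<in> ucarrier U"
    if "a \<in> carrier G" "x \<in> carrier G" for a x
    using that u by (intro cvec.subspace_scale[OF subU] act_mem[OF U] \<xi>_mem) auto
  have wm: "\<theta> (inv_coeff a x *\<^sub>C uact U (\<xi> (inv a) (conj a x)) u) \<in> ucarrier W"
    if "a \<in> carrier G" "x \<in> carrier G" for a x
    using linear_map_mem[OF \<theta> um[OF that]] .
  \<comment> \<open>The common summand of both sides; only arrows a that lead from x to y can
    contribute.\<close>
  define T where "T a x = (if conj a x = y then \<alpha> x b a *\<^sub>C uact W (\<xi> (b \<otimes> a) x)
      (\<theta> (inv_coeff a x *\<^sub>C uact U (\<xi> (inv a) (conj a x)) u)) else 0)" for a x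
  have lhs: "uact W (\<xi> (b \<otimes> a) x) (\<theta> (inv_coeff (b \<otimes> a) x *\<^sub>C
      uact U (\<xi> (inv (b \<otimes> a)) (conj (b \<otimes> a) x)) (uact U (\<xi> b y) u))) = T a x"
    if a: "a \<in> carrier G" and x: "x \<in> carrier G" for a x
  proof -
    have cy: "conj (b \<otimes> a) x = conj b y \<longleftrightarrow> conj a x = y"
      using conj_mult[OF b a x] conj_inv[OF b, of y] conj_inv[OF b, of "conj a x"] a x y by auto
    have ia: "inv (b \<otimes> a) \<otimes> b = inv a" using a b by (simp add: inv_mult_group m_assoc)
    have "uact U (\<xi> (inv (b \<otimes> a)) (conj (b \<otimes> a) x)) (uact U (\<xi> b y) u)
        = (if conj a x = y then \<alpha> y (inv (b \<otimes> a)) b *\<^sub>C uact U (\<xi> (inv a) y) u else 0)"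
      using act_\<xi>_mult[OF U u, of "inv (b \<otimes> a)" "conj (b \<otimes> a) x" b y] a b x y ia cy by simp
    then have eq: "inv_coeff (b \<otimes> a) x *\<^sub>C uact U (\<xi> (inv (b \<otimes> a)) (conj (b \<otimes> a) x)) (uact U (\<xi> b y) u)
        = (if conj a x = y then \<alpha> x b a *\<^sub>C inv_coeff a x *\<^sub>C uact U (\<xi> (inv a) (conj a x)) u else 0)"
      using inv_coeff_transform[OF a b x] by (auto simp: scaleC_scaleC)
    have ba: "b \<otimes> a \<in> carrier G" using a b by simp
    show ?thesis
    proof (cases "conj a x = y")
      case True
      show ?thesis
        unfolding eq T_def if_P[OF True] linear_map_scale[OF \<theta> um[OF a x]]
          linear_map_scale[OF act_\<xi>_linear[OF W ba x] wm[OF a x]] by (rule refl)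
    next
      case False
      show ?thesis
        unfolding eq T_def if_not_P[OF False] linear_map_zero[OF \<theta> subU]
          linear_map_zero[OF act_\<xi>_linear[OF W ba x] subW] by (rule refl)
    qed
  qed
  have "average U W \<theta> (uact U (\<xi> b y) u) = (\<Sum>x\<in>carrier G. \<Sum>a\<in>carrier G. T a x)"
    unfolding average_def
  proof (rule sum.cong[OF refl])
    fix x assume x: "x \<in> carrier G"
    have bij: "bij_betw (\<lambda>a. b \<otimes> a) (carrier G) (carrier G)"
    proof (rule bij_betw_byWitness[where f' = "\<lambda>a. inv b \<otimes> a"])
      show "\<forall>a\<in>carrier G. inv b \<otimes> (b \<otimes> a) = a" "\<forall>a\<in>carrier G. b \<otimes> (inv b \<otimes> a) = a"
        using b by (simp_all add: m_assoc[symmetric])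
    qed (use b in auto)
    show "(\<Sum>a\<in>carrier G. uact W (\<xi> a x) (\<theta> (inv_coeff a x *\<^sub>C
        uact U (\<xi> (inv a) (conj a x)) (uact U (\<xi> b y) u)))) = (\<Sum>a\<in>carrier G. T a x)"
      by (subst sum.reindex_bij_betw[OF bij, symmetric]) (intro sum.cong refl lhs x)
  qed
  moreover have "uact W (\<xi> b y) (average U W \<theta> u) = (\<Sum>x\<in>carrier G. \<Sum>a\<in>carrier G. T a x)"
  proof -
    have m: "uact W (\<xi> a x) (\<theta> (inv_coeff a x *\<^sub>C uact U (\<xi> (inv a) (conj a x)) u)) \<in> ucarrier W"
      if "a \<in> carrier G" "x \<in> carrier G" for a x
      using wm that by (intro act_mem[OF W] \<xi>_mem) auto
    have "uact W (\<xi> b y) (average U W \<theta> u) = (\<Sum>x\<in>carrier G. uact W (\<xi> b y) (\<Sum>a\<in>carrier G.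
        uact W (\<xi> a x) (\<theta> (inv_coeff a x *\<^sub>C uact U (\<xi> (inv a) (conj a x)) u))))"
      unfolding average_def using m
      by (intro linear_map_sum[OF act_\<xi>_linear[OF W b y] subW] cvec.subspace_sum[OF subW]) auto
    also have "\<dots> = (\<Sum>x\<in>carrier G. \<Sum>a\<in>carrier G. uact W (\<xi> b y)
        (uact W (\<xi> a x) (\<theta> (inv_coeff a x *\<^sub>C uact U (\<xi> (inv a) (conj a x)) u))))"
      using m by (intro sum.cong refl linear_map_sum[OF act_\<xi>_linear[OF W b y] subW]) auto
    also have "\<dots> = (\<Sum>x\<in>carrier G. \<Sum>a\<in>carrier G. T a x)"
      using act_\<xi>_mult[OF W wm b y] by (intro sum.cong refl) (auto simp: T_def)
    finally show ?thesis .
  qed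
  ultimately show ?thesis by simp
qed

text \<open>Each summand is an arrow after its inverse, hence a part of the unit. For fixed a these
  parts add up to \<open>u\<close>, which explains the factor
  \<open>card (carrier G)\<close>.\<close>

lemma average_fixes:
  assumes U: "alg_module D U" and u: "u \<in> ucarrier U"
    and \<theta>: "\<And>a x. a \<in> carrier G \<Longrightarrow> x \<in> carrier G \<Longrightarrow>
      \<theta> (inv_coeff a x *\<^sub>C uact U (\<xi> (inv a) (conj a x)) u) = inv_coeff a x *\<^sub>C uact U (\<xi> (inv a) (conj a x)) u"
  shows "average U U \<theta> u = of_nat (card (carrier G)) *\<^sub>C u"
proof -
  have "uact U (\<xi> a x) (\<theta> (inv_coeff a x *\<^sub>C uact U (\<xi> (inv a) (conj a x)) u))
      = inverse (\<alpha> (conj a x) \<one> \<one>) *\<^sub>C uact U (\<xi> \<one> (conj a x)) u"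
    if a: "a \<in> carrier G" and x: "x \<in> carrier G" for a x
  proof -
    have "uact U (\<xi> a x) (\<theta> (inv_coeff a x *\<^sub>C uact U (\<xi> (inv a) (conj a x)) u))
        = inv_coeff a x *\<^sub>C uact U (\<xi> a x) (uact U (\<xi> (inv a) (conj a x)) u)"
      unfolding \<theta>[OF a x] using a x u
      by (intro linear_map_scale[OF act_\<xi>_linear[OF U]] act_mem[OF U] \<xi>_mem) auto
    also have "uact U (\<xi> a x) (uact U (\<xi> (inv a) (conj a x)) u)
        = \<alpha> (conj a x) a (inv a) *\<^sub>C uact U (\<xi> \<one> (conj a x)) u"
      using act_\<xi>_mult[OF U u, of a x "inv a" "conj a x"] a x conj_inv[OF a x] by simp
    finally show ?thesis using inv_coeff_inverse[OF a x] by (simp add: scaleC_scaleC)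
  qed
  then have "average U U \<theta> u = (\<Sum>x\<in>carrier G. \<Sum>a\<in>carrier G.
      inverse (\<alpha> (conj a x) \<one> \<one>) *\<^sub>C uact U (\<xi> \<one> (conj a x)) u)"
    unfolding average_def by (intro sum.cong refl) auto
  also have "\<dots> = (\<Sum>a\<in>carrier G. \<Sum>x\<in>carrier G.
      inverse (\<alpha> (conj a x) \<one> \<one>) *\<^sub>C uact U (\<xi> \<one> (conj a x)) u)"
    by (rule sum.swap)
  also have "\<dots> = (\<Sum>a\<in>carrier G. u)"
  proof (intro sum.cong refl)
    fix a assume a: "a \<in> carrier G"
    have "bij_betw (conj a) (carrier G) (carrier G)"
      by (rule bij_betw_byWitness[where f' = "conj (inv a)"])
         (use a conj_inv[OF a] conj_inv[of "inv a"] in auto)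
    from sum.reindex_bij_betw[OF this, of "\<lambda>x. inverse (\<alpha> x \<one> \<one>) *\<^sub>C uact U (\<xi> \<one> x) u"]
    show "(\<Sum>x\<in>carrier G. inverse (\<alpha> (conj a x) \<one> \<one>) *\<^sub>C uact U (\<xi> \<one> (conj a x)) u) = u"
      using act_unit[OF U u] by simp
  qed
  also have "\<dots> = of_nat (card (carrier G)) *\<^sub>C u"
    by (simp add: cvec.sum_constant_scale)
  finally show ?thesis .
qed

lemma card_G: "(of_nat (card (carrier G)) :: complex) \<noteq> 0"
  using finite_G one_closed by (auto simp: card_eq_0_iff)

text \<open>The average of a linear projection to \<open>W\<close> maps into \<open>W\<close> and is
  a nonzero multiple of the identity there, so its kernel is an invariant complement.
  \<open>U\<close> need not be finite-dimensional; it will be the sum of all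
  \<open>M g\<close>.\<close>

lemma maschke:
  assumes U: "alg_module D U" and W: "cvec.subspace W" "W \<subseteq> ucarrier U"
    "\<forall>d\<in>acarrier D. \<forall>w\<in>W. uact U d w \<in> W"
  obtains C where "cvec.subspace C" "C \<subseteq> ucarrier U" "\<forall>d\<in>acarrier D. \<forall>w\<in>C. uact U d w \<in> C"
    "W \<inter> C = {0}" "\<And>u. u \<in> ucarrier U \<Longrightarrow> \<exists>w\<in>W. \<exists>c\<in>C. u = w + c"
proof -
  let ?n = "of_nat (card (carrier G)) :: complex"
  obtain p where p: "linear_map UNIV W p" "\<And>x. x \<in> W \<Longrightarrow> p x = x" using ex_linear_projection[OF W(1)] by blast
  have pU: "linear_map (ucarrier U) (ucarrier U) p" using p(1) W(2) by (auto simp: linear_map_def)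
  note subU = alg_moduleD(1)[OF U]
  have lin: "linear_map (ucarrier U) (ucarrier U) (average U U p)" using average_linear[OF U U pU] .
  have inW: "average U U p u \<in> W" if "u \<in> ucarrier U" for u
    unfolding average_def using W(3) \<xi>_mem linear_map_mem[OF p(1)]
    by (intro cvec.subspace_sum[OF W(1)]) auto
  have avg: "average U U p w = ?n *\<^sub>C w" if "w \<in> W" for w
    using that W \<xi>_mem
    by (intro average_fixes[OF U] p(2) cvec.subspace_scale[OF W(1)]) auto
  define C where "C = {u \<in> ucarrier U. average U U p u = 0}"
  show ?thesis
  proof
    show "cvec.subspace C" unfolding C_def using lin subU by (rule linear_map_subspace_kernel)
    show "C \<subseteq> ucarrier U" by (auto simp: C_def)
    show "\<forall>d\<in>acarrier D. \<forall>w\<in>C. uact U d w \<in> C"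
    proof (intro ballI)
      fix d w assume "d \<in> acarrier D" "w \<in> C"
      then show "uact U d w \<in> C"
        using homI[OF U U lin average_hom[OF U U pU]] act_mem[OF U] linear_map_zero[OF alg_moduleD(2)[OF U] subU]
        by (auto simp: C_def)
    qed
    show "W \<inter> C = {0}"
      using avg card_G cvec.subspace_0[OF W(1)] cvec.subspace_0[OF subU] linear_map_zero[OF lin subU]
      by (auto simp: C_def)
    fix u assume u: "u \<in> ucarrier U"
    define w where "w = inverse ?n *\<^sub>C average U U p u"
    have w: "w \<in> W" unfolding w_def using inW[OF u] by (rule cvec.subspace_scale[OF W(1)])
    have "average U U p (u - w) = average U U p u - average U U p w"
      using u w W(2) by (intro linear_map_diff[OF lin subU]) auto
    also have "\<dots> = 0" using avg[OF w] card_G by (simp add: w_def scaleC_scaleC scaleC_one)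
    finally have "u - w \<in> C" using u w W(2) cvec.subspace_diff[OF subU] by (auto simp: C_def)
    then show "\<exists>w\<in>W. \<exists>c\<in>C. u = w + c" using w by (intro bexI[of _ w] bexI[of _ "u - w"]) auto
  qed
qed

section \<open>Cyclic submodules and simple modules of the double\<close>

lemma cyclic_submodule:
  assumes U: "alg_module D U" and u: "u \<in> ucarrier U"
  shows "fin_dim ((\<lambda>d. uact U d u) ` acarrier D)" "cvec.subspace ((\<lambda>d. uact U d u) ` acarrier D)"
    "(\<lambda>d. uact U d u) ` acarrier D \<subseteq> ucarrier U" "u \<in> (\<lambda>d. uact U d u) ` acarrier D"
    "\<forall>d\<in>acarrier D. \<forall>w\<in>(\<lambda>d. uact U d u) ` acarrier D. uact U d w \<in> (\<lambda>d. uact U d u) ` acarrier D"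
proof -
  have lin: "linear_map (acarrier D) (ucarrier U) (\<lambda>d. uact U d u)" using alg_moduleD(3)[OF U u] .
  have "acarrier D = cvec.span ((\<lambda>p. \<xi> (fst p) (snd p)) ` (carrier G \<times> carrier G))" (is "_ = cvec.span ?B")
  proof
    show "acarrier D \<subseteq> cvec.span ?B"
    proof
      fix d assume "d \<in> acarrier D"
      then show "d \<in> cvec.span ?B"
        by (subst D_expand) (auto intro!: cvec.span_sum cvec.span_scale intro: cvec.span_base)
    qed
    show "cvec.span ?B \<subseteq> acarrier D"
      using \<xi>_mem D_subspace by (intro cvec.span_minimal) auto
  qed
  moreover have "finite ?B" using finite_G by simp
  ultimately have "fin_dim (acarrier D)" unfolding fin_dim_def by blast
  then show "fin_dim ((\<lambda>d. uact U d u) ` acarrier D)" using lin by (intro image_fin_dim)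
  show "cvec.subspace ((\<lambda>d. uact U d u) ` acarrier D)" using lin D_subspace by (rule linear_map_subspace_image)
  show "(\<lambda>d. uact U d u) ` acarrier D \<subseteq> ucarrier U" using act_mem[OF U _ u] by auto
  show "u \<in> (\<lambda>d. uact U d u) ` acarrier D"
    using alg_moduleD(5)[OF U u] aunit_mem by force
  show "\<forall>d\<in>acarrier D. \<forall>w\<in>(\<lambda>d. uact U d u) ` acarrier D. uact U d w \<in> (\<lambda>d. uact U d u) ` acarrier D"
    using alg_moduleD(4)[OF U _ _ u, symmetric] amult_mem by auto
qed

lemma simple_fin_dim:
  assumes "simple_alg_module D U"
  shows "fin_dim (ucarrier U)"
proof -
  have U: "alg_module D U" and ne: "ucarrier U \<noteq> {0}"
    and s: "\<And>W. cvec.subspace W \<Longrightarrow> W \<subseteq> ucarrier U \<Longrightarrow> \<forall>a\<in>acarrier D. \<forall>w\<in>W. uact U a w \<in> W \<Longrightarrow>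
        W = {0} \<or> W = ucarrier U"
    using assms by (auto simp: simple_alg_module_def)
  obtain u where u: "u \<in> ucarrier U" "u \<noteq> 0" using ne cvec.subspace_0[OF alg_moduleD(1)[OF U]] by blast
  note c = cyclic_submodule[OF U u(1)]
  have "(\<lambda>d. uact U d u) ` acarrier D = ucarrier U"
    using s[OF c(2,3,5)] c(4) u(2) by auto
  then show ?thesis using c(1) by simp
qed

lemma ex_simple_submodule:
  assumes U: "alg_module D U" and W: "fin_dim W" "W \<noteq> {0}" "W \<subseteq> ucarrier U"
    "\<forall>d\<in>acarrier D. \<forall>w\<in>W. uact U d w \<in> W"
  shows "\<exists>S. S \<subseteq> W \<and> simple_alg_module D (U\<lparr>ucarrier := S\<rparr>)"
  using W
proof (induction "cvec.dim W" arbitrary: W rule: less_induct)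
  case less
  have subW: "cvec.subspace W" using less.prems(1) by (rule fin_dim_subspace)
  have mod: "alg_module D (U\<lparr>ucarrier := W\<rparr>)"
    using U subW less.prems(3,4) by (rule submodule_alg_module)
  show ?case
  proof (cases "simple_alg_module D (U\<lparr>ucarrier := W\<rparr>)")
    case False
    then obtain S where S: "cvec.subspace S" "S \<subseteq> W" "\<forall>d\<in>acarrier D. \<forall>w\<in>S. uact U d w \<in> S" "S \<noteq> {0}" "S \<noteq> W"
      using mod less.prems(2) by (auto simp: simple_alg_module_def)
    have fS: "fin_dim S" using less.prems(1) S(2,1) by (rule fin_dim_subset)
    obtain B where B: "finite B" "is_basis B S" "B \<subseteq> S" using fin_dim_basis[OF fS] .
    obtain C where C: "B \<subseteq> C" "C \<subseteq> W" "cvec.independent C" "W \<subseteq> cvec.span C"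
      using cvec.maximal_independent_subset_extend[of B W] B S(2) by (auto simp: is_basis_def)
    have "cvec.span C = W" using C subW cvec.span_minimal[of C W] by auto
    then have Cb: "is_basis C W" using C by (simp add: is_basis_def)
    have fC: "finite C" using is_basis_finite[OF less.prems(1) Cb] .
    have "B \<noteq> C" using S(5) B(2) Cb by (auto simp: is_basis_def)
    then have "card B < card C" using C(1) fC by (intro psubset_card_mono) auto
    moreover have "cvec.dim S = card B" "cvec.dim W = card C"
      using B(2) Cb cvec.dim_span_eq_card_independent by (auto simp: is_basis_def)
    ultimately have "cvec.dim S < cvec.dim W" by simp
    from less.hyps[OF this fS S(4) _ S(3)] show ?thesis using S(2) less.prems(3) by blast
  qed auto
qed

text \<open>\<open>simple_alg_modules\<close> collects modules carried by functions on the naturals,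
  whereas simple submodules of \<open>VS\<close> live in another type. Coordinates with respect to a
  finite basis move them over.\<close>

lemma simple_transport:
  fixes U :: "('a \<times> 'a \<Rightarrow> complex, 'u::complex_vector) amodule"
  assumes "simple_alg_module D U"
  shows "\<exists>U' :: ('a \<times> 'a \<Rightarrow> complex, nat \<Rightarrow> complex) amodule. simple_alg_module D U' \<and> alg_module_iso D U' U"
proof -
  have U: "alg_module D U" and ne: "ucarrier U \<noteq> {0}"
    and s: "\<And>W. cvec.subspace W \<Longrightarrow> W \<subseteq> ucarrier U \<Longrightarrow> \<forall>a\<in>acarrier D. \<forall>w\<in>W. uact U a w \<in> W \<Longrightarrow>
        W = {0} \<or> W = ucarrier U"
    using assms by (auto simp: simple_alg_module_def)
  note subU = alg_moduleD(1)[OF U]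
  obtain B where B: "finite B" "is_basis B (ucarrier U)" "B \<subseteq> ucarrier U"
    using fin_dim_basis[OF simple_fin_dim[OF assms]] by blast
  obtain e where e: "bij_betw e {..<card B} B"
    using ex_bij_betw_nat_finite[OF B(1)] by (auto simp: atLeast0LessThan)
  let ?n = "card B"
  define S where "S = {x :: nat \<Rightarrow> complex. \<forall>i\<ge>?n. x i = 0}"
  define f where "f x = (\<Sum>i<?n. x i *\<^sub>C e i)" for x :: "nat \<Rightarrow> complex"
  have eU: "e i \<in> ucarrier U" if "i < ?n" for i using e that B(3) by (auto dest: bij_betwE)
  have S: "cvec.subspace S"
    by (rule cvec.subspaceI) (auto simp: S_def scaleC_fun_def)
  have f: "linear_map S (ucarrier U) f"
    unfolding linear_map_def f_def using eU
    by (auto simp: scaleC_add_left sum.distrib cvec.scale_sum_right scaleC_scaleC scaleC_fun_def scaleC_complex_def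
        intro!: cvec.subspace_sum[OF subU] cvec.subspace_scale[OF subU])
  have f_B: "f x = (\<Sum>b\<in>B. x (the_inv_into {..<?n} e b) *\<^sub>C b)" for x
    unfolding f_def using e
    by (subst sum.reindex_bij_betw[OF e, symmetric]) (auto simp: the_inv_into_f_f bij_betw_def)
  have "bij_betw f S (ucarrier U)"
    unfolding bij_betw_def
  proof
    show "inj_on f S"
    proof (rule linear_map_inj[OF f S])
      fix x assume x: "x \<in> S" "f x = 0"
      have "x i = 0" if "i < ?n" for i
      proof -
        have "x (the_inv_into {..<?n} e (e i)) = 0"
          using x(2) B(1,2) e that unfolding f_B
          by (intro independent_sum_eq_zero[of B "\<lambda>b. x (the_inv_into {..<?n} e b)"])
             (auto simp: is_basis_def dest: bij_betwE)
        then show ?thesis using e that by (simp add: the_inv_into_f_f bij_betw_def)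
      qed
      then show "x = 0" using x(1) by (auto simp: S_def fun_eq_iff) (metis not_le)
    qed
    show "f ` S = ucarrier U"
    proof
      show "f ` S \<subseteq> ucarrier U" using linear_map_mem[OF f] by auto
      show "ucarrier U \<subseteq> f ` S"
      proof
        fix u assume u: "u \<in> ucarrier U"
        define x where "x i = (if i < ?n then cvec.representation B u (e i) else 0)" for i
        have "f x = (\<Sum>i<?n. cvec.representation B u (e i) *\<^sub>C e i)"
          unfolding f_def by (intro sum.cong) (auto simp: x_def)
        also have "\<dots> = (\<Sum>b\<in>B. cvec.representation B u b *\<^sub>C b)"
          using sum.reindex_bij_betw[OF e] .
        also have "\<dots> = u" using is_basis_sum_representation[OF B(2,1) u] .
        finally have "f x = u" .
        moreover have "x \<in> S" by (simp add: S_def x_def)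
        ultimately show "u \<in> f ` S" by blast
      qed
    qed
  qed
  note bij = this
  define h where "h = the_inv_into S f"
  have h: "linear_map (ucarrier U) S h" unfolding h_def using f S bij by (rule linear_map_inverse)
  have hf: "h (f x) = x" if "x \<in> S" for x
    using that bij by (simp add: h_def the_inv_into_f_f bij_betw_def)
  have fh: "f (h u) = u" if "u \<in> ucarrier U" for u
    using that bij by (simp add: h_def f_the_inv_into_f bij_betw_def)
  define U' where "U' = \<lparr>ucarrier = S, uact = (\<lambda>d x. h (uact U d (f x)))\<rparr>"
  have mod: "alg_module D U'"
    unfolding alg_module_def U'_def amodule.simps
  proof (intro conjI ballI)
    show "cvec.subspace S" by (rule S)
    show "linear_map S S (\<lambda>x. h (uact U d (f x)))" if "d \<in> acarrier D" for d
      using linear_map_comp[OF linear_map_comp[OF f alg_moduleD(2)[OF U that]] h] .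
    show "linear_map (acarrier D) S (\<lambda>d. h (uact U d (f x)))" if "x \<in> S" for x
      using linear_map_comp[OF alg_moduleD(3)[OF U linear_map_mem[OF f that]] h] .
    show "h (uact U (amult D a b) (f x)) = h (uact U a (f (h (uact U b (f x)))))"
      if "a \<in> acarrier D" "b \<in> acarrier D" "x \<in> S" for a b x
      using that linear_map_mem[OF f that(3)] alg_moduleD(4)[OF U] act_mem[OF U] fh by simp
    show "h (uact U (aunit D) (f x)) = x" if "x \<in> S" for x
      using alg_moduleD(5)[OF U linear_map_mem[OF f that]] hf[OF that] by simp
  qed
  have comm: "f (uact U' d x) = uact U d (f x)" if "d \<in> acarrier D" "x \<in> S" for d x
    using fh[OF act_mem[OF U that(1) linear_map_mem[OF f that(2)]]] by (simp add: U'_def)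
  have "simple_alg_module D U'"
    unfolding simple_alg_module_def
  proof (intro conjI allI impI)
    show "alg_module D U'" by fact
    show "ucarrier U' \<noteq> {0}"
    proof
      assume "ucarrier U' = {0}"
      then have "f ` S = {0}" using linear_map_zero[OF f S] by (simp add: U'_def)
      then show False using bij ne by (simp add: bij_betw_def)
    qed
    fix W assume W: "cvec.subspace W \<and> W \<subseteq> ucarrier U' \<and> (\<forall>a\<in>acarrier D. \<forall>w\<in>W. uact U' a w \<in> W)"
    have WS: "W \<subseteq> S" using W by (simp add: U'_def)
    have fW: "linear_map W (ucarrier U) f"
      using linear_map_mem[OF f] linear_map_add[OF f] linear_map_scale[OF f] WS
      unfolding linear_map_def by blast
    have "f ` W = {0} \<or> f ` W = ucarrier U"
    proof (rule s)
      show "cvec.subspace (f ` W)" using fW W linear_map_subspace_image by blast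
      show "f ` W \<subseteq> ucarrier U" using linear_map_mem[OF fW] by auto
      show "\<forall>a\<in>acarrier D. \<forall>w\<in>f ` W. uact U a w \<in> f ` W"
        using W WS comm by (auto simp: subset_iff simp flip: comm)
    qed
    moreover have inj: "inj_on f S" using bij by (simp add: bij_betw_def)
    moreover have "f ` {0} = {0}" using linear_map_zero[OF f S] by simp
    moreover have "f ` S = ucarrier U" using bij by (simp add: bij_betw_def)
    ultimately have "W = {0} \<or> W = S"
      using inj_on_image_eq_iff[OF inj WS, of "{0}"] inj_on_image_eq_iff[OF inj WS, of S] cvec.subspace_0[OF S] by auto
    then show "W = {0} \<or> W = ucarrier U'" by (simp add: U'_def)
  qed
  moreover have "alg_module_iso D U' U"
    unfolding alg_module_iso_def using bij f comm by (intro exI[of _ f]) (simp add: U'_def)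
  ultimately show ?thesis by blast
qed

text \<open>Matrix coefficients of \<open>U\<close> form an element d of the double. Averaging the
  rank-one map that sends u to l(u) w produces a homomorphism whose value at the chosen
  \<open>u\<close> is d w. As d \<noteq> 0 and \<open>W\<close> is faithful, some w makes this value
  nonzero.\<close>

lemma simple_hom_exists:
  assumes U: "simple_alg_module D U" and W: "alg_module D W"
    and faithful: "\<And>d. d \<in> acarrier D \<Longrightarrow> (\<And>w. w \<in> ucarrier W \<Longrightarrow> uact W d w = 0) \<Longrightarrow> d = 0"
  obtains f u where "linear_map (ucarrier U) (ucarrier W) f" "u \<in> ucarrier U" "f u \<noteq> 0"
    "\<And>d u. d \<in> acarrier D \<Longrightarrow> u \<in> ucarrier U \<Longrightarrow> f (uact U d u) = uact W d (f u)"
proof -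
  have Um: "alg_module D U" and ne: "ucarrier U \<noteq> {0}"
    using U by (auto simp: simple_alg_module_def)
  note subU = alg_moduleD(1)[OF Um] and subW = alg_moduleD(1)[OF W]
  obtain u where u: "u \<in> ucarrier U" "u \<noteq> 0" using ne cvec.subspace_0[OF subU] by blast
  \<comment> \<open>The unit is a combination of the \<open>\<xi> \<one> x\<close>, so one of them
    does not kill \<open>u\<close>; the coefficient of d at (\<one>, x0) will be nonzero.\<close>
  have "\<exists>x\<in>carrier G. uact U (\<xi> \<one> x) u \<noteq> 0"
  proof (rule ccontr)
    assume "\<not> ?thesis"
    then have "u = 0" using act_unit[OF Um u(1)] by simp
    then show False using u by simp
  qed
  then obtain x0 where x0: "x0 \<in> carrier G" "uact U (\<xi> \<one> x0) u \<noteq> 0" by blast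
  obtain l where l: "linear_map UNIV UNIV l" "l (uact U (\<xi> \<one> x0) u) = (1 :: complex)"
    using ex_linear_functional[OF x0(2)] by blast
  define d where "d p = (if p \<in> carrier G \<times> carrier G then
      l (inv_coeff (fst p) (snd p) *\<^sub>C uact U (\<xi> (inv (fst p)) (conj (fst p) (snd p))) u) else 0)" for p
  have dD: "d \<in> acarrier D" by (auto simp: d_def twisted_double_def)
  have "d (\<one>, x0) = inv_coeff \<one> x0"
    using x0 l linear_map_scale[OF l(1)] by (simp add: d_def scaleC_complex_def)
  also have "\<dots> \<noteq> 0" using x0 \<alpha>_nonzero[of x0 \<one> \<one>] by (simp add: inv_coeff_def)
  finally have "d \<noteq> 0" by auto
  then obtain w where w: "w \<in> ucarrier W" "uact W d w \<noteq> 0" using faithful[OF dD] by blast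
  define \<theta> where "\<theta> u = l u *\<^sub>C w" for u
  have \<theta>: "linear_map (ucarrier U) (ucarrier W) \<theta>"
    unfolding linear_map_def \<theta>_def using linear_map_add[OF l(1)] linear_map_scale[OF l(1)] w(1)
    by (auto simp: scaleC_add_left scaleC_complex_def scaleC_scaleC cvec.subspace_scale[OF subW])
  have "average U W \<theta> u = (\<Sum>x\<in>carrier G. \<Sum>a\<in>carrier G. d (a, x) *\<^sub>C uact W (\<xi> a x) w)"
    unfolding average_def
  proof (intro sum.cong refl)
    fix x a assume "x \<in> carrier G" "a \<in> carrier G"
    then show "uact W (\<xi> a x) (\<theta> (inv_coeff a x *\<^sub>C uact U (\<xi> (inv a) (conj a x)) u))
        = d (a, x) *\<^sub>C uact W (\<xi> a x) w"
      using linear_map_scale[OF act_\<xi>_linear[OF W] w(1)] by (simp add: \<theta>_def d_def)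
  qed
  also have "\<dots> = (\<Sum>a\<in>carrier G. \<Sum>x\<in>carrier G. d (a, x) *\<^sub>C uact W (\<xi> a x) w)" by (rule sum.swap)
  also have "\<dots> = uact W d w"
    unfolding act_expand[OF W dD w(1)] sum.cartesian_product by (intro sum.cong) auto
  finally have "average U W \<theta> u \<noteq> 0" using w(2) by simp
  then show ?thesis
    using that[OF average_linear[OF Um W \<theta>] u(1)] homI[OF Um W average_linear[OF Um W \<theta>] average_hom[OF Um W \<theta>]]
    by blast
qed

text \<open>Here the invariant subspace in \<open>jacobson_density\<close> is the orbit of the tuple
  of given vectors under the double; it contains the tuple itself because of the unit.\<close>

lemma D_density:
  fixes U :: "'k \<Rightarrow> ('a \<times> 'a \<Rightarrow> complex, 'u::complex_vector) amodule"
  assumes simple: "\<And>k. k \<in> K \<Longrightarrow> simple_alg_module D (U k)"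
    and noniso: "\<And>k l. k \<in> K \<Longrightarrow> l \<in> K \<Longrightarrow> alg_module_iso D (U k) (U l) \<Longrightarrow> k = l"
    and J: "finite J" "\<And>k b. (k, b) \<in> J \<Longrightarrow> k \<in> K \<and> b \<in> ucarrier (U k)"
      "\<And>k. k \<in> K \<Longrightarrow> cvec.independent {b. (k, b) \<in> J}"
    and t: "\<And>k b. (k, b) \<in> J \<Longrightarrow> t (k, b) \<in> ucarrier (U k)"
  obtains d where "d \<in> acarrier D" "\<And>k b. (k, b) \<in> J \<Longrightarrow> uact (U k) d b = t (k, b)"
proof -
  have mod: "alg_module D (U k)" if "k \<in> K" for k using simple[OF that] by (simp add: simple_alg_module_def)
  define E where "E d = (\<lambda>j. if j \<in> J then uact (U (fst j)) d (snd j) else 0)" for d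
  have Jm: "fst j \<in> K" "snd j \<in> ucarrier (U (fst j))" if "j \<in> J" for j
    using J(2)[of "fst j" "snd j"] that by auto
  have E: "linear_map (acarrier D) UNIV E"
    unfolding linear_map_def
  proof (intro conjI ballI allI)
    fix d d' c assume d: "d \<in> acarrier D" "d' \<in> acarrier D"
    show "E (d + d') = E d + E d'"
    proof
      fix j
      show "E (d + d') j = (E d + E d') j"
        using linear_map_add[OF alg_moduleD(3)[OF mod[OF Jm(1)] Jm(2)] d] by (simp add: E_def)
    qed
    show "E (c *\<^sub>C d) = c *\<^sub>C E d"
    proof
      fix j
      show "E (c *\<^sub>C d) j = (c *\<^sub>C E d) j"
        using linear_map_scale[OF alg_moduleD(3)[OF mod[OF Jm(1)] Jm(2)] d(1)] by (simp add: E_def scaleC_fun_def)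
    qed
  qed auto
  have "(\<lambda>j. if j \<in> J then t j else 0) \<in> E ` acarrier D"
  proof (rule jacobson_density[where S = "\<lambda>k. ucarrier (U k)" and act = "\<lambda>k. uact (U k)" and Op = "acarrier D"
        and K = K and J = J])
    show "cvec.subspace (ucarrier (U k))" if "k \<in> K" for k using alg_moduleD(1)[OF mod[OF that]] .
    show "linear_map (ucarrier (U k)) (ucarrier (U k)) (uact (U k) a)" if "k \<in> K" "a \<in> acarrier D" for k a
      using alg_moduleD(2)[OF mod[OF that(1)] that(2)] .
    show "W = {0} \<or> W = ucarrier (U k)"
      if "k \<in> K" "cvec.subspace W" "W \<subseteq> ucarrier (U k)" "\<forall>a\<in>acarrier D. \<forall>w\<in>W. uact (U k) a w \<in> W" for k W
      using simple[OF that(1)] that unfolding simple_alg_module_def by blast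
    show "\<exists>c. \<forall>w\<in>ucarrier (U k). f w = (if k = l then c *\<^sub>C w else 0)"
      if k: "k \<in> K" and l: "l \<in> K" and f: "linear_map (ucarrier (U k)) (ucarrier (U l)) f"
        and c: "\<forall>a\<in>acarrier D. \<forall>w\<in>ucarrier (U k). f (uact (U k) a w) = uact (U l) a (f w)" for k l f
    proof (cases "k = l")
      case True
      have "\<exists>c. \<forall>x\<in>ucarrier (U k). f x = c *\<^sub>C x"
        using f c True simple_fin_dim[OF simple[OF k]] simple[OF k] linear_map_mem[OF f]
        by (intro simple_action_hom_scalar[OF simple_alg_module_action[OF simple[OF k]],
              where ?S0.0 = "ucarrier (U k)"])
           (auto simp: simple_alg_module_def)
      then show ?thesis using True by simp
    next
      case False
      have "f w = 0" if "w \<in> ucarrier (U k)" for w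
        using simple_alg_module_iso[OF simple[OF k] simple[OF l] f _ that] c noniso[OF k l] False by blast
      then show ?thesis using False by simp
    qed
    show "finite J" by (rule J(1))
    show "k \<in> K \<and> b \<in> ucarrier (U k)" if "(k, b) \<in> J" for k b using J(2)[OF that] .
    show "cvec.independent {b. (k, b) \<in> J}" if "k \<in> K" for k using J(3)[OF that] .
    show "cvec.subspace (E ` acarrier D)" using E D_subspace by (rule linear_map_subspace_image)
    show "r j \<in> ucarrier (U (fst j))" if "r \<in> E ` acarrier D" "j \<in> J" for r j
      using that act_mem[OF mod[OF Jm(1)] _ Jm(2)] by (auto simp: E_def)
    show "r j = 0" if "r \<in> E ` acarrier D" "j \<notin> J" for r j using that by (auto simp: E_def)
    show "(\<lambda>j. if j \<in> J then uact (U (fst j)) a (r j) else 0) \<in> E ` acarrier D"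
      if r: "r \<in> E ` acarrier D" and a: "a \<in> acarrier D" for r a
    proof -
      obtain d where d: "d \<in> acarrier D" "r = E d" using r by blast
      have "(\<lambda>j. if j \<in> J then uact (U (fst j)) a (r j) else 0) = E (amult D a d)"
      proof
        fix j
        show "(if j \<in> J then uact (U (fst j)) a (r j) else 0) = E (amult D a d) j"
          using alg_moduleD(4)[OF mod[OF Jm(1)] a d(1) Jm(2)] d(2) by (simp add: E_def)
      qed
      then show ?thesis using amult_mem by blast
    qed
    have "(\<lambda>j. if j \<in> J then snd j else 0) = E (aunit D)"
    proof
      fix j
      show "(if j \<in> J then snd j else 0) = E (aunit D) j"
        using alg_moduleD(5)[OF mod[OF Jm(1)] Jm(2)] by (simp add: E_def)
    qed
    then show "(\<lambda>j. if j \<in> J then snd j else 0) \<in> E ` acarrier D" using aunit_mem by blast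
    show "(if j \<in> J then t j else 0) \<in> ucarrier (U (fst j))" if "j \<in> J" for j
      using t[of "fst j" "snd j"] that by simp
  qed auto
  then obtain d where d: "d \<in> acarrier D" "(\<lambda>j. if j \<in> J then t j else 0) = E d" by blast
  show ?thesis
  proof
    show "d \<in> acarrier D" by fact
    fix k b assume "(k, b) \<in> J"
    then show "uact (U k) d b = t (k, b)" using fun_cong[OF d(2), of "(k, b)"] by (simp add: E_def)
  qed
qed

text \<open>Takes the place of the central idempotent belonging to \<open>U k0\<close>: density
  prescribes the action on bases of finitely many finite-dimensional modules at once.\<close>

lemma D_separate:
  fixes U :: "'k \<Rightarrow> ('a \<times> 'a \<Rightarrow> complex, 'u::complex_vector) amodule"
  assumes K: "finite K" "k0 \<in> K" and simple: "\<And>k. k \<in> K \<Longrightarrow> simple_alg_module D (U k)"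
    and noniso: "\<And>k l. k \<in> K \<Longrightarrow> l \<in> K \<Longrightarrow> alg_module_iso D (U k) (U l) \<Longrightarrow> k = l"
  obtains d where "d \<in> acarrier D" "\<And>u. u \<in> ucarrier (U k0) \<Longrightarrow> uact (U k0) d u = u"
    "\<And>k u. k \<in> K \<Longrightarrow> k \<noteq> k0 \<Longrightarrow> u \<in> ucarrier (U k) \<Longrightarrow> uact (U k) d u = 0"
proof -
  have "\<exists>B. finite B \<and> is_basis B (ucarrier (U k)) \<and> B \<subseteq> ucarrier (U k)" if "k \<in> K" for k
    using fin_dim_basis[OF simple_fin_dim[OF simple[OF that]]] by metis
  then obtain B where B: "\<And>k. k \<in> K \<Longrightarrow> finite (B k)" "\<And>k. k \<in> K \<Longrightarrow> is_basis (B k) (ucarrier (U k))"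
    "\<And>k. k \<in> K \<Longrightarrow> B k \<subseteq> ucarrier (U k)"
    by metis
  define J where "J = Sigma K B"
  have mod: "alg_module D (U k)" if "k \<in> K" for k using simple[OF that] by (simp add: simple_alg_module_def)
  obtain d where d: "d \<in> acarrier D"
    "\<And>k b. (k, b) \<in> J \<Longrightarrow> uact (U k) d b = (if k = k0 then b else 0)"
  proof (rule D_density[of K U J "\<lambda>(k, b). if k = k0 then b else 0"])
    show "finite J" using K(1) B(1) by (auto simp: J_def)
    show "k \<in> K \<and> b \<in> ucarrier (U k)" if "(k, b) \<in> J" for k b using that B(3) by (auto simp: J_def)
    show "cvec.independent {b. (k, b) \<in> J}" if "k \<in> K" for k
      using B(2)[OF that] that by (simp add: J_def is_basis_def)
    show "(case (k, b) of (k, b) \<Rightarrow> if k = k0 then b else 0) \<in> ucarrier (U k)" if "(k, b) \<in> J" for k b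
      using that B(3) cvec.subspace_0[OF alg_moduleD(1)[OF mod]] by (auto simp: J_def)
  qed (use simple noniso that in auto)
  have ext: "uact (U k) d u = (if k = k0 then u else 0)" if "k \<in> K" "u \<in> ucarrier (U k)" for k u
  proof -
    let ?r = "cvec.representation (B k) u"
    have u: "(\<Sum>b\<in>B k. ?r b *\<^sub>C b) = u"
      using is_basis_sum_representation[OF B(2,1)] that by blast
    have "uact (U k) d (\<Sum>b\<in>B k. ?r b *\<^sub>C b) = (\<Sum>b\<in>B k. ?r b *\<^sub>C uact (U k) d b)"
      using B(3)[OF that(1)]
      by (intro linear_map_lincomb[OF alg_moduleD(2)[OF mod[OF that(1)] d(1)] alg_moduleD(1)[OF mod[OF that(1)]]]) auto
    also have "\<dots> = (\<Sum>b\<in>B k. ?r b *\<^sub>C (if k = k0 then b else 0))"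
      using d(2) that by (intro sum.cong) (auto simp: J_def)
    also have "\<dots> = (if k = k0 then u else 0)" using u by auto
    finally show ?thesis using u by simp
  qed
  show ?thesis using that[OF d(1)] ext K(2) by auto
qed

text \<open>For non-isomorphic modules some element acts as 1 on one and as 0 on the other; its
  traces are the dimension and 0.\<close>

lemma alg_character_eq_imp_iso:
  fixes U W :: "('a \<times> 'a \<Rightarrow> complex, 'u::complex_vector) amodule"
  assumes U: "simple_alg_module D U" and W: "simple_alg_module D W"
    and eq: "alg_character D U = alg_character D W"
  shows "alg_module_iso D U W"
proof (rule ccontr)
  assume n: "\<not> alg_module_iso D U W"
  have mods: "alg_module D U" "alg_module D W" using U W by (auto simp: simple_alg_module_def)
  have n': "\<not> alg_module_iso D W U" using n alg_module_iso_sym[OF mods(2,1)] by blast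
  obtain d where d: "d \<in> acarrier D" "\<And>u. u \<in> ucarrier U \<Longrightarrow> uact U d u = u"
    "\<And>u. u \<in> ucarrier W \<Longrightarrow> uact W d u = 0"
  proof (rule D_separate[of "{True, False}" True "\<lambda>k. if k then U else W"])
    show "k = l" if "alg_module_iso D (if k then U else W) (if l then U else W)" for k l
      using that n n' by (cases k; cases l) auto
  qed (use U W in \<open>auto split: if_splits\<close>)
  have "trace_on (ucarrier U) (uact U d) = trace_on (ucarrier W) (uact W d)"
    using fun_cong[OF eq, of d] d(1) by (simp add: alg_character_def)
  then show False
    using trace_on_zero_map[OF simple_fin_dim[OF W] d(3)]
      trace_on_id_map[OF simple_fin_dim[OF U] _ d(2)] U by (simp add: simple_alg_module_def)
qed

lemma iso_imp_alg_character_eq: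
  assumes U: "simple_alg_module D U" and W: "simple_alg_module D W" and iso: "alg_module_iso D U W"
  shows "alg_character D U = alg_character D W"
proof -
  have mods: "alg_module D U" "alg_module D W" using U W by (auto simp: simple_alg_module_def)
  obtain f where f: "bij_betw f (ucarrier U) (ucarrier W)" "linear_map (ucarrier U) (ucarrier W) f"
    "\<And>a u. a \<in> acarrier D \<Longrightarrow> u \<in> ucarrier U \<Longrightarrow> f (uact U a u) = uact W a (f u)"
    using iso unfolding alg_module_iso_def by blast
  show ?thesis
    unfolding alg_character_def
  proof (rule restrict_ext)
    fix d assume "d \<in> acarrier D"
    then show "trace_on (ucarrier U) (uact U d) = trace_on (ucarrier W) (uact W d)"
      using f mods simple_fin_dim[OF U] by (intro trace_on_iso[of _ _ f] alg_moduleD(2)) auto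
  qed
qed

end

section \<open>Products of modes as combinations of modes\<close>

text \<open>The binomials (x choose a) with a < A span the polynomials of degree below A, so this is
  Lagrange interpolation in the binomial basis. A node \<open>y\<close> is added through the factor
  (x - y) / (x0 - y).\<close>

lemma gbinomial_interpolation:
  fixes S :: "complex set"
  assumes "finite S" "x0 \<notin> S"
  shows "\<exists>A \<kappa>. (\<Sum>a<A. \<kappa> a * (x0 gchoose a)) = 1 \<and> (\<forall>x\<in>S. (\<Sum>a<A. \<kappa> a * (x gchoose a)) = 0)"
  using assms
proof (induction S rule: finite_induct)
  case empty
  show ?case by (intro exI[of _ 1] exI[of _ "\<lambda>_. 1"]) simp
next
  case (insert y S)
  then obtain A \<kappa> where k: "(\<Sum>a<A. \<kappa> a * (x0 gchoose a)) = 1"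
    "\<And>x. x \<in> S \<Longrightarrow> (\<Sum>a<A. \<kappa> a * (x gchoose a)) = 0" by auto
  define c where "c = inverse (x0 - y)"
  have c: "c * (x0 - y) = 1" using insert.prems by (simp add: c_def)
  \<comment> \<open>Read off from x (x choose a) = a (x choose a) + (a+1) (x choose a+1), after
    collecting the terms of equal index.\<close>
  define \<kappa>' where "\<kappa>' a = c * ((if a < A then \<kappa> a * (of_nat a - y) else 0) + (if a > 0 then \<kappa> (a - 1) * of_nat a else 0))" for a
  have "(\<Sum>a<Suc A. \<kappa>' a * (x gchoose a)) = c * (x - y) * (\<Sum>a<A. \<kappa> a * (x gchoose a))" for x
  proof -
    have "c * (x - y) * (\<Sum>a<A. \<kappa> a * (x gchoose a))
        = (\<Sum>a<A. c * \<kappa> a * (x * (x gchoose a) - y * (x gchoose a)))"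
      by (simp add: sum_distrib_left algebra_simps)
    also have "\<dots> = (\<Sum>a<A. c * \<kappa> a * (of_nat a - y) * (x gchoose a)) + (\<Sum>a<A. c * \<kappa> a * of_nat (Suc a) * (x gchoose Suc a))"
      unfolding sum.distrib[symmetric] gbinomial_mult_1 by (intro sum.cong) (auto simp: algebra_simps)
    also have "(\<Sum>a<A. c * \<kappa> a * (of_nat a - y) * (x gchoose a))
        = (\<Sum>a<Suc A. c * (if a < A then \<kappa> a * (of_nat a - y) else 0) * (x gchoose a))"
      by (simp add: mult.assoc)
    also have "(\<Sum>a<A. c * \<kappa> a * of_nat (Suc a) * (x gchoose Suc a))
        = (\<Sum>a<Suc A. c * (if a > 0 then \<kappa> (a - 1) * of_nat a else 0) * (x gchoose a))"
      by (subst sum.lessThan_Suc_shift) (simp add: mult.assoc)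
    finally show ?thesis
      unfolding \<kappa>'_def by (simp only: sum.distrib[symmetric] distrib_left distrib_right)
  qed
  then show ?case using k c by (intro exI[of _ "Suc A"] exI[of _ \<kappa>']) (auto simp del: sum.lessThan_Suc)
qed

context twisted_mod
begin

lemma cross_off:
  assumes "u \<in> vcarrier V" "v \<in> vcarrier V" "w \<in> mcarrier M" "of_nat N * m \<notin> \<int>"
  shows "cross K u v w m n = 0"
  unfolding cross_def
proof (intro sum.neutral ballI)
  fix j
  have "of_nat N * (m + of_nat K - of_nat j) = of_nat N * m + (of_int (int N * (int K - int j)) :: rat)"
    by (simp add: algebra_simps)
  then have "of_nat N * (m + of_nat K - of_nat j) \<notin> \<int>"
    using Ints_add_iff[of "of_int (int N * (int K - int j))" "of_nat N * m"] assms(4) by simp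
  then show "((-1) ^ j * (of_nat K gchoose j)) *\<^sub>C
      mY M u (m + of_nat K - of_nat j) (mY M v (n + of_nat j) w) = 0"
    using Y_off[OF assms(1) Y_mem[OF assms(2,3)]] by simp
qed

text \<open>The term j = 0 of the cross coefficient is the product. All other terms have a larger
  index on \<open>v\<close>, so the recursion ends by truncation.\<close>

lemma product_eq_cross:
  "mY M u p (mY M v q w) = cross K u v w (p - of_nat K) q -
     (\<Sum>j\<in>{1..K}. ((-1) ^ j * (of_nat K gchoose j)) *\<^sub>C mY M u (p - of_nat j) (mY M v (q + of_nat j) w))"
proof -
  have "cross K u v w (p - of_nat K) q
      = (\<Sum>j\<in>insert 0 {1..K}. ((-1) ^ j * (of_nat K gchoose j)) *\<^sub>C mY M u (p - of_nat j) (mY M v (q + of_nat j) w))"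
    unfolding cross_def by (intro sum.cong) auto
  then show ?thesis by (simp add: scaleC_one)
qed

end

text \<open>On finitely many vectors, possibly from modules with different twists, a product of two modes
  is one linear combination of modes. The modes \<open>(u_l v)_s w\<close>, summed over \<open>l\<close> with binomial weights, are
  the coefficients of the Laurent polynomial \<open>(z\<^sub>1 - z\<^sub>2)^K Y(u,z\<^sub>1) Y(v,z\<^sub>2) w\<close> in fractional powers of
  \<open>z\<^sub>1\<close> expanded at \<open>z\<^sub>1 = z\<^sub>2\<close>, so interpolation recovers its coefficients in the same way for all twists.\<close>

lemma product_via_iterates:
  fixes V :: "'v::complex_vector voa" and M :: "'i \<Rightarrow> ('v, 'm::complex_vector) vmodule"
  assumes I: "finite I" and tm: "\<And>i. i \<in> I \<Longrightarrow> twisted_mod V (g i) (M i)"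
    and u: "u \<in> vcarrier V" and v: "v \<in> vcarrier V" and w: "\<And>i. i \<in> I \<Longrightarrow> w i \<in> mcarrier (M i)"
  shows "\<exists>F c. finite F \<and> (\<forall>i\<in>I. mY (M i) u p (mY (M i) v q (w i))
      = (\<Sum>z\<in>F. c z *\<^sub>C mY (M i) (vY V u (fst z) v) (snd z) (w i)))"
proof -
  define N where "N i = twisted_mod.N V (g i)" for i
  have "\<forall>i\<in>I. \<exists>K. \<forall>j l. l \<ge> int K \<longrightarrow> vY V ((g i ^^ j) u) l v = 0"
    using twisted_mod.ex_locality_bound[OF tm u v] by blast
  then obtain K0 where K0: "\<And>i j l. i \<in> I \<Longrightarrow> l \<ge> int (K0 i) \<Longrightarrow> vY V ((g i ^^ j) u) l v = 0" by metis
  define K where "K = (\<Sum>i\<in>I. K0 i)"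
  have K: "vY V ((g i ^^ j) u) l v = 0" if "i \<in> I" "l \<ge> int K" for i j l
  proof -
    have "K0 i \<le> K" unfolding K_def using I that by (intro member_le_sum) auto
    then show ?thesis using K0 that by simp
  qed
  \<comment> \<open>A common denominator for the mode indices in all the modules involved.\<close>
  define T where "T = (\<Prod>i\<in>I. N i)"
  have T: "T > 0" unfolding T_def N_def using twisted_mod.N_pos[OF tm] by (intro prod_pos) auto
  have NT: "N i dvd T" if "i \<in> I" for i unfolding T_def using I that by (intro dvd_prodI)
  have "\<forall>i\<in>I. \<exists>n0. \<forall>n\<ge>n0. mY (M i) x n (w i) = 0" if "x \<in> vcarrier V" for x
    using twisted_mod.Y_trunc[OF tm that w] by blast
  then obtain b where b: "\<And>x i n. x \<in> vcarrier V \<Longrightarrow> i \<in> I \<Longrightarrow> n \<ge> b x i \<Longrightarrow> mY (M i) x n (w i) = 0"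
    by metis
  define hi n0 where "hi = Max (insert 0 (b u ` I))" and "n0 = Max (insert 0 (b v ` I))"
  have hi: "mY (M i) u n (w i) = 0" if "i \<in> I" "n \<ge> hi" for i n
  proof (rule b[OF u that(1)])
    have "b u i \<le> hi" unfolding hi_def using I that by (intro Max_ge) auto
    then show "b u i \<le> n" using that by simp
  qed
  have n0: "mY (M i) v n (w i) = 0" if "i \<in> I" "n \<ge> n0" for i n
  proof (rule b[OF v that(1)])
    have "b v i \<le> n0" unfolding n0_def using I that by (intro Max_ge) auto
    then show "b v i \<le> n" using that by simp
  qed
  define X where "X z i = mY (M i) (vY V u (fst z) v) (snd z) (w i)" for z :: "int \<times> rat" and i
  \<comment> \<open>The point is the order of quantifiers: \<open>F\<close> and \<open>c\<close> are
    chosen before the module index i.\<close>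
  define good where "good E \<longleftrightarrow> (\<exists>F c. finite F \<and> (\<forall>i\<in>I. E i = (\<Sum>z\<in>F. c z *\<^sub>C X z i)))" for E :: "'i \<Rightarrow> 'm"
  have good_0: "good E" if "\<And>i. i \<in> I \<Longrightarrow> E i = 0" for E
    unfolding good_def using that by (intro exI[of _ "{}"]) auto
  have good_X: "good (X z)" for z
    unfolding good_def by (intro exI[of _ "{z}"] exI[of _ "\<lambda>_. 1"]) (simp add: scaleC_one)
  have good_cong: "good E" if "good E'" "\<And>i. i \<in> I \<Longrightarrow> E i = E' i" for E E'
    using that unfolding good_def by auto
  have good_add: "good (\<lambda>i. E i + E' i)" if g: "good E" "good E'" for E E'
  proof -
    obtain F c where F: "finite F" "\<And>i. i \<in> I \<Longrightarrow> E i = (\<Sum>z\<in>F. c z *\<^sub>C X z i)"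
      using g(1) unfolding good_def by blast
    obtain F' c' where F': "finite F'" "\<And>i. i \<in> I \<Longrightarrow> E' i = (\<Sum>z\<in>F'. c' z *\<^sub>C X z i)"
      using g(2) unfolding good_def by blast
    have "E i + E' i = (\<Sum>z\<in>F \<union> F'. ((if z \<in> F then c z else 0) + (if z \<in> F' then c' z else 0)) *\<^sub>C X z i)"
      if "i \<in> I" for i
    proof -
      have "E i = (\<Sum>z\<in>F \<union> F'. (if z \<in> F then c z else 0) *\<^sub>C X z i)"
        unfolding F(2)[OF that] using F(1) F'(1) by (intro sum.mono_neutral_cong_left) auto
      moreover have "E' i = (\<Sum>z\<in>F \<union> F'. (if z \<in> F' then c' z else 0) *\<^sub>C X z i)"
        unfolding F'(2)[OF that] using F(1) F'(1) by (intro sum.mono_neutral_cong_left) auto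
      ultimately show ?thesis by (simp add: scaleC_add_left sum.distrib)
    qed
    then show ?thesis unfolding good_def using F(1) F'(1) by (meson finite_UnI)
  qed
  have good_scale: "good (\<lambda>i. d *\<^sub>C E i)" if g: "good E" for d E
  proof -
    obtain F c where F: "finite F" "\<And>i. i \<in> I \<Longrightarrow> E i = (\<Sum>z\<in>F. c z *\<^sub>C X z i)"
      using g unfolding good_def by blast
    have "d *\<^sub>C E i = (\<Sum>z\<in>F. (d * c z) *\<^sub>C X z i)" if "i \<in> I" for i
      unfolding F(2)[OF that] by (simp add: cvec.scale_sum_right scaleC_scaleC)
    then show ?thesis unfolding good_def using F(1)
      by (intro exI[of _ F] exI[of _ "\<lambda>z. d * c z"]) blast
  qed
  have good_sum: "good (\<lambda>i. \<Sum>j\<in>J. E j i)" if "\<And>j. j \<in> J \<Longrightarrow> good (E j)" for J :: "nat set" and E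
    using that by (induction J rule: infinite_finite_induct) (auto intro: good_0 good_add)
  have good_cross: "good (\<lambda>i. twisted_mod.cross (M i) K u v (w i) m n)" for m n
  proof (cases "of_nat T * m \<in> \<int>")
    case False
    have "of_nat (N i) * m \<notin> \<int>" if i: "i \<in> I" for i
    proof
      assume a: "of_nat (N i) * m \<in> \<int>"
      obtain d where d: "T = N i * d" using NT[OF i] by (elim dvdE)
      have "of_nat T * m = of_nat d * (of_nat (N i) * m)" using d by simp
      then show False using False a by (metis Ints_mult Ints_of_nat)
    qed
    then show ?thesis
      using twisted_mod.cross_off[OF tm u v w] by (intro good_0) (simp add: N_def)
  next
    case True
    \<comment> \<open>The bounds are widened so that m itself belongs to the window; the
      interpolation below has to single it out.\<close>
    define lo where "lo = min m (m + n - n0)"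
    define hi' where "hi' = max hi (m + 1)"
    define W where "W = fraction_window T lo hi'"
    have W: "finite W" "m \<in> W"
      using finite_fraction_window[OF T] True by (auto simp: W_def fraction_window_def lo_def hi'_def)
    define q where "q p = (of_rat (- p - 1) :: complex)" for p
    have q: "q p = q p' \<longleftrightarrow> p = p'" for p p' by (simp add: q_def)
    obtain A \<kappa> where k: "(\<Sum>a<A. \<kappa> a * (q m gchoose a)) = 1"
      "\<And>x. x \<in> q ` (W - {m}) \<Longrightarrow> (\<Sum>a<A. \<kappa> a * (x gchoose a)) = 0"
    proof -
      have "finite (q ` (W - {m}))" "q m \<notin> q ` (W - {m})" using W q by auto
      then show ?thesis using gbinomial_interpolation[of "q ` (W - {m})" "q m"] that by blast
    qed
    show ?thesis
    proof (rule good_cong)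
      \<comment> \<open>The outer index m + n + 1 + a is chosen so that, for every a, the iterate
        expands in cross coefficients with the same sum of indices m + n. The weights \<kappa> then
        keep only p = m.\<close>
      show "good (\<lambda>i. \<Sum>a\<in>{..<A}. \<kappa> a *\<^sub>C X (int K - 1 - int a, m + n + 1 + of_nat a) i)"
        by (intro good_sum good_scale good_X)
      fix i assume i: "i \<in> I"
      have Xa: "X (int K - 1 - int a, m + n + 1 + of_nat a) i
          = (\<Sum>p\<in>W. (q p gchoose a) *\<^sub>C twisted_mod.cross (M i) K u v (w i) p (m + n - p))" for a
      proof -
        have "mY (M i) (vY V u (int K - 1 - int a) v) (m + n + 1 + of_nat a) (w i) =
            (\<Sum>p\<in>fraction_window T lo hi'. (of_rat (- p - 1) gchoose a) *\<^sub>C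
               twisted_mod.cross (M i) K u v (w i) p (m + n + 1 + of_nat a - 1 - of_nat a - p))"
          by (rule twisted_mod.iterate_via_cross[OF tm[OF i] u v w[OF i], where hi = hi' and ?n0.0 = n0])
             (use K[OF i] hi[OF i] n0[OF i] NT[OF i] T in \<open>auto simp: N_def lo_def hi'_def\<close>)
        then show ?thesis by (simp add: X_def W_def q_def)
      qed
      have "(\<Sum>a<A. \<kappa> a *\<^sub>C X (int K - 1 - int a, m + n + 1 + of_nat a) i)
          = (\<Sum>p\<in>W. (\<Sum>a<A. \<kappa> a * (q p gchoose a)) *\<^sub>C twisted_mod.cross (M i) K u v (w i) p (m + n - p))"
        unfolding Xa cvec.scale_sum_right cvec.scale_sum_left scaleC_scaleC by (rule sum.swap)
      also have "\<dots> = (\<Sum>p\<in>{m}. twisted_mod.cross (M i) K u v (w i) p (m + n - p))"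
        using W k by (intro sum.mono_neutral_cong_right) (auto simp: scaleC_one)
      finally show "twisted_mod.cross (M i) K u v (w i) m n
          = (\<Sum>a\<in>{..<A}. \<kappa> a *\<^sub>C X (int K - 1 - int a, m + n + 1 + of_nat a) i)" by simp
    qed
  qed
  have "good (\<lambda>i. mY (M i) u p (mY (M i) v q (w i)))"
  \<comment> \<open>Each use of \<open>product_eq_cross\<close> raises q by at least 1, and from
    \<open>n0\<close> on the product vanishes for all i at once.\<close>
  proof (induction "nat \<lceil>n0 - q\<rceil>" arbitrary: p q rule: less_induct)
    case less
    show ?case
    proof (cases "q \<ge> n0")
      case True
      then show ?thesis using n0 twisted_mod.Y_zero[OF tm u] by (intro good_0) simp
    next
      case False
      have IH: "good (\<lambda>i. mY (M i) u (p - of_nat j) (mY (M i) v (q + of_nat j) (w i)))" if "j \<ge> 1" for j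
      proof (rule less.hyps)
        have "n0 - (q + of_nat j) \<le> n0 - q - 1" using that by simp
        then have "\<lceil>n0 - (q + of_nat j)\<rceil> \<le> \<lceil>n0 - q\<rceil> - 1" by (simp add: ceiling_mono flip: ceiling_diff_one)
        moreover have "0 < \<lceil>n0 - q\<rceil>" using False by simp
        ultimately show "nat \<lceil>n0 - (q + of_nat j)\<rceil> < nat \<lceil>n0 - q\<rceil>" by linarith
      qed
      show ?thesis
      proof (rule good_cong)
        show "good (\<lambda>i. twisted_mod.cross (M i) K u v (w i) (p - of_nat K) q +
           (-1) *\<^sub>C (\<Sum>j\<in>{1..K}. ((-1) ^ j * (of_nat K gchoose j)) *\<^sub>C
              mY (M i) u (p - of_nat j) (mY (M i) v (q + of_nat j) (w i))))"
          by (intro good_add good_cross good_scale good_sum IH) auto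
        show "mY (M i) u p (mY (M i) v q (w i)) = twisted_mod.cross (M i) K u v (w i) (p - of_nat K) q +
           (-1) *\<^sub>C (\<Sum>j\<in>{1..K}. ((-1) ^ j * (of_nat K gchoose j)) *\<^sub>C
              mY (M i) u (p - of_nat j) (mY (M i) v (q + of_nat j) (w i)))" if "i \<in> I" for i
          using twisted_mod.product_eq_cross[OF tm[OF that], of u p v q "w i" K] by simp
      qed
    qed
  qed
  then show ?thesis unfolding good_def X_def .
qed

text \<open>The mode of \<open>v\<close> acts inside, on the vectors \<open>w i\<close>. Tuples
  annihilated by a fixed family of modes are therefore stable under the action of \<open>V\<close>,
  which is what \<open>jacobson_density\<close> needs in \<open>modes_independent\<close>.\<close>

lemma sum_modes_zero_closed:
  fixes V :: "'v::complex_vector voa" and w :: "'i \<Rightarrow> 'm::complex_vector"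
  assumes tm: "twisted_mod V g M" and I: "finite I" and u: "\<And>i. i \<in> I \<Longrightarrow> u i \<in> vcarrier V"
    and w: "\<And>i. i \<in> I \<Longrightarrow> w i \<in> mcarrier M" and v: "v \<in> vcarrier V"
    and zero: "\<And>s. (\<Sum>i\<in>I. mY M (u i) s (w i)) = 0"
  shows "(\<Sum>i\<in>I. mY M (u i) p (mY M v q (w i))) = 0"
proof -
  interpret twisted_mod V g M by (rule tm)
  have "\<forall>i\<in>I. \<exists>K. \<forall>j l. l \<ge> int K \<longrightarrow> vY V ((g ^^ j) (u i)) l v = 0"
    using ex_locality_bound[OF u v] by blast
  then obtain K0 where K0: "\<And>i j l. i \<in> I \<Longrightarrow> l \<ge> int (K0 i) \<Longrightarrow> vY V ((g ^^ j) (u i)) l v = 0" by metis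
  define K where "K = (\<Sum>i\<in>I. K0 i)"
  have K: "vY V ((g ^^ j) (u i)) l v = 0" if "i \<in> I" "l \<ge> int K" for i j l
  proof -
    have "K0 i \<le> K" unfolding K_def using I that by (intro member_le_sum) auto
    then show ?thesis using K0 that by simp
  qed
  have "\<forall>i\<in>I. \<exists>n0. \<forall>n\<ge>n0. mY M v n (w i) = 0" using Y_trunc[OF v w] by blast
  then obtain b where b: "\<And>i n. i \<in> I \<Longrightarrow> n \<ge> b i \<Longrightarrow> mY M v n (w i) = 0" by metis
  define n0 where "n0 = Max (insert 0 (b ` I))"
  have n0: "mY M v n (w i) = 0" if "i \<in> I" "n \<ge> n0" for i n
  proof (rule b[OF that(1)])
    have "b i \<le> n0" unfolding n0_def using I that by (intro Max_ge) auto
    then show "b i \<le> n" using that by simp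
  qed
  \<comment> \<open>By weak commutativity \<open>u i\<close> can be moved to the right, where \<open>zero\<close> applies.\<close>
  have cross0: "(\<Sum>i\<in>I. cross K (u i) v (w i) m n) = 0" for m n
  proof -
    have "(\<Sum>i\<in>I. cross K (u i) v (w i) m n) = (\<Sum>i\<in>I. \<Sum>j\<le>K. ((-1) ^ j * (of_nat K gchoose j) * (-1) ^ K) *\<^sub>C
       mY M v (n + of_nat K - of_nat j) (mY M (u i) (m + of_nat j) (w i)))"
      using K by (intro sum.cong refl cross_commute u v w) auto
    also have "\<dots> = (\<Sum>j\<le>K. ((-1) ^ j * (of_nat K gchoose j) * (-1) ^ K) *\<^sub>C
       (\<Sum>i\<in>I. mY M v (n + of_nat K - of_nat j) (mY M (u i) (m + of_nat j) (w i))))"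
      unfolding cvec.scale_sum_right by (rule sum.swap)
    also have "\<dots> = 0"
    proof (intro sum.neutral ballI)
      fix j
      have "(\<Sum>i\<in>I. mY M v (n + of_nat K - of_nat j) (mY M (u i) (m + of_nat j) (w i)))
          = mY M v (n + of_nat K - of_nat j) (\<Sum>i\<in>I. mY M (u i) (m + of_nat j) (w i))"
        by (intro linear_map_sum[OF Y_linear[OF v] M_subspace, symmetric] Y_mem u w)
      then show "((-1) ^ j * (of_nat K gchoose j) * (-1) ^ K) *\<^sub>C
       (\<Sum>i\<in>I. mY M v (n + of_nat K - of_nat j) (mY M (u i) (m + of_nat j) (w i))) = 0"
        using zero Y_zero[OF v] by simp
    qed
    finally show ?thesis .
  qed
  show ?thesis
  proof (induction "nat \<lceil>n0 - q\<rceil>" arbitrary: p q rule: less_induct)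
    case less
    show ?case
    proof (cases "q \<ge> n0")
      case True
      then show ?thesis using n0 Y_zero[OF u] by (intro sum.neutral) auto
    next
      case False
      have IH: "(\<Sum>i\<in>I. mY M (u i) (p - of_nat j) (mY M v (q + of_nat j) (w i))) = 0" if "j \<ge> 1" for j
      proof (rule less.hyps)
        have "n0 - (q + of_nat j) \<le> n0 - q - 1" using that by simp
        then have "\<lceil>n0 - (q + of_nat j)\<rceil> \<le> \<lceil>n0 - q\<rceil> - 1" by (simp add: ceiling_mono flip: ceiling_diff_one)
        moreover have "0 < \<lceil>n0 - q\<rceil>" using False by simp
        ultimately show "nat \<lceil>n0 - (q + of_nat j)\<rceil> < nat \<lceil>n0 - q\<rceil>" by linarith
      qed
      have "(\<Sum>i\<in>I. mY M (u i) p (mY M v q (w i))) = (\<Sum>i\<in>I. cross K (u i) v (w i) (p - of_nat K) q) -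
          (\<Sum>i\<in>I. \<Sum>j\<in>{1..K}. ((-1) ^ j * (of_nat K gchoose j)) *\<^sub>C mY M (u i) (p - of_nat j) (mY M v (q + of_nat j) (w i)))"
        unfolding sum_subtractf[symmetric] by (intro sum.cong refl product_eq_cross)
      also have "(\<Sum>i\<in>I. \<Sum>j\<in>{1..K}. ((-1) ^ j * (of_nat K gchoose j)) *\<^sub>C mY M (u i) (p - of_nat j) (mY M v (q + of_nat j) (w i)))
          = (\<Sum>j\<in>{1..K}. ((-1) ^ j * (of_nat K gchoose j)) *\<^sub>C (\<Sum>i\<in>I. mY M (u i) (p - of_nat j) (mY M v (q + of_nat j) (w i))))"
        unfolding cvec.scale_sum_right by (rule sum.swap)
      also have "\<dots> = 0" using IH by (intro sum.neutral) auto
      finally show ?thesis using cross0 by simp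
    qed
  qed
qed

section \<open>Annihilators, and recovering the twist from a module\<close>

lemma simple_voaD:
  assumes "simple_voa V"
  shows "is_voa V" "\<And>I. cvec.subspace I \<Longrightarrow> I \<subseteq> vcarrier V \<Longrightarrow>
     (\<And>u n x. u \<in> vcarrier V \<Longrightarrow> x \<in> I \<Longrightarrow> vY V u n x \<in> I) \<Longrightarrow> I = {0} \<or> I = vcarrier V"
  using assms unfolding simple_voa_def by blast+

text \<open>By \<open>annihilator_ideal\<close> the annihilator of the module is stable under all
  modes of \<open>V\<close>, so it is zero or everything. The vacuum acts as the identity on a
  nonzero module, which excludes the latter.\<close>

lemma annihilator_zero:
  assumes V: "simple_voa V" and tm: "twisted_mod V g M" and ne: "mcarrier M \<noteq> {0}"
    and x: "x \<in> vcarrier V" "\<And>n w. w \<in> mcarrier M \<Longrightarrow> mY M x n w = 0"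
  shows "x = 0"
proof -
  interpret twisted_mod V g M by (rule tm)
  define I where "I = {x \<in> vcarrier V. \<forall>n. \<forall>w\<in>mcarrier M. mY M x n w = 0}"
  have "I = {0} \<or> I = vcarrier V"
  proof (rule simple_voaD(2)[OF V])
    show "cvec.subspace I"
      by (rule cvec.subspaceI)
         (auto simp: I_def cvec.subspace_0[OF V_subspace] cvec.subspace_add[OF V_subspace]
           cvec.subspace_scale[OF V_subspace] Y_zero_left linear_map_add[OF Y_linear_left]
           linear_map_scale[OF Y_linear_left])
    show "vY V u n x \<in> I" if "u \<in> vcarrier V" "x \<in> I" for u n x
      using that annihilator_ideal[OF that(1)] vY_mem[OF that(1)] by (auto simp: I_def)
  qed (auto simp: I_def)
  moreover have "I \<noteq> vcarrier V"
  proof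
    assume "I = vcarrier V"
    then have "vvac V \<in> I" using is_voaD(5)[OF voa] by simp
    then have "mY M (vvac V) (-1) w = 0" if "w \<in> mcarrier M" for w using that by (auto simp: I_def)
    then have "w = 0" if "w \<in> mcarrier M" for w using that Y_vac[OF that, of "-1"] by simp
    then show False using ne cvec.subspace_0[OF M_subspace] by auto
  qed
  ultimately show ?thesis using x by (auto simp: I_def)
qed

text \<open>The twist can be read from the cosets in which modes are nonzero. If x is an eigenvector
  of \<open>g\<close>, its modes on \<open>M'\<close> live in a single coset; the eigencomponents of
  x under \<open>h\<close> that belong to other cosets act by zero, hence are zero. So x is an
  eigenvector of \<open>h\<close> with the same eigenvalue.\<close>

lemma module_iso_same_twist:
  assumes V: "simple_voa V" and tg: "twisted_mod V g M" and th: "twisted_mod V h M'"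
    and ne: "mcarrier M' \<noteq> {0}" and f: "bij_betw f (mcarrier M) (mcarrier M')"
    "linear_map (mcarrier M) (mcarrier M') f"
    and comm: "\<And>v n w. v \<in> vcarrier V \<Longrightarrow> w \<in> mcarrier M \<Longrightarrow> f (mY M v n w) = mY M' v n (f w)"
    and v: "v \<in> vcarrier V"
  shows "g v = h v"
proof -
  interpret A: twisted_mod V g M by (rule tg)
  interpret B: twisted_mod V h M' by (rule th)
  have main: "g x = h x" if x: "x \<in> aut_eigenspace V g (int j)" for x j
  proof -
    have xV: "x \<in> vcarrier V" using x by (rule A.eigenspace_subset)
    have off: "mY M' x n w' = 0" if w': "w' \<in> mcarrier M'" and "n - of_nat j / of_nat A.N \<notin> \<int>" for n w'
    proof -
      obtain w where w: "w \<in> mcarrier M" "w' = f w" using w' f(1) by (auto simp: bij_betw_def)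
      have "mY M x n w = 0" using A.Y_eigen[OF x _ w(1), of n] that(2) by simp
      then show ?thesis
        using comm[OF xV w(1), of n] w(2) linear_map_zero[OF f(2) A.M_subspace] by simp
    qed
    \<comment> \<open>The modes of this component vanish outside its own coset by definition, and
      inside it because the modes of \<open>x\<close> live in a different one.\<close>
    have zero: "B.eigenpart k x = 0" if k: "k < B.N" "of_nat k / of_nat B.N - of_nat j / of_nat A.N \<notin> (\<int> :: rat set)" for k
    proof (rule annihilator_zero[OF V th ne])
      show "B.eigenpart k x \<in> vcarrier V" using B.eigenpart_mem[OF xV] B.eigenspace_subset by blast
      fix n w' assume w': "w' \<in> mcarrier M'"
      show "mY M' (B.eigenpart k x) n w' = 0"
      proof (cases "n - of_nat k / of_nat B.N \<in> \<int>")
        case True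
        have "n - of_nat j / of_nat A.N \<notin> \<int>"
        proof
          assume "n - of_nat j / of_nat A.N \<in> \<int>"
          then have "(n - of_nat j / of_nat A.N) - (n - of_nat k / of_nat B.N) \<in> \<int>" using True by (rule Ints_diff)
          then show False using k(2) by (simp add: algebra_simps)
        qed
        then show ?thesis using off[OF w'] B.Y_coset[OF xV w' k(1) True] by simp
      qed (use B.Y_eigen[OF B.eigenpart_mem[OF xV] _ w', of n k] in simp)
    qed
    show ?thesis
    proof (cases "x = 0")
      case True
      then show ?thesis using linear_map_zero[OF A.g_linear A.V_subspace] linear_map_zero[OF B.g_linear A.V_subspace] by simp
    next
      case False
      have "\<exists>k<B.N. B.eigenpart k x \<noteq> 0"
      proof (rule ccontr)
        assume "\<not> ?thesis"
        then have "(\<Sum>k<B.N. B.eigenpart k x) = 0" by (intro sum.neutral) auto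
        then show False using False B.sum_eigenpart[OF xV] by simp
      qed
      then obtain k where k: "k < B.N" "B.eigenpart k x \<noteq> 0" by blast
      have kj: "of_nat k / of_nat B.N - of_nat j / of_nat A.N \<in> (\<int> :: rat set)" using zero k by blast
      have "B.eigenpart i x = 0" if i: "i < B.N" "i \<noteq> k" for i
      proof (rule zero[OF i(1)])
        show "of_nat i / of_nat B.N - of_nat j / of_nat A.N \<notin> (\<int> :: rat set)"
        proof
          assume a: "of_nat i / of_nat B.N - of_nat j / of_nat A.N \<in> (\<int> :: rat set)"
          have "(of_nat k / of_nat B.N - of_nat j / of_nat A.N) - (of_nat i / of_nat B.N - of_nat j / of_nat A.N) \<in> (\<int> :: rat set)"
            using kj a by (rule Ints_diff)
          then have "of_nat k / of_nat B.N - of_nat i / of_nat B.N \<in> (\<int> :: rat set)" by (simp add: algebra_simps)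
          then show False using B.coset_unique[of "of_nat k / of_nat B.N" k i] k i by simp
        qed
      qed
      then have "(\<Sum>i<B.N. B.eigenpart i x) = (\<Sum>i\<in>{k}. B.eigenpart i x)"
        using k(1) by (intro sum.mono_neutral_right) auto
      then have xk: "B.eigenpart k x = x" using B.sum_eigenpart[OF xV] by simp
      have hx: "h x = exp (2 * of_real pi * \<i> * of_int (int k) / of_nat B.N) *\<^sub>C x"
        using B.eigenpart_mem[OF xV, of k] xk by (simp add: aut_eigenspace_def B.N_def)
      have gx: "g x = exp (2 * of_real pi * \<i> * of_int (int j) / of_nat A.N) *\<^sub>C x"
        using x by (simp add: aut_eigenspace_def A.N_def)
      \<comment> \<open>The two exponents differ by an integer, so the exponentials agree although
        the orders of the twists may differ.\<close>
      obtain z where "of_nat k / of_nat B.N - of_nat j / of_nat A.N = (of_int z :: rat)"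
        using kj by (auto elim: Ints_cases)
      then have "(of_rat (of_nat k / of_nat B.N - of_nat j / of_nat A.N) :: complex) = of_rat (of_int z)" by simp
      then have kz: "of_nat k / of_nat B.N = of_nat j / of_nat A.N + (of_int z :: complex)"
        by (simp add: of_rat_diff of_rat_divide algebra_simps)
      have "2 * of_real pi * \<i> * of_int (int k) / of_nat B.N
          = 2 * of_real pi * \<i> * (of_nat k / of_nat B.N)" by simp
      also have "\<dots> = 2 * of_real pi * \<i> * (of_nat j / of_nat A.N) + 2 * of_real pi * \<i> * of_int z"
        unfolding kz distrib_left ..
      also have "\<dots> = 2 * of_real pi * \<i> * of_int (int j) / of_nat A.N + \<i> * (2 * of_real pi * of_int z)"
        by simp
      finally have "2 * of_real pi * \<i> * of_int (int k) / of_nat B.N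
          = 2 * of_real pi * \<i> * of_int (int j) / of_nat A.N + \<i> * (2 * of_real pi * of_int z)" .
      moreover have "exp (\<i> * (2 * of_real pi * of_int z)) = 1"
      proof -
        have "exp (\<i> * (2 * of_real pi * of_int z)) = cis (2 * pi * of_int z)" by (simp add: cis_conv_exp)
        also have "\<dots> = 1" by (rule cis_multiple_2pi) auto
        finally show ?thesis .
      qed
      ultimately show ?thesis unfolding hx gx by (simp add: exp_add)
    qed
  qed
  have e: "A.eigenpart j v \<in> vcarrier V" for j using A.eigenpart_mem[OF v] A.eigenspace_subset by blast
  have "g (\<Sum>j<A.N. A.eigenpart j v) = h (\<Sum>j<A.N. A.eigenpart j v)"
    using linear_map_sum[OF A.g_linear A.V_subspace, of "{..<A.N}" "\<lambda>j. A.eigenpart j v"]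
      linear_map_sum[OF B.g_linear A.V_subspace, of "{..<A.N}" "\<lambda>j. A.eigenpart j v"]
      main[OF A.eigenpart_mem[OF v]] e by simp
  then show ?thesis by (simp add: A.sum_eigenpart[OF v])
qed

section \<open>Density of the modes of the orbifold on the sum of the twisted modules\<close>

lemma span_image_explicit:
  assumes "x \<in> cvec.span (f ` S)"
  obtains F c where "finite F" "F \<subseteq> S" "x = (\<Sum>z\<in>F. c z *\<^sub>C f z)"
proof -
  obtain T r where T: "finite T" "T \<subseteq> f ` S" "x = (\<Sum>a\<in>T. r a *\<^sub>C a)"
    using assms unfolding cvec.span_explicit by blast
  obtain F where F: "F \<subseteq> S" "inj_on f F" "T = f ` F" using T(2) unfolding subset_image_inj by blast
  have fin: "finite F" using T(1) F finite_imageD by blast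
  have "x = (\<Sum>z\<in>F. r (f z) *\<^sub>C f z)"
    using T(3) unfolding F(3) sum.reindex[OF F(2)] comp_def .
  then show ?thesis by (rule that[OF fin F(1)])
qed

locale orbifold = group G for G :: "'g monoid" (structure) +
  fixes V :: "'v::complex_vector voa" and \<rho> :: "'g \<Rightarrow> 'v \<Rightarrow> 'v"
    and M :: "'g \<Rightarrow> ('v, 'm::complex_vector) vmodule" and \<phi> :: "'g \<Rightarrow> 'g \<Rightarrow> 'm \<Rightarrow> 'm"
  assumes simple_V: "simple_voa V" and finite_carrier: "finite (carrier G)"
    and \<rho>_hom: "\<rho> \<in> hom G (voa_Aut V)" and \<rho>_inj: "inj_on \<rho> (carrier G)"
    and M_simple: "g \<in> carrier G \<Longrightarrow> simple_twisted_module V (\<rho> g) (M g)"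
    and intertwining: "intertwiners G V \<rho> M \<phi>"
begin

abbreviation VG where "VG \<equiv> fixed_voa V G \<rho>"
abbreviation \<alpha> where "\<alpha> \<equiv> double_cocycle G M \<phi>"
abbreviation VS where "VS \<equiv> Vstar G M"

lemma is_voa: "is_voa V" using simple_voaD(1)[OF simple_V] .

lemma V_subspace: "cvec.subspace (vcarrier V)" using is_voaD(1)[OF is_voa] .

lemma tm: "g \<in> carrier G \<Longrightarrow> twisted_mod V (\<rho> g) (M g)"
  using M_simple[of g] is_voa by (simp add: simple_twisted_module_def twisted_module_def twisted_mod_def)

lemma M_nonzero: "g \<in> carrier G \<Longrightarrow> mcarrier (M g) \<noteq> {0}"
  using M_simple[of g] by (simp add: simple_twisted_module_def)

lemma M_sub: "g \<in> carrier G \<Longrightarrow> cvec.subspace (mcarrier (M g))"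
  using twisted_mod.M_subspace[OF tm] .

lemma M_ex_nonzero: "g \<in> carrier G \<Longrightarrow> \<exists>w\<in>mcarrier (M g). w \<noteq> 0"
  using M_nonzero[of g] cvec.subspace_0[OF M_sub[of g]] by blast

lemma \<rho>_Aut: "g \<in> carrier G \<Longrightarrow> \<rho> g \<in> carrier (voa_Aut V)"
  using \<rho>_hom by (auto simp: hom_def)

lemma \<rho>_linear: "g \<in> carrier G \<Longrightarrow> linear_map (vcarrier V) (vcarrier V) (\<rho> g)"
  using voa_AutD(2)[OF \<rho>_Aut] .

lemma \<rho>_mem: "g \<in> carrier G \<Longrightarrow> v \<in> vcarrier V \<Longrightarrow> \<rho> g v \<in> vcarrier V"
  using linear_map_mem[OF \<rho>_linear] .

lemma \<rho>_mult: "g \<in> carrier G \<Longrightarrow> h \<in> carrier G \<Longrightarrow> v \<in> vcarrier V \<Longrightarrow> \<rho> (g \<otimes> h) v = \<rho> g (\<rho> h v)"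
  using \<rho>_hom voa_Aut_mult[OF \<rho>_Aut \<rho>_Aut] by (simp add: hom_def)

lemma \<rho>_eqD:
  assumes "g \<in> carrier G" "h \<in> carrier G" "\<And>v. v \<in> vcarrier V \<Longrightarrow> \<rho> g v = \<rho> h v"
  shows "g = h"
proof -
  have "\<rho> g \<in> extensional (vcarrier V)" "\<rho> h \<in> extensional (vcarrier V)"
    using \<rho>_Aut assms by (auto simp: voa_Aut_def Bij_def)
  then have "\<rho> g = \<rho> h" using assms(3) by (rule extensionalityI)
  then show ?thesis using \<rho>_inj assms by (simp add: inj_on_def)
qed

lemma \<phi>_facts:
  assumes "g \<in> carrier G" "h \<in> carrier G"
  shows "bij_betw (\<phi> g h) (mcarrier (M g)) (mcarrier (M (h \<otimes> g \<otimes> inv h)))"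
    "linear_map (mcarrier (M g)) (mcarrier (M (h \<otimes> g \<otimes> inv h))) (\<phi> g h)"
    "\<And>v n w. v \<in> vcarrier V \<Longrightarrow> w \<in> mcarrier (M g) \<Longrightarrow>
       \<phi> g h (mY (M g) v n w) = mY (M (h \<otimes> g \<otimes> inv h)) (\<rho> h v) n (\<phi> g h w)"
  using intertwining assms unfolding intertwiners_def Let_def by blast+

lemma \<phi>_mem: "g \<in> carrier G \<Longrightarrow> h \<in> carrier G \<Longrightarrow> w \<in> mcarrier (M g) \<Longrightarrow>
    \<phi> g h w \<in> mcarrier (M (h \<otimes> g \<otimes> inv h))"
  using linear_map_mem[OF \<phi>_facts(2)] .

lemma \<phi>_nonzero:
  assumes "g \<in> carrier G" "h \<in> carrier G" "w \<in> mcarrier (M g)" "w \<noteq> 0"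
  shows "\<phi> g h w \<noteq> 0"
proof
  assume "\<phi> g h w = 0"
  also have "0 = \<phi> g h 0" using linear_map_zero[OF \<phi>_facts(2)[OF assms(1,2)] M_sub[OF assms(1)]] by simp
  finally show False
    using \<phi>_facts(1)[OF assms(1,2)] assms(3,4) cvec.subspace_0[OF M_sub[OF assms(1)]]
    by (auto simp: bij_betw_def inj_on_def)
qed

lemma M_action:
  assumes "g \<in> carrier G"
  shows "simple_action (vcarrier V \<times> UNIV) (\<lambda>(v, n). mY (M g) v n) (mcarrier (M g))"
  unfolding simple_action_def
proof (intro conjI allI impI ballI)
  show "cvec.subspace (mcarrier (M g))" "mcarrier (M g) \<noteq> {0}" using M_sub M_nonzero assms by auto
  fix a assume "a \<in> vcarrier V \<times> (UNIV :: rat set)"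
  then show "linear_map (mcarrier (M g)) (mcarrier (M g)) (case a of (v, n) \<Rightarrow> mY (M g) v n)"
    using twisted_mod.Y_linear[OF tm[OF assms]] by auto
next
  fix W assume "cvec.subspace W \<and> W \<subseteq> mcarrier (M g) \<and>
      (\<forall>a\<in>vcarrier V \<times> UNIV. \<forall>w\<in>W. (case a of (v, n) \<Rightarrow> mY (M g) v n) w \<in> W)"
  then have "vsubmodule V (M g) W" unfolding vsubmodule_def by auto
  then show "W = {0} \<or> W = mcarrier (M g)" using M_simple[OF assms] by (simp add: simple_twisted_module_def)
qed

text \<open>Since L(0) is one of the modes, \<open>f\<close> preserves every weight space; a nonzero
  one is finite-dimensional and provides the eigenvalue.\<close>

lemma M_schur_scalar:
  assumes g: "g \<in> carrier G" and f: "linear_map (mcarrier (M g)) (mcarrier (M g)) f"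
    and comm: "\<And>v n w. v \<in> vcarrier V \<Longrightarrow> w \<in> mcarrier (M g) \<Longrightarrow> f (mY (M g) v n w) = mY (M g) v n (f w)"
  shows "\<exists>c. \<forall>w\<in>mcarrier (M g). f w = c *\<^sub>C w"
proof -
  interpret A: twisted_mod V "\<rho> g" "M g" using tm[OF g] .
  have "\<exists>c. mod_weight_space V (M g) c \<noteq> {0}"
  proof (rule ccontr)
    assume "\<not> ?thesis"
    then have "(\<Union>c. mod_weight_space V (M g) c) = {0}" by auto
    moreover have "cvec.span (\<Union>c. mod_weight_space V (M g) c) = mcarrier (M g)"
      using A.M_weights unfolding direct_sum_def by blast
    ultimately have "mcarrier (M g) = cvec.span {0}" by metis
    then show False using M_nonzero[OF g] by (simp add: cvec.span_insert_0)
  qed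
  then obtain c where c: "mod_weight_space V (M g) c \<noteq> {0}" by blast
  show ?thesis
  proof (rule simple_action_hom_scalar[OF M_action[OF g] f])
    show "f ((case a of (v, n) \<Rightarrow> mY (M g) v n) w) = (case a of (v, n) \<Rightarrow> mY (M g) v n) (f w)"
      if "a \<in> vcarrier V \<times> UNIV" "w \<in> mcarrier (M g)" for a w
      using that comm by auto
    show "fin_dim (mod_weight_space V (M g) c)"
      using M_simple[OF g] by (simp add: simple_twisted_module_def twisted_module_def)
    show "mod_weight_space V (M g) c \<noteq> {0}" by fact
    show "mod_weight_space V (M g) c \<subseteq> mcarrier (M g)" by (auto simp: mod_weight_space_def)
    show "f x \<in> mod_weight_space V (M g) c" if "x \<in> mod_weight_space V (M g) c" for x
    proof -
      have x: "x \<in> mcarrier (M g)" "mY (M g) (vomega V) (of_int 0 + 1) x = c *\<^sub>C x"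
        using that by (auto simp: mod_weight_space_def mod_L_def)
      have "mY (M g) (vomega V) (of_int 0 + 1) (f x) = c *\<^sub>C f x"
        using comm[OF is_voaD(6)[OF is_voa] x(1), of "of_int 0 + 1"] x(2) linear_map_scale[OF f x(1)] by simp
      then show ?thesis using linear_map_mem[OF f x(1)] by (simp add: mod_weight_space_def mod_L_def)
    qed
  qed
qed

text \<open>A nonzero map would be an isomorphism, forcing equal twists by
  \<open>module_iso_same_twist\<close> and then \<open>g = h\<close> because \<rho> is
  injective.\<close>

lemma M_schur:
  assumes g: "g \<in> carrier G" and h: "h \<in> carrier G" and f: "linear_map (mcarrier (M g)) (mcarrier (M h)) f"
    and comm: "\<forall>a\<in>vcarrier V \<times> UNIV. \<forall>w\<in>mcarrier (M g).
      f ((case a of (v, n) \<Rightarrow> mY (M g) v n) w) = (case a of (v, n) \<Rightarrow> mY (M h) v n) (f w)"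
  shows "\<exists>c. \<forall>w\<in>mcarrier (M g). f w = (if g = h then c *\<^sub>C w else 0)"
proof -
  have comm': "f (mY (M g) v n w) = mY (M h) v n (f w)" if "v \<in> vcarrier V" "w \<in> mcarrier (M g)" for v n w
    using bspec[OF bspec[OF comm, of "(v, n)"] that(2)] that(1) by simp
  show ?thesis
  proof (cases "g = h")
    case True
    then show ?thesis using M_schur_scalar[OF g, of f] f comm' by simp
  next
    case False
    have "f w = 0" if w: "w \<in> mcarrier (M g)" for w
    proof (rule ccontr)
      assume nz: "f w \<noteq> 0"
      have "bij_betw f (mcarrier (M g)) (mcarrier (M h))"
        using comm by (intro simple_action_hom_bij[OF M_action[OF g] M_action[OF h] f _ w nz]) auto
      then have "\<rho> g v = \<rho> h v" if "v \<in> vcarrier V" for v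
        using module_iso_same_twist[OF simple_V tm[OF g] tm[OF h] M_nonzero[OF h] _ f comm' that] by blast
      then show False using False \<rho>_eqD[OF g h] by blast
    qed
    then show ?thesis using False by simp
  qed
qed

lemma conj_comp:
  "a \<in> carrier G \<Longrightarrow> b \<in> carrier G \<Longrightarrow> x \<in> carrier G \<Longrightarrow>
    (a \<otimes> b) \<otimes> x \<otimes> inv (a \<otimes> b) = a \<otimes> (b \<otimes> x \<otimes> inv b) \<otimes> inv a"
  by (simp add: m_assoc inv_mult_group)

text \<open>Both sides intertwine the modes of v on \<open>M g\<close> with those of
  \<open>\<rho> (h \<otimes> k) v\<close>. Undoing one of them gives an endomorphism that commutes
  with all modes, hence a scalar; a nonzero vector makes it unique, so the definite description in
  \<open>double_cocycle\<close> is meaningful.\<close>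

lemma \<alpha>_spec:
  assumes g: "g \<in> carrier G" and h: "h \<in> carrier G" and k: "k \<in> carrier G"
  shows "\<alpha> g h k \<noteq> 0 \<and> (\<forall>w\<in>mcarrier (M g).
     \<phi> g (h \<otimes> k) w = inverse (\<alpha> g h k) *\<^sub>C \<phi> (k \<otimes> g \<otimes> inv k) h (\<phi> g k w))"
proof -
  let ?g' = "k \<otimes> g \<otimes> inv k" and ?g'' = "h \<otimes> (k \<otimes> g \<otimes> inv k) \<otimes> inv h"
  let ?S = "mcarrier (M g)" and ?T = "mcarrier (M ?g'')"
  have g': "?g' \<in> carrier G" and g'': "?g'' \<in> carrier G" and hk: "h \<otimes> k \<in> carrier G" using g h k by auto
  have eq: "(h \<otimes> k) \<otimes> g \<otimes> inv (h \<otimes> k) = ?g''" using conj_comp[OF h k g] .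
  define \<psi> where "\<psi> w = \<phi> ?g' h (\<phi> g k w)" for w
  have \<psi>_bij: "bij_betw \<psi> ?S ?T"
    using bij_betw_trans[OF \<phi>_facts(1)[OF g k] \<phi>_facts(1)[OF g' h]] by (simp add: \<psi>_def[abs_def] comp_def)
  have \<psi>_lin: "linear_map ?S ?T \<psi>"
    unfolding \<psi>_def[abs_def] using linear_map_comp[OF \<phi>_facts(2)[OF g k] \<phi>_facts(2)[OF g' h]] .
  have \<psi>_Y: "\<psi> (mY (M g) v n w) = mY (M ?g'') (\<rho> (h \<otimes> k) v) n (\<psi> w)" if "v \<in> vcarrier V" "w \<in> ?S" for v n w
    using \<phi>_facts(3)[OF g k that] \<phi>_facts(3)[OF g' h \<rho>_mem[OF k that(1)] \<phi>_mem[OF g k that(2)]]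
      \<rho>_mult[OF h k that(1)] by (simp add: \<psi>_def)
  note P = \<phi>_facts[OF g hk, unfolded eq]
  define \<theta> where "\<theta> w = the_inv_into ?S \<psi> (\<phi> g (h \<otimes> k) w)" for w
  have inj: "inj_on \<psi> ?S" and im: "\<psi> ` ?S = ?T" using \<psi>_bij by (auto simp: bij_betw_def)
  have \<theta>: "\<psi> (\<theta> w) = \<phi> g (h \<otimes> k) w" "\<theta> w \<in> ?S" if "w \<in> ?S" for w
  proof -
    have "\<phi> g (h \<otimes> k) w \<in> \<psi> ` ?S" using linear_map_mem[OF P(2) that] im by simp
    then show "\<psi> (\<theta> w) = \<phi> g (h \<otimes> k) w" "\<theta> w \<in> ?S"
      unfolding \<theta>_def using f_the_inv_into_f[OF inj] the_inv_into_into[OF inj] by auto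
  qed
  have "linear_map ?S ?S \<theta>"
    unfolding \<theta>_def[abs_def] using linear_map_comp[OF P(2) linear_map_inverse[OF \<psi>_lin M_sub[OF g] \<psi>_bij]] .
  moreover have "\<theta> (mY (M g) v n w) = mY (M g) v n (\<theta> w)" if v: "v \<in> vcarrier V" and w: "w \<in> ?S" for v n w
  proof (rule inj_onD[OF inj])
    have m: "mY (M g) v n w \<in> ?S" using twisted_mod.Y_mem[OF tm[OF g] v w] .
    show "\<psi> (\<theta> (mY (M g) v n w)) = \<psi> (mY (M g) v n (\<theta> w))"
      using \<theta>[OF m] \<theta>[OF w] P(3)[OF v w] \<psi>_Y[OF v \<theta>(2)[OF w]] by simp
    show "\<theta> (mY (M g) v n w) \<in> ?S" using \<theta>(2)[OF m] .
    show "mY (M g) v n (\<theta> w) \<in> ?S" using twisted_mod.Y_mem[OF tm[OF g] v \<theta>(2)[OF w]] .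
  qed
  ultimately obtain c where c: "\<And>w. w \<in> ?S \<Longrightarrow> \<theta> w = c *\<^sub>C w" using M_schur_scalar[OF g] by metis
  have main: "\<phi> g (h \<otimes> k) w = c *\<^sub>C \<psi> w" if "w \<in> ?S" for w
    using \<theta>(1)[OF that] c[OF that] linear_map_scale[OF \<psi>_lin that] by simp
  obtain w0 where w0: "w0 \<in> ?S" "w0 \<noteq> 0" using M_ex_nonzero[OF g] by blast
  have "\<phi> g (h \<otimes> k) w0 \<noteq> 0" using \<phi>_nonzero[OF g hk w0] .
  then have c0: "c \<noteq> 0" and \<psi>0: "\<psi> w0 \<noteq> 0" using main[OF w0(1)] by auto
  have "\<exists>!c. c \<noteq> 0 \<and> (\<forall>w\<in>?S. \<phi> g (h \<otimes> k) w = inverse c *\<^sub>C \<psi> w)"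
  proof (rule ex1I[of _ "inverse c"])
    show "inverse c \<noteq> 0 \<and> (\<forall>w\<in>?S. \<phi> g (h \<otimes> k) w = inverse (inverse c) *\<^sub>C \<psi> w)" using c0 main by simp
    fix c' assume c': "c' \<noteq> 0 \<and> (\<forall>w\<in>?S. \<phi> g (h \<otimes> k) w = inverse c' *\<^sub>C \<psi> w)"
    then have "inverse c' *\<^sub>C \<psi> w0 = c *\<^sub>C \<psi> w0" using main[OF w0(1)] w0(1) by simp
    then have "inverse c' = c" using \<psi>0 by (simp add: cvec.scale_right_imp_eq)
    then show "c' = inverse c" by auto
  qed
  from theI'[OF this] show ?thesis unfolding double_cocycle_def \<psi>_def .
qed

text \<open>The intertwiner of h \<otimes> k \<otimes> l is decomposed along both bracketings and
  compared at a nonzero vector.\<close>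

lemma \<alpha>_cocycle:
  assumes g: "g \<in> carrier G" and h: "h \<in> carrier G" and k: "k \<in> carrier G" and l: "l \<in> carrier G"
  shows "\<alpha> g (h \<otimes> k) l * \<alpha> (l \<otimes> g \<otimes> inv l) h k = \<alpha> g h (k \<otimes> l) * \<alpha> g k l"
proof -
  let ?g1 = "l \<otimes> g \<otimes> inv l"
  let ?g2 = "k \<otimes> ?g1 \<otimes> inv k"
  have g1: "?g1 \<in> carrier G" and g2: "?g2 \<in> carrier G" using g k l by auto
  have e: "(k \<otimes> l) \<otimes> g \<otimes> inv (k \<otimes> l) = ?g2" using conj_comp[OF k l g] .
  obtain w where w: "w \<in> mcarrier (M g)" "w \<noteq> 0" using M_ex_nonzero[OF g] by blast
  have w1: "\<phi> g l w \<in> mcarrier (M ?g1)" using \<phi>_mem[OF g l w(1)] .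
  have w2: "\<phi> ?g1 k (\<phi> g l w) \<in> mcarrier (M ?g2)" using \<phi>_mem[OF g1 k w1] .
  let ?x = "\<phi> ?g2 h (\<phi> ?g1 k (\<phi> g l w))"
  have x0: "?x \<noteq> 0" using \<phi>_nonzero[OF g2 h w2 \<phi>_nonzero[OF g1 k w1 \<phi>_nonzero[OF g l w]]] .
  have 1: "\<phi> g (h \<otimes> k \<otimes> l) w = inverse (\<alpha> g (h \<otimes> k) l) *\<^sub>C inverse (\<alpha> ?g1 h k) *\<^sub>C ?x"
    using \<alpha>_spec[OF g _ l, of "h \<otimes> k"] \<alpha>_spec[OF g1 h k] w w1 h k by simp
  have 2: "\<phi> g (h \<otimes> (k \<otimes> l)) w = inverse (\<alpha> g h (k \<otimes> l)) *\<^sub>C inverse (\<alpha> g k l) *\<^sub>C ?x"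
    using \<alpha>_spec[OF g h, of "k \<otimes> l"] \<alpha>_spec[OF g k l] w k l e
      linear_map_scale[OF \<phi>_facts(2)[OF g2 h] w2] by simp
  have 3: "h \<otimes> k \<otimes> l = h \<otimes> (k \<otimes> l)" using h k l by (rule m_assoc)
  have "(inverse (\<alpha> g (h \<otimes> k) l) * inverse (\<alpha> ?g1 h k)) *\<^sub>C ?x
      = (inverse (\<alpha> g h (k \<otimes> l)) * inverse (\<alpha> g k l)) *\<^sub>C ?x"
    using 1 2 unfolding 3 scaleC_scaleC by (rule subst)
  then have "inverse (\<alpha> g (h \<otimes> k) l) * inverse (\<alpha> ?g1 h k) = inverse (\<alpha> g h (k \<otimes> l)) * inverse (\<alpha> g k l)"
    using x0 cvec.scale_right_imp_eq by blast
  then have "inverse (\<alpha> g (h \<otimes> k) l * \<alpha> ?g1 h k) = inverse (\<alpha> g h (k \<otimes> l) * \<alpha> g k l)"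
    by (simp add: mult.commute)
  then show ?thesis by (rule inverse_eq_imp_eq)
qed

sublocale double G \<alpha>
  using finite_carrier \<alpha>_spec \<alpha>_cocycle by unfold_locales auto

section \<open>The sum of the twisted modules as a module of the double\<close>

lemma VS_iff: "f \<in> mcarrier VS \<longleftrightarrow> (\<forall>g\<in>carrier G. f g \<in> mcarrier (M g)) \<and> (\<forall>g. g \<notin> carrier G \<longrightarrow> f g = 0)"
  by (simp add: Vstar_def)

lemma VS_mem: "f \<in> mcarrier VS \<Longrightarrow> g \<in> carrier G \<Longrightarrow> f g \<in> mcarrier (M g)"
  by (simp add: VS_iff)

lemma VS_subspace: "cvec.subspace (mcarrier VS)"
  by (rule cvec.subspaceI)
     (auto simp: VS_iff scaleC_fun_def cvec.subspace_0[OF M_sub] cvec.subspace_add[OF M_sub]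
       cvec.subspace_scale[OF M_sub])

lemma VS_Y: "mY VS v n f = (\<lambda>g. if g \<in> carrier G then mY (M g) v n (f g) else 0)"
  by (simp add: Vstar_def)

lemma VS_Y_linear: "v \<in> vcarrier V \<Longrightarrow> linear_map (mcarrier VS) (mcarrier VS) (mY VS v n)"
  unfolding linear_map_def
  using twisted_mod.Y_mem[OF tm] linear_map_add[OF twisted_mod.Y_linear[OF tm]]
    linear_map_scale[OF twisted_mod.Y_linear[OF tm]]
  by (auto simp: VS_iff VS_Y scaleC_fun_def fun_eq_iff)

definition X :: "'g \<Rightarrow> 'g \<Rightarrow> ('g \<Rightarrow> 'm) \<Rightarrow> 'g \<Rightarrow> 'm" where
  "X a x f = (\<lambda>y. if y = a \<otimes> x \<otimes> inv a then \<phi> x a (f x) else 0)"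

definition single :: "'g \<Rightarrow> 'm \<Rightarrow> 'g \<Rightarrow> 'm" where
  "single g w = (\<lambda>y. if y = g then w else 0)"

lemma single_mem: "g \<in> carrier G \<Longrightarrow> w \<in> mcarrier (M g) \<Longrightarrow> single g w \<in> mcarrier VS"
  using cvec.subspace_0[OF M_sub] by (auto simp: VS_iff single_def)

lemma single_scale: "single g (c *\<^sub>C w) = c *\<^sub>C single g w"
  by (auto simp: single_def scaleC_fun_def)

lemma single_add: "single g (w + w') = single g w + single g w'"
  by (auto simp: single_def)

lemma double_action_X: "double_action G \<phi> d f = (\<Sum>p\<in>carrier G \<times> carrier G. d p *\<^sub>C X (fst p) (snd p) f)"
  unfolding double_action_def X_def by (intro sum.cong refl) (simp add: case_prod_unfold)

lemma X_mem: "a \<in> carrier G \<Longrightarrow> x \<in> carrier G \<Longrightarrow> f \<in> mcarrier VS \<Longrightarrow> X a x f \<in> mcarrier VS"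
  using \<phi>_mem[of x a "f x"] cvec.subspace_0[OF M_sub] by (auto simp: VS_iff X_def)

lemma X_linear:
  assumes "a \<in> carrier G" "x \<in> carrier G"
  shows "linear_map (mcarrier VS) (mcarrier VS) (X a x)"
  unfolding linear_map_def
  using X_mem[OF assms] linear_map_add[OF \<phi>_facts(2)[OF assms(2,1)]] linear_map_scale[OF \<phi>_facts(2)[OF assms(2,1)]]
    VS_mem assms
  by (auto simp: X_def scaleC_fun_def fun_eq_iff)

lemma X_mult:
  assumes a: "a \<in> carrier G" and x: "x \<in> carrier G" and b: "b \<in> carrier G" and y: "y \<in> carrier G" and f: "f \<in> mcarrier VS"
  shows "X a x (X b y f) = (if x = b \<otimes> y \<otimes> inv b then \<alpha> y a b *\<^sub>C X (a \<otimes> b) y f else 0)"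
proof (cases "x = b \<otimes> y \<otimes> inv b")
  case True
  have "\<phi> y (a \<otimes> b) (f y) = inverse (\<alpha> y a b) *\<^sub>C \<phi> x a (\<phi> y b (f y))"
    using \<alpha>_spec[OF y a b] VS_mem[OF f y] True by simp
  then have "\<phi> x a (\<phi> y b (f y)) = \<alpha> y a b *\<^sub>C \<phi> y (a \<otimes> b) (f y)"
    using \<alpha>_spec[OF y a b] by (simp add: scaleC_scaleC scaleC_one)
  moreover have "(a \<otimes> b) \<otimes> y \<otimes> inv (a \<otimes> b) = a \<otimes> x \<otimes> inv a" using conj_comp[OF a b y] True by simp
  ultimately show ?thesis using True by (auto simp: X_def scaleC_fun_def)
next
  case False
  have "\<phi> x a 0 = 0" using linear_map_zero[OF \<phi>_facts(2)[OF x a] M_sub[OF x]] .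
  then show ?thesis using False by (auto simp: X_def)
qed

text \<open>The intertwiners are arbitrary up to scalars, so even the one for \<one> is only a
  multiple of the identity. The multiple follows from \<one> \<otimes> \<one> = \<one> by cancelling
  one injective factor \<open>\<phi> x \<one>\<close>.\<close>

lemma \<phi>_one:
  assumes x: "x \<in> carrier G" and w: "w \<in> mcarrier (M x)"
  shows "\<phi> x \<one> w = \<alpha> x \<one> \<one> *\<^sub>C w"
proof -
  let ?c = "inverse (\<alpha> x \<one> \<one>)"
  have m: "\<phi> x \<one> w \<in> mcarrier (M x)" using \<phi>_mem[OF x one_closed w] x by simp
  have "\<phi> x \<one> w = ?c *\<^sub>C \<phi> x \<one> (\<phi> x \<one> w)" using \<alpha>_spec[OF x one_closed one_closed] w x by simp
  also have "\<dots> = \<phi> x \<one> (?c *\<^sub>C \<phi> x \<one> w)"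
    using linear_map_scale[OF \<phi>_facts(2)[OF x one_closed] m] by simp
  finally have "w = ?c *\<^sub>C \<phi> x \<one> w"
    using \<phi>_facts(1)[OF x one_closed] w m cvec.subspace_scale[OF M_sub[OF x]] by (auto simp: bij_betw_def inj_on_def)
  then have "\<alpha> x \<one> \<one> *\<^sub>C w = \<alpha> x \<one> \<one> *\<^sub>C ?c *\<^sub>C \<phi> x \<one> w" by simp
  then show ?thesis using \<alpha>_spec[OF x one_closed one_closed] by (simp add: scaleC_scaleC scaleC_one)
qed

lemma X_one:
  assumes x: "x \<in> carrier G" and f: "f \<in> mcarrier VS"
  shows "X \<one> x f = \<alpha> x \<one> \<one> *\<^sub>C single x (f x)"
  using \<phi>_one[OF x VS_mem[OF f x]] x by (auto simp: X_def single_def scaleC_fun_def)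

definition DV :: "('g \<times> 'g \<Rightarrow> complex, 'g \<Rightarrow> 'm) amodule" where
  "DV = \<lparr>ucarrier = mcarrier VS, uact = double_action G \<phi>\<rparr>"

lemma DV_simps [simp]: "ucarrier DV = mcarrier VS" "uact DV = double_action G \<phi>"
  by (simp_all add: DV_def)

lemma sum_fun_apply: "(\<Sum>i\<in>I. f i) x = (\<Sum>i\<in>I. f i x)" for f :: "'i \<Rightarrow> 'k \<Rightarrow> 'l::comm_monoid_add"
  by (induction I rule: infinite_finite_induct) auto

lemma sum_single:
  assumes "f \<in> mcarrier VS"
  shows "(\<Sum>x\<in>carrier G. single x (f x)) = f"
proof
  fix y
  show "(\<Sum>x\<in>carrier G. single x (f x)) y = f y"
    unfolding sum_fun_apply using assms finite_carrier by (auto simp: single_def VS_iff)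
qed

lemma DV_module: "alg_module D DV"
  unfolding DV_def
proof (rule alg_moduleI[where X = X])
  show "(\<Sum>x\<in>carrier G. inverse (\<alpha> x \<one> \<one>) *\<^sub>C X \<one> x u) = u" if "u \<in> mcarrier VS" for u
  proof -
    have "(\<Sum>x\<in>carrier G. inverse (\<alpha> x \<one> \<one>) *\<^sub>C X \<one> x u) = (\<Sum>x\<in>carrier G. single x (u x))"
      using X_one[OF _ that] \<alpha>_spec by (intro sum.cong refl) (simp add: scaleC_scaleC scaleC_one)
    then show ?thesis using sum_single[OF that] by simp
  qed
qed (use VS_subspace X_linear X_mult double_action_X in auto)

lemma action_\<xi>:
  assumes "a \<in> carrier G" "x \<in> carrier G"
  shows "double_action G \<phi> (\<xi> a x) f = X a x f"
proof -
  have "double_action G \<phi> (\<xi> a x) f = (\<Sum>p\<in>carrier G \<times> carrier G. if p = (a, x) then X a x f else 0)"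
    unfolding double_action_X by (intro sum.cong) (auto simp: double_basis_def scaleC_one)
  then show ?thesis using assms finite_carrier by simp
qed

lemma VG_iff: "v \<in> vcarrier VG \<longleftrightarrow> v \<in> vcarrier V \<and> (\<forall>g\<in>carrier G. \<rho> g v = v)"
  by (auto simp: fixed_voa_def)

lemma X_Y_commute:
  assumes a: "a \<in> carrier G" and x: "x \<in> carrier G" and v: "v \<in> vcarrier VG" and f: "f \<in> mcarrier VS"
  shows "X a x (mY VS v n f) = mY VS v n (X a x f)"
proof
  fix y
  have vV: "v \<in> vcarrier V" "\<rho> a v = v" using v a by (auto simp: VG_iff)
  show "X a x (mY VS v n f) y = mY VS v n (X a x f) y"
    using \<phi>_facts(3)[OF x a vV(1) VS_mem[OF f x]] vV(2) x a twisted_mod.Y_zero[OF tm vV(1)]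
    by (auto simp: X_def VS_Y)
qed

lemma action_Y_commute:
  assumes d: "d \<in> acarrier D" and v: "v \<in> vcarrier VG" and f: "f \<in> mcarrier VS"
  shows "double_action G \<phi> d (mY VS v n f) = mY VS v n (double_action G \<phi> d f)"
proof -
  have vV: "v \<in> vcarrier V" using v by (simp add: VG_iff)
  have "mY VS v n (\<Sum>p\<in>carrier G \<times> carrier G. d p *\<^sub>C X (fst p) (snd p) f)
      = (\<Sum>p\<in>carrier G \<times> carrier G. d p *\<^sub>C mY VS v n (X (fst p) (snd p) f))"
    using X_mem[OF _ _ f] by (intro linear_map_lincomb[OF VS_Y_linear[OF vV] VS_subspace]) auto
  also have "\<dots> = (\<Sum>p\<in>carrier G \<times> carrier G. d p *\<^sub>C X (fst p) (snd p) (mY VS v n f))"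
    using X_Y_commute[OF _ _ v f] by (intro sum.cong) auto
  finally show ?thesis unfolding double_action_X by simp
qed

text \<open>The tuples r with the same vanishing sums form an invariant subspace \<open>R\<close>,
  which contains the tuple of basis vectors. By density it contains every tuple, in particular one
  concentrated at \<open>b0\<close>, so \<open>x b0\<close> annihilates the module.\<close>

lemma modes_independent:
  assumes y: "y \<in> carrier G" and B: "finite B" "cvec.independent B" "B \<subseteq> mcarrier (M y)"
    and x: "\<And>b. b \<in> B \<Longrightarrow> x b \<in> vcarrier V" and zero: "\<And>s. (\<Sum>b\<in>B. mY (M y) (x b) s b) = 0"
    and b0: "b0 \<in> B"
  shows "x b0 = 0"
proof (rule annihilator_zero[OF simple_V tm[OF y] M_nonzero[OF y] x[OF b0]])
  interpret A: twisted_mod V "\<rho> y" "M y" using tm[OF y] .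
  fix s w assume w: "w \<in> mcarrier (M y)"
  define J where "J = {y} \<times> B"
  define R where "R = {r. (\<forall>b\<in>B. r (y, b) \<in> mcarrier (M y)) \<and> (\<forall>j. j \<notin> J \<longrightarrow> r j = 0) \<and>
      (\<forall>s. (\<Sum>b\<in>B. mY (M y) (x b) s (r (y, b))) = 0)}"
  have "(\<lambda>j. if j = (y, b0) then w else 0) \<in> R"
  proof (rule jacobson_density[where S = "\<lambda>g. mcarrier (M g)" and act = "\<lambda>g (v, n). mY (M g) v n"
        and Op = "vcarrier V \<times> UNIV" and K = "{y}" and J = J])
    show "cvec.subspace (mcarrier (M k))" if "k \<in> {y}" for k using that M_sub[OF y] by simp
    show "linear_map (mcarrier (M k)) (mcarrier (M k)) (case a of (v, n) \<Rightarrow> mY (M k) v n)"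
      if "k \<in> {y}" "a \<in> vcarrier V \<times> UNIV" for k a
      using that M_action[OF y] unfolding simple_action_def by blast
    show "W = {0} \<or> W = mcarrier (M k)"
      if "k \<in> {y}" "cvec.subspace W" "W \<subseteq> mcarrier (M k)"
        "\<forall>a\<in>vcarrier V \<times> UNIV. \<forall>w\<in>W. (case a of (v, n) \<Rightarrow> mY (M k) v n) w \<in> W" for k W
      using that M_action[OF y] unfolding simple_action_def by blast
    show "\<exists>c. \<forall>w\<in>mcarrier (M k). f w = (if k = l then c *\<^sub>C w else 0)"
      if "k \<in> {y}" "l \<in> {y}" "linear_map (mcarrier (M k)) (mcarrier (M l)) f"
        "\<forall>a\<in>vcarrier V \<times> UNIV. \<forall>w\<in>mcarrier (M k).
          f ((case a of (v, n) \<Rightarrow> mY (M k) v n) w) = (case a of (v, n) \<Rightarrow> mY (M l) v n) (f w)" for k l f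
      using that M_schur[OF y y] by blast
    show "finite J" using B(1) by (simp add: J_def)
    show "k \<in> {y} \<and> b \<in> mcarrier (M k)" if "(k, b) \<in> J" for k b using that B(3) by (auto simp: J_def)
    show "cvec.independent {b. (k, b) \<in> J}" if "k \<in> {y}" for k using that B(2) by (simp add: J_def)
    show "cvec.subspace R"
    proof (rule cvec.subspaceI)
      show "0 \<in> R" using cvec.subspace_0[OF M_sub[OF y]] A.Y_zero[OF x] by (auto simp: R_def)
      fix r r' c assume r: "r \<in> R" and r': "r' \<in> R"
      show "r + r' \<in> R"
        using r r' linear_map_add[OF A.Y_linear[OF x]] cvec.subspace_add[OF M_sub[OF y]]
        by (auto simp: R_def sum.distrib)
    next
      fix c r assume r: "r \<in> R"
      have "(\<Sum>b\<in>B. mY (M y) (x b) s ((c *\<^sub>C r) (y, b))) = c *\<^sub>C (\<Sum>b\<in>B. mY (M y) (x b) s (r (y, b)))" for s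
        unfolding cvec.scale_sum_right using r linear_map_scale[OF A.Y_linear[OF x]]
        by (intro sum.cong) (auto simp: R_def scaleC_fun_def)
      then show "c *\<^sub>C r \<in> R"
        using r cvec.subspace_scale[OF M_sub[OF y]] by (auto simp: R_def scaleC_fun_def)
    qed
    show "r j \<in> mcarrier (M (fst j))" if "r \<in> R" "j \<in> J" for r j using that by (auto simp: R_def J_def)
    show "r j = 0" if "r \<in> R" "j \<notin> J" for r j using that unfolding R_def by blast
    show "(\<lambda>j. if j \<in> J then (case a of (v, n) \<Rightarrow> mY (M (fst j)) v n) (r j) else 0) \<in> R"
      if r: "r \<in> R" and a: "a \<in> vcarrier V \<times> UNIV" for r a
    proof -
      obtain v n where a': "a = (v, n)" "v \<in> vcarrier V" using a by auto
      have rm: "r (y, b) \<in> mcarrier (M y)" if "b \<in> B" for b using r that by (simp add: R_def)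
      have r0: "(\<Sum>b\<in>B. mY (M y) (x b) s (r (y, b))) = 0" for s using r by (simp add: R_def)
      have "(\<Sum>b\<in>B. mY (M y) (x b) s (mY (M y) v n (r (y, b)))) = 0" for s
        by (rule sum_modes_zero_closed[OF tm[OF y] B(1) x _ a'(2) r0]) (use rm in auto)
      then show ?thesis
        using A.Y_mem[OF a'(2) rm] by (auto simp: R_def J_def a'(1))
    qed
    show "(\<lambda>j. if j \<in> J then snd j else 0) \<in> R"
      using B(3) zero by (auto simp: R_def J_def)
    show "(if j = (y, b0) then w else 0) \<in> mcarrier (M (fst j))" if "j \<in> J" for j
      using that w cvec.subspace_0[OF M_sub[OF y]] by (auto simp: J_def)
    show "(if j = (y, b0) then w else 0) = 0" if "j \<notin> J" for j using that b0 by (auto simp: J_def)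
  qed
  then have "(\<Sum>b\<in>B. mY (M y) (x b) s (if b = b0 then w else 0)) = 0" by (simp add: R_def)
  moreover have "(\<Sum>b\<in>B. mY (M y) (x b) s (if b = b0 then w else 0)) = (\<Sum>b\<in>{b0}. mY (M y) (x b) s w)"
    using B(1) b0 A.Y_zero[OF x] by (intro sum.mono_neutral_cong_right) auto
  ultimately show "mY (M y) (x b0) s w = 0" by simp
qed

text \<open>Applied to a vector v_s w, the relation becomes a vanishing sum of modes of the vectors
  \<open>\<rho> a v\<close> on the vectors \<open>c a *\<^sub>C \<phi> x a w\<close>. Rewriting it
  in a basis of their span, \<open>modes_independent\<close> yields linear relations among the
  \<open>\<rho> a v\<close>, to which the functional \<open>l\<close> is applied.\<close>

lemma relation_twist:
  assumes x: "x \<in> carrier G" and y: "y \<in> carrier G" and A: "A \<subseteq> carrier G" "\<And>a. a \<in> A \<Longrightarrow> a \<otimes> x \<otimes> inv a = y"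
    and rel: "\<And>w. w \<in> mcarrier (M x) \<Longrightarrow> (\<Sum>a\<in>A. c a *\<^sub>C \<phi> x a w) = 0"
    and v: "v \<in> vcarrier V" and l: "linear_map UNIV UNIV (l :: 'v \<Rightarrow> complex)" and w: "w \<in> mcarrier (M x)"
  shows "(\<Sum>a\<in>A. (l (\<rho> a v) * c a) *\<^sub>C \<phi> x a w) = 0"
proof -
  have fA: "finite A" using A(1) finite_carrier finite_subset by blast
  define z where "z a = c a *\<^sub>C \<phi> x a w" for a
  have zm: "z a \<in> mcarrier (M y)" if "a \<in> A" for a
    unfolding z_def using \<phi>_mem[OF x _ w, of a] A that by (intro cvec.subspace_scale[OF M_sub[OF y]]) auto
  have zs: "(\<Sum>a\<in>A. mY (M y) (\<rho> a v) s (z a)) = 0" for s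
  proof -
    have "(\<Sum>a\<in>A. mY (M y) (\<rho> a v) s (z a)) = (\<Sum>a\<in>A. c a *\<^sub>C \<phi> x a (mY (M x) v s w))"
    proof (intro sum.cong refl)
      fix a assume a: "a \<in> A"
      then have aG: "a \<in> carrier G" and ay: "a \<otimes> x \<otimes> inv a = y" using A by auto
      have "\<phi> x a w \<in> mcarrier (M y)" using \<phi>_mem[OF x aG w] ay by simp
      then show "mY (M y) (\<rho> a v) s (z a) = c a *\<^sub>C \<phi> x a (mY (M x) v s w)"
        unfolding z_def using \<phi>_facts(3)[OF x aG v w] ay
          linear_map_scale[OF twisted_mod.Y_linear[OF tm[OF y] \<rho>_mem[OF aG v]]] by simp
    qed
    also have "\<dots> = 0" using twisted_mod.Y_mem[OF tm[OF x] v w] by (rule rel)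
    finally show ?thesis .
  qed
  have "fin_dim (cvec.span (z ` A))" using fA by (auto simp: fin_dim_def)
  then obtain B where B: "finite B" "is_basis B (cvec.span (z ` A))" "B \<subseteq> cvec.span (z ` A)"
    using fin_dim_basis by blast
  have BM: "B \<subseteq> mcarrier (M y)"
    using B(3) zm cvec.span_minimal[of "z ` A" "mcarrier (M y)"] M_sub[OF y] by blast
  define \<beta> where "\<beta> a b = cvec.representation B (z a) b" for a b
  have z: "z a = (\<Sum>b\<in>B. \<beta> a b *\<^sub>C b)" if "a \<in> A" for a
    unfolding \<beta>_def using is_basis_sum_representation[OF B(2,1)] that cvec.span_base[of "z a" "z ` A"] by simp
  define u where "u b = (\<Sum>a\<in>A. \<beta> a b *\<^sub>C \<rho> a v)" for b
  have \<rho>v: "\<rho> a v \<in> vcarrier V" if "a \<in> A" for a using \<rho>_mem[OF _ v] that A by auto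
  have uV: "u b \<in> vcarrier V" for b
    unfolding u_def using \<rho>v by (intro cvec.subspace_sum[OF V_subspace] cvec.subspace_scale[OF V_subspace])
  have "(\<Sum>b\<in>B. mY (M y) (u b) s b) = 0" for s
  proof -
    have "(\<Sum>b\<in>B. mY (M y) (u b) s b) = (\<Sum>b\<in>B. \<Sum>a\<in>A. \<beta> a b *\<^sub>C mY (M y) (\<rho> a v) s b)"
      unfolding u_def using BM \<rho>v
      by (intro sum.cong refl linear_map_lincomb[OF twisted_mod.Y_linear_left[OF tm[OF y]] V_subspace]) auto
    also have "\<dots> = (\<Sum>a\<in>A. \<Sum>b\<in>B. \<beta> a b *\<^sub>C mY (M y) (\<rho> a v) s b)" by (rule sum.swap)
    also have "\<dots> = (\<Sum>a\<in>A. mY (M y) (\<rho> a v) s (z a))"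
    proof (intro sum.cong refl)
      fix a assume a: "a \<in> A"
      show "(\<Sum>b\<in>B. \<beta> a b *\<^sub>C mY (M y) (\<rho> a v) s b) = mY (M y) (\<rho> a v) s (z a)"
        unfolding z[OF a] using BM
        by (intro linear_map_lincomb[OF twisted_mod.Y_linear[OF tm[OF y] \<rho>v[OF a]] M_sub[OF y], symmetric]) auto
    qed
    finally show ?thesis using zs by simp
  qed
  then have u0: "u b = 0" if "b \<in> B" for b
    using modes_independent[OF y B(1) _ BM, of u b] uV that B(2) by (simp add: is_basis_def)
  have "(\<Sum>a\<in>A. \<beta> a b * l (\<rho> a v)) = 0" if "b \<in> B" for b
  proof -
    have "l (u b) = (\<Sum>a\<in>A. \<beta> a b *\<^sub>C l (\<rho> a v))"
      unfolding u_def by (intro linear_map_lincomb[OF l]) auto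
    then show ?thesis using u0[OF that] linear_map_zero[OF l] by (simp add: scaleC_complex_def)
  qed
  then have "(\<Sum>b\<in>B. (\<Sum>a\<in>A. \<beta> a b * l (\<rho> a v)) *\<^sub>C b) = 0" by simp
  then have "(\<Sum>a\<in>A. \<Sum>b\<in>B. (\<beta> a b * l (\<rho> a v)) *\<^sub>C b) = 0"
    unfolding cvec.scale_sum_left by (subst sum.swap)
  moreover have "(\<Sum>b\<in>B. (\<beta> a b * l (\<rho> a v)) *\<^sub>C b) = (l (\<rho> a v) * c a) *\<^sub>C \<phi> x a w" if "a \<in> A" for a
  proof -
    have "(l (\<rho> a v) * c a) *\<^sub>C \<phi> x a w = l (\<rho> a v) *\<^sub>C z a" by (simp add: z_def scaleC_scaleC)
    then show ?thesis unfolding z[OF that] by (simp add: cvec.scale_sum_right scaleC_scaleC mult.commute)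
  qed
  ultimately show ?thesis by simp
qed

text \<open>Matrix coefficients of \<open>\<rho>\<close> separate the points of \<open>A\<close>, so \<open>relation_twist\<close> shortens relations.\<close>

lemma \<phi>_independent:
  assumes x: "x \<in> carrier G" and y: "y \<in> carrier G" and A: "A \<subseteq> carrier G" "\<And>a. a \<in> A \<Longrightarrow> a \<otimes> x \<otimes> inv a = y"
    and rel: "\<And>w. w \<in> mcarrier (M x) \<Longrightarrow> (\<Sum>a\<in>A. c a *\<^sub>C \<phi> x a w) = 0"
    and a: "a \<in> A"
  shows "c a = 0"
  using A rel a
proof (induction "card A" arbitrary: A c a rule: less_induct)
  case less
  have fA: "finite A" using less.prems(1) finite_carrier finite_subset by blast
  show ?case
  proof (cases "A = {a}")
    case True
    obtain w where w: "w \<in> mcarrier (M x)" "w \<noteq> 0" using M_ex_nonzero[OF x] by blast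
    have "c a *\<^sub>C \<phi> x a w = 0" using less.prems(3)[OF w(1)] True by simp
    moreover have "\<phi> x a w \<noteq> 0" using \<phi>_nonzero[OF x _ w] less.prems(1,4) by blast
    ultimately show ?thesis by simp
  next
    case False
    then obtain b where b: "b \<in> A" "b \<noteq> a" using less.prems(4) by blast
    have bG: "b \<in> carrier G" and aG: "a \<in> carrier G" using b less.prems(1,4) by auto
    obtain v where v: "v \<in> vcarrier V" "\<rho> a v \<noteq> \<rho> b v" using \<rho>_eqD[OF aG bG] b(2) by blast
    have "\<rho> a v - \<rho> b v \<noteq> 0" using v(2) by simp
    then obtain l :: "'v \<Rightarrow> complex" where l: "linear_map UNIV UNIV l" "l (\<rho> a v - \<rho> b v) = 1"
      using ex_linear_functional by blast
    have lab: "l (\<rho> a v) - l (\<rho> b v) = 1" using l linear_map_diff[OF l(1)] by simp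
    \<comment> \<open>The difference of the twisted relation and \<open>l (\<rho> b v)\<close> times
      the original one has no term at \<open>b\<close>, while the coefficient at \<open>a\<close>
      keeps its value because of \<open>lab\<close>.\<close>
    have "(l (\<rho> a v) - l (\<rho> b v)) * c a = 0"
    proof (rule less.hyps[of "A - {b}" "\<lambda>a. (l (\<rho> a v) - l (\<rho> b v)) * c a" a])
      show "card (A - {b}) < card A" using b(1) fA by (intro psubset_card_mono) auto
      fix w assume w: "w \<in> mcarrier (M x)"
      have "(\<Sum>a\<in>A - {b}. ((l (\<rho> a v) - l (\<rho> b v)) * c a) *\<^sub>C \<phi> x a w)
          = (\<Sum>a\<in>A. ((l (\<rho> a v) - l (\<rho> b v)) * c a) *\<^sub>C \<phi> x a w)"
        using fA by (intro sum.mono_neutral_left) auto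
      also have "\<dots> = (\<Sum>a\<in>A. (l (\<rho> a v) * c a) *\<^sub>C \<phi> x a w) - l (\<rho> b v) *\<^sub>C (\<Sum>a\<in>A. c a *\<^sub>C \<phi> x a w)"
        by (simp add: cvec.scale_sum_right scaleC_scaleC left_diff_distrib cvec.scale_left_diff_distrib sum_subtractf)
      also have "\<dots> = 0"
        using relation_twist[OF x y less.prems(1,2,3) v(1) l(1) w] less.prems(3)[OF w] by simp
      finally show "(\<Sum>a\<in>A - {b}. ((l (\<rho> a v) - l (\<rho> b v)) * c a) *\<^sub>C \<phi> x a w) = 0" .
    qed (use less.prems b in auto)
    then show ?thesis using lab by simp
  qed
qed

text \<open>Acting on vectors of one component x and looking at one component y isolates a relation
  among the \<open>\<phi> x b\<close> with fixed source and target, which is trivial by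
  \<open>\<phi>_independent\<close>.\<close>

lemma DV_faithful:
  assumes d: "d \<in> acarrier D" and zero: "\<And>f. f \<in> mcarrier VS \<Longrightarrow> double_action G \<phi> d f = 0"
  shows "d = 0"
proof
  fix p
  show "d p = 0 p"
  proof (cases "p \<in> carrier G \<times> carrier G")
    case True
    then obtain a x where p: "p = (a, x)" and a: "a \<in> carrier G" and x: "x \<in> carrier G" by auto
    define y where "y = a \<otimes> x \<otimes> inv a"
    have y: "y \<in> carrier G" using a x by (simp add: y_def)
    define A where "A = {b \<in> carrier G. b \<otimes> x \<otimes> inv b = y}"
    have "d (a, x) = 0"
    proof (rule \<phi>_independent[OF x y, where A = A and c = "\<lambda>b. d (b, x)"])
      fix w assume w: "w \<in> mcarrier (M x)"
      let ?f = "single x w"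
      have "0 = double_action G \<phi> d ?f y" using zero[OF single_mem[OF x w]] by simp
      also have "\<dots> = (\<Sum>p\<in>carrier G \<times> carrier G. d p *\<^sub>C X (fst p) (snd p) ?f y)"
        unfolding double_action_X sum_fun_apply by (simp add: scaleC_fun_def)
      also have "\<dots> = (\<Sum>b\<in>carrier G. \<Sum>x'\<in>carrier G. d (b, x') *\<^sub>C X b x' ?f y)"
        by (simp add: sum.cartesian_product case_prod_unfold)
      also have "\<dots> = (\<Sum>b\<in>carrier G. if b \<in> A then d (b, x) *\<^sub>C \<phi> x b w else 0)"
      proof (intro sum.cong refl)
        fix b assume b: "b \<in> carrier G"
        have "X b x' ?f y = 0" if "x' \<in> carrier G" "x' \<noteq> x" for x'
          using that linear_map_zero[OF \<phi>_facts(2)[OF that(1) b] M_sub[OF that(1)]] by (simp add: X_def single_def)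
        then have "(\<Sum>x'\<in>carrier G. d (b, x') *\<^sub>C X b x' ?f y) = (\<Sum>x'\<in>{x}. d (b, x') *\<^sub>C X b x' ?f y)"
          using x finite_carrier by (intro sum.mono_neutral_right) auto
        then show "(\<Sum>x'\<in>carrier G. d (b, x') *\<^sub>C X b x' ?f y) = (if b \<in> A then d (b, x) *\<^sub>C \<phi> x b w else 0)"
          using b by (auto simp: X_def single_def A_def)
      qed
      also have "\<dots> = (\<Sum>b\<in>A. d (b, x) *\<^sub>C \<phi> x b w)"
        using finite_carrier by (intro sum.mono_neutral_cong_right) (auto simp: A_def)
      finally show "(\<Sum>b\<in>A. d (b, x) *\<^sub>C \<phi> x b w) = 0" ..
    qed (use a in \<open>auto simp: A_def y_def\<close>)
    then show ?thesis by (simp add: p)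
  next
    case False
    then show ?thesis using d by (cases p) (auto simp: twisted_double_def)
  qed
qed

text \<open>\<open>jacobson_density\<close> is applied to the span \<open>R\<close> of the tuples
  that single modes produce from the given vectors. Stability of \<open>R\<close> under a further
  mode is where products of modes must again be combinations of modes.\<close>

lemma modes_span_density:
  assumes J: "finite J" "\<And>k b. (k, b) \<in> J \<Longrightarrow> k \<in> carrier G \<and> b \<in> mcarrier (M k)"
    "\<And>k. k \<in> carrier G \<Longrightarrow> cvec.independent {b. (k, b) \<in> J}"
    and t: "\<And>k b. (k, b) \<in> J \<Longrightarrow> t (k, b) \<in> mcarrier (M k)"
  obtains F c where "finite F" "F \<subseteq> vcarrier V \<times> (UNIV :: rat set)"
    "\<And>k b. (k, b) \<in> J \<Longrightarrow> t (k, b) = (\<Sum>z\<in>F. c z *\<^sub>C mY (M k) (fst z) (snd z) b)"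
proof -
  define E where "E z = (\<lambda>j. if j \<in> J then mY (M (fst j)) (fst z) (snd z) (snd j) else 0)" for z
  define R where "R = cvec.span (E ` (vcarrier V \<times> UNIV))"
  have Jm: "fst j \<in> carrier G" "snd j \<in> mcarrier (M (fst j))" if "j \<in> J" for j
    using J(2)[of "fst j" "snd j"] that by auto
  define P where "P = {r. (\<forall>j\<in>J. r j \<in> mcarrier (M (fst j))) \<and> (\<forall>j. j \<notin> J \<longrightarrow> r j = 0)}"
  have P: "cvec.subspace P"
    by (rule cvec.subspaceI)
       (use cvec.subspace_0[OF M_sub[OF Jm(1)]] cvec.subspace_add[OF M_sub[OF Jm(1)]]
         cvec.subspace_scale[OF M_sub[OF Jm(1)]] in \<open>auto simp: P_def scaleC_fun_def\<close>)
  have EP: "E z \<in> P" if "z \<in> vcarrier V \<times> UNIV" for z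
    using that twisted_mod.Y_mem[OF tm[OF Jm(1)] _ Jm(2)] by (auto simp: P_def E_def)
  then have RP: "R \<subseteq> P" unfolding R_def using P by (intro cvec.span_minimal) auto
  have "(\<lambda>j. if j \<in> J then t j else 0) \<in> R"
  proof (rule jacobson_density[where S = "\<lambda>g. mcarrier (M g)" and act = "\<lambda>g (v, n). mY (M g) v n"
        and Op = "vcarrier V \<times> UNIV" and K = "carrier G" and J = J])
    show "cvec.subspace (mcarrier (M k))" if "k \<in> carrier G" for k using that M_sub by simp
    show "linear_map (mcarrier (M k)) (mcarrier (M k)) (case a of (v, n) \<Rightarrow> mY (M k) v n)"
      if "k \<in> carrier G" "a \<in> vcarrier V \<times> UNIV" for k a
      using that M_action[of k] unfolding simple_action_def by blast
    show "W = {0} \<or> W = mcarrier (M k)"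
      if "k \<in> carrier G" "cvec.subspace W" "W \<subseteq> mcarrier (M k)"
        "\<forall>a\<in>vcarrier V \<times> UNIV. \<forall>w\<in>W. (case a of (v, n) \<Rightarrow> mY (M k) v n) w \<in> W" for k W
      using that M_action[of k] unfolding simple_action_def by blast
    show "\<exists>c. \<forall>w\<in>mcarrier (M k). f w = (if k = l then c *\<^sub>C w else 0)"
      if "k \<in> carrier G" "l \<in> carrier G" "linear_map (mcarrier (M k)) (mcarrier (M l)) f"
        "\<forall>a\<in>vcarrier V \<times> UNIV. \<forall>w\<in>mcarrier (M k).
          f ((case a of (v, n) \<Rightarrow> mY (M k) v n) w) = (case a of (v, n) \<Rightarrow> mY (M l) v n) (f w)" for k l f
      using that M_schur by blast
    show "finite J" by (rule J(1))
    show "k \<in> carrier G \<and> b \<in> mcarrier (M k)" if "(k, b) \<in> J" for k b using J(2)[OF that] .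
    show "cvec.independent {b. (k, b) \<in> J}" if "k \<in> carrier G" for k using J(3)[OF that] .
    show "cvec.subspace R" unfolding R_def by (rule cvec.subspace_span)
    show "r j \<in> mcarrier (M (fst j))" if "r \<in> R" "j \<in> J" for r j using that RP by (auto simp: P_def)
    show "r j = 0" if "r \<in> R" "j \<notin> J" for r j using that RP unfolding P_def by blast
    show "(\<lambda>j. if j \<in> J then (case a of (v, n) \<Rightarrow> mY (M (fst j)) v n) (r j) else 0) \<in> R"
      if r: "r \<in> R" and a: "a \<in> vcarrier V \<times> UNIV" for r a
    proof -
      obtain v n where a': "a = (v, n)" "v \<in> vcarrier V" using a by auto
      define A where "A r = (\<lambda>j. if j \<in> J then mY (M (fst j)) v n (r j) else 0)" for r
      note Ylin = twisted_mod.Y_linear[OF tm[OF Jm(1)] a'(2)]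
      have A: "linear_map P P A"
        unfolding linear_map_def
      proof (intro conjI ballI allI)
        fix r assume r: "r \<in> P"
        show "A r \<in> P" using r linear_map_mem[OF Ylin] by (auto simp: A_def P_def)
        show "A (c *\<^sub>C r) = c *\<^sub>C A r" for c
        proof
          fix j
          show "A (c *\<^sub>C r) j = (c *\<^sub>C A r) j"
            using r linear_map_scale[OF Ylin, of j "r j" n c] by (simp add: A_def P_def scaleC_fun_def)
        qed
        show "A (r + r') = A r + A r'" if r': "r' \<in> P" for r'
        proof
          fix j
          show "A (r + r') j = (A r + A r') j"
            using r r' linear_map_add[OF Ylin, of j "r j" "r' j" n] by (simp add: A_def P_def)
        qed
      qed
      \<comment> \<open>The entries of the tuple lie in modules with different twists;
        \<open>product_via_iterates\<close> gives one combination valid in all slots.\<close>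
      have "A (E z) \<in> R" if z: "z \<in> vcarrier V \<times> UNIV" for z
      proof -
        have zV: "fst z \<in> vcarrier V" using z by auto
        obtain F c where F: "finite F" "\<And>j. j \<in> J \<Longrightarrow> mY (M (fst j)) v n (mY (M (fst j)) (fst z) (snd z) (snd j))
            = (\<Sum>z'\<in>F. c z' *\<^sub>C mY (M (fst j)) (vY V v (fst z') (fst z)) (snd z') (snd j))"
          using product_via_iterates[where g = "\<lambda>j. \<rho> (fst j)" and M = "\<lambda>j. M (fst j)" and w = snd,
              OF J(1) tm[OF Jm(1)] a'(2) zV Jm(2)] by meson
        have "A (E z) = (\<Sum>z'\<in>F. c z' *\<^sub>C E (vY V v (fst z') (fst z), snd z'))"
        proof
          fix j
          show "A (E z) j = (\<Sum>z'\<in>F. c z' *\<^sub>C E (vY V v (fst z') (fst z), snd z')) j"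
            unfolding sum_fun_apply using F(2)[of j] by (auto simp: A_def E_def scaleC_fun_def)
        qed
        also have "\<dots> \<in> R"
          unfolding R_def using linear_map_mem[OF is_voaD(2)[OF is_voa a'(2)] zV]
          by (intro cvec.span_sum cvec.span_scale cvec.span_base) auto
        finally show ?thesis .
      qed
      moreover have "cvec.subspace {r \<in> P. A r \<in> R}"
      proof (rule cvec.subspaceI)
        have "A 0 = 0" using linear_map_zero[OF A P] .
        then show "0 \<in> {r \<in> P. A r \<in> R}" using cvec.subspace_0[OF P] by (simp add: R_def cvec.span_zero)
        fix r r' assume rr: "r \<in> {r \<in> P. A r \<in> R}" "r' \<in> {r \<in> P. A r \<in> R}"
        have "A (r + r') = A r + A r'" using linear_map_add[OF A] rr by blast
        then show "r + r' \<in> {r \<in> P. A r \<in> R}" using rr cvec.subspace_add[OF P] by (simp add: R_def cvec.span_add)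
      next
        fix c r assume rr: "r \<in> {r \<in> P. A r \<in> R}"
        have "A (c *\<^sub>C r) = c *\<^sub>C A r" using linear_map_scale[OF A] rr by blast
        then show "c *\<^sub>C r \<in> {r \<in> P. A r \<in> R}" using rr cvec.subspace_scale[OF P] by (simp add: R_def cvec.span_scale)
      qed
      ultimately have "R \<subseteq> {r \<in> P. A r \<in> R}" using EP unfolding R_def by (intro cvec.span_minimal) auto
      then have "A r \<in> R" using r by blast
      then show ?thesis unfolding A_def a'(1) prod.case .
    qed
    have "(\<lambda>j. if j \<in> J then snd j else 0) = E (vvac V, -1)"
      using twisted_mod.Y_vac[OF tm[OF Jm(1)] Jm(2)] by (auto simp: E_def)
    then show "(\<lambda>j. if j \<in> J then snd j else 0) \<in> R"
      unfolding R_def using is_voaD(5)[OF is_voa] by (auto intro: cvec.span_base)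
    show "(if j \<in> J then t j else 0) \<in> mcarrier (M (fst j))" if "j \<in> J" for j
      using t[of "fst j" "snd j"] that by simp
  qed auto
  then obtain F c where F: "finite F" "F \<subseteq> vcarrier V \<times> UNIV"
    "(\<lambda>j. if j \<in> J then t j else 0) = (\<Sum>z\<in>F. c z *\<^sub>C E z)"
    unfolding R_def by (rule span_image_explicit)
  show ?thesis
  proof
    fix k b assume kb: "(k, b) \<in> J"
    have "t (k, b) = (\<Sum>z\<in>F. c z *\<^sub>C E z) (k, b)" using fun_cong[OF F(3), of "(k, b)"] kb by simp
    then show "t (k, b) = (\<Sum>z\<in>F. c z *\<^sub>C mY (M k) (fst z) (snd z) b)"
      unfolding sum_fun_apply using kb by (simp add: E_def scaleC_fun_def)
  qed (use F in auto)
qed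

text \<open>The Reynolds operator of the group.\<close>

definition mean :: "'v \<Rightarrow> 'v" where
  "mean v = inverse (of_nat (card (carrier G))) *\<^sub>C (\<Sum>a\<in>carrier G. \<rho> a v)"

lemma mean_mem:
  assumes v: "v \<in> vcarrier V"
  shows "mean v \<in> vcarrier VG"
proof -
  have s: "(\<Sum>a\<in>carrier G. \<rho> a v) \<in> vcarrier V"
    using \<rho>_mem[OF _ v] by (intro cvec.subspace_sum[OF V_subspace])
  have "\<rho> b (mean v) = mean v" if b: "b \<in> carrier G" for b
  proof -
    have "\<rho> b (\<Sum>a\<in>carrier G. \<rho> a v) = (\<Sum>a\<in>carrier G. \<rho> b (\<rho> a v))"
      using \<rho>_mem[OF _ v] by (intro linear_map_sum[OF \<rho>_linear[OF b] V_subspace])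
    also have "\<dots> = (\<Sum>a\<in>carrier G. \<rho> (b \<otimes> a) v)" using \<rho>_mult[OF b _ v] by simp
    also have "\<dots> = (\<Sum>a\<in>carrier G. \<rho> a v)"
    proof (rule sum.reindex_bij_betw)
      show "bij_betw (\<lambda>a. b \<otimes> a) (carrier G) (carrier G)"
      proof (rule bij_betw_byWitness[where f' = "\<lambda>a. inv b \<otimes> a"])
        show "\<forall>a\<in>carrier G. inv b \<otimes> (b \<otimes> a) = a" "\<forall>a\<in>carrier G. b \<otimes> (inv b \<otimes> a) = a"
          using b by (simp_all add: m_assoc[symmetric])
      qed (use b in auto)
    qed
    finally show ?thesis unfolding mean_def using linear_map_scale[OF \<rho>_linear[OF b] s] by simp
  qed
  then show ?thesis using s cvec.subspace_scale[OF V_subspace] by (simp add: VG_iff mean_def)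
qed

text \<open>Density yields \<open>B\<close> as a combination of modes of \<open>V\<close>; as \<open>B\<close> commutes with \<open>D\<close>, conjugating by the
  intertwiners and averaging replaces each mode by that of a fixed vector.\<close>

lemma fixed_modes_density:
  assumes W: "fin_dim W" "W \<subseteq> mcarrier VS" "\<And>d w. d \<in> acarrier D \<Longrightarrow> w \<in> W \<Longrightarrow> double_action G \<phi> d w \<in> W"
    and B: "linear_map W (mcarrier VS) B"
    and comm: "\<And>d w. d \<in> acarrier D \<Longrightarrow> w \<in> W \<Longrightarrow> B (double_action G \<phi> d w) = double_action G \<phi> d (B w)"
  obtains F c where "finite F" "F \<subseteq> vcarrier V \<times> (UNIV :: rat set)"
    "\<And>w. w \<in> W \<Longrightarrow> B w = (\<Sum>z\<in>F. c z *\<^sub>C mY VS (mean (fst z)) (snd z) w)"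
proof -
  have subW: "cvec.subspace W" using W(1) by (rule fin_dim_subspace)
  have XW: "X a x w \<in> W" and XB: "B (X a x w) = X a x (B w)"
    if "a \<in> carrier G" "x \<in> carrier G" "w \<in> W" for a x w
    using W(3)[OF \<xi>_mem[OF that(1,2)] that(3)] comm[OF \<xi>_mem[OF that(1,2)] that(3)] action_\<xi>[OF that(1,2)] by auto
  have BS: "B w \<in> mcarrier VS" if "w \<in> W" for w using linear_map_mem[OF B that] .
  \<comment> \<open>The homogeneous components of a vector are obtained by the action of the double.
    Hence \<open>W\<close> is graded by \<open>G\<close> and \<open>B\<close> preserves the
    grading.\<close>
  have single_X: "single x (f x) = inverse (\<alpha> x \<one> \<one>) *\<^sub>C X \<one> x f" if "x \<in> carrier G" "f \<in> mcarrier VS" for x f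
    using X_one[OF that] \<alpha>_spec[OF that(1) one_closed one_closed] by (simp add: scaleC_scaleC scaleC_one)
  have single_W: "single x (w x) \<in> W" if "x \<in> carrier G" "w \<in> W" for x w
    using single_X[OF that(1)] XW[OF one_closed that] W(2) that(2) cvec.subspace_scale[OF subW] by auto
  have single_B: "B (single x (w x)) = single x (B w x)" if x: "x \<in> carrier G" and w: "w \<in> W" for x w
  proof -
    have "B (single x (w x)) = inverse (\<alpha> x \<one> \<one>) *\<^sub>C B (X \<one> x w)"
      using single_X[OF x] w W(2) linear_map_scale[OF B XW[OF one_closed x w]] by auto
    then show ?thesis using XB[OF one_closed x w] single_X[OF x BS[OF w]] by simp
  qed
  define P where "P x = (\<lambda>w. w x) ` W" for x
  have ev: "linear_map W UNIV (\<lambda>w. w x)" for x by (auto simp: linear_map_def scaleC_fun_def)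
  have Pf: "fin_dim (P x)" for x unfolding P_def using image_fin_dim[OF ev W(1)] .
  have "\<exists>b. finite b \<and> is_basis b (P x) \<and> b \<subseteq> P x" for x using fin_dim_basis[OF Pf] by metis
  then obtain b where b: "\<And>x. finite (b x)" "\<And>x. is_basis (b x) (P x)" "\<And>x. b x \<subseteq> P x" by metis
  have P_single: "single x y \<in> W" if x: "x \<in> carrier G" and y: "y \<in> P x" for x y
    using y single_W[OF x] by (auto simp: P_def)
  have PM: "P x \<subseteq> mcarrier (M x)" if "x \<in> carrier G" for x
    using W(2) VS_mem that by (auto simp: P_def)
  define T where "T x y = B (single x y) x" for x y
  have T_lin: "linear_map (P x) (mcarrier (M x)) (T x)" if x: "x \<in> carrier G" for x
    unfolding linear_map_def T_def
  proof (intro conjI ballI allI)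
    fix y assume y: "y \<in> P x"
    show "B (single x y) x \<in> mcarrier (M x)" using VS_mem[OF BS[OF P_single[OF x y]] x] .
    show "B (single x (c *\<^sub>C y)) x = c *\<^sub>C B (single x y) x" for c
      using linear_map_scale[OF B P_single[OF x y]] by (simp add: single_scale scaleC_fun_def)
    fix y' assume y': "y' \<in> P x"
    show "B (single x (y + y')) x = B (single x y) x + B (single x y') x"
      using linear_map_add[OF B P_single[OF x y] P_single[OF x y']] by (simp add: single_add)
  qed
  define J where "J = Sigma (carrier G) b"
  obtain F c where F: "finite F" "F \<subseteq> vcarrier V \<times> (UNIV :: rat set)"
    "\<And>k y. (k, y) \<in> J \<Longrightarrow> (case (k, y) of (k, y) \<Rightarrow> T k y) = (\<Sum>z\<in>F. c z *\<^sub>C mY (M k) (fst z) (snd z) y)"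
  proof (rule modes_span_density[of J "\<lambda>(k, y). T k y"])
    show "finite J" using finite_carrier b(1) by (auto simp: J_def)
    show "k \<in> carrier G \<and> y \<in> mcarrier (M k)" if "(k, y) \<in> J" for k y
      using that b(3) PM by (auto simp: J_def)
    show "cvec.independent {y. (k, y) \<in> J}" if "k \<in> carrier G" for k
      using that b(2)[of k] by (simp add: J_def is_basis_def)
    show "(case (k, y) of (k, y) \<Rightarrow> T k y) \<in> mcarrier (M k)" if "(k, y) \<in> J" for k y
      using that linear_map_mem[OF T_lin, of k y] b(3)[of k] by (auto simp: J_def)
  qed blast
  have Fm: "fst z \<in> vcarrier V" if "z \<in> F" for z using F(2) that by auto
  have T_eq: "T x y = (\<Sum>z\<in>F. c z *\<^sub>C mY (M x) (fst z) (snd z) y)" if x: "x \<in> carrier G" and y: "y \<in> P x" for x y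
  proof -
    let ?r = "cvec.representation (b x) y"
    have ys: "(\<Sum>b\<in>b x. ?r b *\<^sub>C b) = y" using is_basis_sum_representation[OF b(2,1) y] .
    have "T x (\<Sum>b\<in>b x. ?r b *\<^sub>C b) = (\<Sum>b\<in>b x. ?r b *\<^sub>C T x b)"
      using b(3) by (intro linear_map_lincomb[OF T_lin[OF x] fin_dim_subspace[OF Pf]]) auto
    also have "\<dots> = (\<Sum>b\<in>b x. \<Sum>z\<in>F. c z *\<^sub>C ?r b *\<^sub>C mY (M x) (fst z) (snd z) b)"
    proof (rule sum.cong[OF refl])
      fix b' assume "b' \<in> b x"
      then have "T x b' = (\<Sum>z\<in>F. c z *\<^sub>C mY (M x) (fst z) (snd z) b')"
        using F(3)[of x b'] x by (simp add: J_def)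
      then show "?r b' *\<^sub>C T x b' = (\<Sum>z\<in>F. c z *\<^sub>C ?r b' *\<^sub>C mY (M x) (fst z) (snd z) b')"
        by (simp only: cvec.scale_sum_right cvec.scale_left_commute)
    qed
    also have "\<dots> = (\<Sum>z\<in>F. c z *\<^sub>C (\<Sum>b\<in>b x. ?r b *\<^sub>C mY (M x) (fst z) (snd z) b))"
      unfolding cvec.scale_sum_right by (rule sum.swap)
    also have "\<dots> = (\<Sum>z\<in>F. c z *\<^sub>C mY (M x) (fst z) (snd z) (\<Sum>b\<in>b x. ?r b *\<^sub>C b))"
    proof (intro sum.cong refl)
      fix z assume z: "z \<in> F"
      have "mY (M x) (fst z) (snd z) (\<Sum>b\<in>b x. ?r b *\<^sub>C b) = (\<Sum>b\<in>b x. ?r b *\<^sub>C mY (M x) (fst z) (snd z) b)"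
        using b(3) PM[OF x]
        by (intro linear_map_lincomb[OF twisted_mod.Y_linear[OF tm[OF x] Fm[OF z]] M_sub[OF x]]) auto
      then show "c z *\<^sub>C (\<Sum>b\<in>b x. ?r b *\<^sub>C mY (M x) (fst z) (snd z) b)
          = c z *\<^sub>C mY (M x) (fst z) (snd z) (\<Sum>b\<in>b x. ?r b *\<^sub>C b)" by simp
    qed
    finally show ?thesis unfolding ys .
  qed
  \<comment> \<open>The component at h is carried by \<open>inv a\<close> to the component at g,
    where the combination is applied, and returned by \<open>\<phi> g a\<close>. \<open>B\<close>
    commutes with both moves, while each mode of v comes back as a mode of
    \<open>\<rho> a v\<close>.\<close>
  have twist: "B w h = (\<Sum>z\<in>F. c z *\<^sub>C mY (M h) (\<rho> a (fst z)) (snd z) (w h))"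
    if w: "w \<in> W" and h: "h \<in> carrier G" and a: "a \<in> carrier G" for w h a
  proof -
    define g where "g = inv a \<otimes> h \<otimes> a"
    have g: "g \<in> carrier G" using a h by (simp add: g_def)
    have gh: "a \<otimes> g \<otimes> inv a = h" using a h by (simp add: g_def m_assoc[symmetric]) (simp add: m_assoc)
    have hg: "inv a \<otimes> h \<otimes> inv (inv a) = g" using a by (simp add: g_def)
    have ia: "inv a \<in> carrier G" using a by simp
    define w1 where "w1 = X (inv a) h w"
    have w1: "w1 \<in> W" unfolding w1_def using XW[OF ia h w] .
    \<comment> \<open>The scalar by which going to g and back acts on the component at h; it cancels
      at the end.\<close>
    define \<kappa> where "\<kappa> = \<alpha> h a (inv a) * \<alpha> h \<one> \<one>"
    have \<kappa>0: "\<kappa> \<noteq> 0" using \<alpha>_spec[OF h a ia] \<alpha>_spec[OF h one_closed one_closed] by (simp add: \<kappa>_def)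
    have Xw1: "X a g w1 = \<kappa> *\<^sub>C single h (w h)"
      using X_mult[OF a g ia h, of w] W(2) w hg a X_one[OF h, of w] by (auto simp: w1_def \<kappa>_def scaleC_scaleC)
    have w1g: "w1 g \<in> P g" using w1 by (auto simp: P_def)
    have w1m: "w1 g \<in> mcarrier (M g)" using w1g PM[OF g] by auto
    have "T g (w1 g) = B w1 g" using single_B[OF g w1] by (simp add: T_def single_def)
    then have "\<phi> g a (B w1 g) = \<phi> g a (\<Sum>z\<in>F. c z *\<^sub>C mY (M g) (fst z) (snd z) (w1 g))"
      using T_eq[OF g w1g] by simp
    also have "\<dots> = (\<Sum>z\<in>F. c z *\<^sub>C \<phi> g a (mY (M g) (fst z) (snd z) (w1 g)))"
      using twisted_mod.Y_mem[OF tm[OF g] Fm w1m] by (intro linear_map_lincomb[OF \<phi>_facts(2)[OF g a] M_sub[OF g]])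
    also have "\<dots> = (\<Sum>z\<in>F. c z *\<^sub>C mY (M h) (\<rho> a (fst z)) (snd z) (\<phi> g a (w1 g)))"
      using \<phi>_facts(3)[OF g a Fm w1m] gh by simp
    finally have 1: "\<phi> g a (B w1 g) = (\<Sum>z\<in>F. c z *\<^sub>C mY (M h) (\<rho> a (fst z)) (snd z) (\<phi> g a (w1 g)))" .
    have "\<phi> g a (w1 g) = X a g w1 h" using gh by (simp add: X_def)
    also have "\<dots> = \<kappa> *\<^sub>C w h" unfolding Xw1 by (simp add: single_def scaleC_fun_def)
    finally have 2: "\<phi> g a (w1 g) = \<kappa> *\<^sub>C w h" .
    have "\<phi> g a (B w1 g) = X a g (B w1) h" using gh by (simp add: X_def)
    also have "\<dots> = B (\<kappa> *\<^sub>C single h (w h)) h" using XB[OF a g w1] Xw1 by simp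
    also have "\<dots> = \<kappa> *\<^sub>C B w h"
      using linear_map_scale[OF B single_W[OF h w]] single_B[OF h w] by (simp add: single_def scaleC_fun_def)
    finally have 3: "\<phi> g a (B w1 g) = \<kappa> *\<^sub>C B w h" .
    have wh: "w h \<in> mcarrier (M h)" using w W(2) VS_mem[OF _ h] by auto
    have "\<kappa> *\<^sub>C B w h = (\<Sum>z\<in>F. c z *\<^sub>C \<kappa> *\<^sub>C mY (M h) (\<rho> a (fst z)) (snd z) (w h))"
      using 1 unfolding 2 3
      using linear_map_scale[OF twisted_mod.Y_linear[OF tm[OF h] \<rho>_mem[OF a Fm]] wh] by simp
    also have "\<dots> = \<kappa> *\<^sub>C (\<Sum>z\<in>F. c z *\<^sub>C mY (M h) (\<rho> a (fst z)) (snd z) (w h))"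
      unfolding cvec.scale_sum_right by (intro sum.cong refl cvec.scale_left_commute)
    finally show ?thesis using \<kappa>0 by simp
  qed
  show ?thesis
  proof
    fix w assume w: "w \<in> W"
    show "B w = (\<Sum>z\<in>F. c z *\<^sub>C mY VS (mean (fst z)) (snd z) w)"
    proof
      fix h
      show "B w h = (\<Sum>z\<in>F. c z *\<^sub>C mY VS (mean (fst z)) (snd z) w) h"
      proof (cases "h \<in> carrier G")
        case False
        then show ?thesis using BS[OF w] by (simp add: sum_fun_apply VS_iff VS_Y scaleC_fun_def)
      next
        case True
        let ?n = "of_nat (card (carrier G)) :: complex"
        have wh: "w h \<in> mcarrier (M h)" using w W(2) VS_mem[OF _ True] by auto
        \<comment> \<open>Since \<open>twist\<close> holds for every a with the same coefficients,
          its instances may be averaged.\<close>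
        have "?n *\<^sub>C B w h = (\<Sum>a\<in>carrier G. B w h)" by (simp add: cvec.sum_constant_scale)
        also have "\<dots> = (\<Sum>a\<in>carrier G. \<Sum>z\<in>F. c z *\<^sub>C mY (M h) (\<rho> a (fst z)) (snd z) (w h))"
          using twist[OF w True] by (intro sum.cong refl)
        also have "\<dots> = (\<Sum>z\<in>F. c z *\<^sub>C (\<Sum>a\<in>carrier G. mY (M h) (\<rho> a (fst z)) (snd z) (w h)))"
          unfolding cvec.scale_sum_right by (rule sum.swap)
        also have "\<dots> = (\<Sum>z\<in>F. c z *\<^sub>C ?n *\<^sub>C mY (M h) (mean (fst z)) (snd z) (w h))"
        proof (rule sum.cong[OF refl])
          fix z assume z: "z \<in> F"
          note L = twisted_mod.Y_linear_left[OF tm[OF True] wh]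
          have s: "(\<Sum>a\<in>carrier G. \<rho> a (fst z)) \<in> vcarrier V"
            using \<rho>_mem[OF _ Fm[OF z]] by (intro cvec.subspace_sum[OF V_subspace])
          have "mY (M h) (mean (fst z)) (snd z) (w h)
              = inverse ?n *\<^sub>C mY (M h) (\<Sum>a\<in>carrier G. \<rho> a (fst z)) (snd z) (w h)"
            unfolding mean_def using linear_map_scale[OF L s] by simp
          also have "mY (M h) (\<Sum>a\<in>carrier G. \<rho> a (fst z)) (snd z) (w h)
              = (\<Sum>a\<in>carrier G. mY (M h) (\<rho> a (fst z)) (snd z) (w h))"
            using \<rho>_mem[OF _ Fm[OF z]] by (intro linear_map_sum[OF L V_subspace])
          finally have "?n *\<^sub>C mY (M h) (mean (fst z)) (snd z) (w h) = (\<Sum>a\<in>carrier G. mY (M h) (\<rho> a (fst z)) (snd z) (w h))"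
            using card_G by (simp add: scaleC_scaleC scaleC_one)
          then show "c z *\<^sub>C (\<Sum>a\<in>carrier G. mY (M h) (\<rho> a (fst z)) (snd z) (w h))
              = c z *\<^sub>C ?n *\<^sub>C mY (M h) (mean (fst z)) (snd z) (w h)" by simp
        qed
        also have "\<dots> = ?n *\<^sub>C (\<Sum>z\<in>F. c z *\<^sub>C mY (M h) (mean (fst z)) (snd z) (w h))"
          unfolding cvec.scale_sum_right by (intro sum.cong refl cvec.scale_left_commute)
        finally have "B w h = (\<Sum>z\<in>F. c z *\<^sub>C mY (M h) (mean (fst z)) (snd z) (w h))"
          using card_G by simp
        then show ?thesis using True by (simp add: sum_fun_apply VS_Y scaleC_fun_def)
      qed
    qed
  qed (use F in auto)
qed

end

section \<open>Submodules over the orbifold\<close>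

lemma span_UN_explicit:
  assumes sub: "\<And>i. i \<in> I \<Longrightarrow> cvec.subspace (T i)" and x: "x \<in> cvec.span (\<Union>i\<in>I. T i)"
  shows "\<exists>J f. finite J \<and> J \<subseteq> I \<and> (\<forall>i\<in>J. f i \<in> T i) \<and> x = (\<Sum>i\<in>J. f i)"
proof -
  let ?P = "{x. \<exists>J f. finite J \<and> J \<subseteq> I \<and> (\<forall>i\<in>J. f i \<in> T i) \<and> x = (\<Sum>i\<in>J. f i)}"
  have "cvec.span (\<Union>i\<in>I. T i) \<subseteq> ?P"
  proof (rule cvec.span_minimal)
    show "(\<Union>i\<in>I. T i) \<subseteq> ?P"
    proof
      fix x assume "x \<in> (\<Union>i\<in>I. T i)"
      then obtain i where "i \<in> I" "x \<in> T i" by blast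
      then show "x \<in> ?P" by (auto intro!: exI[of _ "{i}"] exI[of _ "\<lambda>_. x"])
    qed
    show "cvec.subspace ?P"
    proof (rule cvec.subspaceI)
      show "0 \<in> ?P" by (auto intro!: exI[of _ "{}"])
      fix x y assume "x \<in> ?P" "y \<in> ?P"
      then obtain J f J' f' where J: "finite J" "J \<subseteq> I" "\<And>i. i \<in> J \<Longrightarrow> f i \<in> T i" "x = (\<Sum>i\<in>J. f i)"
        and J': "finite J'" "J' \<subseteq> I" "\<And>i. i \<in> J' \<Longrightarrow> f' i \<in> T i" "y = (\<Sum>i\<in>J'. f' i)" by blast
      define h where "h i = (if i \<in> J then f i else 0) + (if i \<in> J' then f' i else 0)" for i
      have "x = (\<Sum>i\<in>J \<union> J'. if i \<in> J then f i else 0)"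
        unfolding J(4) using J(1) J'(1) by (intro sum.mono_neutral_cong_left) auto
      moreover have "y = (\<Sum>i\<in>J \<union> J'. if i \<in> J' then f' i else 0)"
        unfolding J'(4) using J(1) J'(1) by (intro sum.mono_neutral_cong_left) auto
      ultimately have "x + y = (\<Sum>i\<in>J \<union> J'. h i)" by (simp add: h_def sum.distrib)
      moreover have "h i \<in> T i" if "i \<in> J \<union> J'" for i
      proof -
        have "cvec.subspace (T i)" using that J(2) J'(2) sub by blast
        then show ?thesis
          unfolding h_def using J(3) J'(3) by (intro cvec.subspace_add) (auto simp: cvec.subspace_0)
      qed
      ultimately show "x + y \<in> ?P" using J(1,2) J'(1,2) by (intro CollectI exI[of _ "J \<union> J'"] exI[of _ h]) auto
    next
      fix c x assume "x \<in> ?P"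
      then obtain J f where J: "finite J" "J \<subseteq> I" "\<And>i. i \<in> J \<Longrightarrow> f i \<in> T i" "x = (\<Sum>i\<in>J. f i)" by blast
      have "c *\<^sub>C f i \<in> T i" if "i \<in> J" for i using J(2,3) that sub cvec.subspace_scale by blast
      then show "c *\<^sub>C x \<in> ?P" using J
        by (intro CollectI exI[of _ J] exI[of _ "\<lambda>i. c *\<^sub>C f i"]) (auto simp: cvec.scale_sum_right)
    qed
  qed
  then show ?thesis using x by blast
qed

text \<open>Applying L - c0 removes one component and multiplies the others by nonzero scalars. The
  lemma yields both the grading of invariant subspaces and, for the zero subspace, the independence
  of eigenspaces.\<close>

lemma eigencomponents_mem:
  assumes S: "cvec.subspace S" and L: "linear_map S S L" and W: "cvec.subspace W" "W \<subseteq> S"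
    "\<And>w. w \<in> W \<Longrightarrow> L w \<in> W"
    and J: "finite J" "\<And>c. c \<in> J \<Longrightarrow> f c \<in> S \<and> L (f c) = c *\<^sub>C f c" "(\<Sum>c\<in>J. f c) \<in> W"
  shows "\<forall>c\<in>J. f c \<in> W"
  using J
proof (induction J arbitrary: f rule: finite_induct)
  case (insert c0 J)
  let ?s = "\<Sum>c\<in>insert c0 J. f c"
  have "L ?s = (\<Sum>c\<in>insert c0 J. L (f c))" using insert.prems by (intro linear_map_sum[OF L S]) auto
  also have "\<dots> = (\<Sum>c\<in>insert c0 J. c *\<^sub>C f c)" using insert.prems by (intro sum.cong) auto
  finally have "L ?s - c0 *\<^sub>C ?s = (\<Sum>c\<in>insert c0 J. (c - c0) *\<^sub>C f c)"
    by (simp only: cvec.scale_sum_right sum_subtractf[symmetric] cvec.scale_left_diff_distrib)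
  also have "\<dots> = (\<Sum>c\<in>J. (c - c0) *\<^sub>C f c)" using insert.hyps by simp
  finally have s: "(\<Sum>c\<in>J. (c - c0) *\<^sub>C f c) \<in> W"
    using insert.prems(2) W(3) cvec.subspace_diff[OF W(1)] cvec.subspace_scale[OF W(1)] by metis
  have "\<forall>c\<in>J. (c - c0) *\<^sub>C f c \<in> W"
  proof (rule insert.IH[OF _ s])
    fix c assume "c \<in> J"
    then show "(c - c0) *\<^sub>C f c \<in> S \<and> L ((c - c0) *\<^sub>C f c) = c *\<^sub>C (c - c0) *\<^sub>C f c"
      using insert.prems(1)[of c] linear_map_scale[OF L] cvec.subspace_scale[OF S]
      by (auto simp: scaleC_scaleC mult.commute)
  qed
  then have J: "f c \<in> W" if "c \<in> J" for c
  proof -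
    have "c - c0 \<noteq> 0" using that insert.hyps by auto
    moreover have "inverse (c - c0) *\<^sub>C (c - c0) *\<^sub>C f c \<in> W"
      using \<open>\<forall>c\<in>J. (c - c0) *\<^sub>C f c \<in> W\<close> that cvec.subspace_scale[OF W(1)] by blast
    ultimately show ?thesis by (simp add: scaleC_scaleC scaleC_one)
  qed
  have "?s - (\<Sum>c\<in>J. f c) \<in> W"
    by (rule cvec.subspace_diff[OF W(1) insert.prems(2) cvec.subspace_sum[OF W(1)]]) (rule J)
  then have "f c0 \<in> W" using insert.hyps by simp
  then show ?case using J by blast
qed simp

context twisted_mod
begin

lemma Y_virasoro:
  "w \<in> mcarrier M \<Longrightarrow> mod_L V M m (mod_L V M n w) - mod_L V M n (mod_L V M m w)
        = of_int (m - n) *\<^sub>C mod_L V M (m + n) w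
          + (if m + n = 0 then of_int (m ^ 3 - m) / 12 * of_rat (vrank V) else 0) *\<^sub>C w"
  using module unfolding weak_twisted_module_def Let_def by blast

lemma Y_derivative:
  "v \<in> vcarrier V \<Longrightarrow> w \<in> mcarrier M \<Longrightarrow> mY M (voa_L V (-1) v) n w = - of_rat n *\<^sub>C mY M v (n - 1) w"
  using module unfolding weak_twisted_module_def Let_def by blast

end

section \<open>The fixed-point algebra and its modules inside the sum\<close>

context orbifold
begin

lemma VG_simps [simp]:
  "vY VG = vY V" "vvac VG = vvac V" "vomega VG = vomega V" "vrank VG = vrank V" "voa_L VG = voa_L V"
  by (auto simp: fixed_voa_def voa_L_def fun_eq_iff)

lemma VG_subset: "v \<in> vcarrier VG \<Longrightarrow> v \<in> vcarrier V" by (simp add: VG_iff)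

lemma VG_subspace: "cvec.subspace (vcarrier VG)"
  by (rule cvec.subspaceI)
     (auto simp: VG_iff cvec.subspace_0[OF V_subspace] cvec.subspace_add[OF V_subspace]
       cvec.subspace_scale[OF V_subspace] linear_map_zero[OF \<rho>_linear V_subspace]
       linear_map_add[OF \<rho>_linear] linear_map_scale[OF \<rho>_linear])

lemma VG_closed: "u \<in> vcarrier VG \<Longrightarrow> v \<in> vcarrier VG \<Longrightarrow> vY V u n v \<in> vcarrier VG"
  using voa_AutD(3)[OF \<rho>_Aut] linear_map_mem[OF is_voaD(2)[OF is_voa]] by (simp add: VG_iff)

lemma VG_group: "group (voa_Aut VG)"
  using VG_closed is_voaD(5,6)[OF is_voa] voa_AutD(4,5)[OF \<rho>_Aut]
  by (intro voa_Aut_group VG_subspace) (auto simp: VG_iff)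

lemma VG_one_ord: "group.ord (voa_Aut VG) \<one>\<^bsub>voa_Aut VG\<^esub> = 1"
  using group.ord_id[OF VG_group] by simp

lemma VG_one_mem: "\<one>\<^bsub>voa_Aut VG\<^esub> \<in> carrier (voa_Aut VG)"
  using VG_group by (simp add: group.is_monoid monoid.one_closed)

lemma VG_eigenspace: "v \<in> aut_eigenspace VG \<one>\<^bsub>voa_Aut VG\<^esub> j \<Longrightarrow> v \<in> vcarrier VG"
  by (simp add: aut_eigenspace_def)

lemma fixed_eigenspace: "v \<in> vcarrier VG \<Longrightarrow> g \<in> carrier G \<Longrightarrow> v \<in> aut_eigenspace V (\<rho> g) 0"
  by (simp add: aut_eigenspace_def VG_iff scaleC_one)

abbreviation sub where "sub W \<equiv> VS\<lparr>mcarrier := W\<rparr>"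

lemma VS_trunc:
  assumes v: "v \<in> vcarrier V" and w: "w \<in> mcarrier VS"
  shows "\<exists>n0. \<forall>n\<ge>n0. mY VS v n w = 0"
proof -
  have "\<forall>g\<in>carrier G. \<exists>n0. \<forall>n\<ge>n0. mY (M g) v n (w g) = 0"
    using twisted_mod.Y_trunc[OF tm v VS_mem[OF w]] by blast
  then obtain b where b: "\<And>g n. g \<in> carrier G \<Longrightarrow> n \<ge> b g \<Longrightarrow> mY (M g) v n (w g) = 0" by metis
  show ?thesis
  proof (intro exI allI impI)
    fix n assume n: "n \<ge> Max (b ` carrier G)"
    show "mY VS v n w = 0"
    proof
      fix g
      show "mY VS v n w g = 0 g"
      proof (cases "g \<in> carrier G")
        case True
        have "b g \<le> Max (b ` carrier G)" using finite_carrier True by (intro Max_ge) auto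
        then show ?thesis using b[OF True, of n] n True by (simp add: VS_Y)
      qed (simp add: VS_Y)
    qed
  qed
qed

lemma VS_trunc_nat:
  assumes v: "v \<in> vcarrier V" and w: "w \<in> mcarrier VS"
  shows "\<exists>I. \<forall>i\<ge>I. mY VS v (n + of_nat i) w = 0"
proof -
  obtain n0 where n0: "\<And>n. n \<ge> n0 \<Longrightarrow> mY VS v n w = 0" using VS_trunc[OF assms] by blast
  show ?thesis
  proof (intro exI allI impI)
    fix i assume "i \<ge> nat \<lceil>n0 - n\<rceil>"
    then have "n0 - n \<le> of_nat i" by (metis ceiling_le_iff nat_le_iff of_int_of_nat_eq)
    then show "mY VS v (n + of_nat i) w = 0" by (intro n0) simp
  qed
qed

lemma VS_Y_linear_left:
  "w \<in> mcarrier VS \<Longrightarrow> linear_map (vcarrier V) (mcarrier VS) (\<lambda>v. mY VS v n w)"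
  unfolding linear_map_def
  using linear_map_mem[OF VS_Y_linear] linear_map_add[OF twisted_mod.Y_linear_left[OF tm VS_mem]]
    linear_map_scale[OF twisted_mod.Y_linear_left[OF tm VS_mem]]
  by (auto simp: VS_Y scaleC_fun_def fun_eq_iff)

lemma mod_L_sub: "mod_L VG (sub W) n w = (\<lambda>g. if g \<in> carrier G then mod_L V (M g) n (w g) else 0)"
  by (intro ext) (simp add: mod_L_def VS_Y)

text \<open>A fixed vector lies in the eigenspace with j = 0 for every twist, so the coset condition
  is m \<in> \<int> in all components. A truncation bound common to all of \<open>G\<close> turns
  the sums into finite ones, which can be compared componentwise.\<close>

lemma fixed_jacobi:
  assumes u: "u \<in> vcarrier VG" and v: "v \<in> vcarrier VG" and w: "w \<in> mcarrier VS"
    and m: "m \<in> \<int>"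
  shows "Sum_any (\<lambda>i::nat. ((-1) ^ i * (of_int l gchoose i)) *\<^sub>C
            (mY VS u (m + of_int l - of_nat i) (mY VS v (n + of_nat i) w)
             - ((-1) powi l) *\<^sub>C mY VS v (n + of_int l - of_nat i) (mY VS u (m + of_nat i) w)))
        = Sum_any (\<lambda>i::nat. (of_rat m gchoose i) *\<^sub>C
            mY VS (vY V u (l + int i) v) (m + n - of_nat i) w)"
    (is "Sum_any ?L = Sum_any ?R")
proof -
  have uV: "u \<in> vcarrier V" and vV: "v \<in> vcarrier V" using u v by (auto simp: VG_iff)
  obtain I1 where I1: "\<And>i. i \<ge> I1 \<Longrightarrow> mY VS v (n + of_nat i) w = 0" using VS_trunc_nat[OF vV w] by blast
  obtain I2 where I2: "\<And>i. i \<ge> I2 \<Longrightarrow> mY VS u (m + of_nat i) w = 0" using VS_trunc_nat[OF uV w] by blast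
  obtain b where b: "\<And>n. n \<ge> b \<Longrightarrow> vY V u n v = 0" using is_voaD(4)[OF is_voa uV vV] by blast
  define I where "I = I1 + I2 + nat (b - l)"
  have Iv: "mY VS v (n + of_nat i) w = 0" and Iu: "mY VS u (m + of_nat i) w = 0" and Iuv: "vY V u (l + int i) v = 0"
    if "i \<ge> I" for i
    using that by (auto simp: I_def intro!: I1 I2 b)
  have Yz: "mY VS x p 0 = 0" if "x \<in> vcarrier V" for x p
    using linear_map_zero[OF VS_Y_linear[OF that] VS_subspace] .
  have "Sum_any ?L = (\<Sum>i<I. ?L i)"
  proof (rule Sum_any.expand_superset)
    show "{i. ?L i \<noteq> 0} \<subseteq> {..<I}"
    proof
      fix i assume i: "i \<in> {i. ?L i \<noteq> 0}"
      have z: "?L i = 0" if "i \<ge> I"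
        unfolding Iv[OF that] Iu[OF that] Yz[OF uV] Yz[OF vV] by (simp only: cvec.scale_zero_right diff_zero)
      show "i \<in> {..<I}"
      proof (rule ccontr)
        assume "i \<notin> {..<I}"
        then have "I \<le> i" by simp
        from i z[OF this] show False unfolding mem_Collect_eq by (rule notE)
      qed
    qed
  qed auto
  also have "\<dots> = (\<Sum>i<I. ?R i)"
  proof
    fix g
    show "(\<Sum>i<I. ?L i) g = (\<Sum>i<I. ?R i) g"
    proof (cases "g \<in> carrier G")
      case True
      interpret A: twisted_mod V "\<rho> g" "M g" using tm[OF True] .
      have "(\<Sum>i<I. ((-1) ^ i * (of_int l gchoose i)) *\<^sub>C
            (mY (M g) u (m + of_int l - of_nat i) (mY (M g) v (n + of_nat i) (w g))
             - ((-1) powi l) *\<^sub>C mY (M g) v (n + of_int l - of_nat i) (mY (M g) u (m + of_nat i) (w g))))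
        = (\<Sum>i<I. (of_rat m gchoose i) *\<^sub>C mY (M g) (vY V u (l + int i) v) (m + n - of_nat i) (w g))"
      proof (rule A.jacobi[OF fixed_eigenspace[OF u True] vV VS_mem[OF w True]])
        show "m - of_int 0 / of_nat A.N \<in> \<int>" using m by simp
        show "mY (M g) v (n + of_nat i) (w g) = 0" if "i \<ge> I" for i
          using fun_cong[OF Iv[OF that], of g] True by (simp add: VS_Y)
        show "mY (M g) u (m + of_nat i) (w g) = 0" if "i \<ge> I" for i
          using fun_cong[OF Iu[OF that], of g] True by (simp add: VS_Y)
      qed (rule Iuv)
      then show ?thesis using True by (simp add: sum_fun_apply VS_Y scaleC_fun_def)
    qed (simp add: sum_fun_apply VS_Y scaleC_fun_def)
  qed
  also have "\<dots> = Sum_any ?R"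
  proof (rule Sum_any.expand_superset[symmetric])
    show "{i. ?R i \<noteq> 0} \<subseteq> {..<I}"
    proof
      fix i assume i: "i \<in> {i. ?R i \<noteq> 0}"
      have z: "?R i = 0" if "i \<ge> I"
        unfolding Iuv[OF that] using linear_map_zero[OF VS_Y_linear_left[OF w] V_subspace]
        by (simp only: cvec.scale_zero_right)
      show "i \<in> {..<I}"
      proof (rule ccontr)
        assume "i \<notin> {..<I}"
        then have "I \<le> i" by simp
        from i z[OF this] show False unfolding mem_Collect_eq by (rule notE)
      qed
    qed
  qed auto
  finally show ?thesis .
qed

lemma VS_weight_fin_dim:
  "fin_dim {f \<in> mcarrier VS. \<forall>g\<in>carrier G. f g \<in> mod_weight_space V (M g) c}" (is "fin_dim ?E")
proof -
  have "\<exists>B. finite B \<and> mod_weight_space V (M g) c = cvec.span B" if "g \<in> carrier G" for g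
    using M_simple[OF that] by (auto simp: simple_twisted_module_def twisted_module_def fin_dim_def)
  then obtain B where B: "\<And>g. g \<in> carrier G \<Longrightarrow> finite (B g)"
    "\<And>g. g \<in> carrier G \<Longrightarrow> mod_weight_space V (M g) c = cvec.span (B g)" by metis
  have wsub: "cvec.subspace (mod_weight_space V (M g) c)" if "g \<in> carrier G" for g
    unfolding B(2)[OF that] by (rule cvec.subspace_span)
  define C where "C = (\<Union>g\<in>carrier G. single g ` B g)"
  have E: "cvec.subspace ?E"
  proof (rule cvec.subspaceI)
    show "0 \<in> ?E" using cvec.subspace_0[OF VS_subspace] cvec.subspace_0[OF wsub] by simp
    show "x + y \<in> ?E" if "x \<in> ?E" "y \<in> ?E" for x y
      using that cvec.subspace_add[OF VS_subspace, of x y] cvec.subspace_add[OF wsub] by simp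
    show "a *\<^sub>C x \<in> ?E" if "x \<in> ?E" for a x
    proof
      have "(a *\<^sub>C x) g \<in> mod_weight_space V (M g) c" if "g \<in> carrier G" for g
        using \<open>x \<in> ?E\<close> cvec.subspace_scale[OF wsub[OF that]] that by (simp add: scaleC_fun_def)
      then show "a *\<^sub>C x \<in> mcarrier VS \<and> (\<forall>g\<in>carrier G. (a *\<^sub>C x) g \<in> mod_weight_space V (M g) c)"
        using that cvec.subspace_scale[OF VS_subspace] by blast
    qed
  qed
  have sp: "?E \<subseteq> cvec.span C"
  proof
    fix f assume f: "f \<in> ?E"
    have "single g (f g) \<in> cvec.span C" if g: "g \<in> carrier G" for g
    proof -
      have "cvec.span (B g) \<subseteq> {y. single g y \<in> cvec.span C}"
      proof (rule cvec.span_minimal)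
        show "B g \<subseteq> {y. single g y \<in> cvec.span C}" using g by (auto simp: C_def intro: cvec.span_base)
        have "single g 0 = 0" by (auto simp: single_def)
        then show "cvec.subspace {y. single g y \<in> cvec.span C}"
          by (intro cvec.subspaceI) (auto simp: single_add single_scale intro: cvec.span_zero cvec.span_add cvec.span_scale)
      qed
      then show ?thesis using f g B(2)[OF g] by blast
    qed
    then have "(\<Sum>g\<in>carrier G. single g (f g)) \<in> cvec.span C" by (rule cvec.span_sum)
    then show "f \<in> cvec.span C" using sum_single[of f] f by simp
  qed
  have "finite C" using B(1) finite_carrier by (simp add: C_def)
  then have "fin_dim (cvec.span C)" unfolding fin_dim_def by blast
  then show ?thesis using sp E by (rule fin_dim_subset)
qed

text \<open>The identities are inherited from the components. What needs an argument is the grading: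
  the Virasoro vector is fixed by \<open>G\<close>, so L(0) preserves W and W contains the weight
  components of its vectors.\<close>

lemma sub_twisted_module:
  assumes "vsubmodule VG VS W"
  shows "twisted_module VG \<one>\<^bsub>voa_Aut VG\<^esub> (sub W)"
proof -
  have W: "cvec.subspace W" "W \<subseteq> mcarrier VS" "\<And>v n w. v \<in> vcarrier VG \<Longrightarrow> w \<in> W \<Longrightarrow> mY VS v n w \<in> W"
    using assms unfolding vsubmodule_def by blast+
  have WS: "w \<in> mcarrier VS" if "w \<in> W" for w using that W(2) by blast
  have omega: "vomega V \<in> vcarrier VG"
    using is_voaD(6)[OF is_voa] voa_AutD(5)[OF \<rho>_Aut] by (simp add: VG_iff)
  let ?N = "group.ord (voa_Aut VG) \<one>\<^bsub>voa_Aut VG\<^esub>"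
  define L where "L = mY VS (vomega V) (of_int 0 + 1)"
  have L_lin: "linear_map (mcarrier VS) (mcarrier VS) L"
    unfolding L_def using VS_Y_linear[OF is_voaD(6)[OF is_voa]] .
  have wsp: "mod_weight_space VG (sub W) c = {w \<in> W. L w = c *\<^sub>C w}" for c
    by (simp add: mod_weight_space_def mod_L_def L_def)
  have comp: "w g \<in> mod_weight_space V (M g) c" if w: "w \<in> W" "L w = c *\<^sub>C w" and g: "g \<in> carrier G" for w c g
    using fun_cong[OF w(2), of g] g VS_mem[OF WS[OF w(1)] g]
    by (simp add: mod_weight_space_def mod_L_def L_def VS_Y scaleC_fun_def)
  have lin: "linear_map W W (mY VS v n)" if "v \<in> vcarrier VG" for v n
    using W(3)[OF that] linear_map_add[OF VS_Y_linear[OF VG_subset[OF that]]]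
      linear_map_scale[OF VS_Y_linear[OF VG_subset[OF that]]] WS
    unfolding linear_map_def by blast
  have LW: "L w \<in> W" if "w \<in> W" for w unfolding L_def using W(3)[OF omega that] .
  have weights: "direct_sum UNIV (mod_weight_space VG (sub W)) W"
    unfolding direct_sum_def wsp
  proof (intro conjI ballI allI impI)
    have sub: "cvec.subspace {w \<in> U. L w = c *\<^sub>C w}" if "cvec.subspace U" "U \<subseteq> mcarrier VS" for U c
    proof (rule cvec.subspaceI)
      show "0 \<in> {w \<in> U. L w = c *\<^sub>C w}"
        using cvec.subspace_0[OF that(1)] linear_map_zero[OF L_lin VS_subspace] by (simp only: mem_Collect_eq cvec.scale_zero_right)
      show "x + y \<in> {w \<in> U. L w = c *\<^sub>C w}" if "x \<in> {w \<in> U. L w = c *\<^sub>C w}" "y \<in> {w \<in> U. L w = c *\<^sub>C w}" for x y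
        using that \<open>U \<subseteq> mcarrier VS\<close> cvec.subspace_add[OF \<open>cvec.subspace U\<close>] linear_map_add[OF L_lin, of x y]
        by (simp only: mem_Collect_eq scaleC_add_right subset_iff)
      show "d *\<^sub>C x \<in> {w \<in> U. L w = c *\<^sub>C w}" if "x \<in> {w \<in> U. L w = c *\<^sub>C w}" for d x
        using that \<open>U \<subseteq> mcarrier VS\<close> cvec.subspace_scale[OF \<open>cvec.subspace U\<close>] linear_map_scale[OF L_lin, of x d]
        by (simp only: mem_Collect_eq subset_iff scaleC_scaleC mult.commute)
    qed
    show "cvec.subspace {w \<in> W. L w = c *\<^sub>C w}" for c using sub[OF W(1,2)] .
    define E where "E c = {w \<in> mcarrier VS. L w = c *\<^sub>C w}" for c
    have E: "cvec.subspace (E c)" for c unfolding E_def using sub[OF VS_subspace order_refl] .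
    \<comment> \<open>Each of the finitely many \<open>M g\<close> is spanned by weight vectors, so
      eigenvectors of L(0) span the whole sum.\<close>
    have all: "mcarrier VS \<subseteq> cvec.span (\<Union>c. E c)"
    proof
      fix f assume f: "f \<in> mcarrier VS"
      have "single g (f g) \<in> cvec.span (\<Union>c. E c)" if g: "g \<in> carrier G" for g
      proof -
        interpret A: twisted_mod V "\<rho> g" "M g" using tm[OF g] .
        have "cvec.span (\<Union>c. mod_weight_space V (M g) c) \<subseteq> {y. single g y \<in> cvec.span (\<Union>c. E c)}"
        proof (rule cvec.span_minimal)
          show "(\<Union>c. mod_weight_space V (M g) c) \<subseteq> {y. single g y \<in> cvec.span (\<Union>c. E c)}"
          proof
            fix y assume "y \<in> (\<Union>c. mod_weight_space V (M g) c)"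
            then obtain c where y: "y \<in> mcarrier (M g)" "mY (M g) (vomega V) (of_int 0 + 1) y = c *\<^sub>C y"
              by (auto simp: mod_weight_space_def mod_L_def)
            have "L (single g y) = c *\<^sub>C single g y"
            proof
              fix h
              show "L (single g y) h = (c *\<^sub>C single g y) h"
                using y(2) g twisted_mod.Y_zero[OF tm is_voaD(6)[OF is_voa], of h]
                by (auto simp: L_def VS_Y single_def scaleC_fun_def)
            qed
            then have "single g y \<in> E c" unfolding E_def using single_mem[OF g y(1)] by blast
            then show "y \<in> {y. single g y \<in> cvec.span (\<Union>c. E c)}" by (auto intro: cvec.span_base)
          qed
          have "single g 0 = 0" by (auto simp: single_def)
          then show "cvec.subspace {y. single g y \<in> cvec.span (\<Union>c. E c)}"
            by (intro cvec.subspaceI)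
               (simp_all only: mem_Collect_eq single_add single_scale cvec.span_zero cvec.span_add cvec.span_scale)
        qed
        moreover have "cvec.span (\<Union>c. mod_weight_space V (M g) c) = mcarrier (M g)"
          using A.M_weights unfolding direct_sum_def by blast
        ultimately show ?thesis using VS_mem[OF f g] by blast
      qed
      then have "(\<Sum>g\<in>carrier G. single g (f g)) \<in> cvec.span (\<Union>c. E c)" by (rule cvec.span_sum)
      then show "f \<in> cvec.span (\<Union>c. E c)" using sum_single[OF f] by simp
    qed
    show "cvec.span (\<Union>c. {w \<in> W. L w = c *\<^sub>C w}) = W"
    proof
      show "cvec.span (\<Union>c. {w \<in> W. L w = c *\<^sub>C w}) \<subseteq> W" using W(1) by (intro cvec.span_minimal) auto
      show "W \<subseteq> cvec.span (\<Union>c. {w \<in> W. L w = c *\<^sub>C w})"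
      proof
        fix w assume w: "w \<in> W"
        then have "w \<in> cvec.span (\<Union>c\<in>UNIV. E c)" using all WS by blast
        then obtain J f where J: "finite J" "\<forall>c\<in>J. f c \<in> E c" "w = (\<Sum>c\<in>J. f c)"
          using span_UN_explicit[of UNIV E w] E by blast
        have "\<forall>c\<in>J. f c \<in> W"
          using J w by (intro eigencomponents_mem[OF VS_subspace L_lin W(1,2) LW J(1)]) (auto simp: E_def)
        then have "f c \<in> cvec.span (\<Union>c. {w \<in> W. L w = c *\<^sub>C w})" if "c \<in> J" for c
          using that J(2) by (intro cvec.span_base) (auto simp: E_def)
        then show "w \<in> cvec.span (\<Union>c. {w \<in> W. L w = c *\<^sub>C w})"
          unfolding J(3) by (rule cvec.span_sum)
      qed
    qed
    fix J f c assume J: "finite J \<and> J \<subseteq> UNIV \<and> (\<forall>c\<in>J. f c \<in> {w \<in> W. L w = c *\<^sub>C w}) \<and> (\<Sum>c\<in>J. f c) = 0"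
      and c: "c \<in> J"
    \<comment> \<open>Independence of the weight spaces: the sum lies in the zero subspace, so its
      components do.\<close>
    have "\<forall>c\<in>J. f c \<in> {0}"
    proof (rule eigencomponents_mem[OF VS_subspace L_lin cvec.subspace_single_0])
      show "{0} \<subseteq> mcarrier VS" using cvec.subspace_0[OF VS_subspace] by blast
      show "L w \<in> {0}" if "w \<in> {0}" for w using that linear_map_zero[OF L_lin VS_subspace] by blast
      show "finite J" using J by blast
      show "f c \<in> mcarrier VS \<and> L (f c) = c *\<^sub>C f c" if "c \<in> J" for c using J that WS by blast
      show "(\<Sum>c\<in>J. f c) \<in> {0}" using J by blast
    qed
    then show "f c = 0" using c by blast
  qed
  have lower: "\<exists>b. \<forall>n::rat. of_nat ?N * n \<in> \<int> \<and> n < b \<longrightarrow> mod_weight_space VG (sub W) (of_rat n + c) = {0}" for c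
  proof -
    have "\<exists>b. \<forall>n::rat. of_nat (twisted_mod.N V (\<rho> g)) * n \<in> \<int> \<and> n < b \<longrightarrow>
        mod_weight_space V (M g) (of_rat n + c) = {0}" if "g \<in> carrier G" for g
      using twisted_mod.M_lower[OF tm[OF that]] .
    then obtain b where b: "\<And>g n. g \<in> carrier G \<Longrightarrow> of_nat (twisted_mod.N V (\<rho> g)) * n \<in> \<int> \<Longrightarrow> n < b g \<Longrightarrow>
        mod_weight_space V (M g) (of_rat n + c) = {0}" by metis
    show ?thesis
    proof (intro exI allI impI)
      fix n :: rat assume n: "of_nat ?N * n \<in> \<int> \<and> n < Min (b ` carrier G)"
      then have nZ: "n \<in> \<int>" by (simp add: VG_one_ord)
      have "w = 0" if w: "w \<in> W" "L w = (of_rat n + c) *\<^sub>C w" for w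
      proof
        fix g
        show "w g = 0 g"
        proof (cases "g \<in> carrier G")
          case True
          \<comment> \<open>Finitely many lower bounds have a minimum, and an integral n is
            admissible for the order of every twist.\<close>
          have "Min (b ` carrier G) \<le> b g" using finite_carrier True by (intro Min_le) auto
          then have "mod_weight_space V (M g) (of_rat n + c) = {0}"
            using n nZ by (intro b[OF True]) (auto intro!: Ints_mult)
          then show ?thesis using comp[OF w True] by simp
        next
          case False
          then show ?thesis using WS[OF w(1)] by (simp add: VS_iff)
        qed
      qed
      moreover have "0 \<in> W" "L 0 = (of_rat n + c) *\<^sub>C 0"
        using cvec.subspace_0[OF W(1)] linear_map_zero[OF L_lin VS_subspace] by (simp_all only: cvec.scale_zero_right)
      ultimately show "mod_weight_space VG (sub W) (of_rat n + c) = {0}" unfolding wsp by blast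
    qed
  qed
  have off: "mY VS v n w = 0" if v: "v \<in> vcarrier VG" and n: "n \<notin> \<int>" and w: "w \<in> W" for v n w
  proof
    fix g
    show "mY VS v n w g = 0 g"
    proof (cases "g \<in> carrier G")
      case True
      have "n - of_int 0 / of_nat (twisted_mod.N V (\<rho> g)) \<notin> \<int>" using n by simp
      from twisted_mod.Y_eigen[OF tm[OF True] fixed_eigenspace[OF v True] this VS_mem[OF WS[OF w] True]]
      show ?thesis using True by (simp add: VS_Y)
    qed (simp add: VS_Y)
  qed
  have vac: "mY VS (vvac V) n w = (if n = -1 then w else 0)" if w: "w \<in> W" for n w
  proof
    fix g
    show "mY VS (vvac V) n w g = (if n = -1 then w else 0) g"
    proof (cases "g \<in> carrier G")
      case True
      show ?thesis
        using twisted_mod.Y_vac[OF tm[OF True] VS_mem[OF WS[OF w] True], of n] True by (simp add: VS_Y)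
    next
      case False
      then show ?thesis using WS[OF w] by (simp add: VS_Y VS_iff)
    qed
  qed
  have jac: "twisted_jacobi VG \<one>\<^bsub>voa_Aut VG\<^esub> (sub W)"
    unfolding twisted_jacobi_def Let_def VG_one_ord
  proof (intro allI ballI impI)
    fix k u v w l and m n :: rat
    assume u: "u \<in> aut_eigenspace VG \<one>\<^bsub>voa_Aut VG\<^esub> k" and v: "v \<in> vcarrier VG" and w: "w \<in> mcarrier (sub W)"
      and mn: "m - of_int k / of_nat 1 \<in> \<int> \<and> of_nat 1 * n \<in> \<int>"
    have "m - of_int k + of_int k \<in> \<int>" using mn by (intro Ints_add) auto
    then have m: "m \<in> \<int>" by simp
    have wS: "w \<in> mcarrier VS" using w WS by simp
    show "Sum_any (\<lambda>i::nat. ((-1) ^ i * (of_int l gchoose i)) *\<^sub>C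
            (mY (sub W) u (m + of_int l - of_nat i) (mY (sub W) v (n + of_nat i) w)
             - ((-1) powi l) *\<^sub>C mY (sub W) v (n + of_int l - of_nat i) (mY (sub W) u (m + of_nat i) w)))
        = Sum_any (\<lambda>i::nat. (of_rat m gchoose i) *\<^sub>C
            mY (sub W) (vY VG u (l + int i) v) (m + n - of_nat i) w)"
      using fixed_jacobi[OF VG_eigenspace[OF u] v wS m] by simp
  qed
  have vir: "mod_L VG (sub W) m (mod_L VG (sub W) n w) - mod_L VG (sub W) n (mod_L VG (sub W) m w)
        = of_int (m - n) *\<^sub>C mod_L VG (sub W) (m + n) w
          + (if m + n = 0 then of_int (m ^ 3 - m) / 12 * of_rat (vrank VG) else 0) *\<^sub>C w"
    if w: "w \<in> W" for m n w
  proof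
    fix g
    show "(mod_L VG (sub W) m (mod_L VG (sub W) n w) - mod_L VG (sub W) n (mod_L VG (sub W) m w)) g
        = (of_int (m - n) *\<^sub>C mod_L VG (sub W) (m + n) w
          + (if m + n = 0 then of_int (m ^ 3 - m) / 12 * of_rat (vrank VG) else 0) *\<^sub>C w) g"
    proof (cases "g \<in> carrier G")
      case True
      then show ?thesis
        unfolding mod_L_sub
        using twisted_mod.Y_virasoro[OF tm[OF True] VS_mem[OF WS[OF w] True], of m n]
        by (simp add: scaleC_fun_def)
    next
      case False
      then show ?thesis
        unfolding mod_L_sub using WS[OF w] by (simp add: scaleC_fun_def VS_iff)
    qed
  qed
  have der: "mY VS (voa_L V (-1) v) n w = - of_rat n *\<^sub>C mY VS v (n - 1) w" if v: "v \<in> vcarrier VG" and w: "w \<in> W" for v n w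
  proof
    fix g
    show "mY VS (voa_L V (-1) v) n w g = (- of_rat n *\<^sub>C mY VS v (n - 1) w) g"
      using twisted_mod.Y_derivative[OF tm VG_subset[OF v] VS_mem[OF WS[OF w]], where n = n]
      by (simp add: VS_Y scaleC_fun_def)
  qed
  have left: "linear_map (vcarrier VG) W (\<lambda>v. mY VS v n w)" if w: "w \<in> W" for n w
    unfolding linear_map_def
  proof (intro conjI ballI allI)
    fix x assume x: "x \<in> vcarrier VG"
    show "mY VS x n w \<in> W" using W(3)[OF x w] .
    show "mY VS (c *\<^sub>C x) n w = c *\<^sub>C mY VS x n w" for c
      using linear_map_scale[OF VS_Y_linear_left[OF WS[OF w]] VG_subset[OF x]] .
    show "mY VS (x + y) n w = mY VS x n w + mY VS y n w" if "y \<in> vcarrier VG" for y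
      using linear_map_add[OF VS_Y_linear_left[OF WS[OF w]] VG_subset[OF x] VG_subset[OF that]] .
  qed
  have fin: "fin_dim (mod_weight_space VG (sub W) c)" for c
  proof (rule fin_dim_subset[OF VS_weight_fin_dim[of c]])
    show "mod_weight_space VG (sub W) c \<subseteq> {f \<in> mcarrier VS. \<forall>g\<in>carrier G. f g \<in> mod_weight_space V (M g) c}"
      unfolding wsp using comp WS by blast
    show "cvec.subspace (mod_weight_space VG (sub W) c)"
      using conjunct1[OF weights[unfolded direct_sum_def]] by (rule bspec) simp
  qed
  have "weak_twisted_module VG \<one>\<^bsub>voa_Aut VG\<^esub> (sub W)"
    unfolding weak_twisted_module_def Let_def
  proof (intro conjI)
    show "\<one>\<^bsub>voa_Aut VG\<^esub> \<in> carrier (voa_Aut VG)" by (rule VG_one_mem)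
    show "?N > 0" by (simp add: VG_one_ord)
    show "cvec.subspace (mcarrier (sub W))" using W(1) by simp
    show "direct_sum UNIV (mod_weight_space VG (sub W)) (mcarrier (sub W))" using weights by simp
    show "\<forall>c. \<exists>b. \<forall>n::rat. of_nat ?N * n \<in> \<int> \<and> n < b \<longrightarrow> mod_weight_space VG (sub W) (of_rat n + c) = {0}"
      using lower by blast
    show "\<forall>v\<in>vcarrier VG. \<forall>n. linear_map (mcarrier (sub W)) (mcarrier (sub W)) (mY (sub W) v n)" using lin by simp
    show "\<forall>w\<in>mcarrier (sub W). \<forall>n. linear_map (vcarrier VG) (mcarrier (sub W)) (\<lambda>v. mY (sub W) v n w)" using left by simp
    show "\<forall>j. \<forall>v\<in>aut_eigenspace VG \<one>\<^bsub>voa_Aut VG\<^esub> j. \<forall>n. n - of_int j / of_nat ?N \<notin> \<int> \<longrightarrow>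
        (\<forall>w\<in>mcarrier (sub W). mY (sub W) v n w = 0)"
    proof (intro allI ballI impI)
      fix j v w and n :: rat assume v: "v \<in> aut_eigenspace VG \<one>\<^bsub>voa_Aut VG\<^esub> j" and n: "n - of_int j / of_nat ?N \<notin> \<int>"
        and w: "w \<in> mcarrier (sub W)"
      have "n \<notin> \<int>"
      proof
        assume "n \<in> \<int>"
        then have "n - of_int j \<in> \<int>" by (intro Ints_diff) auto
        moreover have "n - of_int j / of_nat ?N = n - of_int j" by (simp add: VG_one_ord)
        ultimately show False using n by metis
      qed
      then show "mY (sub W) v n w = 0" using off[OF VG_eigenspace[OF v]] w by simp
    qed
    show "\<forall>v\<in>vcarrier VG. \<forall>w\<in>mcarrier (sub W). \<exists>n0. \<forall>n\<ge>n0. mY (sub W) v n w = 0"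
      using VS_trunc[OF VG_subset WS] by simp
    show "\<forall>w\<in>mcarrier (sub W). \<forall>n. mY (sub W) (vvac VG) n w = (if n = -1 then w else 0)" using vac by simp
    show "twisted_jacobi VG \<one>\<^bsub>voa_Aut VG\<^esub> (sub W)" by (rule jac)
    show "\<forall>m n. \<forall>w\<in>mcarrier (sub W).
        mod_L VG (sub W) m (mod_L VG (sub W) n w) - mod_L VG (sub W) n (mod_L VG (sub W) m w)
        = of_int (m - n) *\<^sub>C mod_L VG (sub W) (m + n) w
          + (if m + n = 0 then of_int (m ^ 3 - m) / 12 * of_rat (vrank VG) else 0) *\<^sub>C w"
      using vir by simp
    show "\<forall>v\<in>vcarrier VG. \<forall>w\<in>mcarrier (sub W). \<forall>n.
        mY (sub W) (voa_L VG (-1) v) n w = - of_rat n *\<^sub>C mY (sub W) v (n - 1) w"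
      using der by simp
  qed
  then show ?thesis using fin by (simp add: twisted_module_def)
qed

text \<open>All module axioms for W are provided by \<open>sub_twisted_module\<close>, so simplicity
  can be tested on invariant subspaces of the sum alone.\<close>

lemma simple_vsubmoduleI:
  assumes W: "vsubmodule VG VS W" "W \<noteq> {0}"
    and simple: "\<And>W'. vsubmodule VG VS W' \<Longrightarrow> W' \<subseteq> W \<Longrightarrow> W' = {0} \<or> W' = W"
  shows "sub W \<in> simple_vsubmodules VG VS"
proof -
  have "vsubmodule VG VS W'" "W' \<subseteq> W" if "vsubmodule VG (sub W) W'" for W'
    using that W(1) by (auto simp: vsubmodule_def)
  then have "simple_voa_module VG (sub W)"
    unfolding simple_voa_module_def simple_twisted_module_def
    using sub_twisted_module[OF W(1)] W(2) simple by simp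
  then show ?thesis unfolding simple_vsubmodules_def using W(1) by blast
qed

lemma simple_vsubmodulesD:
  assumes "Z \<in> simple_vsubmodules VG VS"
  shows "\<exists>W. Z = sub W \<and> vsubmodule VG VS W \<and> W \<noteq> {0} \<and>
    (\<forall>W'. vsubmodule VG VS W' \<and> W' \<subseteq> W \<longrightarrow> W' = {0} \<or> W' = W)"
proof -
  obtain W where W: "Z = sub W" "vsubmodule VG VS W" "simple_voa_module VG (sub W)"
    using assms unfolding simple_vsubmodules_def by blast
  have "vsubmodule VG (sub W) W'" if "vsubmodule VG VS W'" "W' \<subseteq> W" for W'
    using that by (simp add: vsubmodule_def)
  then show ?thesis
    using W unfolding simple_voa_module_def simple_twisted_module_def by (intro exI[of _ W]) auto
qed

end

section \<open>Multiplicity spaces and the decomposition\<close>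

lemma vmodule_iso_refl: "vmodule_iso V M M"
  unfolding vmodule_iso_def by (intro exI[of _ "\<lambda>x. x"]) (auto simp: linear_map_def bij_betw_def)

lemma vmodule_iso_sym:
  assumes sub: "cvec.subspace (mcarrier M)"
    and closed: "\<And>v n w. v \<in> vcarrier V \<Longrightarrow> w \<in> mcarrier M \<Longrightarrow> mY M v n w \<in> mcarrier M"
    and iso: "vmodule_iso V M N"
  shows "vmodule_iso V N M"
proof -
  obtain f where f: "bij_betw f (mcarrier M) (mcarrier N)" "linear_map (mcarrier M) (mcarrier N) f"
    "\<And>v n w. v \<in> vcarrier V \<Longrightarrow> w \<in> mcarrier M \<Longrightarrow> f (mY M v n w) = mY N v n (f w)"
    using iso unfolding vmodule_iso_def by blast
  let ?h = "the_inv_into (mcarrier M) f"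
  have inj: "inj_on f (mcarrier M)" and im: "f ` mcarrier M = mcarrier N"
    using f(1) by (auto simp: bij_betw_def)
  have "?h (mY N v n y) = mY M v n (?h y)" if v: "v \<in> vcarrier V" and y: "y \<in> mcarrier N" for v n y
  proof -
    obtain w where w: "w \<in> mcarrier M" "y = f w" using y im by blast
    have "?h (f (mY M v n w)) = mY M v n w" using inj closed[OF v w(1)] by (rule the_inv_into_f_f)
    then show ?thesis using f(3)[OF v w(1)] the_inv_into_f_f[OF inj w(1)] w(2) by simp
  qed
  then show ?thesis
    unfolding vmodule_iso_def
    using bij_betw_the_inv_into[OF f(1)] linear_map_inverse[OF f(2) sub f(1)] by blast
qed

lemma vmodule_iso_trans:
  assumes "vmodule_iso V M N" "vmodule_iso V N P"
  shows "vmodule_iso V M P"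
proof -
  obtain f where f: "bij_betw f (mcarrier M) (mcarrier N)" "linear_map (mcarrier M) (mcarrier N) f"
    "\<And>v n w. v \<in> vcarrier V \<Longrightarrow> w \<in> mcarrier M \<Longrightarrow> f (mY M v n w) = mY N v n (f w)"
    using assms(1) unfolding vmodule_iso_def by blast
  obtain h where h: "bij_betw h (mcarrier N) (mcarrier P)" "linear_map (mcarrier N) (mcarrier P) h"
    "\<And>v n w. v \<in> vcarrier V \<Longrightarrow> w \<in> mcarrier N \<Longrightarrow> h (mY N v n w) = mY P v n (h w)"
    using assms(2) unfolding vmodule_iso_def by blast
  show ?thesis
    unfolding vmodule_iso_def
  proof (intro exI conjI ballI allI)
    show "bij_betw (\<lambda>x. h (f x)) (mcarrier M) (mcarrier P)"
      using bij_betw_trans[OF f(1) h(1)] by (simp add: comp_def)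
    show "linear_map (mcarrier M) (mcarrier P) (\<lambda>x. h (f x))" using linear_map_comp[OF f(2) h(2)] .
    show "h (f (mY M v n w)) = mY P v n (h (f w))" if "v \<in> vcarrier V" "w \<in> mcarrier M" for v n w
      using that f(3) h(3) linear_map_mem[OF f(2)] by simp
  qed
qed

lemma bij_betw_equiv_classes:
  assumes r: "equiv A r" and c: "\<And>x. x \<in> X \<Longrightarrow> c x \<in> A"
    and surj: "\<And>a. a \<in> A \<Longrightarrow> \<exists>x\<in>X. (c x, a) \<in> r"
    and inj: "\<And>x y. x \<in> X \<Longrightarrow> y \<in> X \<Longrightarrow> (c x, c y) \<in> r \<Longrightarrow> x = y"
  shows "bij_betw (\<lambda>x. r `` {c x}) X (A // r)"
  unfolding bij_betw_def
proof
  show "inj_on (\<lambda>x. r `` {c x}) X"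
    using inj eq_equiv_class_iff[OF r c c] by (auto simp: inj_on_def)
  show "(\<lambda>x. r `` {c x}) ` X = A // r"
  proof
    show "(\<lambda>x. r `` {c x}) ` X \<subseteq> A // r" using c by (auto intro: quotientI)
    show "A // r \<subseteq> (\<lambda>x. r `` {c x}) ` X"
    proof
      fix q assume "q \<in> A // r"
      then obtain a where a: "a \<in> A" "q = r `` {a}" by (rule quotientE)
      obtain x where x: "x \<in> X" "(c x, a) \<in> r" using surj[OF a(1)] by blast
      have "r `` {c x} = r `` {a}" using r x(2) by (rule equiv_class_eq)
      then show "q \<in> (\<lambda>x. r `` {c x}) ` X" using x(1) a(2) by blast
    qed
  qed
qed

lemma alg_module_iso_rel_equiv:
  assumes "\<And>U. U \<in> S \<Longrightarrow> alg_module A U"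
  shows "equiv S (alg_module_iso_rel A S)"
proof (rule equivI)
  show "alg_module_iso_rel A S \<subseteq> S \<times> S" by (auto simp: alg_module_iso_rel_def)
  show "refl_on S (alg_module_iso_rel A S)"
    by (auto simp: refl_on_def alg_module_iso_rel_def alg_module_iso_refl)
  show "sym (alg_module_iso_rel A S)"
  proof (rule symI)
    fix U W assume "(U, W) \<in> alg_module_iso_rel A S"
    then have UW: "U \<in> S" "W \<in> S" "alg_module_iso A U W" by (simp_all add: alg_module_iso_rel_def)
    show "(W, U) \<in> alg_module_iso_rel A S"
      using UW(1,2) alg_module_iso_sym[OF assms[OF UW(1)] assms[OF UW(2)] UW(3)]
      by (simp add: alg_module_iso_rel_def)
  qed
  show "trans (alg_module_iso_rel A S)"
    using alg_module_iso_trans by (fastforce simp: trans_def alg_module_iso_rel_def)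
qed

lemma vmodule_iso_rel_equiv:
  assumes "\<And>M. M \<in> S \<Longrightarrow> cvec.subspace (mcarrier M)"
    "\<And>M v n w. M \<in> S \<Longrightarrow> v \<in> vcarrier V \<Longrightarrow> w \<in> mcarrier M \<Longrightarrow> mY M v n w \<in> mcarrier M"
  shows "equiv S (vmodule_iso_rel V S)"
proof (rule equivI)
  show "vmodule_iso_rel V S \<subseteq> S \<times> S" by (auto simp: vmodule_iso_rel_def)
  show "refl_on S (vmodule_iso_rel V S)"
    by (auto simp: refl_on_def vmodule_iso_rel_def vmodule_iso_refl)
  show "sym (vmodule_iso_rel V S)"
  proof (rule symI)
    fix M N assume "(M, N) \<in> vmodule_iso_rel V S"
    then have MN: "M \<in> S" "N \<in> S" "vmodule_iso V M N" by (simp_all add: vmodule_iso_rel_def)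
    show "(N, M) \<in> vmodule_iso_rel V S"
      using MN(1,2) vmodule_iso_sym[OF assms(1)[OF MN(1)] assms(2)[OF MN(1)] MN(3)]
      by (simp add: vmodule_iso_rel_def)
  qed
  show "trans (vmodule_iso_rel V S)"
    using vmodule_iso_trans[where V = V] unfolding trans_def vmodule_iso_rel_def by blast
qed

section \<open>Multiplicity spaces of the simple characters\<close>

context orbifold
begin

abbreviation chars where "chars \<equiv> simple_characters D"

definition rep :: "(('g \<times> 'g \<Rightarrow> complex) \<Rightarrow> complex) \<Rightarrow> ('g \<times> 'g \<Rightarrow> complex, nat \<Rightarrow> complex) amodule" where
  "rep \<chi> = (SOME U. U \<in> simple_alg_modules D \<and> alg_character D U = \<chi>)"

lemma rep:
  assumes "\<chi> \<in> chars"
  shows "simple_alg_module D (rep \<chi>)" "alg_character D (rep \<chi>) = \<chi>"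
proof -
  have "\<exists>U. U \<in> simple_alg_modules D \<and> alg_character D U = \<chi>"
    using assms by (auto simp: simple_characters_def)
  from someI_ex[OF this] show "simple_alg_module D (rep \<chi>)" "alg_character D (rep \<chi>) = \<chi>"
    by (auto simp: rep_def simple_alg_modules_def)
qed

lemma rep_module: "\<chi> \<in> chars \<Longrightarrow> alg_module D (rep \<chi>)"
  using rep(1) by (simp add: simple_alg_module_def)

lemma rep_iso_eq: "\<chi> \<in> chars \<Longrightarrow> \<chi>' \<in> chars \<Longrightarrow> alg_module_iso D (rep \<chi>) (rep \<chi>') \<Longrightarrow> \<chi> = \<chi>'"
  using iso_imp_alg_character_eq[OF rep(1) rep(1)] rep(2) by metis

text \<open>The given module may live in any type; it is transported first and then compared with
  the representative of its character.\<close>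

lemma rep_exists:
  assumes "simple_alg_module D U"
  shows "\<exists>\<chi>\<in>chars. alg_module_iso D (rep \<chi>) U"
proof -
  obtain U' :: "('g \<times> 'g \<Rightarrow> complex, nat \<Rightarrow> complex) amodule"
    where U': "simple_alg_module D U'" "alg_module_iso D U' U"
    using simple_transport[OF assms] by blast
  have c: "alg_character D U' \<in> chars"
    using U'(1) by (auto simp: simple_characters_def simple_alg_modules_def)
  have "alg_module_iso D (rep (alg_character D U')) U'"
    using rep[OF c] U'(1) by (intro alg_character_eq_imp_iso) auto
  then show ?thesis using U'(2) c alg_module_iso_trans by blast
qed

definition rvec :: "(('g \<times> 'g \<Rightarrow> complex) \<Rightarrow> complex) \<Rightarrow> nat \<Rightarrow> complex" where
  "rvec \<chi> = (SOME m. m \<in> ucarrier (rep \<chi>) \<and> m \<noteq> 0)"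

lemma rvec:
  assumes "\<chi> \<in> chars"
  shows "rvec \<chi> \<in> ucarrier (rep \<chi>)" "rvec \<chi> \<noteq> 0"
proof -
  have "ucarrier (rep \<chi>) \<noteq> {0}" "0 \<in> ucarrier (rep \<chi>)"
    using rep(1)[OF assms] cvec.subspace_0[OF alg_moduleD(1)[OF rep_module[OF assms]]]
    by (simp_all only: simple_alg_module_def simp_thms)
  then have "\<exists>m. m \<in> ucarrier (rep \<chi>) \<and> m \<noteq> 0" by blast
  from someI_ex[OF this] show "rvec \<chi> \<in> ucarrier (rep \<chi>)" "rvec \<chi> \<noteq> 0" unfolding rvec_def by auto
qed

lemma rvec_cyclic:
  assumes \<chi>: "\<chi> \<in> chars" and m: "m \<in> ucarrier (rep \<chi>)"
  shows "\<exists>d\<in>acarrier D. uact (rep \<chi>) d (rvec \<chi>) = m"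
proof -
  let ?W = "(\<lambda>d. uact (rep \<chi>) d (rvec \<chi>)) ` acarrier D"
  note c = cyclic_submodule[OF rep_module[OF \<chi>] rvec(1)[OF \<chi>]]
  have "?W = {0} \<or> ?W = ucarrier (rep \<chi>)"
    using rep(1)[OF \<chi>] c(2,3,5) unfolding simple_alg_module_def by blast
  then have "?W = ucarrier (rep \<chi>)" using c(4) rvec(2)[OF \<chi>] by blast
  then have "m \<in> ?W" using m by simp
  then show ?thesis by (elim imageE) blast
qed

definition Hom :: "(('g \<times> 'g \<Rightarrow> complex) \<Rightarrow> complex) \<Rightarrow> ((nat \<Rightarrow> complex) \<Rightarrow> 'g \<Rightarrow> 'm) set" where
  "Hom \<chi> = {f. linear_map (ucarrier (rep \<chi>)) (mcarrier VS) f \<and>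
     (\<forall>d\<in>acarrier D. \<forall>m\<in>ucarrier (rep \<chi>). f (uact (rep \<chi>) d m) = double_action G \<phi> d (f m))}"

lemma HomD:
  assumes "f \<in> Hom \<chi>"
  shows "linear_map (ucarrier (rep \<chi>)) (mcarrier VS) f"
    "\<And>d m. d \<in> acarrier D \<Longrightarrow> m \<in> ucarrier (rep \<chi>) \<Longrightarrow> f (uact (rep \<chi>) d m) = double_action G \<phi> d (f m)"
  using assms by (auto simp: Hom_def)

text \<open>Multiplicity spaces: a homomorphism is identified with its value at the cyclic vector \<open>rvec \<chi>\<close>.\<close>

definition mult_space :: "(('g \<times> 'g \<Rightarrow> complex) \<Rightarrow> complex) \<Rightarrow> ('g \<Rightarrow> 'm) set" where
  "mult_space \<chi> = (\<lambda>f. f (rvec \<chi>)) ` Hom \<chi>"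

text \<open>Evaluation of homomorphisms: if w is the value of f at \<open>rvec \<chi>\<close>, then
  d w = f(m) for every d that maps \<open>rvec \<chi>\<close> to m. Hence the chosen d does not
  matter on \<open>mult_space \<chi>\<close>.\<close>

definition \<tau> :: "(('g \<times> 'g \<Rightarrow> complex) \<Rightarrow> complex) \<Rightarrow> (nat \<Rightarrow> complex) \<Rightarrow> ('g \<Rightarrow> 'm) \<Rightarrow> 'g \<Rightarrow> 'm" where
  "\<tau> \<chi> m w = double_action G \<phi> (SOME d. d \<in> acarrier D \<and> uact (rep \<chi>) d (rvec \<chi>) = m) w"

definition isotypic :: "(('g \<times> 'g \<Rightarrow> complex) \<Rightarrow> complex) \<Rightarrow> ('g \<Rightarrow> 'm) set" where
  "isotypic \<chi> = cvec.span {\<tau> \<chi> m w | m w. m \<in> ucarrier (rep \<chi>) \<and> w \<in> mult_space \<chi>}"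

lemma DV_act_linear: "d \<in> acarrier D \<Longrightarrow> linear_map (mcarrier VS) (mcarrier VS) (double_action G \<phi> d)"
  using alg_moduleD(2)[OF DV_module] by simp

lemma \<tau>_coset:
  assumes "\<chi> \<in> chars" "m \<in> ucarrier (rep \<chi>)"
  shows "\<exists>d\<in>acarrier D. uact (rep \<chi>) d (rvec \<chi>) = m \<and> (\<forall>w. \<tau> \<chi> m w = double_action G \<phi> d w)"
proof -
  have "\<exists>d. d \<in> acarrier D \<and> uact (rep \<chi>) d (rvec \<chi>) = m" using rvec_cyclic[OF assms] by blast
  from someI_ex[OF this] show ?thesis unfolding \<tau>_def by blast
qed

lemma \<tau>_Hom:
  assumes "\<chi> \<in> chars" "f \<in> Hom \<chi>" "m \<in> ucarrier (rep \<chi>)"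
  shows "\<tau> \<chi> m (f (rvec \<chi>)) = f m"
proof -
  obtain d where d: "d \<in> acarrier D" "uact (rep \<chi>) d (rvec \<chi>) = m" "\<tau> \<chi> m (f (rvec \<chi>)) = double_action G \<phi> d (f (rvec \<chi>))"
    using \<tau>_coset[OF assms(1,3)] by blast
  then show ?thesis using HomD(2)[OF assms(2) d(1) rvec(1)[OF assms(1)]] by simp
qed

lemma mult_spaceE:
  assumes "w \<in> mult_space \<chi>"
  obtains f where "f \<in> Hom \<chi>" "w = f (rvec \<chi>)"
  using assms by (auto simp: mult_space_def)

lemma mult_space_VS: "\<chi> \<in> chars \<Longrightarrow> w \<in> mult_space \<chi> \<Longrightarrow> w \<in> mcarrier VS"
  using linear_map_mem[OF HomD(1) rvec(1)] by (auto simp: mult_space_def)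

text \<open>Composing a homomorphism with a mode of a fixed vector gives a homomorphism again,
  because the two actions commute.\<close>

lemma mult_space_vsubmodule:
  assumes \<chi>: "\<chi> \<in> chars"
  shows "vsubmodule VG VS (mult_space \<chi>)"
  unfolding vsubmodule_def
proof (intro conjI ballI allI)
  note S = VS_subspace
  show "cvec.subspace (mult_space \<chi>)"
  proof (rule cvec.subspaceI)
    have "(\<lambda>m. 0) \<in> Hom \<chi>"
      using cvec.subspace_0[OF S] linear_map_zero[OF DV_act_linear S] by (simp add: Hom_def linear_map_def)
    then show "0 \<in> mult_space \<chi>" unfolding mult_space_def by (rule image_eqI[rotated]) simp
    fix x y assume "x \<in> mult_space \<chi>" "y \<in> mult_space \<chi>"
    then obtain f h where f: "f \<in> Hom \<chi>" "x = f (rvec \<chi>)" and h: "h \<in> Hom \<chi>" "y = h (rvec \<chi>)"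
      by (auto simp: mult_space_def)
    note F = HomD[OF f(1)] and H = HomD[OF h(1)]
    have "(\<lambda>m. f m + h m) \<in> Hom \<chi>"
      unfolding Hom_def
    proof (intro CollectI conjI ballI)
      show "linear_map (ucarrier (rep \<chi>)) (mcarrier VS) (\<lambda>m. f m + h m)"
        using F(1) H(1) cvec.subspace_add[OF S] unfolding linear_map_def
        by (simp add: scaleC_add_right add_ac del: plus_fun_apply)
      show "f (uact (rep \<chi>) d m) + h (uact (rep \<chi>) d m) = double_action G \<phi> d (f m + h m)"
        if "d \<in> acarrier D" "m \<in> ucarrier (rep \<chi>)" for d m
        using F(2)[OF that] H(2)[OF that]
          linear_map_add[OF DV_act_linear[OF that(1)] linear_map_mem[OF F(1) that(2)] linear_map_mem[OF H(1) that(2)]]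
        by metis
    qed
    then show "x + y \<in> mult_space \<chi>" unfolding mult_space_def f(2) h(2) by (rule image_eqI[rotated]) (rule refl)
  next
    fix c x assume "x \<in> mult_space \<chi>"
    then obtain f where f: "f \<in> Hom \<chi>" "x = f (rvec \<chi>)" by (auto simp: mult_space_def)
    note F = HomD[OF f(1)]
    have "(\<lambda>m. c *\<^sub>C f m) \<in> Hom \<chi>"
      unfolding Hom_def
    proof (intro CollectI conjI ballI)
      show "linear_map (ucarrier (rep \<chi>)) (mcarrier VS) (\<lambda>m. c *\<^sub>C f m)"
        using F(1) cvec.subspace_scale[OF S] unfolding linear_map_def
        by (simp add: scaleC_add_right scaleC_scaleC mult.commute del: plus_fun_apply)
      show "c *\<^sub>C f (uact (rep \<chi>) d m) = double_action G \<phi> d (c *\<^sub>C f m)"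
        if "d \<in> acarrier D" "m \<in> ucarrier (rep \<chi>)" for d m
        using F(2)[OF that] linear_map_scale[OF DV_act_linear[OF that(1)] linear_map_mem[OF F(1) that(2)]] by metis
    qed
    then show "c *\<^sub>C x \<in> mult_space \<chi>" unfolding mult_space_def f(2) by (rule image_eqI[rotated]) (rule refl)
  qed
  show "mult_space \<chi> \<subseteq> mcarrier VS" using mult_space_VS[OF \<chi>] by blast
  fix v n w assume v: "v \<in> vcarrier VG" and w: "w \<in> mult_space \<chi>"
  obtain f where f: "f \<in> Hom \<chi>" "w = f (rvec \<chi>)" using w by (rule mult_spaceE)
  note F = HomD[OF f(1)]
  have "(\<lambda>m. mY VS v n (f m)) \<in> Hom \<chi>"
    unfolding Hom_def
  proof (intro CollectI conjI ballI)
    show "linear_map (ucarrier (rep \<chi>)) (mcarrier VS) (\<lambda>m. mY VS v n (f m))"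
      using linear_map_comp[OF F(1) VS_Y_linear[OF VG_subset[OF v]]] .
    show "mY VS v n (f (uact (rep \<chi>) d m)) = double_action G \<phi> d (mY VS v n (f m))"
      if "d \<in> acarrier D" "m \<in> ucarrier (rep \<chi>)" for d m
      using F(2)[OF that] action_Y_commute[OF that(1) v linear_map_mem[OF F(1) that(2)]] by metis
  qed
  then show "mY VS v n w \<in> mult_space \<chi>" unfolding mult_space_def f(2) by (rule image_eqI[rotated]) (rule refl)
qed

lemma Hom_inj:
  assumes \<chi>: "\<chi> \<in> chars" and f: "f \<in> Hom \<chi>" and nz: "f (rvec \<chi>) \<noteq> 0"
  shows "inj_on f (ucarrier (rep \<chi>))"
proof (rule linear_map_inj[OF HomD(1)[OF f] alg_moduleD(1)[OF rep_module[OF \<chi>]]])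
  let ?U = "ucarrier (rep \<chi>)"
  have "{m \<in> ?U. f m = 0} = {0} \<or> {m \<in> ?U. f m = 0} = ?U"
  proof -
    have "cvec.subspace {m \<in> ?U. f m = 0}"
      using HomD(1)[OF f] alg_moduleD(1)[OF rep_module[OF \<chi>]] by (rule linear_map_subspace_kernel)
    moreover have "\<forall>d\<in>acarrier D. \<forall>m\<in>{m \<in> ?U. f m = 0}. uact (rep \<chi>) d m \<in> {m \<in> ?U. f m = 0}"
      using HomD(2)[OF f] act_mem[OF rep_module[OF \<chi>]] linear_map_zero[OF DV_act_linear VS_subspace]
      by simp
    ultimately show ?thesis using rep(1)[OF \<chi>] unfolding simple_alg_module_def by blast
  qed
  then show "m = 0" if "m \<in> ?U" "f m = 0" for m using that nz rvec(1)[OF \<chi>] by blast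
qed

text \<open>Faithfulness of the double on the sum is used here, through
  \<open>simple_hom_exists\<close>. The homomorphism found there is nonzero somewhere, hence at the
  generator \<open>rvec \<chi>\<close>.\<close>

lemma mult_space_nonzero:
  assumes \<chi>: "\<chi> \<in> chars"
  shows "mult_space \<chi> \<noteq> {0}"
proof -
  obtain f u where f: "linear_map (ucarrier (rep \<chi>)) (ucarrier DV) f" "u \<in> ucarrier (rep \<chi>)" "f u \<noteq> 0"
    "\<And>d u. d \<in> acarrier D \<Longrightarrow> u \<in> ucarrier (rep \<chi>) \<Longrightarrow> f (uact (rep \<chi>) d u) = uact DV d (f u)"
    using simple_hom_exists[OF rep(1)[OF \<chi>] DV_module] DV_faithful by auto
  have fH: "f \<in> Hom \<chi>" using f(1,4) by (simp add: Hom_def)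
  obtain d where d: "d \<in> acarrier D" "uact (rep \<chi>) d (rvec \<chi>) = u" using rvec_cyclic[OF \<chi> f(2)] by blast
  have "f (rvec \<chi>) \<noteq> 0"
  proof
    assume "f (rvec \<chi>) = 0"
    then have "f u = 0"
      using HomD(2)[OF fH d(1) rvec(1)[OF \<chi>]] d(2) linear_map_zero[OF DV_act_linear[OF d(1)] VS_subspace] by metis
    then show False using f(3) by simp
  qed
  moreover have "f (rvec \<chi>) \<in> mult_space \<chi>" using fH by (auto simp: mult_space_def)
  ultimately show ?thesis by blast
qed

lemma vsubmodule_mean_sum:
  assumes "vsubmodule VG VS Z" "w \<in> Z" "F \<subseteq> vcarrier V \<times> UNIV"
  shows "(\<Sum>z\<in>F. c z *\<^sub>C mY VS (mean (fst z)) (snd z) w) \<in> Z"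
proof -
  have "mY VS (mean (fst z)) (snd z) w \<in> Z" if "z \<in> F" for z
    using assms mean_mem[of "fst z"] that unfolding vsubmodule_def by auto
  then show ?thesis using assms(1) unfolding vsubmodule_def
    by (intro cvec.subspace_sum cvec.subspace_scale) auto
qed

lemma Hom_image:
  assumes \<chi>: "\<chi> \<in> chars" and f: "f \<in> Hom \<chi>"
  shows "fin_dim (f ` ucarrier (rep \<chi>))" "f ` ucarrier (rep \<chi>) \<subseteq> mcarrier VS"
    "\<And>d w. d \<in> acarrier D \<Longrightarrow> w \<in> f ` ucarrier (rep \<chi>) \<Longrightarrow> double_action G \<phi> d w \<in> f ` ucarrier (rep \<chi>)"
proof -
  show "fin_dim (f ` ucarrier (rep \<chi>))"
    using HomD(1)[OF f] simple_fin_dim[OF rep(1)[OF \<chi>]] by (rule image_fin_dim)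
  show "f ` ucarrier (rep \<chi>) \<subseteq> mcarrier VS" using linear_map_mem[OF HomD(1)[OF f]] by blast
  show "double_action G \<phi> d w \<in> f ` ucarrier (rep \<chi>)" if d: "d \<in> acarrier D" and w: "w \<in> f ` ucarrier (rep \<chi>)" for d w
  proof -
    obtain m where m: "m \<in> ucarrier (rep \<chi>)" "w = f m" using w by blast
    show ?thesis
      unfolding m(2) HomD(2)[OF f d m(1), symmetric] using act_mem[OF rep_module[OF \<chi>] d m(1)] by (rule imageI)
  qed
qed

text \<open>Two homomorphisms f and h, f nonzero, differ by a map from the image of f to the sum
  that is linear over the double. By \<open>fixed_modes_density\<close> this map is a combination of
  modes of fixed vectors, so the value of h lies in every submodule that contains the value of
  f.\<close>

lemma mult_space_simple:
  assumes \<chi>: "\<chi> \<in> chars" and Z: "vsubmodule VG VS Z" "Z \<subseteq> mult_space \<chi>"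
  shows "Z = {0} \<or> Z = mult_space \<chi>"
proof (rule disjCI)
  assume ne: "Z \<noteq> mult_space \<chi>"
  show "Z = {0}"
  proof (rule ccontr)
    assume "Z \<noteq> {0}"
    moreover have "0 \<in> Z" using Z(1) cvec.subspace_0 unfolding vsubmodule_def by blast
    ultimately obtain z where z: "z \<in> Z" "z \<noteq> 0" by blast
    obtain f where f: "f \<in> Hom \<chi>" "z = f (rvec \<chi>)" using z(1) Z(2) mult_spaceE by blast
    let ?U = "ucarrier (rep \<chi>)" and ?W = "f ` ucarrier (rep \<chi>)"
    have inj: "inj_on f ?U" using Hom_inj[OF \<chi> f(1)] f(2) z(2) by simp
    have fbij: "bij_betw f ?U ?W" using inj by (simp add: bij_betw_def)
    have flin: "linear_map ?U ?W f" using HomD(1)[OF f(1)] unfolding linear_map_def by blast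
    note U = alg_moduleD(1)[OF rep_module[OF \<chi>]]
    have "mult_space \<chi> \<subseteq> Z"
    proof
      fix w assume "w \<in> mult_space \<chi>"
      then obtain h where h: "h \<in> Hom \<chi>" "w = h (rvec \<chi>)" by (rule mult_spaceE)
      define B where "B = (\<lambda>x. h (the_inv_into ?U f x))"
      have Bf: "B (f m) = h m" if "m \<in> ?U" for m
        unfolding B_def using the_inv_into_f_f[OF inj that] by simp
      have Blin: "linear_map ?W (mcarrier VS) B"
        unfolding B_def using linear_map_comp[OF linear_map_inverse[OF flin U fbij] HomD(1)[OF h(1)]] .
      have Bact: "B (double_action G \<phi> d w) = double_action G \<phi> d (B w)" if d: "d \<in> acarrier D" and w: "w \<in> ?W" for d w
      proof -
        obtain m where m: "m \<in> ?U" "w = f m" using w by blast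
        show ?thesis
          unfolding m(2) HomD(2)[OF f(1) d m(1), symmetric] Bf[OF act_mem[OF rep_module[OF \<chi>] d m(1)]] Bf[OF m(1)]
          using HomD(2)[OF h(1) d m(1)] .
      qed
      obtain F c where F: "finite F" "F \<subseteq> vcarrier V \<times> (UNIV :: rat set)"
        "\<And>w. w \<in> ?W \<Longrightarrow> B w = (\<Sum>z\<in>F. c z *\<^sub>C mY VS (mean (fst z)) (snd z) w)"
        proof (rule fixed_modes_density[OF Hom_image[OF \<chi> f(1)] Blin Bact])
    fix F :: "('v \<times> rat) set" and c
    assume a: "finite F" "F \<subseteq> vcarrier V \<times> (UNIV :: rat set)"
      "\<And>w. w \<in> ?W \<Longrightarrow> B w = (\<Sum>z\<in>F. c z *\<^sub>C mY VS (mean (fst z)) (snd z) w)"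
    show ?thesis by (rule that) (fact a)+
  qed assumption+
      have "w = B z" unfolding f(2) h(2) using Bf[OF rvec(1)[OF \<chi>]] ..
      also have "\<dots> = (\<Sum>z'\<in>F. c z' *\<^sub>C mY VS (mean (fst z')) (snd z') z)"
        using f(2) rvec(1)[OF \<chi>] by (intro F(3)) blast
      also have "\<dots> \<in> Z" using vsubmodule_mean_sum[OF Z(1) z(1) F(2)] .
      finally show "w \<in> Z" .
    qed
    then show False using ne Z(2) by blast
  qed
qed

lemma mult_space_simple_vsubmodule: "\<chi> \<in> chars \<Longrightarrow> sub (mult_space \<chi>) \<in> simple_vsubmodules VG VS"
  using mult_space_vsubmodule mult_space_nonzero mult_space_simple by (intro simple_vsubmoduleI) auto

lemma mult_space_subspace: "\<chi> \<in> chars \<Longrightarrow> cvec.subspace (mult_space \<chi>)"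
  using mult_space_vsubmodule unfolding vsubmodule_def by blast

lemma \<tau>_mem_VS: "\<chi> \<in> chars \<Longrightarrow> m \<in> ucarrier (rep \<chi>) \<Longrightarrow> w \<in> mult_space \<chi> \<Longrightarrow> \<tau> \<chi> m w \<in> mcarrier VS"
  using \<tau>_Hom linear_map_mem[OF HomD(1)] by (metis mult_spaceE)

lemma \<tau>_mem: "m \<in> ucarrier (rep \<chi>) \<Longrightarrow> w \<in> mult_space \<chi> \<Longrightarrow> \<tau> \<chi> m w \<in> isotypic \<chi>"
  unfolding isotypic_def by (intro cvec.span_base) blast

lemma isotypic_VS: "\<chi> \<in> chars \<Longrightarrow> isotypic \<chi> \<subseteq> mcarrier VS"
  unfolding isotypic_def using \<tau>_mem_VS by (intro cvec.span_minimal VS_subspace) auto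

lemma \<tau>_linear_right:
  assumes "\<chi> \<in> chars" "m \<in> ucarrier (rep \<chi>)"
  shows "linear_map (mult_space \<chi>) (isotypic \<chi>) (\<tau> \<chi> m)"
proof -
  obtain d where d: "d \<in> acarrier D" "\<And>w. \<tau> \<chi> m w = double_action G \<phi> d w"
    using \<tau>_coset[OF assms] by blast
  show ?thesis
    using \<tau>_mem[OF assms(2)] linear_map_add[OF DV_act_linear[OF d(1)]] linear_map_scale[OF DV_act_linear[OF d(1)]]
      mult_space_VS[OF assms(1)] unfolding linear_map_def d(2) by blast
qed

lemma \<tau>_linear_left:
  assumes "\<chi> \<in> chars" "w \<in> mult_space \<chi>"
  shows "linear_map (ucarrier (rep \<chi>)) (isotypic \<chi>) (\<lambda>m. \<tau> \<chi> m w)"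
proof -
  obtain f where f: "f \<in> Hom \<chi>" "w = f (rvec \<chi>)" using assms(2) by (rule mult_spaceE)
  have e: "\<tau> \<chi> m w = f m" if "m \<in> ucarrier (rep \<chi>)" for m using \<tau>_Hom[OF assms(1) f(1) that] f(2) by simp
  note U = alg_moduleD(1)[OF rep_module[OF assms(1)]]
  show ?thesis
    unfolding linear_map_def
  proof (intro conjI ballI allI)
    fix m assume m: "m \<in> ucarrier (rep \<chi>)"
    show "\<tau> \<chi> m w \<in> isotypic \<chi>" using \<tau>_mem[OF m assms(2)] .
    show "\<tau> \<chi> (c *\<^sub>C m) w = c *\<^sub>C \<tau> \<chi> m w" for c
      unfolding e[OF m] e[OF cvec.subspace_scale[OF U m]] by (rule linear_map_scale[OF HomD(1)[OF f(1)] m])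
    fix m' assume m': "m' \<in> ucarrier (rep \<chi>)"
    show "\<tau> \<chi> (m + m') w = \<tau> \<chi> m w + \<tau> \<chi> m' w"
      unfolding e[OF m] e[OF m'] e[OF cvec.subspace_add[OF U m m']] by (rule linear_map_add[OF HomD(1)[OF f(1)] m m'])
  qed
qed

lemma \<tau>_action:
  assumes \<chi>: "\<chi> \<in> chars" and m: "m \<in> ucarrier (rep \<chi>)" and w: "w \<in> mult_space \<chi>" and d: "d \<in> acarrier D"
  shows "double_action G \<phi> d (\<tau> \<chi> m w) = \<tau> \<chi> (uact (rep \<chi>) d m) w"
proof -
  obtain f where f: "f \<in> Hom \<chi>" "w = f (rvec \<chi>)" using w by (rule mult_spaceE)
  show ?thesis
    unfolding f(2) \<tau>_Hom[OF \<chi> f(1) m] \<tau>_Hom[OF \<chi> f(1) act_mem[OF rep_module[OF \<chi>] d m]]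
    using HomD(2)[OF f(1) d m] by simp
qed

lemma \<tau>_modes:
  assumes \<chi>: "\<chi> \<in> chars" and m: "m \<in> ucarrier (rep \<chi>)" and w: "w \<in> mult_space \<chi>" and v: "v \<in> vcarrier VG"
  shows "mY VS v n (\<tau> \<chi> m w) = \<tau> \<chi> m (mY VS v n w)"
proof -
  obtain d where d: "d \<in> acarrier D" "\<And>w. \<tau> \<chi> m w = double_action G \<phi> d w"
    using \<tau>_coset[OF \<chi> m] by blast
  show ?thesis unfolding d(2) using action_Y_commute[OF d(1) v mult_space_VS[OF \<chi> w]] by simp
qed

lemma \<tau>_rvec: "\<chi> \<in> chars \<Longrightarrow> w \<in> mult_space \<chi> \<Longrightarrow> \<tau> \<chi> (rvec \<chi>) w = w"
  using \<tau>_Hom[OF _ _ rvec(1)] by (metis mult_spaceE)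

text \<open>By density some element of the double sends \<open>x0\<close> to
  \<open>rvec \<chi>\<close> and kills the rest of \<open>X\<close>; applied to the sum it leaves
  just \<open>w x0\<close>.\<close>

lemma \<tau>_sum_zero:
  fixes X :: "(nat \<Rightarrow> complex) set"
  assumes \<chi>: "\<chi> \<in> chars" and X: "finite X" "cvec.independent X" "X \<subseteq> ucarrier (rep \<chi>)"
    and w: "\<And>x. x \<in> X \<Longrightarrow> w x \<in> mult_space \<chi>" and zero: "(\<Sum>x\<in>X. \<tau> \<chi> x (w x)) = 0" and x0: "x0 \<in> X"
  shows "w x0 = 0"
proof -
  obtain d where d: "d \<in> acarrier D"
    "\<And>k x. (k, x) \<in> {()} \<times> X \<Longrightarrow> uact (rep \<chi>) d x = (case (k, x) of (k, x) \<Rightarrow> if x = x0 then rvec \<chi> else 0)"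
  proof (rule D_density[of "{()}" "\<lambda>_. rep \<chi>" "{()} \<times> X" "\<lambda>(k, x). if x = x0 then rvec \<chi> else 0"])
    show "(case (k, b) of (k, x) \<Rightarrow> if x = x0 then rvec \<chi> else 0) \<in> ucarrier (rep \<chi>)" for k :: unit and b
      using rvec(1)[OF \<chi>] cvec.subspace_0[OF alg_moduleD(1)[OF rep_module[OF \<chi>]]]
      unfolding prod.case by (cases "b = x0") simp_all
  qed (use \<chi> rep(1) X in auto)
  have \<tau>S: "\<tau> \<chi> x (w x) \<in> mcarrier VS" if "x \<in> X" for x using \<tau>_mem_VS[OF \<chi> _ w[OF that]] X(3) that by blast
  have "0 = double_action G \<phi> d (\<Sum>x\<in>X. \<tau> \<chi> x (w x))"
    unfolding zero using linear_map_zero[OF DV_act_linear[OF d(1)] VS_subspace] ..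
  also have "\<dots> = (\<Sum>x\<in>X. double_action G \<phi> d (\<tau> \<chi> x (w x)))"
    using \<tau>S by (intro linear_map_sum[OF DV_act_linear[OF d(1)] VS_subspace])
  also have "\<dots> = (\<Sum>x\<in>X. if x = x0 then w x0 else 0)"
  proof (rule sum.cong[OF refl])
    fix x assume x: "x \<in> X"
    have xU: "x \<in> ucarrier (rep \<chi>)" using x X(3) by blast
    have "double_action G \<phi> d (\<tau> \<chi> x (w x)) = \<tau> \<chi> (if x = x0 then rvec \<chi> else 0) (w x)"
      using \<tau>_action[OF \<chi> xU w[OF x] d(1)] d(2)[of "()" x] x by simp
    also have "\<dots> = (if x = x0 then w x0 else 0)"
    proof (cases "x = x0")
      case True
      then show ?thesis using \<tau>_rvec[OF \<chi> w[OF x]] by simp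
    next
      case False
      then show ?thesis
        using linear_map_zero[OF \<tau>_linear_left[OF \<chi> w[OF x]] alg_moduleD(1)[OF rep_module[OF \<chi>]]] by simp
    qed
    finally show "double_action G \<phi> d (\<tau> \<chi> x (w x)) = (if x = x0 then w x0 else 0)" .
  qed
  also have "\<dots> = w x0" using X(1) x0 by simp
  finally show ?thesis ..
qed

text \<open>The relation is sorted by first factors. \<open>X\<close> is finite; \<open>Y\<close>
  may be infinite, but only the finite set \<open>Q\<close> of second factors occurs.\<close>

lemma \<tau>_sum_zero_coeff:
  fixes X :: "(nat \<Rightarrow> complex) set"
  assumes \<chi>: "\<chi> \<in> chars" and X: "is_basis X (ucarrier (rep \<chi>))" and Y: "is_basis Y (mult_space \<chi>)"
    and P: "finite P" "P \<subseteq> X \<times> Y" and zero: "(\<Sum>p\<in>P. c p *\<^sub>C \<tau> \<chi> (fst p) (snd p)) = 0" and p: "p \<in> P"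
  shows "c p = 0"
proof -
  have fX: "finite X" using is_basis_finite[OF simple_fin_dim[OF rep(1)[OF \<chi>]] X] .
  have XU: "X \<subseteq> ucarrier (rep \<chi>)" and YW: "Y \<subseteq> mult_space \<chi>" using X Y by (auto dest: is_basis_subset)
  define Q where "Q = snd ` P"
  have Q: "finite Q" "Q \<subseteq> Y" using P by (auto simp: Q_def)
  define e where "e x y = (if (x, y) \<in> P then c (x, y) else 0)" for x y
  define w where "w x = (\<Sum>y\<in>Q. e x y *\<^sub>C y)" for x
  note W = mult_space_subspace[OF \<chi>]
  have w: "w x \<in> mult_space \<chi>" for x
    unfolding w_def using Q(2) YW by (intro cvec.subspace_sum[OF W] cvec.subspace_scale[OF W]) auto
  have "(\<Sum>x\<in>X. \<tau> \<chi> x (w x)) = (\<Sum>x\<in>X. \<Sum>y\<in>Q. e x y *\<^sub>C \<tau> \<chi> x y)"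
    unfolding w_def using XU Q(2) YW
    by (intro sum.cong refl linear_map_lincomb[OF \<tau>_linear_right[OF \<chi>] W]) auto
  also have "\<dots> = (\<Sum>p\<in>X \<times> Q. e (fst p) (snd p) *\<^sub>C \<tau> \<chi> (fst p) (snd p))"
    by (simp add: sum.cartesian_product case_prod_unfold)
  also have "\<dots> = (\<Sum>p\<in>P. c p *\<^sub>C \<tau> \<chi> (fst p) (snd p))"
  proof (rule sum.mono_neutral_cong_right)
    show "finite (X \<times> Q)" using fX Q(1) by simp
    show "P \<subseteq> X \<times> Q" using P(2) by (force simp: Q_def)
    show "\<forall>p\<in>X \<times> Q - P. e (fst p) (snd p) *\<^sub>C \<tau> \<chi> (fst p) (snd p) = 0"
    proof
      fix p assume "p \<in> X \<times> Q - P"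
      then have "e (fst p) (snd p) = 0" by (simp add: e_def)
      then show "e (fst p) (snd p) *\<^sub>C \<tau> \<chi> (fst p) (snd p) = 0" by (simp only: cvec.scale_zero_left)
    qed
    show "e (fst p) (snd p) *\<^sub>C \<tau> \<chi> (fst p) (snd p) = c p *\<^sub>C \<tau> \<chi> (fst p) (snd p)" if "p \<in> P" for p
      using that by (simp only: e_def prod.collapse if_True)
  qed
  finally have "(\<Sum>x\<in>X. \<tau> \<chi> x (w x)) = 0" using zero by simp
  moreover have "fst p \<in> X" using p P(2) by auto
  moreover have "cvec.independent X" using X unfolding is_basis_def by (rule conjunct1)
  ultimately have "w (fst p) = 0" by (intro \<tau>_sum_zero[OF \<chi> fX _ XU w])
  then have "e (fst p) (snd p) = 0"
    unfolding w_def
  proof (rule independent_sum_eq_zero[rotated 2])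
    have "cvec.independent Y" using Y unfolding is_basis_def by (rule conjunct1)
    then show "cvec.independent Q" using Q(2) by (rule cvec.independent_mono)
    show "finite Q" by (rule Q(1))
    show "snd p \<in> Q" using p by (simp add: Q_def)
  qed
  then show ?thesis using p by (simp add: e_def)
qed

lemma \<tau>_tensor_product:
  assumes \<chi>: "\<chi> \<in> chars"
  shows "is_tensor_product (\<tau> \<chi>) (ucarrier (rep \<chi>)) (mult_space \<chi>) (isotypic \<chi>)"
  unfolding is_tensor_product_def
proof (intro conjI ballI allI impI)
  show "linear_map (mult_space \<chi>) (isotypic \<chi>) (\<tau> \<chi> a)" if "a \<in> ucarrier (rep \<chi>)" for a
    using \<tau>_linear_right[OF \<chi> that] .
  show "linear_map (ucarrier (rep \<chi>)) (isotypic \<chi>) (\<lambda>a. \<tau> \<chi> a b)" if "b \<in> mult_space \<chi>" for b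
    using \<tau>_linear_left[OF \<chi> that] .
  fix X Y assume XY: "is_basis X (ucarrier (rep \<chi>)) \<and> is_basis Y (mult_space \<chi>)"
  then have X: "is_basis X (ucarrier (rep \<chi>))" and Y: "is_basis Y (mult_space \<chi>)" by auto
  have XU: "X \<subseteq> ucarrier (rep \<chi>)" and YW: "Y \<subseteq> mult_space \<chi>" using X Y by (auto dest: is_basis_subset)
  have fX: "finite X" using is_basis_finite[OF simple_fin_dim[OF rep(1)[OF \<chi>]] X] .
  note coeff = \<tau>_sum_zero_coeff[OF \<chi> X Y]
  show inj: "inj_on (\<lambda>(x, y). \<tau> \<chi> x y) (X \<times> Y)"
  proof (rule inj_onI)
    fix p q assume pq: "p \<in> X \<times> Y" "q \<in> X \<times> Y" "(case p of (x, y) \<Rightarrow> \<tau> \<chi> x y) = (case q of (x, y) \<Rightarrow> \<tau> \<chi> x y)"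
    show "p = q"
    proof (rule ccontr)
      assume ne: "p \<noteq> q"
      \<comment> \<open>Two equal images would be a relation with coefficients 1 and -1.\<close>
      define c where "c r = (if r = p then 1 else - 1 :: complex)" for r
      have "(\<Sum>r\<in>{p, q}. c r *\<^sub>C \<tau> \<chi> (fst r) (snd r)) = \<tau> \<chi> (fst p) (snd p) - \<tau> \<chi> (fst q) (snd q)"
        using ne by (simp add: c_def scaleC_one cvec.scale_minus_left)
      also have "\<dots> = 0" using pq(3) by (simp add: case_prod_unfold)
      finally have "c p = 0" using pq(1,2) by (intro coeff[of "{p, q}"]) auto
      then show False by (simp add: c_def)
    qed
  qed
  show "is_basis ((\<lambda>(x, y). \<tau> \<chi> x y) ` (X \<times> Y)) (isotypic \<chi>)"
    unfolding is_basis_def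
  proof
    show "cvec.independent ((\<lambda>(x, y). \<tau> \<chi> x y) ` (X \<times> Y))"
      unfolding cvec.independent_explicit_module
    proof (intro allI impI)
      fix t u v assume t: "finite t" "t \<subseteq> (\<lambda>(x, y). \<tau> \<chi> x y) ` (X \<times> Y)" "(\<Sum>v\<in>t. u v *\<^sub>C v) = 0" "v \<in> t"
      obtain P where P: "P \<subseteq> X \<times> Y" "t = (\<lambda>(x, y). \<tau> \<chi> x y) ` P" using t(2) unfolding subset_image_iff by blast
      have injP: "inj_on (\<lambda>(x, y). \<tau> \<chi> x y) P" using inj P(1) by (rule inj_on_subset)
      have fP: "finite P" using t(1) P(2) injP finite_image_iff by blast
      have "(\<Sum>v\<in>t. u v *\<^sub>C v) = (\<Sum>p\<in>P. u (\<tau> \<chi> (fst p) (snd p)) *\<^sub>C \<tau> \<chi> (fst p) (snd p))"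
        unfolding P(2) sum.reindex[OF injP] by (intro sum.cong refl) (simp add: case_prod_unfold)
      then have z: "(\<Sum>p\<in>P. u (\<tau> \<chi> (fst p) (snd p)) *\<^sub>C \<tau> \<chi> (fst p) (snd p)) = 0" using t(3) by simp
      obtain p where p: "p \<in> P" "v = \<tau> \<chi> (fst p) (snd p)" using t(4) P(2) by force
      show "u v = 0" using coeff[OF fP P(1) z p(1)] p(2) by simp
    qed
    let ?I = "(\<lambda>(x, y). \<tau> \<chi> x y) ` (X \<times> Y)"
    show "cvec.span ?I = isotypic \<chi>"
    proof
      show "cvec.span ?I \<subseteq> isotypic \<chi>"
        using \<tau>_mem XU YW by (intro cvec.span_minimal) (auto simp: isotypic_def subset_iff)
      have "\<tau> \<chi> m w \<in> cvec.span ?I" if m: "m \<in> ucarrier (rep \<chi>)" and w: "w \<in> mult_space \<chi>" for m w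
      proof -
        have "w \<in> cvec.span Y" using Y w by (simp add: is_basis_def)
        then obtain t r where t: "finite t" "t \<subseteq> Y" "w = (\<Sum>y\<in>t. r y *\<^sub>C y)"
          unfolding cvec.span_explicit by blast
        have "\<tau> \<chi> m w = (\<Sum>y\<in>t. r y *\<^sub>C \<tau> \<chi> m y)"
          unfolding t(3) using t(2) YW
          by (intro linear_map_lincomb[OF \<tau>_linear_right[OF \<chi> m] mult_space_subspace[OF \<chi>]]) auto
        moreover have "\<tau> \<chi> m y \<in> cvec.span ?I" if y: "y \<in> t" for y
        proof -
          have yW: "y \<in> mult_space \<chi>" using y t(2) YW by blast
          have "\<tau> \<chi> m y = \<tau> \<chi> (\<Sum>x\<in>X. cvec.representation X m x *\<^sub>C x) y"
            using is_basis_sum_representation[OF X fX m] by simp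
          also have "\<dots> = (\<Sum>x\<in>X. cvec.representation X m x *\<^sub>C \<tau> \<chi> x y)"
            using XU by (intro linear_map_lincomb[OF \<tau>_linear_left[OF \<chi> yW] alg_moduleD(1)[OF rep_module[OF \<chi>]]]) auto
          also have "\<dots> \<in> cvec.span ?I"
            using y t(2) by (intro cvec.span_sum cvec.span_scale cvec.span_base) auto
          finally show ?thesis .
        qed
        ultimately show ?thesis by (simp only: cvec.span_sum cvec.span_scale)
      qed
      then show "isotypic \<chi> \<subseteq> cvec.span ?I"
        unfolding isotypic_def by (intro cvec.span_minimal cvec.subspace_span) blast
    qed
  qed
qed

text \<open>An element that acts as a scalar on a simple module acts by the same scalar on the
  corresponding isotypic part; here the scalars are 1 and 0.\<close>

lemma isotypic_separate:
  assumes J: "finite J" "J \<subseteq> chars" and \<chi>0: "\<chi>0 \<in> J"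
  obtains d where "d \<in> acarrier D" "\<And>t. t \<in> isotypic \<chi>0 \<Longrightarrow> double_action G \<phi> d t = t"
    "\<And>\<chi> t. \<chi> \<in> J \<Longrightarrow> \<chi> \<noteq> \<chi>0 \<Longrightarrow> t \<in> isotypic \<chi> \<Longrightarrow> double_action G \<phi> d t = 0"
proof -
  have simple: "simple_alg_module D (rep k)" if "k \<in> J" for k using rep(1) that J(2) by blast
  have noniso: "k = l" if "k \<in> J" "l \<in> J" "alg_module_iso D (rep k) (rep l)" for k l
    using rep_iso_eq that J(2) by blast
  obtain d where d: "d \<in> acarrier D" "\<And>u. u \<in> ucarrier (rep \<chi>0) \<Longrightarrow> uact (rep \<chi>0) d u = u"
    "\<And>\<chi> u. \<chi> \<in> J \<Longrightarrow> \<chi> \<noteq> \<chi>0 \<Longrightarrow> u \<in> ucarrier (rep \<chi>) \<Longrightarrow> uact (rep \<chi>) d u = 0"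
  proof (rule D_separate[OF J(1) \<chi>0 simple noniso])
    fix d assume a: "d \<in> acarrier D" "\<And>u. u \<in> ucarrier (rep \<chi>0) \<Longrightarrow> uact (rep \<chi>0) d u = u"
      "\<And>\<chi> u. \<chi> \<in> J \<Longrightarrow> \<chi> \<noteq> \<chi>0 \<Longrightarrow> u \<in> ucarrier (rep \<chi>) \<Longrightarrow> uact (rep \<chi>) d u = 0"
    show ?thesis by (rule that) (fact a)+
  qed assumption+
  have ext: "double_action G \<phi> d t = c *\<^sub>C t"
    if \<chi>: "\<chi> \<in> chars" and c: "\<And>u. u \<in> ucarrier (rep \<chi>) \<Longrightarrow> uact (rep \<chi>) d u = c *\<^sub>C u" and t: "t \<in> isotypic \<chi>" for \<chi> c t
  proof -
    note A = DV_act_linear[OF d(1)]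
    have sub: "cvec.subspace {t \<in> mcarrier VS. double_action G \<phi> d t = c *\<^sub>C t}"
    proof (rule cvec.subspaceI)
      show "0 \<in> {t \<in> mcarrier VS. double_action G \<phi> d t = c *\<^sub>C t}"
        using cvec.subspace_0[OF VS_subspace] linear_map_zero[OF A VS_subspace]
        by (simp only: mem_Collect_eq cvec.scale_zero_right)
      show "x + y \<in> {t \<in> mcarrier VS. double_action G \<phi> d t = c *\<^sub>C t}"
        if "x \<in> {t \<in> mcarrier VS. double_action G \<phi> d t = c *\<^sub>C t}" "y \<in> {t \<in> mcarrier VS. double_action G \<phi> d t = c *\<^sub>C t}" for x y
        using that cvec.subspace_add[OF VS_subspace] linear_map_add[OF A, of x y]
        by (simp only: mem_Collect_eq scaleC_add_right)
      show "b *\<^sub>C x \<in> {t \<in> mcarrier VS. double_action G \<phi> d t = c *\<^sub>C t}"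
        if "x \<in> {t \<in> mcarrier VS. double_action G \<phi> d t = c *\<^sub>C t}" for b x
        using that cvec.subspace_scale[OF VS_subspace] linear_map_scale[OF A, of x b]
        by (simp only: mem_Collect_eq scaleC_scaleC mult.commute)
    qed
    have gen: "\<tau> \<chi> m w \<in> {t \<in> mcarrier VS. double_action G \<phi> d t = c *\<^sub>C t}"
      if m: "m \<in> ucarrier (rep \<chi>)" and w: "w \<in> mult_space \<chi>" for m w
    proof -
      have "double_action G \<phi> d (\<tau> \<chi> m w) = c *\<^sub>C \<tau> \<chi> m w"
        unfolding \<tau>_action[OF \<chi> m w d(1)] c[OF m] using linear_map_scale[OF \<tau>_linear_left[OF \<chi> w] m] .
      then show ?thesis using \<tau>_mem_VS[OF \<chi> m w] by blast
    qed
    have "isotypic \<chi> \<subseteq> {t \<in> mcarrier VS. double_action G \<phi> d t = c *\<^sub>C t}"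
      unfolding isotypic_def using gen by (intro cvec.span_minimal sub) blast
    then show ?thesis using t by blast
  qed
  show ?thesis
  proof
    show "d \<in> acarrier D" by fact
    have c0: "\<chi>0 \<in> chars" using J \<chi>0 by blast
    have "uact (rep \<chi>0) d u = 1 *\<^sub>C u" if "u \<in> ucarrier (rep \<chi>0)" for u
      unfolding scaleC_one using d(2)[OF that] .
    then show "double_action G \<phi> d t = t" if "t \<in> isotypic \<chi>0" for t
      using ext[OF c0 _ that, of 1] unfolding scaleC_one by blast
    fix \<chi> t assume \<chi>: "\<chi> \<in> J" "\<chi> \<noteq> \<chi>0" and t: "t \<in> isotypic \<chi>"
    have "\<chi> \<in> chars" using J \<chi> by blast
    moreover have "uact (rep \<chi>) d u = 0 *\<^sub>C u" if "u \<in> ucarrier (rep \<chi>)" for u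
      unfolding cvec.scale_zero_left using d(3)[OF \<chi> that] .
    ultimately show "double_action G \<phi> d t = 0" using ext[OF _ _ t, of 0] unfolding cvec.scale_zero_left by blast
  qed
qed

lemma simple_submodule_Hom:
  assumes S: "simple_alg_module D (DV\<lparr>ucarrier := S\<rparr>)" "S \<subseteq> mcarrier VS"
  obtains \<chi> f where "\<chi> \<in> chars" "f \<in> Hom \<chi>" "f ` ucarrier (rep \<chi>) = S" "f (rvec \<chi>) \<noteq> 0"
proof -
  obtain \<chi> where \<chi>: "\<chi> \<in> chars" "alg_module_iso D (rep \<chi>) (DV\<lparr>ucarrier := S\<rparr>)"
    using rep_exists[OF S(1)] by blast
  obtain f where f: "bij_betw f (ucarrier (rep \<chi>)) S" "linear_map (ucarrier (rep \<chi>)) S f"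
    "\<And>d u. d \<in> acarrier D \<Longrightarrow> u \<in> ucarrier (rep \<chi>) \<Longrightarrow> f (uact (rep \<chi>) d u) = double_action G \<phi> d (f u)"
    using \<chi>(2) unfolding alg_module_iso_def by auto
  have fH: "f \<in> Hom \<chi>" using f(2,3) S(2) unfolding Hom_def linear_map_def by blast
  have "f (rvec \<chi>) \<noteq> f 0"
    using f(1) rvec[OF \<chi>(1)] cvec.subspace_0[OF alg_moduleD(1)[OF rep_module[OF \<chi>(1)]]]
    unfolding bij_betw_def inj_on_def by blast
  then have "f (rvec \<chi>) \<noteq> 0"
    using linear_map_zero[OF f(2) alg_moduleD(1)[OF rep_module[OF \<chi>(1)]]] by metis
  then show ?thesis using that[OF \<chi>(1) fH] f(1) unfolding bij_betw_def by blast
qed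

text \<open>The submodule generated by z is finite-dimensional, so it contains a simple one, and all
  its vectors have the form d z. Keeping d explicit matters later: its action commutes with the
  fixed modes and thus maps modules of \<open>VG\<close> to each other.\<close>

lemma cyclic_Hom:
  assumes z: "z \<in> mcarrier VS" "z \<noteq> 0"
  obtains \<chi> f d where "\<chi> \<in> chars" "f \<in> Hom \<chi>" "f (rvec \<chi>) \<noteq> 0" "d \<in> acarrier D"
    "f (rvec \<chi>) = double_action G \<phi> d z"
proof -
  have zD: "z \<in> ucarrier DV" using z(1) unfolding DV_simps .
  define Z where "Z = (\<lambda>d. uact DV d z) ` acarrier D"
  note Zc = cyclic_submodule[OF DV_module zD, folded Z_def]
  have Z0: "Z \<noteq> {0}" using Zc(4) z(2) by blast
  obtain T where T: "T \<subseteq> Z" "simple_alg_module D (DV\<lparr>ucarrier := T\<rparr>)"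
    using ex_simple_submodule[OF DV_module Zc(1) Z0 Zc(3,5)] by blast
  have TV: "T \<subseteq> mcarrier VS" using T(1) Zc(3) unfolding DV_simps by blast
  obtain \<chi> f where f: "\<chi> \<in> chars" "f \<in> Hom \<chi>" "f ` ucarrier (rep \<chi>) = T" "f (rvec \<chi>) \<noteq> 0"
    using simple_submodule_Hom[OF T(2) TV] .
  have "f (rvec \<chi>) \<in> Z" using f(3) rvec(1)[OF f(1)] T(1) by blast
  then obtain d where "d \<in> acarrier D" "f (rvec \<chi>) = double_action G \<phi> d z"
    unfolding Z_def DV_simps by blast
  then show ?thesis using that f(1,2,4) by blast
qed

text \<open>Independence comes from the elements of \<open>isotypic_separate\<close>. For
  exhaustion, the span S of the isotypic parts has an invariant complement by
  \<open>maschke\<close>; a nonzero complement would contain a vector of some multiplicity space,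
  and these lie in S.\<close>

lemma isotypic_direct_sum: "direct_sum chars isotypic (mcarrier VS)"
  unfolding direct_sum_def
proof (intro conjI allI impI)
  show "\<forall>\<chi>\<in>chars. cvec.subspace (isotypic \<chi>)" unfolding isotypic_def by (intro ballI cvec.subspace_span)
  fix J f
  assume J: "finite J \<and> J \<subseteq> chars \<and> (\<forall>\<chi>\<in>J. f \<chi> \<in> isotypic \<chi>) \<and> (\<Sum>\<chi>\<in>J. f \<chi>) = 0"
  show "\<forall>\<chi>\<in>J. f \<chi> = 0"
  proof
    fix \<chi> assume \<chi>: "\<chi> \<in> J"
    obtain d where d: "d \<in> acarrier D" "\<And>t. t \<in> isotypic \<chi> \<Longrightarrow> double_action G \<phi> d t = t"
      "\<And>\<chi>' t. \<chi>' \<in> J \<Longrightarrow> \<chi>' \<noteq> \<chi> \<Longrightarrow> t \<in> isotypic \<chi>' \<Longrightarrow> double_action G \<phi> d t = 0"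
      using isotypic_separate[of J \<chi>] J \<chi> by blast
    note A = DV_act_linear[OF d(1)]
    have fS: "f \<chi>' \<in> mcarrier VS" if "\<chi>' \<in> J" for \<chi>' using J that isotypic_VS by blast
    \<comment> \<open>On the relation, d keeps the term at \<chi> and removes all others.\<close>
    have "0 = double_action G \<phi> d (\<Sum>\<chi>\<in>J. f \<chi>)" using J linear_map_zero[OF A VS_subspace] by metis
    also have "\<dots> = (\<Sum>\<chi>\<in>J. double_action G \<phi> d (f \<chi>))" using fS by (rule linear_map_sum[OF A VS_subspace])
    also have "\<dots> = (\<Sum>\<chi>'\<in>J. if \<chi>' = \<chi> then f \<chi> else 0)"
    proof (rule sum.cong[OF refl])
      fix \<chi>' assume \<chi>': "\<chi>' \<in> J"
      have m: "f \<chi>' \<in> isotypic \<chi>'" using J \<chi>' by blast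
      show "double_action G \<phi> d (f \<chi>') = (if \<chi>' = \<chi> then f \<chi> else 0)"
      proof (cases "\<chi>' = \<chi>")
        case True
        show ?thesis using d(2)[of "f \<chi>'"] m unfolding True if_P[OF refl] by blast
      next
        case False
        show ?thesis using d(3)[OF \<chi>' False m] unfolding if_not_P[OF False] .
      qed
    qed
    also have "\<dots> = f \<chi>" using J \<chi> by (simp only: sum.delta if_True)
    finally show "f \<chi> = 0" by (rule sym)
  qed
next
  define S where "S = cvec.span (\<Union>\<chi>\<in>chars. isotypic \<chi>)"
  have S: "cvec.subspace S" unfolding S_def by (rule cvec.subspace_span)
  have SV: "S \<subseteq> mcarrier VS" unfolding S_def using isotypic_VS by (intro cvec.span_minimal VS_subspace) blast
  have inS: "\<tau> \<chi> m w \<in> S" if "\<chi> \<in> chars" "m \<in> ucarrier (rep \<chi>)" "w \<in> mult_space \<chi>" for \<chi> m w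
    unfolding S_def using \<tau>_mem[OF that(2,3)] that(1) by (intro cvec.span_base) blast
  have stable: "\<forall>d\<in>acarrier D. \<forall>w\<in>S. uact DV d w \<in> S"
  proof
    fix d assume d: "d \<in> acarrier D"
    note A = DV_act_linear[OF d]
    have sub: "cvec.subspace {t \<in> mcarrier VS. double_action G \<phi> d t \<in> S}"
    proof (rule cvec.subspaceI)
      show "0 \<in> {t \<in> mcarrier VS. double_action G \<phi> d t \<in> S}"
        using cvec.subspace_0[OF VS_subspace] linear_map_zero[OF A VS_subspace] cvec.subspace_0[OF S] by (simp only: mem_Collect_eq)
      show "x + y \<in> {t \<in> mcarrier VS. double_action G \<phi> d t \<in> S}"
        if "x \<in> {t \<in> mcarrier VS. double_action G \<phi> d t \<in> S}" "y \<in> {t \<in> mcarrier VS. double_action G \<phi> d t \<in> S}" for x y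
        using that cvec.subspace_add[OF VS_subspace] cvec.subspace_add[OF S] linear_map_add[OF A, of x y]
        by (simp only: mem_Collect_eq)
      show "b *\<^sub>C x \<in> {t \<in> mcarrier VS. double_action G \<phi> d t \<in> S}"
        if "x \<in> {t \<in> mcarrier VS. double_action G \<phi> d t \<in> S}" for b x
        using that cvec.subspace_scale[OF VS_subspace] cvec.subspace_scale[OF S] linear_map_scale[OF A, of x b]
        by (simp only: mem_Collect_eq)
    qed
    have gen: "\<tau> \<chi> m w \<in> {t \<in> mcarrier VS. double_action G \<phi> d t \<in> S}"
      if "\<chi> \<in> chars" "m \<in> ucarrier (rep \<chi>)" "w \<in> mult_space \<chi>" for \<chi> m w
      using \<tau>_mem_VS[OF that] \<tau>_action[OF that d] inS[OF that(1) act_mem[OF rep_module[OF that(1)] d that(2)] that(3)]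
      by (simp only: mem_Collect_eq)
    have "isotypic \<chi> \<subseteq> {t \<in> mcarrier VS. double_action G \<phi> d t \<in> S}" if "\<chi> \<in> chars" for \<chi>
      unfolding isotypic_def using gen[OF that] by (intro cvec.span_minimal sub) blast
    then have "S \<subseteq> {t \<in> mcarrier VS. double_action G \<phi> d t \<in> S}"
      unfolding S_def[of] by (intro cvec.span_minimal sub[unfolded S_def]) blast
    then show "\<forall>w\<in>S. uact DV d w \<in> S" by auto
  qed
  obtain C where C: "cvec.subspace C" "C \<subseteq> ucarrier DV" "\<forall>d\<in>acarrier D. \<forall>w\<in>C. uact DV d w \<in> C"
    "S \<inter> C = {0}" "\<And>u. u \<in> ucarrier DV \<Longrightarrow> \<exists>w\<in>S. \<exists>c\<in>C. u = w + c"
    using maschke[OF DV_module S _ stable] SV unfolding DV_simps by blast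
  have "C = {0}"
  proof (rule ccontr)
    assume "C \<noteq> {0}"
    then obtain c where c: "c \<in> C" "c \<noteq> 0" using cvec.subspace_0[OF C(1)] by blast
    have "c \<in> mcarrier VS" using c(1) C(2) unfolding DV_simps by blast
    then obtain \<chi> f d where f: "\<chi> \<in> chars" "f \<in> Hom \<chi>" "f (rvec \<chi>) \<noteq> 0" "d \<in> acarrier D"
      "f (rvec \<chi>) = double_action G \<phi> d c"
      using c(2) by (rule cyclic_Hom)
    have "f (rvec \<chi>) \<in> mult_space \<chi>" using f(2) by (auto simp: mult_space_def)
    then have "\<tau> \<chi> (rvec \<chi>) (f (rvec \<chi>)) \<in> S" using f(1) rvec(1) by (intro inS)
    then have "f (rvec \<chi>) \<in> S" using \<tau>_Hom[OF f(1,2) rvec(1)[OF f(1)]] by simp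
    moreover have "f (rvec \<chi>) \<in> C" using C(3) f(4,5) c(1) unfolding DV_simps by simp
    ultimately show False using C(4) f(3) by blast
  qed
  have "mcarrier VS \<subseteq> S"
  proof
    fix u assume "u \<in> mcarrier VS"
    then obtain w where "w \<in> S" "u = w + 0" using C(5)[of u] \<open>C = {0}\<close> unfolding DV_simps by blast
    then show "u \<in> S" by (simp only: add_0_right)
  qed
  then show "cvec.span (\<Union>\<chi>\<in>chars. isotypic \<chi>) = mcarrier VS" using SV unfolding S_def by blast
qed

section \<open>Simple modules of the fixed-point algebra and the bijection\<close>

lemma VG_modes_simple_action:
  assumes W: "vsubmodule VG VS W" "W \<noteq> {0}"
    and simple: "\<forall>W'. vsubmodule VG VS W' \<and> W' \<subseteq> W \<longrightarrow> W' = {0} \<or> W' = W"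
  shows "simple_action (vcarrier VG \<times> UNIV) (\<lambda>(v, n). mY VS v n) W"
  unfolding simple_action_def
proof (intro conjI ballI allI impI)
  show "cvec.subspace W" "W \<noteq> {0}" using W unfolding vsubmodule_def by auto
  have closed: "W \<subseteq> mcarrier VS" "\<And>v n w. v \<in> vcarrier VG \<Longrightarrow> w \<in> W \<Longrightarrow> mY VS v n w \<in> W"
    using W(1) unfolding vsubmodule_def by blast+
  have lin: "linear_map W W (mY VS v n)" if "v \<in> vcarrier VG" for v n
    using closed(2)[OF that] linear_map_add[OF VS_Y_linear[OF VG_subset[OF that]]]
      linear_map_scale[OF VS_Y_linear[OF VG_subset[OF that]]] closed(1)
    unfolding linear_map_def by blast
  show "linear_map W W (case a of (v, n) \<Rightarrow> mY VS v n)" if "a \<in> vcarrier VG \<times> (UNIV :: rat set)" for a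
    using lin that by (cases a) simp
  fix W' assume W': "cvec.subspace W' \<and> W' \<subseteq> W \<and>
    (\<forall>a\<in>vcarrier VG \<times> UNIV. \<forall>w\<in>W'. (case a of (v, n) \<Rightarrow> mY VS v n) w \<in> W')"
  have "vsubmodule VG VS W'"
    unfolding vsubmodule_def
  proof (intro conjI ballI allI)
    show "cvec.subspace W'" "W' \<subseteq> mcarrier VS" using W' closed(1) by blast+
    fix v n w assume v: "v \<in> vcarrier VG" and w: "w \<in> W'"
    have "\<forall>a\<in>vcarrier VG \<times> UNIV. \<forall>w\<in>W'. (case a of (v, n) \<Rightarrow> mY VS v n) w \<in> W'" using W' by (elim conjE)
    from bspec[OF bspec[OF this, of "(v, n)"] w] v show "mY VS v n w \<in> W'" by simp
  qed
  then show "W' = {0} \<or> W' = W" using simple W' by blast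
qed

text \<open>Some d moves a nonzero z of W into a multiplicity space without killing it. Since d
  commutes with the modes of \<open>VG\<close>, it maps all of the simple W there, and Schur's lemma
  makes it an isomorphism.\<close>

lemma simple_vsubmodule_iso_mult_space:
  assumes W: "vsubmodule VG VS W" "W \<noteq> {0}"
    and simple: "\<forall>W'. vsubmodule VG VS W' \<and> W' \<subseteq> W \<longrightarrow> W' = {0} \<or> W' = W"
  shows "\<exists>\<chi>\<in>chars. vmodule_iso VG (sub W) (sub (mult_space \<chi>))"
proof -
  have closed: "cvec.subspace W" "W \<subseteq> mcarrier VS" "\<And>v n w. v \<in> vcarrier VG \<Longrightarrow> w \<in> W \<Longrightarrow> mY VS v n w \<in> W"
    using W(1) unfolding vsubmodule_def by blast+
  obtain z where z: "z \<in> W" "z \<noteq> 0" using W(2) cvec.subspace_0[OF closed(1)] by blast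
  have "z \<in> mcarrier VS" using z(1) closed(2) by blast
  then obtain \<chi> f d where f: "\<chi> \<in> chars" "f \<in> Hom \<chi>" "f (rvec \<chi>) \<noteq> 0"
    and d: "d \<in> acarrier D" "f (rvec \<chi>) = double_action G \<phi> d z"
    using z(2) by (rule cyclic_Hom)
  have fm: "f (rvec \<chi>) \<in> mult_space \<chi>" using f(2) by (auto simp: mult_space_def)
  note A = DV_act_linear[OF d(1)]
  note V\<chi> = mult_space_vsubmodule[OF f(1)]
  note Vs = mult_space_subspace[OF f(1)]
  \<comment> \<open>The vectors of W that d sends into the multiplicity space; this submodule
    contains z, so it is W.\<close>
  define W1 where "W1 = {x \<in> W. double_action G \<phi> d x \<in> mult_space \<chi>}"
  have "vsubmodule VG VS W1"
    unfolding vsubmodule_def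
  proof (intro conjI ballI allI)
    show "cvec.subspace W1"
    proof (rule cvec.subspaceI)
      show "0 \<in> W1" unfolding W1_def
        using cvec.subspace_0[OF closed(1)] cvec.subspace_0[OF Vs] linear_map_zero[OF A VS_subspace] by (simp only: mem_Collect_eq)
      show "x + y \<in> W1" if "x \<in> W1" "y \<in> W1" for x y
        using that closed(2) cvec.subspace_add[OF closed(1)] cvec.subspace_add[OF Vs] linear_map_add[OF A, of x y]
        by (simp only: W1_def mem_Collect_eq subset_iff)
      show "c *\<^sub>C x \<in> W1" if "x \<in> W1" for c x
        using that closed(2) cvec.subspace_scale[OF closed(1)] cvec.subspace_scale[OF Vs] linear_map_scale[OF A, of x c]
        by (simp only: W1_def mem_Collect_eq subset_iff)
    qed
    show "W1 \<subseteq> mcarrier VS" using closed(2) by (auto simp: W1_def)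
    fix v n x assume v: "v \<in> vcarrier VG" and x: "x \<in> W1"
    have xW: "x \<in> W" "double_action G \<phi> d x \<in> mult_space \<chi>" using x by (auto simp: W1_def)
    have "double_action G \<phi> d (mY VS v n x) = mY VS v n (double_action G \<phi> d x)"
      using action_Y_commute[OF d(1) v] xW(1) closed(2) by blast
    moreover have "mY VS v n (double_action G \<phi> d x) \<in> mult_space \<chi>"
      using V\<chi> v xW(2) unfolding vsubmodule_def by blast
    ultimately show "mY VS v n x \<in> W1" using closed(3)[OF v xW(1)] by (simp add: W1_def)
  qed
  moreover have "W1 \<subseteq> W" by (auto simp: W1_def)
  moreover have "z \<in> W1" using z(1) fm d(2) by (simp add: W1_def)
  ultimately have "W1 = W" using simple z(2) by blast
  then have map: "double_action G \<phi> d x \<in> mult_space \<chi>" if "x \<in> W" for x using that by (auto simp: W1_def)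
  have lin: "linear_map W (mult_space \<chi>) (double_action G \<phi> d)"
    using map linear_map_add[OF A] linear_map_scale[OF A] closed(2) unfolding linear_map_def by blast
  have comm: "double_action G \<phi> d (mY VS v n x) = mY VS v n (double_action G \<phi> d x)"
    if "v \<in> vcarrier VG" "x \<in> W" for v n x
    using action_Y_commute[OF d(1) that(1)] that(2) closed(2) by blast
  have "bij_betw (double_action G \<phi> d) W (mult_space \<chi>)"
  proof (rule simple_action_hom_bij[OF VG_modes_simple_action[OF W simple]
        VG_modes_simple_action[OF V\<chi> mult_space_nonzero[OF f(1)]] lin _ z(1)])
    show "\<forall>W'. vsubmodule VG VS W' \<and> W' \<subseteq> mult_space \<chi> \<longrightarrow> W' = {0} \<or> W' = mult_space \<chi>"
      using mult_space_simple[OF f(1)] by blast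
    show "double_action G \<phi> d z \<noteq> 0" using d(2) f(3) by simp
    show "double_action G \<phi> d ((case a of (v, n) \<Rightarrow> mY VS v n) w) = (case a of (v, n) \<Rightarrow> mY VS v n) (double_action G \<phi> d w)"
      if "a \<in> vcarrier VG \<times> UNIV" "w \<in> W" for a w
      using comm that by (cases a) simp
  qed
  then have "vmodule_iso VG (sub W) (sub (mult_space \<chi>))"
    unfolding vmodule_iso_def using lin comm by (intro exI[of _ "double_action G \<phi> d"]) simp
  then show ?thesis using f(1) by blast
qed

text \<open>If the characters differ, some element of the double is the identity on the image of f
  and zero on the image of h. On the sum of the two images it equals a combination of fixed modes.
  The isomorphism \<theta> commutes with that combination, which fixes w but kills \<theta>
  w.\<close>

lemma mult_space_iso_eq:
  assumes \<chi>: "\<chi> \<in> chars" "\<chi>' \<in> chars" and iso: "vmodule_iso VG (sub (mult_space \<chi>)) (sub (mult_space \<chi>'))"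
  shows "\<chi> = \<chi>'"
proof (rule ccontr)
  assume ne: "\<chi> \<noteq> \<chi>'"
  obtain \<theta> where \<theta>: "bij_betw \<theta> (mult_space \<chi>) (mult_space \<chi>')" "linear_map (mult_space \<chi>) (mult_space \<chi>') \<theta>"
    "\<And>v n w. v \<in> vcarrier VG \<Longrightarrow> w \<in> mult_space \<chi> \<Longrightarrow> \<theta> (mY VS v n w) = mY VS v n (\<theta> w)"
    using iso unfolding vmodule_iso_def by auto
  note S = mult_space_subspace[OF \<chi>(1)]
  obtain w where w: "w \<in> mult_space \<chi>" "w \<noteq> 0"
    using mult_space_nonzero[OF \<chi>(1)] cvec.subspace_0[OF S] by blast
  have \<theta>w: "\<theta> w \<in> mult_space \<chi>'" using linear_map_mem[OF \<theta>(2) w(1)] .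
  have "\<theta> w \<noteq> \<theta> 0" using \<theta>(1) w cvec.subspace_0[OF S] unfolding bij_betw_def inj_on_def by blast
  then have \<theta>w0: "\<theta> w \<noteq> 0" using linear_map_zero[OF \<theta>(2) S] by metis
  obtain f where f: "f \<in> Hom \<chi>" "w = f (rvec \<chi>)" using w(1) by (rule mult_spaceE)
  obtain h where h: "h \<in> Hom \<chi>'" "\<theta> w = h (rvec \<chi>')" using \<theta>w by (rule mult_spaceE)
  let ?A = "f ` ucarrier (rep \<chi>)" and ?B = "h ` ucarrier (rep \<chi>')"
  note fA = Hom_image[OF \<chi>(1) f(1)] and hB = Hom_image[OF \<chi>(2) h(1)]
  \<comment> \<open>Both images have to lie in one finite-dimensional submodule, so that a single
    combination of modes describes d on both.\<close>
  define W where "W = {x + y | x y. x \<in> ?A \<and> y \<in> ?B}"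
  obtain X Y where XY: "finite X" "?A = cvec.span X" "finite Y" "?B = cvec.span Y"
    using fA(1) hB(1) by (auto simp: fin_dim_def)
  have "W = cvec.span (X \<union> Y)" unfolding W_def XY(2,4) cvec.span_Un by blast
  then have Wf: "fin_dim W" using XY(1,3) by (auto simp: fin_dim_def)
  have WV: "W \<subseteq> mcarrier VS" unfolding W_def using fA(2) hB(2) cvec.subspace_add[OF VS_subspace] by blast
  have split: "\<exists>m\<in>ucarrier (rep \<chi>). \<exists>m'\<in>ucarrier (rep \<chi>'). x = f m + h m'" if "x \<in> W" for x
    using that unfolding W_def by blast
  have fiso: "f m \<in> isotypic \<chi>" if "m \<in> ucarrier (rep \<chi>)" for m
    using \<tau>_Hom[OF \<chi>(1) f(1) that] \<tau>_mem[OF that w(1)] f(2) by simp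
  have hiso: "h m \<in> isotypic \<chi>'" if "m \<in> ucarrier (rep \<chi>')" for m
    using \<tau>_Hom[OF \<chi>(2) h(1) that] \<tau>_mem[OF that \<theta>w] h(2) by simp
  obtain d where d: "d \<in> acarrier D" "\<And>t. t \<in> isotypic \<chi> \<Longrightarrow> double_action G \<phi> d t = t"
    "\<And>\<chi>'' t. \<chi>'' \<in> {\<chi>, \<chi>'} \<Longrightarrow> \<chi>'' \<noteq> \<chi> \<Longrightarrow> t \<in> isotypic \<chi>'' \<Longrightarrow> double_action G \<phi> d t = 0"
    using isotypic_separate[of "{\<chi>, \<chi>'}" \<chi>] \<chi> by blast
  note A = DV_act_linear[OF d(1)]
  have fm: "f m \<in> mcarrier VS" if "m \<in> ucarrier (rep \<chi>)" for m using linear_map_mem[OF HomD(1)[OF f(1)] that] .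
  have hm: "h m \<in> mcarrier VS" if "m \<in> ucarrier (rep \<chi>')" for m using linear_map_mem[OF HomD(1)[OF h(1)] that] .
  have dsplit: "double_action G \<phi> d (f m + h m') = f m"
    if m: "m \<in> ucarrier (rep \<chi>)" and m': "m' \<in> ucarrier (rep \<chi>')" for m m'
  proof -
    have "double_action G \<phi> d (f m + h m') = double_action G \<phi> d (f m) + double_action G \<phi> d (h m')"
      using linear_map_add[OF A fm[OF m] hm[OF m']] .
    also have "double_action G \<phi> d (f m) = f m" using d(2)[OF fiso[OF m]] .
    also have "double_action G \<phi> d (h m') = 0" using d(3)[of \<chi>' "h m'"] hiso[OF m'] ne by blast
    finally show ?thesis by (simp only: add_0_right)
  qed
  have act_split: "double_action G \<phi> d' (f m + h m') = f (uact (rep \<chi>) d' m) + h (uact (rep \<chi>') d' m')"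
    if "d' \<in> acarrier D" "m \<in> ucarrier (rep \<chi>)" "m' \<in> ucarrier (rep \<chi>')" for d' m m'
    using linear_map_add[OF DV_act_linear[OF that(1)] fm[OF that(2)] hm[OF that(3)]]
      HomD(2)[OF f(1) that(1,2)] HomD(2)[OF h(1) that(1,3)] by metis
  have Wact: "double_action G \<phi> d' x \<in> W" if d': "d' \<in> acarrier D" and x: "x \<in> W" for d' x
  proof -
    obtain m m' where m: "m \<in> ucarrier (rep \<chi>)" "m' \<in> ucarrier (rep \<chi>')" "x = f m + h m'" using split[OF x] by blast
    show ?thesis
      unfolding m(3) act_split[OF d' m(1,2)] W_def
      using act_mem[OF rep_module[OF \<chi>(1)] d' m(1)] act_mem[OF rep_module[OF \<chi>(2)] d' m(2)] by blast
  qed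
  have Wlin: "linear_map W (mcarrier VS) (double_action G \<phi> d)" using A WV unfolding linear_map_def by blast
  \<comment> \<open>The element d is not claimed to be central; on \<open>W\<close> it commutes with
    the double because it acts there as the projection to the first image.\<close>
  have Wcomm: "double_action G \<phi> d (double_action G \<phi> d' x) = double_action G \<phi> d' (double_action G \<phi> d x)"
    if d': "d' \<in> acarrier D" and x: "x \<in> W" for d' x
  proof -
    obtain m m' where m: "m \<in> ucarrier (rep \<chi>)" "m' \<in> ucarrier (rep \<chi>')" "x = f m + h m'" using split[OF x] by blast
    show ?thesis
      unfolding m(3) act_split[OF d' m(1,2)] dsplit[OF m(1,2)]
        dsplit[OF act_mem[OF rep_module[OF \<chi>(1)] d' m(1)] act_mem[OF rep_module[OF \<chi>(2)] d' m(2)]]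
      using HomD(2)[OF f(1) d' m(1)] .
  qed
  obtain F c where F: "finite F" "F \<subseteq> vcarrier V \<times> (UNIV :: rat set)"
    "\<And>x. x \<in> W \<Longrightarrow> double_action G \<phi> d x = (\<Sum>z\<in>F. c z *\<^sub>C mY VS (mean (fst z)) (snd z) x)"
    proof (rule fixed_modes_density[OF Wf WV Wact Wlin Wcomm])
    fix F :: "('v \<times> rat) set" and c
    assume a: "finite F" "F \<subseteq> vcarrier V \<times> (UNIV :: rat set)"
      "\<And>x. x \<in> W \<Longrightarrow> double_action G \<phi> d x = (\<Sum>z\<in>F. c z *\<^sub>C mY VS (mean (fst z)) (snd z) x)"
    show ?thesis by (rule that) (fact a)+
  qed assumption+
  have Fm: "mean (fst z) \<in> vcarrier VG" if "z \<in> F" for z using mean_mem[of "fst z"] F(2) that by auto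
  have z0: "0 \<in> ?A" "0 \<in> ?B" using XY(2,4) by (simp_all only: cvec.span_zero)
  have "w + 0 \<in> W" "0 + \<theta> w \<in> W"
    unfolding W_def using z0 f(2) h(2) rvec(1)[OF \<chi>(1)] rvec(1)[OF \<chi>(2)] by blast+
  then have wW: "w \<in> W" "\<theta> w \<in> W" by (simp_all only: add_0_right add_0_left)
  have dw: "double_action G \<phi> d w = w" using d(2)[OF fiso[OF rvec(1)[OF \<chi>(1)]]] f(2) by simp
  have d\<theta>w: "double_action G \<phi> d (\<theta> w) = 0"
    using d(3)[of \<chi>' "\<theta> w"] hiso[OF rvec(1)[OF \<chi>(2)]] h(2) ne by simp
  have mw: "mY VS (mean (fst z)) (snd z) w \<in> mult_space \<chi>" if "z \<in> F" for z
    using mult_space_vsubmodule[OF \<chi>(1)] Fm[OF that] w(1) unfolding vsubmodule_def by blast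
  have "\<theta> w = \<theta> (\<Sum>z\<in>F. c z *\<^sub>C mY VS (mean (fst z)) (snd z) w)" using F(3)[OF wW(1)] dw by simp
  also have "\<dots> = (\<Sum>z\<in>F. c z *\<^sub>C \<theta> (mY VS (mean (fst z)) (snd z) w))"
    using mw by (intro linear_map_lincomb[OF \<theta>(2) S])
  also have "\<dots> = (\<Sum>z\<in>F. c z *\<^sub>C mY VS (mean (fst z)) (snd z) (\<theta> w))"
    using \<theta>(3)[OF Fm w(1)] by (intro sum.cong refl) simp
  also have "\<dots> = 0" using F(3)[OF wW(2)] d\<theta>w by simp
  finally show False using \<theta>w0 by simp
qed

text \<open>The simple characters index the isomorphism classes on both sides, through
  \<open>rep\<close> and through \<open>mult_space\<close>; \<open>F\<close> undoes the first
  indexing and applies the second.\<close>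

theorem decomposition:
  "\<exists>(M\<^sub>\<chi> :: (('g \<times> 'g \<Rightarrow> complex) \<Rightarrow> complex) \<Rightarrow> ('g \<times> 'g \<Rightarrow> complex, nat \<Rightarrow> complex) amodule)
      (V\<^sub>\<chi> :: (('g \<times> 'g \<Rightarrow> complex) \<Rightarrow> complex) \<Rightarrow> ('v, 'g \<Rightarrow> 'm) vmodule) T \<tau> F.
      (\<forall>\<chi>\<in>simple_characters D.
         M\<^sub>\<chi> \<chi> \<in> simple_alg_modules D \<and> alg_character D (M\<^sub>\<chi> \<chi>) = \<chi> \<and>
         V\<^sub>\<chi> \<chi> \<in> simple_vsubmodules VG (Vstar G M) \<and>
         is_tensor_product (\<tau> \<chi>) (ucarrier (M\<^sub>\<chi> \<chi>)) (mcarrier (V\<^sub>\<chi> \<chi>)) (T \<chi>) \<and>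
         (\<forall>m\<in>ucarrier (M\<^sub>\<chi> \<chi>). \<forall>w\<in>mcarrier (V\<^sub>\<chi> \<chi>).
            (\<forall>d\<in>acarrier D. double_action G \<phi> d (\<tau> \<chi> m w) = \<tau> \<chi> (uact (M\<^sub>\<chi> \<chi>) d m) w) \<and>
            (\<forall>v\<in>vcarrier VG. \<forall>n. mY (Vstar G M) v n (\<tau> \<chi> m w) = \<tau> \<chi> m (mY (V\<^sub>\<chi> \<chi>) v n w)))) \<and>
      direct_sum (simple_characters D) T (mcarrier (Vstar G M)) \<and>
      bij_betw F
        (simple_alg_modules D // alg_module_iso_rel D (simple_alg_modules D))
        (simple_vsubmodules VG (Vstar G M) //
           vmodule_iso_rel VG (simple_vsubmodules VG (Vstar G M))) \<and>
      (\<forall>\<chi>\<in>simple_characters D.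
         F (alg_module_iso_rel D (simple_alg_modules D) `` {M\<^sub>\<chi> \<chi>})
         = vmodule_iso_rel VG (simple_vsubmodules VG (Vstar G M)) `` {V\<^sub>\<chi> \<chi>})"
proof -
  let ?A = "simple_alg_modules D :: ('g \<times> 'g \<Rightarrow> complex, nat \<Rightarrow> complex) amodule set"
  let ?rA = "alg_module_iso_rel D ?A"
  let ?B = "simple_vsubmodules VG VS" and ?rB = "vmodule_iso_rel VG (simple_vsubmodules VG VS)"
  let ?V = "\<lambda>\<chi>. sub (mult_space \<chi>)"
  have eA: "equiv ?A ?rA"
    by (rule alg_module_iso_rel_equiv) (simp add: simple_alg_modules_def simple_alg_module_def)
  have eB: "equiv ?B ?rB"
  proof (rule vmodule_iso_rel_equiv)
    fix N assume "N \<in> ?B"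
    then obtain W where W: "N = sub W" "vsubmodule VG VS W" using simple_vsubmodulesD by blast
    show "cvec.subspace (mcarrier N)" using W by (simp add: vsubmodule_def)
    show "mY N v n w \<in> mcarrier N" if "v \<in> vcarrier VG" "w \<in> mcarrier N" for v n w
      using W that by (simp add: vsubmodule_def)
  qed
  have repA: "rep \<chi> \<in> ?A" if "\<chi> \<in> chars" for \<chi> using rep(1)[OF that] by (simp add: simple_alg_modules_def)
  have bA: "bij_betw (\<lambda>\<chi>. ?rA `` {rep \<chi>}) chars (?A // ?rA)"
  proof (rule bij_betw_equiv_classes[OF eA repA])
    show "\<exists>\<chi>\<in>chars. (rep \<chi>, U) \<in> ?rA" if "U \<in> ?A" for U
      using rep_exists[of U] that repA by (auto simp: alg_module_iso_rel_def simple_alg_modules_def)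
    show "\<chi> = \<chi>'" if "\<chi> \<in> chars" "\<chi>' \<in> chars" "(rep \<chi>, rep \<chi>') \<in> ?rA" for \<chi> \<chi>'
      using that rep_iso_eq by (auto simp: alg_module_iso_rel_def)
  qed
  have bB: "bij_betw (\<lambda>\<chi>. ?rB `` {?V \<chi>}) chars (?B // ?rB)"
  proof (rule bij_betw_equiv_classes[OF eB mult_space_simple_vsubmodule])
    fix N assume N: "N \<in> ?B"
    obtain W where W: "N = sub W" "vsubmodule VG VS W" "W \<noteq> {0}"
      "\<forall>W'. vsubmodule VG VS W' \<and> W' \<subseteq> W \<longrightarrow> W' = {0} \<or> W' = W"
      using simple_vsubmodulesD[OF N] by blast
    obtain \<chi> where \<chi>: "\<chi> \<in> chars" "vmodule_iso VG N (?V \<chi>)"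
      using simple_vsubmodule_iso_mult_space[OF W(2-4)] W(1) by blast
    then have "(N, ?V \<chi>) \<in> ?rB" using N mult_space_simple_vsubmodule by (auto simp: vmodule_iso_rel_def)
    then have "(?V \<chi>, N) \<in> ?rB" using eB by (meson equivE symE)
    then show "\<exists>\<chi>\<in>chars. (?V \<chi>, N) \<in> ?rB" using \<chi>(1) by blast
  next
    show "\<chi> = \<chi>'" if "\<chi> \<in> chars" "\<chi>' \<in> chars" "(?V \<chi>, ?V \<chi>') \<in> ?rB" for \<chi> \<chi>'
      using that mult_space_iso_eq by (auto simp: vmodule_iso_rel_def)
  qed
  define F where "F = (\<lambda>c. ?rB `` {?V (the_inv_into chars (\<lambda>\<chi>. ?rA `` {rep \<chi>}) c)})"
  have F_rep: "F (?rA `` {rep \<chi>}) = ?rB `` {?V \<chi>}" if "\<chi> \<in> chars" for \<chi>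
    unfolding F_def using the_inv_into_f_f[OF bij_betw_imp_inj_on[OF bA] that] by simp
  have bF: "bij_betw F (?A // ?rA) (?B // ?rB)"
    using bij_betw_trans[OF bij_betw_the_inv_into[OF bA] bB] by (simp add: F_def comp_def)
  show ?thesis
  proof (intro exI conjI ballI allI)
    show "rep \<chi> \<in> ?A" "alg_character D (rep \<chi>) = \<chi>" if "\<chi> \<in> chars" for \<chi> using repA rep(2) that by auto
    show "?V \<chi> \<in> ?B" if "\<chi> \<in> chars" for \<chi> using mult_space_simple_vsubmodule[OF that] .
    show "is_tensor_product (\<tau> \<chi>) (ucarrier (rep \<chi>)) (mcarrier (?V \<chi>)) (isotypic \<chi>)" if "\<chi> \<in> chars" for \<chi>
      using \<tau>_tensor_product[OF that] by simp
    show "double_action G \<phi> d (\<tau> \<chi> m w) = \<tau> \<chi> (uact (rep \<chi>) d m) w"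
      if "\<chi> \<in> chars" "m \<in> ucarrier (rep \<chi>)" "w \<in> mcarrier (?V \<chi>)" "d \<in> acarrier D" for \<chi> m w d
      using that by (intro \<tau>_action) auto
    show "mY VS v n (\<tau> \<chi> m w) = \<tau> \<chi> m (mY (?V \<chi>) v n w)"
      if "\<chi> \<in> chars" "m \<in> ucarrier (rep \<chi>)" "w \<in> mcarrier (?V \<chi>)" "v \<in> vcarrier VG" for \<chi> m w v n
      using that by (simp add: \<tau>_modes)
    show "direct_sum chars isotypic (mcarrier VS)" by (rule isotypic_direct_sum)
    show "bij_betw F (?A // ?rA) (?B // ?rB)" by (rule bF)
    show "F (?rA `` {rep \<chi>}) = ?rB `` {?V \<chi>}" if "\<chi> \<in> chars" for \<chi> using F_rep[OF that] .
  qed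
qed

end

theorem mainTheorem5:
  fixes V :: "'v::complex_vector voa"
    and G :: "'g monoid"
    and \<rho> :: "'g \<Rightarrow> 'v \<Rightarrow> 'v"
    and M :: "'g \<Rightarrow> ('v, 'm::complex_vector) vmodule"
    and \<phi> :: "'g \<Rightarrow> 'g \<Rightarrow> 'm \<Rightarrow> 'm"
  defines "VG \<equiv> fixed_voa V G \<rho>"
    and "D \<equiv> twisted_double G (double_cocycle G M \<phi>)"
  assumes V: "simple_voa V"
    and G: "nilpotent_group G" "finite (carrier G)"
    and faithful: "\<rho> \<in> hom G (voa_Aut V)" "inj_on \<rho> (carrier G)"
    and M: "\<And>g. g \<in> carrier G \<Longrightarrow> unique_simple_twisted_module V (\<rho> g) (M g)"
    and \<phi>: "intertwiners G V \<rho> M \<phi>"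
  shows "\<exists>(M\<^sub>\<chi> :: (('g \<times> 'g \<Rightarrow> complex) \<Rightarrow> complex) \<Rightarrow> ('g \<times> 'g \<Rightarrow> complex, nat \<Rightarrow> complex) amodule)
      (V\<^sub>\<chi> :: (('g \<times> 'g \<Rightarrow> complex) \<Rightarrow> complex) \<Rightarrow> ('v, 'g \<Rightarrow> 'm) vmodule) T \<tau> F.
      (\<forall>\<chi>\<in>simple_characters D.
         M\<^sub>\<chi> \<chi> \<in> simple_alg_modules D \<and> alg_character D (M\<^sub>\<chi> \<chi>) = \<chi> \<and>
         V\<^sub>\<chi> \<chi> \<in> simple_vsubmodules VG (Vstar G M) \<and>
         is_tensor_product (\<tau> \<chi>) (ucarrier (M\<^sub>\<chi> \<chi>)) (mcarrier (V\<^sub>\<chi> \<chi>)) (T \<chi>) \<and>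
         (\<forall>m\<in>ucarrier (M\<^sub>\<chi> \<chi>). \<forall>w\<in>mcarrier (V\<^sub>\<chi> \<chi>).
            (\<forall>d\<in>acarrier D. double_action G \<phi> d (\<tau> \<chi> m w) = \<tau> \<chi> (uact (M\<^sub>\<chi> \<chi>) d m) w) \<and>
            (\<forall>v\<in>vcarrier VG. \<forall>n. mY (Vstar G M) v n (\<tau> \<chi> m w) = \<tau> \<chi> m (mY (V\<^sub>\<chi> \<chi>) v n w)))) \<and>
      direct_sum (simple_characters D) T (mcarrier (Vstar G M)) \<and>
      bij_betw F
        (simple_alg_modules D // alg_module_iso_rel D (simple_alg_modules D))
        (simple_vsubmodules VG (Vstar G M) //
           vmodule_iso_rel VG (simple_vsubmodules VG (Vstar G M))) \<and>
      (\<forall>\<chi>\<in>simple_characters D.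
         F (alg_module_iso_rel D (simple_alg_modules D) `` {M\<^sub>\<chi> \<chi>})
         = vmodule_iso_rel VG (simple_vsubmodules VG (Vstar G M)) `` {V\<^sub>\<chi> \<chi>})"
proof -
  have "orbifold G V \<rho> M \<phi>"
    unfolding orbifold_def orbifold_axioms_def
    using V G faithful M \<phi> by (auto simp: nilpotent_group_def unique_simple_twisted_module_def)
  from orbifold.decomposition[OF this] show ?thesis unfolding VG_def D_def .
qed

end
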